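(* Let $G$ be a discrete group, $X$ a non-empty locally compact Hausdorff second-countable space and $\alpha$ an amenable action of $G$ on $X$. The following are equivalent: (i) $G$ is MAP and the union of finite orbits of the $G$-action is dense in $X$; (ii) $C_0(X)\rtimes G$ is RFD. Moreover, these (equivalent) conditions imply that $G$ itself is amenable.
   Context: A discrete group is MAP (maximally almost periodic) if its finite-dimensional unitary representations separate its points. A C*-algebra is RFD if its finite-dimensional representations separate its points. $C_0(X)\rtimes G$ is the full crossed product by the induced action. An action of a discrete group $G$ on a locally compact Hausdorff space $X$ by homeomorphisms is amenable if there is a net of continuous maps $m_i:X\to\mathrm{Prob}(G)$, $x\mapsto m_i^x$ (with $\mathrm{Prob}(G)\subset\ell^1(G)$ the set of probability measures on $G$), such that for each $g\in G$ one has $\|g\cdot m_i^x-m_i^{gx}\|_1\to0$ uniformly for $x$ in compact subsets of $X$. *)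

theory Defs
  imports
    "HOL-Analysis.Analysis"
    "HOL-Algebra.Group_Action"
    "Jordan_Normal_Form.Schur_Decomposition"
begin

section \<open>Amenability and maximal almost periodicity\<close>

definition amenable_group :: "('g, 'b) monoid_scheme \<Rightarrow> bool" where
  "amenable_group G \<longleftrightarrow>
     (let B = {f :: 'g \<Rightarrow> real. bounded (f ` carrier G)} in
      \<exists>\<mu> :: ('g \<Rightarrow> real) \<Rightarrow> real.
        (\<forall>f\<in>B. \<forall>f'\<in>B. \<mu> (\<lambda>s. f s + f' s) = \<mu> f + \<mu> f') \<and>
        (\<forall>c. \<forall>f\<in>B. \<mu> (\<lambda>s. c * f s) = c * \<mu> f) \<and>
        (\<forall>f\<in>B. (\<forall>s\<in>carrier G. 0 \<le> f s) \<longrightarrow> 0 \<le> \<mu> f) \<and>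
        \<mu> (\<lambda>s. 1) = 1 \<and>
        (\<forall>g\<in>carrier G. \<forall>f\<in>B. \<mu> (\<lambda>s. f (inv\<^bsub>G\<^esub> g \<otimes>\<^bsub>G\<^esub> s)) = \<mu> f))"

definition action_by_homeomorphisms ::
  "('g, 'b) monoid_scheme \<Rightarrow> ('g \<Rightarrow> 'x::topological_space \<Rightarrow> 'x) \<Rightarrow> bool" where
  "action_by_homeomorphisms G \<alpha> \<longleftrightarrow>
     group_action G UNIV \<alpha> \<and> (\<forall>g\<in>carrier G. \<exists>h. homeomorphism UNIV UNIV (\<alpha> g) h)"

definition Prob :: "('g, 'b) monoid_scheme \<Rightarrow> ('g \<Rightarrow> real) set" where
  "Prob G = {p. (\<forall>s\<in>carrier G. 0 \<le> p s) \<and> (\<forall>s. s \<notin> carrier G \<longrightarrow> p s = 0) \<and>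
                (p has_sum 1) (carrier G)}"

definition ell1_dist :: "('g, 'b) monoid_scheme \<Rightarrow> ('g \<Rightarrow> real) \<Rightarrow> ('g \<Rightarrow> real) \<Rightarrow> real" where
  "ell1_dist G p q = (\<Sum>\<^sub>\<infinity>s\<in>carrier G. \<bar>p s - q s\<bar>)"

definition translate :: "('g, 'b) monoid_scheme \<Rightarrow> 'g \<Rightarrow> ('g \<Rightarrow> real) \<Rightarrow> 'g \<Rightarrow> real" where
  "translate G g p = (\<lambda>s. if s \<in> carrier G then p (inv\<^bsub>G\<^esub> g \<otimes>\<^bsub>G\<^esub> s) else 0)"

definition continuous_Prob_maps ::
  "('g, 'b) monoid_scheme \<Rightarrow> ('x::topological_space \<Rightarrow> 'g \<Rightarrow> real) set" where
  "continuous_Prob_maps G =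
     {m. (\<forall>x. m x \<in> Prob G) \<and> (\<forall>x. ((\<lambda>y. ell1_dist G (m y) (m x)) \<longlongrightarrow> 0) (at x))}"

text \<open>Nets of maps are rendered by proper filters on the space of maps: a net induces the filter
  generated by its tails, and a proper filter \<open>F\<close> is the tail filter of the net
  \<open>(A, m) \<mapsto> m\<close> indexed by the pairs with \<open>m \<in> A\<close> and \<open>A\<close> a member of \<open>F\<close>.\<close>

definition amenable_action ::
  "('g, 'b) monoid_scheme \<Rightarrow> ('g \<Rightarrow> 'x::topological_space \<Rightarrow> 'x) \<Rightarrow> bool" where
  "amenable_action G \<alpha> \<longleftrightarrow>
     action_by_homeomorphisms G \<alpha> \<and>
     (\<exists>F :: ('x \<Rightarrow> 'g \<Rightarrow> real) filter.
        F \<noteq> bot \<and>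
        (\<forall>\<^sub>F m in F. m \<in> continuous_Prob_maps G) \<and>
        (\<forall>g\<in>carrier G. \<forall>K. compact K \<longrightarrow>
           uniform_limit K (\<lambda>m x. ell1_dist G (translate G g (m x)) (m (\<alpha> g x))) (\<lambda>x. 0) F))"

definition unitary_mats :: "nat \<Rightarrow> complex mat set" where
  "unitary_mats n = {U \<in> carrier_mat n n. U * mat_adjoint U = 1\<^sub>m n \<and> mat_adjoint U * U = 1\<^sub>m n}"

definition fd_unitary_rep ::
  "('g, 'b) monoid_scheme \<Rightarrow> nat \<Rightarrow> ('g \<Rightarrow> complex mat) \<Rightarrow> bool" where
  "fd_unitary_rep G n \<rho> \<longleftrightarrow>
     (\<forall>g\<in>carrier G. \<rho> g \<in> unitary_mats n) \<and>
     (\<forall>g\<in>carrier G. \<forall>h\<in>carrier G. \<rho> (g \<otimes>\<^bsub>G\<^esub> h) = \<rho> g * \<rho> h)"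

definition MAP :: "('g, 'b) monoid_scheme \<Rightarrow> bool" where
  "MAP G \<longleftrightarrow>
     (\<forall>g\<in>carrier G. \<forall>h\<in>carrier G. g \<noteq> h \<longrightarrow> (\<exists>n \<rho>. fd_unitary_rep G n \<rho> \<and> \<rho> g \<noteq> \<rho> h))"


section \<open>Normed *-algebras, completion, residual finite-dimensionality\<close>

record 'a star_algebra =
  sa_carrier :: "'a set"
  sa_add :: "'a \<Rightarrow> 'a \<Rightarrow> 'a"
  sa_scale :: "complex \<Rightarrow> 'a \<Rightarrow> 'a"
  sa_mult :: "'a \<Rightarrow> 'a \<Rightarrow> 'a"
  sa_star :: "'a \<Rightarrow> 'a"
  sa_norm :: "'a \<Rightarrow> real"

definition sa_dist :: "'a star_algebra \<Rightarrow> 'a \<Rightarrow> 'a \<Rightarrow> real" where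
  "sa_dist A a b = sa_norm A (sa_add A a (sa_scale A (-1) b))"

definition fd_star_rep :: "'a star_algebra \<Rightarrow> nat \<Rightarrow> ('a \<Rightarrow> complex mat) \<Rightarrow> bool" where
  "fd_star_rep A n \<phi> \<longleftrightarrow>
     (\<forall>a\<in>sa_carrier A. \<phi> a \<in> carrier_mat n n) \<and>
     (\<forall>a\<in>sa_carrier A. \<forall>b\<in>sa_carrier A. \<phi> (sa_add A a b) = \<phi> a + \<phi> b) \<and>
     (\<forall>c. \<forall>a\<in>sa_carrier A. \<phi> (sa_scale A c a) = c \<cdot>\<^sub>m \<phi> a) \<and>
     (\<forall>a\<in>sa_carrier A. \<forall>b\<in>sa_carrier A. \<phi> (sa_mult A a b) = \<phi> a * \<phi> b) \<and>
     (\<forall>a\<in>sa_carrier A. \<phi> (sa_star A a) = mat_adjoint (\<phi> a))"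

definition RFD :: "'a star_algebra \<Rightarrow> bool" where
  "RFD A \<longleftrightarrow>
     (\<forall>a\<in>sa_carrier A. \<forall>b\<in>sa_carrier A. a \<noteq> b \<longrightarrow> (\<exists>n \<phi>. fd_star_rep A n \<phi> \<and> \<phi> a \<noteq> \<phi> b))"

definition Cauchy_seqs :: "'a star_algebra \<Rightarrow> (nat \<Rightarrow> 'a) set" where
  "Cauchy_seqs A =
     {s. (\<forall>n. s n \<in> sa_carrier A) \<and>
         (\<forall>e>0. \<exists>N. \<forall>m\<ge>N. \<forall>n\<ge>N. sa_dist A (s m) (s n) < e)}"

definition null_rel :: "'a star_algebra \<Rightarrow> ((nat \<Rightarrow> 'a) \<times> (nat \<Rightarrow> 'a)) set" where
  "null_rel A =
     {(s, t). s \<in> Cauchy_seqs A \<and> t \<in> Cauchy_seqs A \<and> (\<lambda>n. sa_dist A (s n) (t n)) \<longlonglongrightarrow> 0}"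

text \<open>The Hausdorff completion of a *-algebra with respect to a C*-seminorm: Cauchy sequences modulo
  null sequences, with the operations induced termwise.\<close>

definition completion :: "'a star_algebra \<Rightarrow> (nat \<Rightarrow> 'a) set star_algebra" where
  "completion A =
     \<lparr> sa_carrier = Cauchy_seqs A // null_rel A,
       sa_add = (\<lambda>P Q. \<Union>s\<in>P. \<Union>t\<in>Q. null_rel A `` {\<lambda>n. sa_add A (s n) (t n)}),
       sa_scale = (\<lambda>c P. \<Union>s\<in>P. null_rel A `` {\<lambda>n. sa_scale A c (s n)}),
       sa_mult = (\<lambda>P Q. \<Union>s\<in>P. \<Union>t\<in>Q. null_rel A `` {\<lambda>n. sa_mult A (s n) (t n)}),
       sa_star = (\<lambda>P. \<Union>s\<in>P. null_rel A `` {\<lambda>n. sa_star A (s n)}),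
       sa_norm = (\<lambda>P. the_elem ((\<lambda>s. lim (\<lambda>n. sa_norm A (s n))) ` P)) \<rparr>"


section \<open>Operators on the Hilbert space of square-summable families\<close>

type_synonym 'i operator = "('i \<Rightarrow> complex) \<Rightarrow> ('i \<Rightarrow> complex)"

definition ell2 :: "('i \<Rightarrow> complex) set" where
  "ell2 = {\<xi>. (\<lambda>i. (cmod (\<xi> i))\<^sup>2) summable_on UNIV}"

definition ell2_inner :: "('i \<Rightarrow> complex) \<Rightarrow> ('i \<Rightarrow> complex) \<Rightarrow> complex" where
  "ell2_inner \<xi> \<eta> = (\<Sum>\<^sub>\<infinity>i. \<xi> i * cnj (\<eta> i))"

definition ell2_norm :: "('i \<Rightarrow> complex) \<Rightarrow> real" where
  "ell2_norm \<xi> = sqrt (\<Sum>\<^sub>\<infinity>i. (cmod (\<xi> i))\<^sup>2)"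

text \<open>Only the values of an operator on \<open>ell2\<close> are relevant.\<close>

definition bounded_operator :: "'i operator \<Rightarrow> bool" where
  "bounded_operator T \<longleftrightarrow>
     (\<forall>\<xi>\<in>ell2. T \<xi> \<in> ell2) \<and>
     (\<forall>\<xi>\<in>ell2. \<forall>\<eta>\<in>ell2. T (\<lambda>i. \<xi> i + \<eta> i) = (\<lambda>i. T \<xi> i + T \<eta> i)) \<and>
     (\<forall>c. \<forall>\<xi>\<in>ell2. T (\<lambda>i. c * \<xi> i) = (\<lambda>i. c * T \<xi> i)) \<and>
     (\<exists>C. \<forall>\<xi>\<in>ell2. ell2_norm (T \<xi>) \<le> C * ell2_norm \<xi>)"

definition unitary_operator :: "'i operator \<Rightarrow> bool" where
  "unitary_operator U \<longleftrightarrow>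
     bounded_operator U \<and> U ` ell2 = ell2 \<and>
     (\<forall>\<xi>\<in>ell2. \<forall>\<eta>\<in>ell2. ell2_inner (U \<xi>) (U \<eta>) = ell2_inner \<xi> \<eta>)"

definition operator_norm :: "'i operator \<Rightarrow> real" where
  "operator_norm T = (SUP \<xi>\<in>{\<xi> \<in> ell2. ell2_norm \<xi> \<le> 1}. ell2_norm (T \<xi>))"


section \<open>The full crossed product\<close>

definition C0 :: "('x::topological_space \<Rightarrow> complex) set" where
  "C0 = {f. continuous_on UNIV f \<and> (\<forall>e>0. \<exists>K. compact K \<and> (\<forall>x. x \<notin> K \<longrightarrow> cmod (f x) < e))}"

definition act_fun ::
  "('g, 'b) monoid_scheme \<Rightarrow> ('g \<Rightarrow> 'x \<Rightarrow> 'x) \<Rightarrow> 'g \<Rightarrow> ('x \<Rightarrow> complex) \<Rightarrow> 'x \<Rightarrow> complex" where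
  "act_fun G \<alpha> g f = (\<lambda>x. f (\<alpha> (inv\<^bsub>G\<^esub> g) x))"

definition C0_star_rep ::
  "(('x::topological_space \<Rightarrow> complex) \<Rightarrow> 'i operator) \<Rightarrow> bool" where
  "C0_star_rep \<pi> \<longleftrightarrow>
     (\<forall>f\<in>C0. bounded_operator (\<pi> f)) \<and>
     (\<forall>f\<in>C0. \<forall>f'\<in>C0. \<forall>\<xi>\<in>ell2. \<pi> (\<lambda>x. f x + f' x) \<xi> = (\<lambda>i. \<pi> f \<xi> i + \<pi> f' \<xi> i)) \<and>
     (\<forall>c. \<forall>f\<in>C0. \<forall>\<xi>\<in>ell2. \<pi> (\<lambda>x. c * f x) \<xi> = (\<lambda>i. c * \<pi> f \<xi> i)) \<and>
     (\<forall>f\<in>C0. \<forall>f'\<in>C0. \<forall>\<xi>\<in>ell2. \<pi> (\<lambda>x. f x * f' x) \<xi> = \<pi> f (\<pi> f' \<xi>)) \<and>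
     (\<forall>f\<in>C0. \<forall>\<xi>\<in>ell2. \<forall>\<eta>\<in>ell2.
        ell2_inner (\<pi> (\<lambda>x. cnj (f x)) \<xi>) \<eta> = ell2_inner \<xi> (\<pi> f \<eta>))"

definition unitary_rep :: "('g, 'b) monoid_scheme \<Rightarrow> ('g \<Rightarrow> 'i operator) \<Rightarrow> bool" where
  "unitary_rep G u \<longleftrightarrow>
     (\<forall>g\<in>carrier G. unitary_operator (u g)) \<and>
     (\<forall>g\<in>carrier G. \<forall>h\<in>carrier G. \<forall>\<xi>\<in>ell2. u (g \<otimes>\<^bsub>G\<^esub> h) \<xi> = u g (u h \<xi>))"

definition covariant_rep ::
  "('g, 'b) monoid_scheme \<Rightarrow> ('g \<Rightarrow> 'x::topological_space \<Rightarrow> 'x) \<Rightarrow>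
   (('x \<Rightarrow> complex) \<Rightarrow> 'i operator) \<Rightarrow> ('g \<Rightarrow> 'i operator) \<Rightarrow> bool" where
  "covariant_rep G \<alpha> \<pi> u \<longleftrightarrow>
     C0_star_rep \<pi> \<and> unitary_rep G u \<and>
     (\<forall>g\<in>carrier G. \<forall>f\<in>C0. \<forall>\<xi>\<in>ell2. u g (\<pi> f \<xi>) = \<pi> (act_fun G \<alpha> g f) (u g \<xi>))"

text \<open>The function \<open>a\<close> stands for the finite formal sum of the \<open>a g\<close> times the canonical
  unitaries indexed by \<open>g\<close>.\<close>

definition cp_supp :: "('g, 'b) monoid_scheme \<Rightarrow> ('g \<Rightarrow> 'x \<Rightarrow> complex) \<Rightarrow> 'g set" where
  "cp_supp G a = {g \<in> carrier G. a g \<noteq> (\<lambda>x. 0)}"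

definition integrated_form ::
  "('g, 'b) monoid_scheme \<Rightarrow> (('x \<Rightarrow> complex) \<Rightarrow> 'i operator) \<Rightarrow> ('g \<Rightarrow> 'i operator) \<Rightarrow>
   ('g \<Rightarrow> 'x \<Rightarrow> complex) \<Rightarrow> 'i operator" where
  "integrated_form G \<pi> u a = (\<lambda>\<xi> i. \<Sum>g\<in>cp_supp G a. \<pi> (a g) (u g \<xi>) i)"

text \<open>The universal norm is the supremum over all covariant representations. To quantify over a set
  of Hilbert spaces, all representations are taken on the space of square-summable families indexed
  by the type \<open>'g \<Rightarrow> 'x \<Rightarrow> complex\<close>. This loses nothing: the supremum over all representations is
  the supremum over the cyclic ones, a cyclic representation has a dense subset that is an image of
  the algebraic crossed product, a subset of this type, so its Hilbert space embeds in that space;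
  on the orthogonal complement one lets functions act by zero (nondegeneracy is not required) and
  the group trivially.\<close>

definition universal_norm ::
  "('g, 'b) monoid_scheme \<Rightarrow> ('g \<Rightarrow> 'x::topological_space \<Rightarrow> 'x) \<Rightarrow> ('g \<Rightarrow> 'x \<Rightarrow> complex) \<Rightarrow> real"
  where
  "universal_norm G \<alpha> a =
     Sup {operator_norm (integrated_form G \<pi> u a) |
            (\<pi> :: ('x \<Rightarrow> complex) \<Rightarrow> ('g \<Rightarrow> 'x \<Rightarrow> complex) operator) u. covariant_rep G \<alpha> \<pi> u}"

definition alg_crossed_product ::
  "('g, 'b) monoid_scheme \<Rightarrow> ('g \<Rightarrow> 'x::topological_space \<Rightarrow> 'x) \<Rightarrow> ('g \<Rightarrow> 'x \<Rightarrow> complex) star_algebra"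
  where
  "alg_crossed_product G \<alpha> =
     \<lparr> sa_carrier = {a. (\<forall>g\<in>carrier G. a g \<in> C0) \<and> (\<forall>g. g \<notin> carrier G \<longrightarrow> a g = (\<lambda>x. 0)) \<and>
                        finite (cp_supp G a)},
       sa_add = (\<lambda>a b g x. a g x + b g x),
       sa_scale = (\<lambda>c a g x. c * a g x),
       sa_mult = (\<lambda>a b g x. if g \<in> carrier G
          then (\<Sum>h\<in>cp_supp G a. a h x * act_fun G \<alpha> h (b (inv\<^bsub>G\<^esub> h \<otimes>\<^bsub>G\<^esub> g)) x) else 0),
       sa_star = (\<lambda>a g x. if g \<in> carrier G
          then act_fun G \<alpha> g (\<lambda>y. cnj (a (inv\<^bsub>G\<^esub> g) y)) x else 0),
       sa_norm = universal_norm G \<alpha> \<rparr>"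

definition full_crossed_product ::
  "('g, 'b) monoid_scheme \<Rightarrow> ('g \<Rightarrow> 'x::topological_space \<Rightarrow> 'x) \<Rightarrow>
   (nat \<Rightarrow> 'g \<Rightarrow> 'x \<Rightarrow> complex) set star_algebra" where
  "full_crossed_product G \<alpha> = completion (alg_crossed_product G \<alpha>)"

end

theory Submission
  imports Defs
begin

text \<open>A finite-dimensional representation of the crossed product sees only finitely many points of \<open>X\<close>, and these
  make up finite orbits; conversely, finite orbits combined with finite-dimensional representations of \<open>G\<close> give
  enough representations to compute the norm.

  Suppose first that the crossed product is RFD, and let \<open>\<phi>\<close> be a finite-dimensional representation of the
  algebraic crossed product. The functions \<open>f\<close> with \<open>\<phi>(f \<delta>\<^sub>1) = 0\<close> form an invariant ideal. Its zero set is
  invariant and finite (\<open>finite_zero_set\<close>), and the ideal consists of all functions that vanish there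
  (\<open>null_ideal_if_vanishes\<close>). A compactly supported function that \<open>\<phi>\<close> does not kill therefore has a point of a
  finite orbit in its support (\<open>null_ideal_compact_support\<close>). The algebraic crossed product embeds into its
  completion, by means of the regular representations (\<open>cp_dist_pos\<close>), so every non-zero function survives in
  some \<open>\<phi>\<close>, and the finite orbits are dense. Cutting the canonical unitaries down by a function equal to \<open>1\<close> on
  the zero set turns \<open>\<phi>\<close> into a unitary representation of \<open>G\<close> (\<open>fd_unitary_rep_of_fd_rep\<close>), and these separate
  the points of \<open>G\<close>.

  Suppose conversely that \<open>G\<close> is MAP and the finite orbits are dense. It suffices that finite-dimensional
  representations compute the universal norm (\<open>RFD_completionI\<close>). Let \<open>(\<pi>, u)\<close> be any covariant representation,
  \<open>\<xi>\<close> a vector and \<open>a\<close> a finite sum of terms \<open>a\<^sub>g \<delta>\<^sub>g\<close>.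

  \<^item> Averaged over a finite orbit, the maps that witness amenability of the action become almost invariant
    probability measures on \<open>G\<close>; their square roots are almost invariant vectors \<open>w\<close> in \<open>\<ell>\<^sup>2(G)\<close>
    (\<open>approximately_invariant_vectors\<close>). Through the vectors \<open>w(h) u(h)\<^sup>* \<xi>\<close> the action of \<open>a\<close> on \<open>\<xi>\<close> is compared
    with that of the matrix of functions \<open>b(k, h)(x) = a(k h\<^sup>-\<^sup>1)(k x)\<close> (\<open>integrated_form_bound_from_matrices\<close>).

  \<^item> In the representation \<open>\<pi>\<close> such a matrix has norm at most the supremum over \<open>x\<close> of the norms of its values
    (\<open>C0_star_rep_matrix_contractive\<close>), and by density points \<open>x\<close> of finite orbits suffice.

  \<^item> At such a point the value is nearly a compression of a finite-dimensional representation: the functions on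
    the orbit, tensored with a unitary representation of \<open>G\<close> whose normalized trace is nearly the indicator of
    the unit. Almost periodicity provides these representations, as high tensor powers
    (\<open>small_trace_kernel\<close>), and the small trace makes translates of basis vectors nearly orthonormal
    (\<open>small_trace_gram\<close>, \<open>finite_orbit_bound\<close>).

  Amenability of \<open>G\<close> needs a single finite orbit: the probability measures of the first step have a cluster
  point among the means on \<open>G\<close>, and it is invariant (\<open>amenable_if_finite_orbit\<close>).\<close>

section \<open>Square-summable families\<close>

lemma ell2_abs_summable:
  assumes "\<xi> \<in> ell2" "\<eta> \<in> ell2"
  shows "(\<lambda>i. cmod (\<xi> i * cnj (\<eta> i))) summable_on UNIV"
proof (rule summable_on_comparison_test)
  show "(\<lambda>i. (cmod (\<xi> i))\<^sup>2 + (cmod (\<eta> i))\<^sup>2) summable_on UNIV"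
    using assms by (intro summable_on_add) (auto simp: ell2_def)
  fix i
  have "2 * (cmod (\<xi> i) * cmod (\<eta> i)) \<le> (cmod (\<xi> i))\<^sup>2 + (cmod (\<eta> i))\<^sup>2"
    using sum_squares_bound[of "cmod (\<xi> i)" "cmod (\<eta> i)"] by simp
  moreover have "0 \<le> cmod (\<xi> i) * cmod (\<eta> i)" by simp
  ultimately have "cmod (\<xi> i) * cmod (\<eta> i) \<le> (cmod (\<xi> i))\<^sup>2 + (cmod (\<eta> i))\<^sup>2"
    by linarith
  then show "cmod (\<xi> i * cnj (\<eta> i)) \<le> (cmod (\<xi> i))\<^sup>2 + (cmod (\<eta> i))\<^sup>2"
    by (simp only: norm_mult complex_mod_cnj)
qed simp

lemma ell2_summable:
  assumes "\<xi> \<in> ell2" "\<eta> \<in> ell2"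
  shows "(\<lambda>i. \<xi> i * cnj (\<eta> i)) summable_on UNIV"
  using abs_summable_summable[OF ell2_abs_summable[OF assms]] .

lemma ell2_zero [simp]: "(\<lambda>i. 0) \<in> ell2"
  by (simp add: ell2_def)

lemma ell2_add:
  assumes "\<xi> \<in> ell2" "\<eta> \<in> ell2"
  shows "(\<lambda>i. \<xi> i + \<eta> i) \<in> ell2"
proof -
  have s: "(\<lambda>i. 2 * (cmod (\<xi> i))\<^sup>2 + 2 * (cmod (\<eta> i))\<^sup>2) summable_on UNIV"
    using assms by (intro summable_on_add summable_on_cmult_right) (auto simp: ell2_def)
  have "(cmod (\<xi> i + \<eta> i))\<^sup>2 \<le> 2 * (cmod (\<xi> i))\<^sup>2 + 2 * (cmod (\<eta> i))\<^sup>2" for i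
  proof -
    have "(cmod (\<xi> i + \<eta> i))\<^sup>2 \<le> (cmod (\<xi> i) + cmod (\<eta> i))\<^sup>2"
      by (intro power_mono norm_triangle_ineq) auto
    also have "\<dots> \<le> 2 * (cmod (\<xi> i))\<^sup>2 + 2 * (cmod (\<eta> i))\<^sup>2"
      using sum_squares_bound[of "cmod (\<xi> i)" "cmod (\<eta> i)"] by (simp add: power2_sum)
    finally show ?thesis .
  qed
  then show ?thesis
    unfolding ell2_def by (auto intro!: summable_on_comparison_test[OF s])
qed

lemma ell2_scale:
  assumes "\<xi> \<in> ell2"
  shows "(\<lambda>i. c * \<xi> i) \<in> ell2"
  using assms summable_on_cmult_right[of "\<lambda>i. (cmod (\<xi> i))\<^sup>2" UNIV "(cmod c)\<^sup>2"]
  by (auto simp: ell2_def norm_mult power_mult_distrib)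

lemma ell2_sum:
  assumes "\<And>k. k \<in> A \<Longrightarrow> \<xi> k \<in> ell2"
  shows "(\<lambda>i. \<Sum>k\<in>A. \<xi> k i) \<in> ell2"
  using assms
proof (induction A rule: infinite_finite_induct)
  case (insert x F)
  then show ?case using ell2_add[of "\<xi> x" "\<lambda>i. \<Sum>k\<in>F. \<xi> k i"] by auto
qed auto

lemma ell2_diff:
  assumes "\<xi> \<in> ell2" "\<eta> \<in> ell2"
  shows "(\<lambda>i. \<xi> i - \<eta> i) \<in> ell2"
  using ell2_add[OF assms(1) ell2_scale[OF assms(2), of "-1"]] by simp

lemma ell2_inner_add:
  assumes "\<xi> \<in> ell2" "\<eta> \<in> ell2" "\<zeta> \<in> ell2"
  shows "ell2_inner (\<lambda>i. \<xi> i + \<eta> i) \<zeta> = ell2_inner \<xi> \<zeta> + ell2_inner \<eta> \<zeta>"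
  unfolding ell2_inner_def
  using infsum_add[OF ell2_summable[OF assms(1,3)] ell2_summable[OF assms(2,3)]]
  by (simp add: algebra_simps)

lemma ell2_inner_scale:
  assumes "\<xi> \<in> ell2" "\<zeta> \<in> ell2"
  shows "ell2_inner (\<lambda>i. c * \<xi> i) \<zeta> = c * ell2_inner \<xi> \<zeta>"
  unfolding ell2_inner_def
  using infsum_cmult_right[OF ell2_summable[OF assms], of c]
  by (simp add: mult.assoc)

lemma ell2_inner_commute: "ell2_inner \<xi> \<eta> = cnj (ell2_inner \<eta> \<xi>)"
  by (simp add: ell2_inner_def flip: infsum_cnj) (simp add: mult.commute)

lemma ell2_inner_add_right:
  assumes "\<xi> \<in> ell2" "\<eta> \<in> ell2" "\<zeta> \<in> ell2"
  shows "ell2_inner \<zeta> (\<lambda>i. \<xi> i + \<eta> i) = ell2_inner \<zeta> \<xi> + ell2_inner \<zeta> \<eta>"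
  using ell2_inner_add[OF assms] ell2_inner_commute by (metis complex_cnj_add)

lemma ell2_inner_scale_right:
  assumes "\<xi> \<in> ell2" "\<zeta> \<in> ell2"
  shows "ell2_inner \<zeta> (\<lambda>i. c * \<xi> i) = cnj c * ell2_inner \<zeta> \<xi>"
  using ell2_inner_scale[OF assms, of c] ell2_inner_commute by (metis complex_cnj_mult)

lemma ell2_inner_zero [simp]: "ell2_inner (\<lambda>i. 0) \<zeta> = 0" "ell2_inner \<zeta> (\<lambda>i. 0) = 0"
  by (auto simp: ell2_inner_def)

lemma ell2_inner_sum:
  assumes "\<And>k. k \<in> A \<Longrightarrow> \<xi> k \<in> ell2" "\<zeta> \<in> ell2"
  shows "ell2_inner (\<lambda>i. \<Sum>k\<in>A. \<xi> k i) \<zeta> = (\<Sum>k\<in>A. ell2_inner (\<xi> k) \<zeta>)"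
  using assms(1)
proof (induction A rule: infinite_finite_induct)
  case (insert x F)
  then show ?case
    using ell2_inner_add[of "\<xi> x" "\<lambda>i. \<Sum>k\<in>F. \<xi> k i" \<zeta>] ell2_sum[of F \<xi>] assms(2) by auto
qed auto

lemma ell2_inner_sum_right:
  assumes "\<And>k. k \<in> A \<Longrightarrow> \<xi> k \<in> ell2" "\<zeta> \<in> ell2"
  shows "ell2_inner \<zeta> (\<lambda>i. \<Sum>k\<in>A. \<xi> k i) = (\<Sum>k\<in>A. ell2_inner \<zeta> (\<xi> k))"
  by (subst ell2_inner_commute, subst ell2_inner_sum) (auto simp: assms ell2_inner_commute[of \<zeta>])

lemma ell2_norm_nonneg [simp]: "0 \<le> ell2_norm \<xi>"
  by (simp add: ell2_norm_def infsum_nonneg)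

lemma ell2_norm_zero [simp]: "ell2_norm (\<lambda>i. 0) = 0"
  by (simp add: ell2_norm_def)

lemma ell2_norm_square: "(ell2_norm \<xi>)\<^sup>2 = (\<Sum>\<^sub>\<infinity>i. (cmod (\<xi> i))\<^sup>2)"
  by (simp add: ell2_norm_def infsum_nonneg)

lemma ell2_inner_self: 
  assumes "\<xi> \<in> ell2"
  shows "ell2_inner \<xi> \<xi> = of_real ((ell2_norm \<xi>)\<^sup>2)"
proof -
  have "((\<lambda>i. of_real ((cmod (\<xi> i))\<^sup>2) :: complex) has_sum of_real ((ell2_norm \<xi>)\<^sup>2)) UNIV"
    using assms by (intro has_sum_of_real) (auto simp: ell2_norm_square ell2_def)
  then show ?thesis
    unfolding ell2_inner_def by (subst complex_norm_square[symmetric]) (simp add: infsumI)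
qed

lemma ell2_norm_eq_zero:
  assumes "\<xi> \<in> ell2" "ell2_norm \<xi> = 0"
  shows "\<xi> = (\<lambda>i. 0)"
proof
  fix i
  have "(\<Sum>\<^sub>\<infinity>i. (cmod (\<xi> i))\<^sup>2) = 0" using assms(2) ell2_norm_square[of \<xi>] by simp
  then have "(cmod (\<xi> i))\<^sup>2 = 0"
    using assms(1) by (intro nonneg_infsum_le_0D[where A=UNIV]) (auto simp: ell2_def)
  then show "\<xi> i = 0" by simp
qed

lemma ell2_norm_scale:
  assumes "\<xi> \<in> ell2"
  shows "ell2_norm (\<lambda>i. c * \<xi> i) = cmod c * ell2_norm \<xi>"
  by (simp add: ell2_norm_def norm_mult power_mult_distrib infsum_cmult_right' real_sqrt_mult)

lemma ell2_norm_minus_commute: "ell2_norm (\<lambda>i. \<xi> i - \<eta> i) = ell2_norm (\<lambda>i. \<eta> i - \<xi> i)"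
  by (simp add: ell2_norm_def norm_minus_commute)

lemma ell2_coord_le:
  assumes "\<xi> \<in> ell2"
  shows "cmod (\<xi> i) \<le> ell2_norm \<xi>"
proof -
  have "sum (\<lambda>i. (cmod (\<xi> i))\<^sup>2) {i} \<le> (\<Sum>\<^sub>\<infinity>i. (cmod (\<xi> i))\<^sup>2)"
    using assms by (intro finite_sum_le_infsum) (auto simp: ell2_def)
  then have "(cmod (\<xi> i))\<^sup>2 \<le> (ell2_norm \<xi>)\<^sup>2" by (simp add: ell2_norm_square)
  then show ?thesis using power2_le_imp_le ell2_norm_nonneg by blast
qed

text \<open>Summation of the weighted inequality \<open>xy \<le> s x\<^sup>2/2 + y\<^sup>2/(2s)\<close>, where \<open>s\<close> is the ratio of the two norms.\<close>

lemma ell2_Cauchy_Schwarz: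
  assumes "\<xi> \<in> ell2" "\<eta> \<in> ell2"
  shows "cmod (ell2_inner \<xi> \<eta>) \<le> ell2_norm \<xi> * ell2_norm \<eta>"
proof (cases "ell2_norm \<xi> = 0 \<or> ell2_norm \<eta> = 0")
  case True
  then show ?thesis using ell2_norm_eq_zero assms by fastforce
next
  case False
  define s where "s = ell2_norm \<eta> / ell2_norm \<xi>"
  have pos: "ell2_norm \<xi> > 0" "ell2_norm \<eta> > 0" using False ell2_norm_nonneg by (metis less_eq_real_def)+
  then have s: "s > 0" by (simp add: s_def)
  have *: "cmod (\<xi> i * cnj (\<eta> i)) \<le> s / 2 * (cmod (\<xi> i))\<^sup>2 + 1 / (2 * s) * (cmod (\<eta> i))\<^sup>2" for i
  proof -
    have "0 \<le> (s * cmod (\<xi> i) - cmod (\<eta> i))\<^sup>2" by simp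
    then have "2 * s * (cmod (\<xi> i) * cmod (\<eta> i)) \<le> s\<^sup>2 * (cmod (\<xi> i))\<^sup>2 + (cmod (\<eta> i))\<^sup>2"
      by (simp add: power2_diff power_mult_distrib algebra_simps)
    then show ?thesis using s by (simp add: norm_mult field_simps power2_eq_square)
  qed
  have S1: "(\<lambda>i. s / 2 * (cmod (\<xi> i))\<^sup>2) summable_on UNIV"
    and S2: "(\<lambda>i. 1 / (2 * s) * (cmod (\<eta> i))\<^sup>2) summable_on UNIV"
    using assms by (intro summable_on_cmult_right; simp add: ell2_def)+
  have "cmod (ell2_inner \<xi> \<eta>) \<le> (\<Sum>\<^sub>\<infinity>i. cmod (\<xi> i * cnj (\<eta> i)))"
    unfolding ell2_inner_def using ell2_abs_summable[OF assms] by (intro norm_infsum_bound) simp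
  also have "\<dots> \<le> (\<Sum>\<^sub>\<infinity>i. s / 2 * (cmod (\<xi> i))\<^sup>2 + 1 / (2 * s) * (cmod (\<eta> i))\<^sup>2)"
    using ell2_abs_summable[OF assms] S1 S2 *
    by (intro infsum_mono summable_on_add) auto
  also have "\<dots> = s / 2 * (ell2_norm \<xi>)\<^sup>2 + 1 / (2 * s) * (ell2_norm \<eta>)\<^sup>2"
    by (subst infsum_add[OF S1 S2]) (simp only: infsum_cmult_right' ell2_norm_square)
  also have "\<dots> = ell2_norm \<xi> * ell2_norm \<eta>"
    using pos by (simp add: s_def field_simps power2_eq_square)
  finally show ?thesis .
qed

lemma ell2_norm_add_square:
  assumes "\<xi> \<in> ell2" "\<eta> \<in> ell2"
  shows "(ell2_norm (\<lambda>i. \<xi> i + \<eta> i))\<^sup>2 = (ell2_norm \<xi>)\<^sup>2 + (ell2_norm \<eta>)\<^sup>2 + 2 * Re (ell2_inner \<xi> \<eta>)"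
proof -
  have "of_real ((ell2_norm (\<lambda>i. \<xi> i + \<eta> i))\<^sup>2) =
     ell2_inner \<xi> \<xi> + ell2_inner \<eta> \<xi> + (ell2_inner \<xi> \<eta> + ell2_inner \<eta> \<eta>)"
    using assms
    by (subst ell2_inner_self[symmetric]; simp add: ell2_add ell2_inner_add ell2_inner_add_right)
  then have "(ell2_norm (\<lambda>i. \<xi> i + \<eta> i))\<^sup>2 = Re (ell2_inner \<xi> \<xi> + ell2_inner \<eta> \<xi> + (ell2_inner \<xi> \<eta> + ell2_inner \<eta> \<eta>))"
    by (metis Re_complex_of_real)
  then show ?thesis
    using assms by (simp add: ell2_inner_self ell2_inner_commute[of \<eta> \<xi>])
qed

lemma ell2_norm_triangle:
  assumes "\<xi> \<in> ell2" "\<eta> \<in> ell2"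
  shows "ell2_norm (\<lambda>i. \<xi> i + \<eta> i) \<le> ell2_norm \<xi> + ell2_norm \<eta>"
proof -
  have "Re (ell2_inner \<xi> \<eta>) \<le> ell2_norm \<xi> * ell2_norm \<eta>"
    using ell2_Cauchy_Schwarz[OF assms] complex_Re_le_cmod order_trans by blast
  then have "(ell2_norm (\<lambda>i. \<xi> i + \<eta> i))\<^sup>2 \<le> (ell2_norm \<xi> + ell2_norm \<eta>)\<^sup>2"
    by (simp add: ell2_norm_add_square[OF assms] power2_sum)
  then show ?thesis by (rule power2_le_imp_le) simp
qed

lemma ell2_norm_sum:
  assumes "\<And>k. k \<in> A \<Longrightarrow> \<xi> k \<in> ell2"
  shows "ell2_norm (\<lambda>i. \<Sum>k\<in>A. \<xi> k i) \<le> (\<Sum>k\<in>A. ell2_norm (\<xi> k))"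
  using assms
proof (induction A rule: infinite_finite_induct)
  case (insert x F)
  have "ell2_norm (\<lambda>i. \<Sum>k\<in>insert x F. \<xi> k i) = ell2_norm (\<lambda>i. \<xi> x i + (\<Sum>k\<in>F. \<xi> k i))"
    using insert by simp
  also have "\<dots> \<le> ell2_norm (\<xi> x) + ell2_norm (\<lambda>i. \<Sum>k\<in>F. \<xi> k i)"
    using insert by (intro ell2_norm_triangle ell2_sum) auto
  also have "\<dots> \<le> (\<Sum>k\<in>insert x F. ell2_norm (\<xi> k))" using insert by simp
  finally show ?case .
qed auto

text \<open>The norms of approximately orthonormal or approximately invariant vectors are compared through this double
  sum.\<close>

lemma ell2_norm_sum_square:
  assumes "\<And>k. k \<in> A \<Longrightarrow> \<xi> k \<in> ell2"
  shows "of_real ((ell2_norm (\<lambda>i. \<Sum>k\<in>A. c k * \<xi> k i))\<^sup>2) =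
    (\<Sum>k\<in>A. \<Sum>l\<in>A. c k * cnj (c l) * ell2_inner (\<xi> k) (\<xi> l))"
proof -
  have e: "(\<lambda>i. c k * \<xi> k i) \<in> ell2" if "k \<in> A" for k
    using assms that ell2_scale by blast
  have "of_real ((ell2_norm (\<lambda>i. \<Sum>k\<in>A. c k * \<xi> k i))\<^sup>2) =
     (\<Sum>k\<in>A. ell2_inner (\<lambda>i. c k * \<xi> k i) (\<lambda>i. \<Sum>l\<in>A. c l * \<xi> l i))"
    using e by (subst ell2_inner_self[symmetric]; simp add: ell2_sum ell2_inner_sum)
  also have "\<dots> = (\<Sum>k\<in>A. \<Sum>l\<in>A. c k * cnj (c l) * ell2_inner (\<xi> k) (\<xi> l))"
    using assms e by (intro sum.cong refl)
      (simp add: ell2_inner_scale ell2_inner_scale_right ell2_sum ell2_inner_sum_right sum_distrib_left mult.assoc)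
  finally show ?thesis .
qed

lemma ell2_norm_eqI_inner:
  assumes "\<xi> \<in> ell2" "\<eta> \<in> ell2" "ell2_inner \<xi> \<xi> = ell2_inner \<eta> \<eta>"
  shows "ell2_norm \<xi> = ell2_norm \<eta>"
proof -
  have "of_real ((ell2_norm \<xi>)\<^sup>2) = (of_real ((ell2_norm \<eta>)\<^sup>2) :: complex)"
    using assms by (simp add: ell2_inner_self)
  then show ?thesis by (simp only: of_real_eq_iff) (simp add: power2_eq_iff_nonneg)
qed

lemma ell2_sum_norm_square_has_sum:
  assumes "finite A" "\<And>k. k \<in> A \<Longrightarrow> \<xi> k \<in> ell2"
  shows "((\<lambda>i. \<Sum>k\<in>A. (cmod (\<xi> k i))\<^sup>2) has_sum (\<Sum>k\<in>A. (ell2_norm (\<xi> k))\<^sup>2)) UNIV"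
  using assms
proof (induction A rule: finite_induct)
  case (insert x F)
  have "((\<lambda>i. (cmod (\<xi> x i))\<^sup>2) has_sum (ell2_norm (\<xi> x))\<^sup>2) UNIV"
    using insert by (simp add: ell2_norm_square ell2_def)
  from has_sum_add[OF this insert.IH] insert show ?case by simp
qed simp

text \<open>An inequality between complex matrices may be applied to vectors, coordinate by coordinate.\<close>

lemma ell2_matrix_bound:
  fixes B :: "'k \<Rightarrow> 'h \<Rightarrow> complex"
  assumes fin: "finite L" "finite K"
    and B: "\<And>z. (\<Sum>k\<in>L. (cmod (\<Sum>h\<in>K. B k h * z h))\<^sup>2) \<le> R * (\<Sum>h\<in>K. (cmod (z h))\<^sup>2)"
    and \<eta>: "\<And>h. h \<in> K \<Longrightarrow> \<eta> h \<in> ell2"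
  shows "(\<Sum>k\<in>L. (ell2_norm (\<lambda>i. \<Sum>h\<in>K. B k h * \<eta> h i))\<^sup>2) \<le> R * (\<Sum>h\<in>K. (ell2_norm (\<eta> h))\<^sup>2)"
proof (rule has_sum_mono)
  show "((\<lambda>i. \<Sum>k\<in>L. (cmod (\<Sum>h\<in>K. B k h * \<eta> h i))\<^sup>2) has_sum
      (\<Sum>k\<in>L. (ell2_norm (\<lambda>i. \<Sum>h\<in>K. B k h * \<eta> h i))\<^sup>2)) UNIV"
    using fin \<eta> by (intro ell2_sum_norm_square_has_sum ell2_sum ell2_scale)
  show "((\<lambda>i. R * (\<Sum>h\<in>K. (cmod (\<eta> h i))\<^sup>2)) has_sum R * (\<Sum>h\<in>K. (ell2_norm (\<eta> h))\<^sup>2)) UNIV"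
    using fin \<eta> by (intro has_sum_cmult_right ell2_sum_norm_square_has_sum)
qed (rule B)

definition delta :: "'i \<Rightarrow> 'i \<Rightarrow> complex" where
  "delta k = (\<lambda>i. if i = k then 1 else 0)"

lemma finite_support_ell2:
  assumes "finite Z" "\<And>i. i \<notin> Z \<Longrightarrow> \<xi> i = 0"
  shows "\<xi> \<in> ell2"
  unfolding ell2_def mem_Collect_eq
  by (rule finite_nonzero_values_imp_summable_on, rule finite_subset[OF _ assms(1)]) (use assms(2) in auto)

lemma delta_ell2 [simp]: "delta k \<in> ell2"
  by (rule finite_support_ell2[of "{k}"]) (auto simp: delta_def)

lemma ell2_inner_delta: "ell2_inner \<xi> (delta k) = \<xi> k"
proof -
  have "ell2_inner \<xi> (delta k) = (\<Sum>\<^sub>\<infinity>i\<in>{k}. \<xi> i * cnj (delta k i))"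
    unfolding ell2_inner_def by (rule infsum_cong_neutral) (auto simp: delta_def)
  then show ?thesis by (simp add: delta_def)
qed

lemma ell2_norm_finite_support:
  assumes "finite Z" "\<And>i. i \<notin> Z \<Longrightarrow> \<xi> i = 0"
  shows "ell2_norm \<xi> = L2_set (\<lambda>i. cmod (\<xi> i)) Z"
proof -
  have "(\<Sum>\<^sub>\<infinity>i. (cmod (\<xi> i))\<^sup>2) = (\<Sum>\<^sub>\<infinity>i\<in>Z. (cmod (\<xi> i))\<^sup>2)"
    by (rule infsum_cong_neutral) (use assms(2) in auto)
  then show ?thesis using assms(1) by (simp add: ell2_norm_def L2_set_def)
qed

lemma ell2_norm_delta: "ell2_norm (delta k) = 1"
  by (subst ell2_norm_finite_support[of "{k}"]) (auto simp: delta_def L2_set_def)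

section \<open>Bounded operators\<close>

lemma bounded_operatorD:
  assumes "bounded_operator T"
  shows "\<xi> \<in> ell2 \<Longrightarrow> T \<xi> \<in> ell2"
    and "\<xi> \<in> ell2 \<Longrightarrow> \<eta> \<in> ell2 \<Longrightarrow> T (\<lambda>i. \<xi> i + \<eta> i) = (\<lambda>i. T \<xi> i + T \<eta> i)"
    and "\<xi> \<in> ell2 \<Longrightarrow> T (\<lambda>i. c * \<xi> i) = (\<lambda>i. c * T \<xi> i)"
  using assms by (auto simp: bounded_operator_def)

lemma bounded_operator_zero: "bounded_operator T \<Longrightarrow> T (\<lambda>i. 0) = (\<lambda>i. 0)"
  using bounded_operatorD(3)[of T "\<lambda>i. 0" 0] by simp

lemma bounded_operator_sum:
  assumes "bounded_operator T" "\<And>k. k \<in> A \<Longrightarrow> \<xi> k \<in> ell2"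
  shows "T (\<lambda>i. \<Sum>k\<in>A. \<xi> k i) = (\<lambda>i. \<Sum>k\<in>A. T (\<xi> k) i)"
  using assms(2)
proof (induction A rule: infinite_finite_induct)
  case (insert x F)
  then show ?case
    using bounded_operatorD(2)[OF assms(1), of "\<xi> x" "\<lambda>i. \<Sum>k\<in>F. \<xi> k i"] ell2_sum[of F \<xi>] by auto
qed (auto simp: bounded_operator_zero[OF assms(1)])

lemma bounded_operator_diff:
  assumes "bounded_operator T" "\<xi> \<in> ell2" "\<eta> \<in> ell2"
  shows "T (\<lambda>i. \<xi> i - \<eta> i) = (\<lambda>i. T \<xi> i - T \<eta> i)"
  using bounded_operatorD(2)[OF assms(1,2) ell2_scale[OF assms(3), of "-1"]]
    bounded_operatorD(3)[OF assms(1,3), of "-1"] by simp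

lemma operator_norm_le:
  assumes "\<And>\<xi>. \<xi> \<in> ell2 \<Longrightarrow> ell2_norm (T \<xi>) \<le> C * ell2_norm \<xi>" "0 \<le> C"
  shows "operator_norm T \<le> C"
  unfolding operator_norm_def
proof (rule cSUP_least)
  show "{\<xi> \<in> ell2. ell2_norm \<xi> \<le> 1} \<noteq> {}" using ell2_zero ell2_norm_zero by fastforce
  fix \<xi> :: "'a \<Rightarrow> complex" assume "\<xi> \<in> {\<xi> \<in> ell2. ell2_norm \<xi> \<le> 1}"
  then show "ell2_norm (T \<xi>) \<le> C"
    using assms(1)[of \<xi>] mult_left_mono[of "ell2_norm \<xi>" 1 C] assms(2) by auto
qed

lemma operator_norm_bound:
  assumes T: "bounded_operator T" and \<xi>: "\<xi> \<in> ell2"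
  shows "ell2_norm (T \<xi>) \<le> operator_norm T * ell2_norm \<xi>"
proof (cases "ell2_norm \<xi> = 0")
  case True
  then show ?thesis using ell2_norm_eq_zero[OF \<xi>] bounded_operator_zero[OF T] by simp
next
  case False
  obtain C where C: "\<And>\<xi>. \<xi> \<in> ell2 \<Longrightarrow> ell2_norm (T \<xi>) \<le> C * ell2_norm \<xi>"
    using T unfolding bounded_operator_def by blast
  define c where "c = complex_of_real (1 / ell2_norm \<xi>)"
  have c: "cmod c * ell2_norm \<xi> = 1"
    using False by (simp add: c_def norm_divide)
  have "bdd_above ((\<lambda>\<xi>. ell2_norm (T \<xi>)) ` {\<xi> \<in> ell2. ell2_norm \<xi> \<le> 1})"
  proof (rule bdd_aboveI2)
    fix \<eta> :: "'a \<Rightarrow> complex" assume \<eta>: "\<eta> \<in> {\<xi> \<in> ell2. ell2_norm \<xi> \<le> 1}"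
    have "ell2_norm (T \<eta>) \<le> C * ell2_norm \<eta>" using C \<eta> by auto
    also have "\<dots> \<le> \<bar>C\<bar> * ell2_norm \<eta>" by (simp add: mult_right_mono)
    also have "\<dots> \<le> \<bar>C\<bar>" using \<eta> mult_left_mono[of "ell2_norm \<eta>" 1 "\<bar>C\<bar>"] by auto
    finally show "ell2_norm (T \<eta>) \<le> \<bar>C\<bar>" .
  qed
  then have "ell2_norm (T (\<lambda>i. c * \<xi> i)) \<le> operator_norm T"
    unfolding operator_norm_def
    using \<xi> c by (intro cSUP_upper) (auto simp: ell2_scale ell2_norm_scale)
  then have "cmod c * ell2_norm (T \<xi>) \<le> operator_norm T"
    using bounded_operatorD[OF T] \<xi> by (simp add: ell2_norm_scale)
  then have "cmod c * ell2_norm (T \<xi>) * ell2_norm \<xi> \<le> operator_norm T * ell2_norm \<xi>"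
    by (simp add: mult_right_mono)
  moreover have "cmod c * ell2_norm (T \<xi>) * ell2_norm \<xi> = (cmod c * ell2_norm \<xi>) * ell2_norm (T \<xi>)"
    by (simp add: mult_ac)
  ultimately show ?thesis using c by simp
qed

section \<open>Functions vanishing at infinity\<close>

lemma C0_continuous: "f \<in> C0 \<Longrightarrow> continuous_on UNIV f"
  by (simp add: C0_def)

lemma C0_I:
  assumes "continuous_on UNIV f" "\<And>e. e > 0 \<Longrightarrow> \<exists>K. compact K \<and> (\<forall>x. x \<notin> K \<longrightarrow> cmod (f x) < e)"
  shows "f \<in> C0"
  using assms by (simp add: C0_def)

lemma C0_small:
  assumes "f \<in> C0" "e > 0"
  obtains K where "compact K" "\<And>x. x \<notin> K \<Longrightarrow> cmod (f x) < e"
  using assms by (auto simp: C0_def)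

lemma C0_compact_support:
  assumes "continuous_on UNIV f" "compact K" "\<And>x. x \<notin> K \<Longrightarrow> f x = 0"
  shows "f \<in> C0"
  using assms by (intro C0_I) auto

lemma C0_zero [simp]: "(\<lambda>x. 0) \<in> C0"
  by (rule C0_compact_support[of _ "{}"]) auto

lemma C0_compose:
  assumes f: "f \<in> C0" and \<phi>: "continuous_on UNIV \<phi>" "\<phi> 0 = 0"
  shows "(\<lambda>x. \<phi> (f x)) \<in> C0"
proof (rule C0_I)
  show "continuous_on UNIV (\<lambda>x. \<phi> (f x))"
    using continuous_on_compose2[OF \<phi>(1) C0_continuous[OF f]] by auto
  fix e :: real assume "e > 0"
  moreover have "isCont \<phi> 0" using \<phi>(1) by (simp add: continuous_on_eq_continuous_at)
  ultimately obtain d where d: "d > 0" "\<And>z. cmod z < d \<Longrightarrow> cmod (\<phi> z) < e"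
    using \<phi>(2) unfolding continuous_at_eps_delta by (auto simp: dist_norm)
  obtain K where "compact K" "\<And>x. x \<notin> K \<Longrightarrow> cmod (f x) < d" using C0_small[OF f d(1)] by blast
  with d show "\<exists>K. compact K \<and> (\<forall>x. x \<notin> K \<longrightarrow> cmod (\<phi> (f x)) < e)" by blast
qed

lemma C0_scale: "f \<in> C0 \<Longrightarrow> (\<lambda>x. c * f x) \<in> C0"
  by (rule C0_compose[where \<phi>="\<lambda>z. c * z"]) (auto intro!: continuous_intros)

lemma C0_cnj: "f \<in> C0 \<Longrightarrow> (\<lambda>x. cnj (f x)) \<in> C0"
  by (rule C0_compose[where \<phi>=cnj]) (auto intro!: continuous_intros)

lemma C0_add:
  assumes "f \<in> C0" "g \<in> C0"
  shows "(\<lambda>x. f x + g x) \<in> C0"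
proof (rule C0_I)
  show "continuous_on UNIV (\<lambda>x. f x + g x)"
    using assms by (intro continuous_intros C0_continuous)
  fix e :: real assume e: "e > 0"
  then have "e/2 > 0" by simp
  obtain K where K: "compact K" "\<And>x. x \<notin> K \<Longrightarrow> cmod (f x) < e/2"
    using C0_small[OF assms(1) \<open>e/2>0\<close>] by blast
  obtain K' where K': "compact K'" "\<And>x. x \<notin> K' \<Longrightarrow> cmod (g x) < e/2"
    using C0_small[OF assms(2) \<open>e/2>0\<close>] by blast
  have "cmod (f x + g x) < e" if "x \<notin> K \<union> K'" for x
    using norm_triangle_ineq[of "f x" "g x"] K(2)[of x] K'(2)[of x] that by auto
  then show "\<exists>K. compact K \<and> (\<forall>x. x \<notin> K \<longrightarrow> cmod (f x + g x) < e)"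
    using K(1) K'(1) compact_Un by blast
qed

lemma C0_sum: "(\<And>k. k \<in> A \<Longrightarrow> f k \<in> C0) \<Longrightarrow> (\<lambda>x. \<Sum>k\<in>A. f k x) \<in> C0"
  by (induction A rule: infinite_finite_induct) (auto intro: C0_add)

lemma C0_diff: "f \<in> C0 \<Longrightarrow> g \<in> C0 \<Longrightarrow> (\<lambda>x. f x - g x) \<in> C0"
  using C0_add[of f "\<lambda>x. (-1) * g x"] C0_scale[of g "-1"] by simp

lemma C0_bounded:
  assumes f: "f \<in> C0"
  obtains B where "B > 0" "\<And>x. cmod (f x) \<le> B"
proof -
  obtain K where K: "compact K" "\<And>x. x \<notin> K \<Longrightarrow> cmod (f x) < 1" using C0_small[OF f, of 1] by auto
  have "compact (f ` K)"
    using K(1) C0_continuous[OF f] by (intro compact_continuous_image) (auto intro: continuous_on_subset)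
  then obtain b where b: "\<forall>z\<in>f ` K. cmod z \<le> b" using compact_imp_bounded bounded_iff by blast
  have "cmod (f x) \<le> max 1 b" for x
    using b K(2)[of x] by (cases "x \<in> K") auto
  then show ?thesis using that[of "max 1 b"] by auto
qed

lemma C0_mult_bounded:
  assumes f: "f \<in> C0" and g: "continuous_on UNIV g" "\<And>x. cmod (g x) \<le> B"
  shows "(\<lambda>x. f x * g x) \<in> C0"
proof (rule C0_I)
  show "continuous_on UNIV (\<lambda>x. f x * g x)"
    using C0_continuous[OF f] g by (intro continuous_intros)
  fix e :: real assume e: "e > 0"
  define d where "d = e / (\<bar>B\<bar> + 1)"
  have d: "d > 0" using e by (auto simp: d_def intro!: divide_pos_pos)
  obtain K where K: "compact K" "\<And>x. x \<notin> K \<Longrightarrow> cmod (f x) < d"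
    using C0_small[OF f d] by blast
  have "cmod (f x * g x) < e" if "x \<notin> K" for x
  proof -
    have "cmod (f x * g x) \<le> cmod (f x) * (\<bar>B\<bar> + 1)"
      using g(2)[of x] by (auto simp: norm_mult intro!: mult_left_mono)
    also have "\<dots> < d * (\<bar>B\<bar> + 1)" using K(2)[OF that] by (intro mult_strict_right_mono) auto
    also have "\<dots> = e" using e by (simp add: d_def)
    finally show ?thesis .
  qed
  with K(1) show "\<exists>K. compact K \<and> (\<forall>x. x \<notin> K \<longrightarrow> cmod (f x * g x) < e)" by blast
qed

lemma C0_mult: "f \<in> C0 \<Longrightarrow> g \<in> C0 \<Longrightarrow> (\<lambda>x. f x * g x) \<in> C0"
  by (metis C0_bounded C0_mult_bounded C0_continuous)

text \<open>A point of a locally compact Hausdorff space has a compact neighbourhood inside \<open>U\<close>, and the space is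
  completely regular, so a function can be made to vanish outside the interior of that neighbourhood.\<close>

lemma bump_function:
  fixes x :: "'x::t2_space"
  assumes lc: "locally_compact_space (euclidean :: 'x topology)" and U: "open U" "x \<in> U"
  obtains f :: "'x \<Rightarrow> real" and K where "continuous_on UNIV f" "\<And>y. 0 \<le> f y" "\<And>y. f y \<le> 1" "f x = 1"
    "compact K" "K \<subseteq> U" "\<And>y. y \<notin> K \<Longrightarrow> f y = 0"
proof -
  have H: "Hausdorff_space (euclidean :: 'x topology)"
    unfolding Hausdorff_space_def disjnt_def using hausdorff by auto
  have reg: "regular_space (euclidean :: 'x topology)"
    using lc H locally_compact_Hausdorff_imp_regular_space by blast
  then have cr: "completely_regular_space (euclidean :: 'x topology)"
    using lc locally_compact_regular_imp_completely_regular_space by blast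
  have "neighbourhood_base_of (compactin euclidean) (euclidean :: 'x topology)"
    using lc reg locally_compact_imp_neighbourhood_base by blast
  then have "\<exists>V K. openin euclidean V \<and> compactin euclidean K \<and> x \<in> V \<and> V \<subseteq> K \<and> K \<subseteq> U"
    using U open_openin[of U] unfolding neighbourhood_base_of by blast
  then obtain V K where VK: "open V" "compact K" "x \<in> V" "V \<subseteq> K" "K \<subseteq> U"
    using open_openin compactin_euclidean_iff by blast
  have "closedin euclidean (- V)" "x \<in> topspace euclidean - (- V)"
    using VK by (auto simp: closed_closedin[symmetric])
  then obtain f :: "'x \<Rightarrow> real" where f: "continuous_map euclidean (top_of_set {0..1}) f" "f x = 0" "f ` (- V) \<subseteq> {1}"
    using cr unfolding completely_regular_space_def by blast
  have c: "continuous_on UNIV f" and r: "\<And>y. f y \<in> {0..1}"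
    using f(1) by (auto simp: continuous_map_in_subtopology)
  show ?thesis
  proof (rule that[of "\<lambda>y. 1 - f y" K])
    show "continuous_on UNIV (\<lambda>y. 1 - f y)" using c by (intro continuous_intros)
    show "1 - f y = 0" if "y \<notin> K" for y using f(3) VK that by auto
  qed (use r f VK in auto)
qed

text \<open>Squares are used because \<open>\<Sum>\<^sub>c \<pi>(q\<^sub>c) b\<^sub>c \<pi>(q\<^sub>c)\<close> is a product of a row, a diagonal and a column of operators.
  The bumps are normalized by \<open>max S (1/2)\<close>, where \<open>S\<close> is their sum: this is continuous and positive everywhere,
  and equals \<open>S\<close> on \<open>Q\<close>, where some bump exceeds \<open>1/2\<close>.\<close>

lemma partition_of_unity_squares:
  fixes U :: "'x::t2_space \<Rightarrow> 'x set"
  assumes lc: "locally_compact_space (euclidean :: 'x topology)" and Q: "compact Q"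
    and U: "\<And>x. x \<in> Q \<Longrightarrow> open (U x)" "\<And>x. x \<in> Q \<Longrightarrow> x \<in> U x"
  obtains F and q :: "'x \<Rightarrow> 'x \<Rightarrow> real" where "finite F" "F \<subseteq> Q"
    "\<And>x. x \<in> F \<Longrightarrow> (\<lambda>y. of_real (q x y)) \<in> C0" "\<And>x y. x \<in> F \<Longrightarrow> 0 \<le> q x y"
    "\<And>x y. x \<in> F \<Longrightarrow> q x y \<noteq> 0 \<Longrightarrow> y \<in> U x"
    "\<And>y. (\<Sum>x\<in>F. (q x y)\<^sup>2) \<le> 1" "\<And>y. y \<in> Q \<Longrightarrow> (\<Sum>x\<in>F. (q x y)\<^sup>2) = 1"
proof -
  have "\<exists>f::'x \<Rightarrow> real. continuous_on UNIV f \<and> (\<forall>y. 0 \<le> f y) \<and> f x = 1 \<and>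
     (\<exists>K. compact K \<and> K \<subseteq> U x \<and> (\<forall>y. y \<notin> K \<longrightarrow> f y = 0))" if "x \<in> Q" for x
    by (rule bump_function[OF lc U(1)[OF that] U(2)[OF that]]) blast
  then obtain f :: "'x \<Rightarrow> 'x \<Rightarrow> real" where f: "\<And>x. x \<in> Q \<Longrightarrow> continuous_on UNIV (f x)"
     "\<And>x y. x \<in> Q \<Longrightarrow> 0 \<le> f x y" "\<And>x. x \<in> Q \<Longrightarrow> f x x = 1"
     "\<And>x. x \<in> Q \<Longrightarrow> \<exists>K. compact K \<and> K \<subseteq> U x \<and> (\<forall>y. y \<notin> K \<longrightarrow> f x y = 0)"
    by metis
  have op: "open {y. f x y > 1/2}" if "x \<in> Q" for x
    using f(1)[OF that] by (intro open_Collect_less) (auto intro: continuous_intros)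
  have "Q \<subseteq> (\<Union>x\<in>Q. {y. f x y > 1/2})" using f(3) by fastforce
  then obtain F where F: "F \<subseteq> Q" "finite F" "Q \<subseteq> (\<Union>x\<in>F. {y. f x y > 1/2})"
    using compactE_image[OF Q, of Q "\<lambda>x. {y. f x y > 1/2}"] op by metis
  define S where "S = (\<lambda>y. \<Sum>x\<in>F. f x y)"
  have S0: "0 \<le> S y" for y unfolding S_def using F f(2) by (intro sum_nonneg) auto
  have Sc: "continuous_on UNIV S" unfolding S_def using F f(1) by (intro continuous_intros) auto
  define q where "q = (\<lambda>x y. sqrt (f x y / max (S y) (1/2)))"
  have qsq: "(q x y)\<^sup>2 = f x y / max (S y) (1/2)" if "x \<in> F" for x y
    using f(2)[of x y] F that by (auto simp: q_def)
  have sq: "(\<Sum>x\<in>F. (q x y)\<^sup>2) = S y / max (S y) (1/2)" for y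
    unfolding S_def sum_divide_distrib using qsq by (intro sum.cong) (auto simp: S_def)
  show ?thesis
  proof (rule that[of F q])
    fix x assume x: "x \<in> F"
    then have xQ: "x \<in> Q" using F by auto
    obtain K where K: "compact K" "K \<subseteq> U x" "\<And>y. y \<notin> K \<Longrightarrow> f x y = 0" using f(4)[OF xQ] by auto
    show "(\<lambda>y. complex_of_real (q x y)) \<in> C0"
    proof (rule C0_compact_support[OF _ K(1)])
      show "continuous_on UNIV (\<lambda>y. complex_of_real (q x y))"
        unfolding q_def using f(1)[OF xQ] Sc by (intro continuous_intros) (auto simp: max_def)
    qed (use K in \<open>auto simp: q_def\<close>)
    show "0 \<le> q x y" for y using f(2)[OF xQ] by (auto simp: q_def)
    show "y \<in> U x" if "q x y \<noteq> 0" for y using that K by (auto simp: q_def)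
  next
    fix y
    show "(\<Sum>x\<in>F. (q x y)\<^sup>2) \<le> 1" unfolding sq using S0[of y] by (auto simp: field_simps max_def)
    assume "y \<in> Q"
    then obtain x where x: "x \<in> F" "f x y > 1/2" using F by auto
    then have "f x y \<le> S y" unfolding S_def using F f(2) by (intro member_le_sum) auto
    then show "(\<Sum>x\<in>F. (q x y)\<^sup>2) = 1" unfolding sq using x by (auto simp: max_def)
  qed (use F in auto)
qed

section \<open>Representations of functions vanishing at infinity\<close>

lemma C0_star_repD:
  assumes "C0_star_rep \<pi>" "f \<in> C0"
  shows "bounded_operator (\<pi> f)"
    and "f' \<in> C0 \<Longrightarrow> \<xi> \<in> ell2 \<Longrightarrow> \<pi> (\<lambda>x. f x + f' x) \<xi> = (\<lambda>i. \<pi> f \<xi> i + \<pi> f' \<xi> i)"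
    and "\<xi> \<in> ell2 \<Longrightarrow> \<pi> (\<lambda>x. c * f x) \<xi> = (\<lambda>i. c * \<pi> f \<xi> i)"
    and "f' \<in> C0 \<Longrightarrow> \<xi> \<in> ell2 \<Longrightarrow> \<pi> (\<lambda>x. f x * f' x) \<xi> = \<pi> f (\<pi> f' \<xi>)"
    and "\<xi> \<in> ell2 \<Longrightarrow> \<eta> \<in> ell2 \<Longrightarrow> ell2_inner (\<pi> (\<lambda>x. cnj (f x)) \<xi>) \<eta> = ell2_inner \<xi> (\<pi> f \<eta>)"
    and "\<xi> \<in> ell2 \<Longrightarrow> \<pi> f \<xi> \<in> ell2"
  using assms by (auto simp: C0_star_rep_def bounded_operator_def)

lemma C0_star_rep_zero:
  assumes "C0_star_rep \<pi>" "\<xi> \<in> ell2"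
  shows "\<pi> (\<lambda>x. 0) \<xi> = (\<lambda>i. 0)"
  using C0_star_repD(3)[OF assms(1) C0_zero assms(2), of 0] by simp

lemma C0_star_rep_sum:
  assumes "C0_star_rep \<pi>" "\<And>k. k \<in> A \<Longrightarrow> f k \<in> C0" "\<xi> \<in> ell2"
  shows "\<pi> (\<lambda>x. \<Sum>k\<in>A. f k x) \<xi> = (\<lambda>i. \<Sum>k\<in>A. \<pi> (f k) \<xi> i)"
  using assms(2)
proof (induction A rule: infinite_finite_induct)
  case (insert x F)
  then show ?case
    using C0_star_repD(2)[OF assms(1), of "f x" "\<lambda>y. \<Sum>k\<in>F. f k y" \<xi>] C0_sum[of F f] assms(3) by auto
qed (use C0_star_rep_zero[OF assms(1,3)] in auto)

lemma C0_star_rep_diff: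
  assumes "C0_star_rep \<pi>" "f \<in> C0" "g \<in> C0" "\<xi> \<in> ell2"
  shows "\<pi> (\<lambda>x. f x - g x) \<xi> = (\<lambda>i. \<pi> f \<xi> i - \<pi> g \<xi> i)"
  using C0_star_repD(2)[OF assms(1,2) C0_scale[OF assms(3), of "-1"] assms(4)]
    C0_star_repD(3)[OF assms(1,3,4), of "-1"] by simp

lemma C0_star_rep_norm_square:
  assumes "C0_star_rep \<pi>" "f \<in> C0" "\<xi> \<in> ell2"
  shows "of_real ((ell2_norm (\<pi> f \<xi>))\<^sup>2) = ell2_inner (\<pi> (\<lambda>x. of_real ((cmod (f x))\<^sup>2)) \<xi>) \<xi>"
proof -
  have "of_real ((ell2_norm (\<pi> f \<xi>))\<^sup>2) = ell2_inner (\<pi> f \<xi>) (\<pi> f \<xi>)"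
    using C0_star_repD(6)[OF assms] by (simp add: ell2_inner_self)
  also have "\<dots> = ell2_inner (\<pi> (\<lambda>x. cnj (f x)) (\<pi> f \<xi>)) \<xi>"
    using C0_star_repD(5)[OF assms(1,2) C0_star_repD(6)[OF assms] assms(3)] by simp
  also have "\<pi> (\<lambda>x. cnj (f x)) (\<pi> f \<xi>) = \<pi> (\<lambda>x. cnj (f x) * f x) \<xi>"
    using C0_star_repD(4)[OF assms(1) C0_cnj assms(2,3)] assms(2) by simp
  also have "(\<lambda>x. cnj (f x) * f x) = (\<lambda>x. of_real ((cmod (f x))\<^sup>2))"
    by (subst complex_norm_square) (simp add: mult.commute)
  finally show ?thesis .
qed

text \<open>If \<open>0 \<le> k \<le> C\<close> then \<open>C k - k\<^sup>2\<close> is the square of an element \<open>r\<close> of \<open>C0\<close>. For \<open>k = |f|\<^sup>2\<close> this gives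
  \<open>\<parallel>\<pi>(k) \<xi>\<parallel>\<^sup>2 \<le> C \<parallel>\<pi>(f) \<xi>\<parallel>\<^sup>2\<close>, while \<open>\<parallel>\<pi>(f) \<xi>\<parallel>\<^sup>2 = \<langle>\<pi>(k) \<xi>, \<xi>\<rangle> \<le> \<parallel>\<pi>(k) \<xi>\<parallel> \<parallel>\<xi>\<parallel>\<close>.\<close>

lemma C0_star_rep_contractive:
  assumes rep: "C0_star_rep \<pi>" and f: "f \<in> C0" and \<xi>: "\<xi> \<in> ell2" and c: "\<And>x. cmod (f x) \<le> c"
  shows "ell2_norm (\<pi> f \<xi>) \<le> c * ell2_norm \<xi>"
proof -
  define C where "C = c\<^sup>2"
  have c0: "0 \<le> c" using c norm_ge_zero order_trans by blast
  define k where "k = (\<lambda>x. complex_of_real ((cmod (f x))\<^sup>2))"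
  define r where "r = (\<lambda>x. complex_of_real (sqrt ((cmod (f x))\<^sup>2 * (C - (cmod (f x))\<^sup>2))))"
  have k: "k \<in> C0" unfolding k_def
    by (rule C0_compose[OF f, where \<phi>="\<lambda>z. complex_of_real ((cmod z)\<^sup>2)"]) (auto intro!: continuous_intros)
  have r: "r \<in> C0" unfolding r_def
    by (rule C0_compose[OF f, where \<phi>="\<lambda>z. complex_of_real (sqrt ((cmod z)\<^sup>2 * (C - (cmod z)\<^sup>2)))"])
      (auto intro!: continuous_intros)
  have le: "(cmod (f x))\<^sup>2 \<le> C" for x using c[of x] by (simp add: C_def power_mono)
  have rr: "(\<lambda>x. complex_of_real ((cmod (r x))\<^sup>2)) = (\<lambda>x. of_real C * k x - k x * k x)"
  proof
    fix x
    have "(cmod (r x))\<^sup>2 = (cmod (f x))\<^sup>2 * (C - (cmod (f x))\<^sup>2)"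
      unfolding r_def norm_of_real power2_abs using le[of x] by (intro real_sqrt_pow2) auto
    then show "complex_of_real ((cmod (r x))\<^sup>2) = of_real C * k x - k x * k x"
      unfolding k_def by (simp only:) (simp add: algebra_simps)
  qed
  have kk: "(\<lambda>x. complex_of_real ((cmod (k x))\<^sup>2)) = (\<lambda>x. k x * k x)"
    by (auto simp: k_def power2_eq_square norm_mult)
  have k\<xi>: "\<pi> k \<xi> \<in> ell2" and kk\<xi>: "\<pi> (\<lambda>x. k x * k x) \<xi> \<in> ell2"
    using C0_star_repD(6)[OF rep _ \<xi>] k C0_mult by blast+
  define a where "a = ell2_norm (\<pi> f \<xi>)"
  define b where "b = ell2_norm (\<pi> k \<xi>)"
  have fk: "complex_of_real (a\<^sup>2) = ell2_inner (\<pi> k \<xi>) \<xi>"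
    using C0_star_rep_norm_square[OF rep f \<xi>] by (simp add: a_def k_def)
  have bk: "complex_of_real (b\<^sup>2) = ell2_inner (\<pi> (\<lambda>x. k x * k x) \<xi>) \<xi>"
    using C0_star_rep_norm_square[OF rep k \<xi>] unfolding b_def kk .
  have "\<pi> (\<lambda>x. of_real C * k x - k x * k x) \<xi> = (\<lambda>i. of_real C * \<pi> k \<xi> i + (-1) * \<pi> (\<lambda>x. k x * k x) \<xi> i)"
    using C0_star_rep_diff[OF rep C0_scale[OF k, of "of_real C"] C0_mult[OF k k] \<xi>]
      C0_star_repD(3)[OF rep k \<xi>, of "of_real C"] by simp
  then have "complex_of_real ((ell2_norm (\<pi> r \<xi>))\<^sup>2) =
      ell2_inner (\<lambda>i. of_real C * \<pi> k \<xi> i + (-1) * \<pi> (\<lambda>x. k x * k x) \<xi> i) \<xi>"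
    using C0_star_rep_norm_square[OF rep r \<xi>] rr by simp
  also have "\<dots> = of_real C * of_real (a\<^sup>2) + (-1) * of_real (b\<^sup>2)"
    using k\<xi> kk\<xi> \<xi> ell2_scale[OF k\<xi>] ell2_scale[OF kk\<xi>]
    by (simp only: ell2_inner_add ell2_inner_scale fk bk)
  also have "\<dots> = complex_of_real (C * a\<^sup>2 - b\<^sup>2)" by simp
  finally have "(ell2_norm (\<pi> r \<xi>))\<^sup>2 = C * a\<^sup>2 - b\<^sup>2" using of_real_eq_iff by blast
  then have 1: "b\<^sup>2 \<le> C * a\<^sup>2" using zero_le_power2[of "ell2_norm (\<pi> r \<xi>)"] by linarith
  have "cmod (complex_of_real (a\<^sup>2)) \<le> b * ell2_norm \<xi>"
    unfolding fk b_def by (rule ell2_Cauchy_Schwarz[OF k\<xi> \<xi>])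
  then have 2: "a\<^sup>2 \<le> b * ell2_norm \<xi>" unfolding norm_of_real by simp
  have "(a\<^sup>2)\<^sup>2 \<le> (b * ell2_norm \<xi>)\<^sup>2" using 2 by (intro power_mono) auto
  also have "\<dots> \<le> C * a\<^sup>2 * (ell2_norm \<xi>)\<^sup>2"
    using 1 by (simp add: power_mult_distrib mult_right_mono)
  finally have 3: "a\<^sup>2 * a\<^sup>2 \<le> a\<^sup>2 * (c * ell2_norm \<xi>)\<^sup>2"
    by (simp add: C_def power2_eq_square mult_ac)
  have a0: "a \<ge> 0" by (simp add: a_def)
  show ?thesis
  proof (cases "a = 0")
    case False
    then have "a\<^sup>2 \<le> (c * ell2_norm \<xi>)\<^sup>2" using mult_left_le_imp_le[OF 3] by simp
    then show ?thesis unfolding a_def[symmetric] using c0 by (auto intro: power2_le_imp_le[OF _ mult_nonneg_nonneg])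
  qed (use c0 a_def in simp)
qed

text \<open>The sum is \<open>\<langle>\<pi>(\<Sum>\<^sub>j |q\<^sub>j|\<^sup>2) \<xi>, \<xi>\<rangle>\<close>.\<close>

lemma C0_star_rep_column_contractive:
  assumes rep: "C0_star_rep \<pi>" and A: "finite A" and q: "\<And>j. j \<in> A \<Longrightarrow> q j \<in> C0"
    and le: "\<And>x. (\<Sum>j\<in>A. (cmod (q j x))\<^sup>2) \<le> 1" and \<xi>: "\<xi> \<in> ell2"
  shows "(\<Sum>j\<in>A. (ell2_norm (\<pi> (q j) \<xi>))\<^sup>2) \<le> (ell2_norm \<xi>)\<^sup>2"
proof -
  define S where "S = (\<lambda>x. \<Sum>j\<in>A. complex_of_real ((cmod (q j x))\<^sup>2))"
  have qq: "(\<lambda>x. complex_of_real ((cmod (q j x))\<^sup>2)) \<in> C0" if "j \<in> A" for j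
    by (rule C0_compose[OF q[OF that], where \<phi>="\<lambda>z. complex_of_real ((cmod z)\<^sup>2)"])
      (auto intro!: continuous_intros)
  have S: "S \<in> C0" unfolding S_def using qq by (rule C0_sum)
  have S1: "cmod (S x) \<le> 1" for x
  proof -
    have "cmod (S x) = \<bar>\<Sum>j\<in>A. (cmod (q j x))\<^sup>2\<bar>" unfolding S_def of_real_sum[symmetric] norm_of_real ..
    also have "\<dots> \<le> 1" using le[of x] by (simp add: sum_nonneg)
    finally show ?thesis .
  qed
  have "complex_of_real (\<Sum>j\<in>A. (ell2_norm (\<pi> (q j) \<xi>))\<^sup>2) =
      (\<Sum>j\<in>A. ell2_inner (\<pi> (\<lambda>x. of_real ((cmod (q j x))\<^sup>2)) \<xi>) \<xi>)"
    unfolding of_real_sum using C0_star_rep_norm_square[OF rep q \<xi>] by (intro sum.cong) auto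
  also have "\<dots> = ell2_inner (\<lambda>i. \<Sum>j\<in>A. \<pi> (\<lambda>x. of_real ((cmod (q j x))\<^sup>2)) \<xi> i) \<xi>"
    by (rule ell2_inner_sum[symmetric]) (use C0_star_repD(6)[OF rep qq \<xi>] \<xi> in auto)
  also have "(\<lambda>i. \<Sum>j\<in>A. \<pi> (\<lambda>x. of_real ((cmod (q j x))\<^sup>2)) \<xi> i) = \<pi> S \<xi>"
    unfolding S_def by (rule C0_star_rep_sum[OF rep _ \<xi>, symmetric]) (rule qq)
  finally have e: "complex_of_real (\<Sum>j\<in>A. (ell2_norm (\<pi> (q j) \<xi>))\<^sup>2) = ell2_inner (\<pi> S \<xi>) \<xi>" .
  have "cmod (complex_of_real (\<Sum>j\<in>A. (ell2_norm (\<pi> (q j) \<xi>))\<^sup>2)) \<le> ell2_norm (\<pi> S \<xi>) * ell2_norm \<xi>"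
    unfolding e using ell2_Cauchy_Schwarz C0_star_repD(6)[OF rep S \<xi>] \<xi> by blast
  also have "\<dots> \<le> (1 * ell2_norm \<xi>) * ell2_norm \<xi>"
    by (intro mult_right_mono C0_star_rep_contractive[OF rep S \<xi> S1]) simp
  finally show ?thesis unfolding norm_of_real by (simp add: power2_eq_square)
qed

text \<open>The row is the adjoint of the column formed by the same functions.\<close>

lemma C0_star_rep_row_contractive:
  assumes rep: "C0_star_rep \<pi>" and A: "finite A" and q: "\<And>j. j \<in> A \<Longrightarrow> q j \<in> C0"
    and real: "\<And>j x. j \<in> A \<Longrightarrow> cnj (q j x) = q j x"
    and le: "\<And>x. (\<Sum>j\<in>A. (cmod (q j x))\<^sup>2) \<le> 1" and \<theta>: "\<And>j. j \<in> A \<Longrightarrow> \<theta> j \<in> ell2"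
  shows "(ell2_norm (\<lambda>i. \<Sum>j\<in>A. \<pi> (q j) (\<theta> j) i))\<^sup>2 \<le> (\<Sum>j\<in>A. (ell2_norm (\<theta> j))\<^sup>2)"
proof -
  define \<zeta> where "\<zeta> = (\<lambda>i. \<Sum>j\<in>A. \<pi> (q j) (\<theta> j) i)"
  have m: "\<pi> (q j) \<eta> \<in> ell2" if "j \<in> A" "\<eta> \<in> ell2" for j \<eta>
    using C0_star_repD(6)[OF rep q] that by blast
  have \<zeta>: "\<zeta> \<in> ell2" unfolding \<zeta>_def by (intro ell2_sum m \<theta>)
  define t where "t = L2_set (\<lambda>j. ell2_norm (\<theta> j)) A"
  have tsq: "t\<^sup>2 = (\<Sum>j\<in>A. (ell2_norm (\<theta> j))\<^sup>2)" by (simp add: t_def L2_set_def sum_nonneg)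
  have "of_real ((ell2_norm \<zeta>)\<^sup>2) = ell2_inner \<zeta> \<zeta>" using \<zeta> by (simp add: ell2_inner_self)
  also have "\<dots> = (\<Sum>j\<in>A. ell2_inner (\<pi> (q j) (\<theta> j)) \<zeta>)"
    unfolding \<zeta>_def using m \<theta> ell2_sum[of A "\<lambda>j. \<pi> (q j) (\<theta> j)"] by (intro ell2_inner_sum) auto
  also have "\<dots> = (\<Sum>j\<in>A. ell2_inner (\<theta> j) (\<pi> (q j) \<zeta>))"
    using C0_star_repD(5)[OF rep q \<theta> \<zeta>] real by (intro sum.cong) auto
  finally have "(ell2_norm \<zeta>)\<^sup>2 = cmod (\<Sum>j\<in>A. ell2_inner (\<theta> j) (\<pi> (q j) \<zeta>))"
    by (metis norm_of_real abs_power2)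
  also have "\<dots> \<le> (\<Sum>j\<in>A. ell2_norm (\<theta> j) * ell2_norm (\<pi> (q j) \<zeta>))"
    using ell2_Cauchy_Schwarz m \<theta> \<zeta> by (intro sum_norm_le) blast
  also have "\<dots> \<le> t * L2_set (\<lambda>j. ell2_norm (\<pi> (q j) \<zeta>)) A"
    unfolding t_def using L2_set_mult_ineq[of "\<lambda>j. ell2_norm (\<theta> j)" "\<lambda>j. ell2_norm (\<pi> (q j) \<zeta>)" A] by simp
  also have "L2_set (\<lambda>j. ell2_norm (\<pi> (q j) \<zeta>)) A \<le> ell2_norm \<zeta>"
    unfolding L2_set_def using C0_star_rep_column_contractive[OF rep A q le \<zeta>]
    by (intro real_le_lsqrt) (auto simp: sum_nonneg)
  finally have "ell2_norm \<zeta> * ell2_norm \<zeta> \<le> t * ell2_norm \<zeta>"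
    by (simp add: power2_eq_square t_def mult_left_mono)
  then have "ell2_norm \<zeta> \<le> t"
    using ell2_norm_nonneg[of \<zeta>] L2_set_nonneg[of "\<lambda>j. ell2_norm (\<theta> j)" A]
    unfolding t_def mult_le_cancel_right by linarith
  then show ?thesis unfolding \<zeta>_def[symmetric] tsq[symmetric] by (intro power_mono) auto
qed

text \<open>Near a point \<open>c\<close> of a fine cover the matrix \<open>b\<close> is close to the
  scalar matrix \<open>b(c)\<close>, so \<open>\<pi>(b)\<close> is close to \<open>\<Sum>\<^sub>c \<pi>(q\<^sub>c) b(c) \<pi>(q\<^sub>c)\<close>; this factors as a column contraction,
  a block diagonal of scalar matrices and a row contraction.\<close>

lemma C0_star_rep_matrix_contractive:
  fixes b :: "'k \<Rightarrow> 'h \<Rightarrow> 'x::t2_space \<Rightarrow> complex" and \<pi> :: "('x \<Rightarrow> complex) \<Rightarrow> 'i operator"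
  assumes lc: "locally_compact_space (euclidean :: 'x topology)" and rep: "C0_star_rep \<pi>"
    and fin: "finite L" "finite K" and b: "\<And>k h. k \<in> L \<Longrightarrow> h \<in> K \<Longrightarrow> b k h \<in> C0"
    and R: "0 \<le> R"
    and bd: "\<And>x z. (\<Sum>k\<in>L. (cmod (\<Sum>h\<in>K. b k h x * z h))\<^sup>2) \<le> R * (\<Sum>h\<in>K. (cmod (z h))\<^sup>2)"
    and \<eta>: "\<And>h. h \<in> K \<Longrightarrow> \<eta> h \<in> ell2"
  shows "(\<Sum>k\<in>L. (ell2_norm (\<lambda>i. \<Sum>h\<in>K. \<pi> (b k h) (\<eta> h) i))\<^sup>2) \<le> R * (\<Sum>h\<in>K. (ell2_norm (\<eta> h))\<^sup>2)"
proof -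
  define N where "N = (\<Sum>h\<in>K. (ell2_norm (\<eta> h))\<^sup>2)"
  define M where "M = (\<Sum>h\<in>K. ell2_norm (\<eta> h))"
  define A where "A = (\<lambda>k. ell2_norm (\<lambda>i. \<Sum>h\<in>K. \<pi> (b k h) (\<eta> h) i))"
  (* e bounds the oscillation of b on the sets of the cover and its size off the compact set Q *)
  have approx: "L2_set A L \<le> sqrt (R * N) + L2_set (\<lambda>k. 2 * M) L * e" if e: "e > 0" for e
  proof -
    have "\<exists>Q. compact Q \<and> (\<forall>y. y \<notin> Q \<longrightarrow> cmod (b k h y) < e)" if "k \<in> L" "h \<in> K" for k h
      using C0_small[OF b[OF that] e] by metis
    then obtain Q0 where Q0: "\<And>k h. k \<in> L \<Longrightarrow> h \<in> K \<Longrightarrow> compact (Q0 k h)"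
      "\<And>k h y. k \<in> L \<Longrightarrow> h \<in> K \<Longrightarrow> y \<notin> Q0 k h \<Longrightarrow> cmod (b k h y) < e" by metis
    define Q where "Q = (\<Union>k\<in>L. \<Union>h\<in>K. Q0 k h)"
    have Q: "compact Q" unfolding Q_def using fin Q0(1) by (intro compact_UN)
    define U where "U = (\<lambda>x. \<Inter>k\<in>L. \<Inter>h\<in>K. {y. cmod (b k h y - b k h x) < e})"
    have U: "open (U x)" "x \<in> U x" for x
    proof -
      show "open (U x)" unfolding U_def
        using fin C0_continuous[OF b] by (intro open_INT ballI open_Collect_less continuous_intros) auto
    qed (use e in \<open>auto simp: U_def\<close>)
    obtain F and q :: "'x \<Rightarrow> 'x \<Rightarrow> real" where F: "finite F"
      and q0: "\<And>x. x \<in> F \<Longrightarrow> (\<lambda>y. of_real (q x y)) \<in> C0" "\<And>x y. x \<in> F \<Longrightarrow> q x y \<noteq> 0 \<Longrightarrow> y \<in> U x"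
        "\<And>y. (\<Sum>x\<in>F. (q x y)\<^sup>2) \<le> 1" "\<And>y. y \<in> Q \<Longrightarrow> (\<Sum>x\<in>F. (q x y)\<^sup>2) = 1"
      using partition_of_unity_squares[OF lc Q, of U] U by metis
    define qc where "qc = (\<lambda>x y. complex_of_real (q x y))"
    have qc: "\<And>x. x \<in> F \<Longrightarrow> qc x \<in> C0" "\<And>x y. cnj (qc x y) = qc x y"
      "\<And>y. (\<Sum>x\<in>F. (cmod (qc x y))\<^sup>2) \<le> 1"
      using q0(1,3) by (auto simp: qc_def)
    define b' where "b' = (\<lambda>k h y. \<Sum>c\<in>F. qc c y * (b k h c * qc c y))"
    have b'C0: "b' k h \<in> C0" for k h
      unfolding b'_def using qc(1) by (intro C0_sum C0_mult C0_scale)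
    have close: "cmod (b k h y - b' k h y) \<le> 2 * e" if kh: "k \<in> L" "h \<in> K" for k h y
    proof -
      have s: "(\<Sum>c\<in>F. (q c y)\<^sup>2 * cmod (b k h y - b k h c)) \<le> (\<Sum>c\<in>F. (q c y)\<^sup>2 * e)"
      proof (rule sum_mono)
        fix c assume c: "c \<in> F"
        show "(q c y)\<^sup>2 * cmod (b k h y - b k h c) \<le> (q c y)\<^sup>2 * e"
        proof (cases "q c y = 0")
          case False
          then have "y \<in> U c" using q0(2) c by auto
          then have "cmod (b k h y - b k h c) < e" using kh by (auto simp: U_def)
          then show ?thesis by (intro mult_left_mono) auto
        qed simp
      qed
      have s2: "(\<Sum>c\<in>F. (q c y)\<^sup>2 * e) \<le> e"
        using q0(3)[of y] e by (simp flip: sum_distrib_right)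
      have "b k h y - b' k h y = of_real (1 - (\<Sum>c\<in>F. (q c y)\<^sup>2)) * b k h y
           + (\<Sum>c\<in>F. of_real ((q c y)\<^sup>2) * (b k h y - b k h c))"
        by (simp add: b'_def qc_def algebra_simps sum_subtractf sum_distrib_left power2_eq_square)
      then have "cmod (b k h y - b' k h y) \<le> cmod (of_real (1 - (\<Sum>c\<in>F. (q c y)\<^sup>2)) * b k h y)
           + cmod (\<Sum>c\<in>F. of_real ((q c y)\<^sup>2) * (b k h y - b k h c))"
        using norm_triangle_ineq by simp
      also have "cmod (\<Sum>c\<in>F. of_real ((q c y)\<^sup>2) * (b k h y - b k h c)) \<le> (\<Sum>c\<in>F. (q c y)\<^sup>2 * cmod (b k h y - b k h c))"
        by (rule order_trans[OF norm_sum]) (simp add: norm_mult norm_power)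
      also have "cmod (of_real (1 - (\<Sum>c\<in>F. (q c y)\<^sup>2)) * b k h y) \<le> e"
      proof (cases "y \<in> Q")
        case True
        then show ?thesis using q0(4)[OF True] e by simp
      next
        case False
        then have "cmod (b k h y) < e" using kh Q0(2) by (auto simp: Q_def)
        moreover have "cmod (of_real (1 - (\<Sum>c\<in>F. (q c y)\<^sup>2))) \<le> 1"
          unfolding norm_of_real using q0(3)[of y] by (simp add: sum_nonneg)
        ultimately show ?thesis unfolding norm_mult
          using mult_mono[of "cmod (of_real (1 - (\<Sum>c\<in>F. (q c y)\<^sup>2)))" 1 "cmod (b k h y)" e] by simp
      qed
      finally show ?thesis using s s2 by linarith
    qed
    define \<theta> where "\<theta> = (\<lambda>k c i. \<Sum>h\<in>K. b k h c * \<pi> (qc c) (\<eta> h) i)"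
    have m: "\<pi> (qc c) \<zeta> \<in> ell2" if "c \<in> F" "\<zeta> \<in> ell2" for c \<zeta>
      using C0_star_repD(6)[OF rep qc(1)] that by blast
    have \<theta>: "\<theta> k c \<in> ell2" if "c \<in> F" for k c
      unfolding \<theta>_def by (intro ell2_sum ell2_scale m \<eta> that)
    define B where "B = (\<lambda>k. ell2_norm (\<lambda>i. \<Sum>h\<in>K. \<pi> (b' k h) (\<eta> h) i))"
    have fact: "(\<lambda>i. \<Sum>h\<in>K. \<pi> (b' k h) (\<eta> h) i) = (\<lambda>i. \<Sum>c\<in>F. \<pi> (qc c) (\<theta> k c) i)" for k
    proof -
      have "\<pi> (b' k h) (\<eta> h) = (\<lambda>i. \<Sum>c\<in>F. \<pi> (qc c) (\<lambda>i. b k h c * \<pi> (qc c) (\<eta> h) i) i)" if h: "h \<in> K" for h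
      proof -
        have "\<pi> (b' k h) (\<eta> h) = (\<lambda>i. \<Sum>c\<in>F. \<pi> (\<lambda>y. qc c y * (b k h c * qc c y)) (\<eta> h) i)"
          unfolding b'_def using qc(1) by (intro C0_star_rep_sum[OF rep] C0_mult C0_scale \<eta> h)
        also have "\<dots> = (\<lambda>i. \<Sum>c\<in>F. \<pi> (qc c) (\<lambda>i. b k h c * \<pi> (qc c) (\<eta> h) i) i)"
          using C0_star_repD(4)[OF rep qc(1) C0_scale[OF qc(1)] \<eta>[OF h]]
            C0_star_repD(3)[OF rep qc(1) \<eta>[OF h]] by (intro ext sum.cong refl) auto
        finally show ?thesis .
      qed
      then have "(\<lambda>i. \<Sum>h\<in>K. \<pi> (b' k h) (\<eta> h) i) =
          (\<lambda>i. \<Sum>h\<in>K. \<Sum>c\<in>F. \<pi> (qc c) (\<lambda>i. b k h c * \<pi> (qc c) (\<eta> h) i) i)" by simp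
      also have "\<dots> = (\<lambda>i. \<Sum>c\<in>F. \<Sum>h\<in>K. \<pi> (qc c) (\<lambda>i. b k h c * \<pi> (qc c) (\<eta> h) i) i)"
        by (intro ext sum.swap)
      also have "\<dots> = (\<lambda>i. \<Sum>c\<in>F. \<pi> (qc c) (\<theta> k c) i)"
      proof (intro ext sum.cong refl)
        fix i c assume c: "c \<in> F"
        have "\<pi> (qc c) (\<theta> k c) = (\<lambda>i. \<Sum>h\<in>K. \<pi> (qc c) (\<lambda>i. b k h c * \<pi> (qc c) (\<eta> h) i) i)"
          unfolding \<theta>_def by (intro bounded_operator_sum C0_star_repD(1)[OF rep qc(1)] c ell2_scale m \<eta>)
        then show "(\<Sum>h\<in>K. \<pi> (qc c) (\<lambda>i. b k h c * \<pi> (qc c) (\<eta> h) i) i) = \<pi> (qc c) (\<theta> k c) i"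
          by simp
      qed
      finally show ?thesis .
    qed
    have "(\<Sum>k\<in>L. (B k)\<^sup>2) \<le> (\<Sum>k\<in>L. \<Sum>c\<in>F. (ell2_norm (\<theta> k c))\<^sup>2)"
      unfolding B_def fact
      by (intro sum_mono C0_star_rep_row_contractive[OF rep F]) (use qc \<theta> in auto)
    also have "\<dots> = (\<Sum>c\<in>F. \<Sum>k\<in>L. (ell2_norm (\<theta> k c))\<^sup>2)" by (rule sum.swap)
    also have "\<dots> \<le> (\<Sum>c\<in>F. R * (\<Sum>h\<in>K. (ell2_norm (\<pi> (qc c) (\<eta> h)))\<^sup>2))"
      unfolding \<theta>_def by (intro sum_mono ell2_matrix_bound fin bd m \<eta>)
    also have "\<dots> = R * (\<Sum>h\<in>K. \<Sum>c\<in>F. (ell2_norm (\<pi> (qc c) (\<eta> h)))\<^sup>2)"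
      unfolding sum_distrib_left[symmetric] by (subst sum.swap) simp
    also have "\<dots> \<le> R * N"
      unfolding N_def using qc \<eta> R
      by (intro mult_left_mono sum_mono C0_star_rep_column_contractive[OF rep F]) auto
    finally have BN: "L2_set B L \<le> sqrt (R * N)" unfolding L2_set_def by simp
    have "A k \<le> B k + e * (2 * M)" if k: "k \<in> L" for k
    proof -
      have bb: "\<pi> (b k h) (\<eta> h) \<in> ell2" "\<pi> (b' k h) (\<eta> h) \<in> ell2" if "h \<in> K" for h
        using C0_star_repD(6)[OF rep] b b'C0 \<eta> k that by blast+
      have dd: "\<pi> (\<lambda>x. b k h x - b' k h x) (\<eta> h) = (\<lambda>i. \<pi> (b k h) (\<eta> h) i - \<pi> (b' k h) (\<eta> h) i)" if "h \<in> K" for h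
        using C0_star_rep_diff[OF rep b b'C0 \<eta>] k that by blast
      have "A k = ell2_norm (\<lambda>i. (\<Sum>h\<in>K. \<pi> (b' k h) (\<eta> h) i) + (\<Sum>h\<in>K. \<pi> (b k h) (\<eta> h) i - \<pi> (b' k h) (\<eta> h) i))"
        unfolding A_def by (simp add: sum_subtractf)
      also have "\<dots> \<le> B k + ell2_norm (\<lambda>i. \<Sum>h\<in>K. \<pi> (b k h) (\<eta> h) i - \<pi> (b' k h) (\<eta> h) i)"
        unfolding B_def by (intro ell2_norm_triangle ell2_sum ell2_diff bb)
      also have "ell2_norm (\<lambda>i. \<Sum>h\<in>K. \<pi> (b k h) (\<eta> h) i - \<pi> (b' k h) (\<eta> h) i) \<le>
          (\<Sum>h\<in>K. ell2_norm (\<lambda>i. \<pi> (b k h) (\<eta> h) i - \<pi> (b' k h) (\<eta> h) i))"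
        by (intro ell2_norm_sum ell2_diff bb)
      also have "\<dots> \<le> (\<Sum>h\<in>K. 2 * e * ell2_norm (\<eta> h))"
      proof (rule sum_mono)
        fix h assume h: "h \<in> K"
        show "ell2_norm (\<lambda>i. \<pi> (b k h) (\<eta> h) i - \<pi> (b' k h) (\<eta> h) i) \<le> 2 * e * ell2_norm (\<eta> h)"
          unfolding dd[OF h, symmetric]
          by (intro C0_star_rep_contractive[OF rep] C0_diff b b'C0 \<eta> k h close)
      qed
      finally show ?thesis by (simp add: M_def sum_distrib_left mult_ac)
    qed
    then have "L2_set A L \<le> L2_set (\<lambda>k. B k + e * (2 * M)) L"
      by (intro L2_set_mono) (auto simp: A_def)
    also have "\<dots> \<le> L2_set B L + L2_set (\<lambda>k. e * (2 * M)) L" by (rule L2_set_triangle_ineq)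
    also have "L2_set (\<lambda>k. e * (2 * M)) L = L2_set (\<lambda>k. 2 * M) L * e"
      using e by (simp add: L2_set_right_distrib[symmetric])
    finally show ?thesis using BN by simp
  qed
  have "L2_set A L \<le> sqrt (R * N)"
  proof (rule field_le_epsilon)
    fix d :: real assume d: "d > 0"
    define c where "c = L2_set (\<lambda>k. 2 * M) L"
    have c: "c \<ge> 0" by (simp add: c_def)
    have "L2_set A L \<le> sqrt (R * N) + c * (d / (c + 1))"
      unfolding c_def by (rule approx) (use d c in \<open>auto simp: c_def[symmetric] intro!: divide_pos_pos\<close>)
    also have "c * (d / (c + 1)) \<le> d" using c d by (simp add: field_simps)
    finally show "L2_set A L \<le> sqrt (R * N) + d" by simp
  qed
  then have "(\<Sum>k\<in>L. (A k)\<^sup>2) \<le> R * N" unfolding L2_set_def by simp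
  then show ?thesis by (simp add: A_def N_def)
qed

section \<open>Covariant representations and their integrated forms\<close>

lemma unitary_repD:
  assumes "unitary_rep G u" "g \<in> carrier G"
  shows "bounded_operator (u g)" "\<xi> \<in> ell2 \<Longrightarrow> u g \<xi> \<in> ell2"
    "\<xi> \<in> ell2 \<Longrightarrow> \<eta> \<in> ell2 \<Longrightarrow> ell2_inner (u g \<xi>) (u g \<eta>) = ell2_inner \<xi> \<eta>"
    "h \<in> carrier G \<Longrightarrow> \<xi> \<in> ell2 \<Longrightarrow> u (g \<otimes>\<^bsub>G\<^esub> h) \<xi> = u g (u h \<xi>)"
    "\<xi> \<in> ell2 \<Longrightarrow> ell2_norm (u g \<xi>) = ell2_norm \<xi>"
proof -
  show *: "bounded_operator (u g)"
    using assms by (auto simp: unitary_rep_def unitary_operator_def)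
  show 2: "\<xi> \<in> ell2 \<Longrightarrow> u g \<xi> \<in> ell2"
    using * by (auto simp: bounded_operator_def)
  show 3: "\<xi> \<in> ell2 \<Longrightarrow> \<eta> \<in> ell2 \<Longrightarrow> ell2_inner (u g \<xi>) (u g \<eta>) = ell2_inner \<xi> \<eta>" for \<eta>
    using assms by (auto simp: unitary_rep_def unitary_operator_def)
  show "h \<in> carrier G \<Longrightarrow> \<xi> \<in> ell2 \<Longrightarrow> u (g \<otimes>\<^bsub>G\<^esub> h) \<xi> = u g (u h \<xi>)"
    using assms by (auto simp: unitary_rep_def)
  show "\<xi> \<in> ell2 \<Longrightarrow> ell2_norm (u g \<xi>) = ell2_norm \<xi>"
    using 2 3[of \<xi>] ell2_norm_eqI_inner by blast
qed

locale dynamical_system = group G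
  for G :: "('g, 'b) monoid_scheme" (structure) +
  fixes \<alpha> :: "'g \<Rightarrow> 'x::t2_space \<Rightarrow> 'x"
  assumes locally_compact: "locally_compact_space (euclidean :: 'x topology)"
    and action: "action_by_homeomorphisms G \<alpha>"
begin

lemma group_action: "group_action G UNIV \<alpha>"
  using action by (simp add: action_by_homeomorphisms_def)

lemma act_mult: "g \<in> carrier G \<Longrightarrow> h \<in> carrier G \<Longrightarrow> \<alpha> (g \<otimes> h) x = \<alpha> g (\<alpha> h x)"
  using group_action.composition_rule[OF group_action] by simp

lemma act_one [simp]: "\<alpha> \<one> x = x"
  using group_action.id_eq_one[OF group_action] by (metis restrict_UNIV)

lemma act_inv [simp]:
  "g \<in> carrier G \<Longrightarrow> \<alpha> g (\<alpha> (inv g) x) = x" "g \<in> carrier G \<Longrightarrow> \<alpha> (inv g) (\<alpha> g x) = x"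
  by (simp_all flip: act_mult)

lemma act_continuous: "g \<in> carrier G \<Longrightarrow> continuous_on UNIV (\<alpha> g)"
  using action by (auto simp: action_by_homeomorphisms_def homeomorphism_def)

lemma act_fun_C0:
  assumes g: "g \<in> carrier G" and f: "f \<in> C0"
  shows "act_fun G \<alpha> g f \<in> C0"
proof (rule C0_I)
  show "continuous_on UNIV (act_fun G \<alpha> g f)"
    unfolding act_fun_def
    using continuous_on_compose2[OF C0_continuous[OF f] act_continuous[of "inv g"]] g by auto
  fix e :: real assume "e > 0"
  then obtain K where K: "compact K" "\<And>x. x \<notin> K \<Longrightarrow> cmod (f x) < e" using C0_small[OF f] by blast
  have "compact (\<alpha> g ` K)"
    using K(1) act_continuous[OF g] by (intro compact_continuous_image) (auto intro: continuous_on_subset)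
  moreover have "cmod (act_fun G \<alpha> g f x) < e" if "x \<notin> \<alpha> g ` K" for x
    unfolding act_fun_def using that g by (intro K(2)) (metis act_inv(1) image_eqI)
  ultimately show "\<exists>K. compact K \<and> (\<forall>x. x \<notin> K \<longrightarrow> cmod (act_fun G \<alpha> g f x) < e)" by blast
qed

lemma act_fun_mult:
  assumes "g \<in> carrier G" "h \<in> carrier G"
  shows "act_fun G \<alpha> (g \<otimes> h) f = act_fun G \<alpha> g (act_fun G \<alpha> h f)"
  using assms by (auto simp: act_fun_def inv_mult_group act_mult)

lemma act_fun_one [simp]: "act_fun G \<alpha> \<one> f = f"
  by (simp add: act_fun_def)

abbreviation "cp \<equiv> alg_crossed_product G \<alpha>"
abbreviation "cpc \<equiv> sa_carrier (alg_crossed_product G \<alpha>)"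

lemma cpcD:
  assumes "a \<in> cpc"
  shows "a g \<in> C0" "finite (cp_supp G a)" "g \<notin> carrier G \<Longrightarrow> a g = (\<lambda>x. 0)"
  using assms by (cases "g \<in> carrier G"; auto simp: alg_crossed_product_def)+

lemma cpcI:
  assumes "\<And>g. g \<in> carrier G \<Longrightarrow> a g \<in> C0" "\<And>g. g \<notin> carrier G \<Longrightarrow> a g = (\<lambda>x. 0)"
    "finite S" "\<And>g. g \<in> carrier G \<Longrightarrow> g \<notin> S \<Longrightarrow> a g = (\<lambda>x. 0)"
  shows "a \<in> cpc"
proof -
  have "cp_supp G a \<subseteq> S" using assms(4) by (auto simp: cp_supp_def)
  then have "finite (cp_supp G a)" using assms(3) finite_subset by blast
  then show ?thesis using assms(1,2) by (auto simp: alg_crossed_product_def)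
qed

lemma cp_supp_subset: "cp_supp G a \<subseteq> carrier G"
  by (auto simp: cp_supp_def)

lemma cp_supp_carrier: "g \<in> cp_supp G a \<Longrightarrow> g \<in> carrier G"
  by (simp add: cp_supp_def)

lemma cp_simps:
  "sa_add cp a b = (\<lambda>g x. a g x + b g x)"
  "sa_scale cp c a = (\<lambda>g x. c * a g x)"
  "sa_mult cp a b = (\<lambda>g x. if g \<in> carrier G
          then (\<Sum>h\<in>cp_supp G a. a h x * act_fun G \<alpha> h (b (inv h \<otimes> g)) x) else 0)"
  "sa_star cp a = (\<lambda>g x. if g \<in> carrier G
          then act_fun G \<alpha> g (\<lambda>y. cnj (a (inv g) y)) x else 0)"
  "sa_norm cp = universal_norm G \<alpha>"
  by (auto simp: alg_crossed_product_def)

lemma cp_add_closed: "a \<in> cpc \<Longrightarrow> b \<in> cpc \<Longrightarrow> sa_add cp a b \<in> cpc"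
  unfolding cp_simps
  by (rule cpcI[where S="cp_supp G a \<union> cp_supp G b"]) (auto simp: cpcD intro!: C0_add, auto simp: cp_supp_def)

lemma cp_scale_closed: "a \<in> cpc \<Longrightarrow> sa_scale cp c a \<in> cpc"
  unfolding cp_simps
  by (rule cpcI[where S="cp_supp G a"]) (auto simp: cpcD intro!: C0_scale, auto simp: cp_supp_def)

lemma cp_mult_outside:
  assumes "a \<in> cpc" "b \<in> cpc" "g \<in> carrier G" "g \<notin> (\<lambda>(h, k). h \<otimes> k) ` (cp_supp G a \<times> cp_supp G b)"
    "h \<in> cp_supp G a"
  shows "b (inv h \<otimes> g) = (\<lambda>x. 0)"
proof (rule ccontr)
  assume "b (inv h \<otimes> g) \<noteq> (\<lambda>x. 0)"
  moreover have h: "h \<in> carrier G" using assms by (auto simp: cp_supp_def)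
  ultimately have "inv h \<otimes> g \<in> cp_supp G b" using assms by (auto simp: cp_supp_def)
  moreover have "h \<otimes> (inv h \<otimes> g) = g" using h assms by (simp flip: m_assoc)
  ultimately show False using assms(4,5) by force
qed

lemma cp_mult_closed: "a \<in> cpc \<Longrightarrow> b \<in> cpc \<Longrightarrow> sa_mult cp a b \<in> cpc"
  unfolding cp_simps
proof (rule cpcI[where S="(\<lambda>(h, k). h \<otimes> k) ` (cp_supp G a \<times> cp_supp G b)"], goal_cases)
  case (1 g)
  then show ?case by (auto intro!: C0_sum C0_mult act_fun_C0 simp: cpcD) (auto simp: cp_supp_def)
next
  case (4 g)
  then show ?case by (auto simp: fun_eq_iff act_fun_def cp_mult_outside intro!: sum.neutral)
qed (auto simp: cpcD)

lemma cp_star_closed: "a \<in> cpc \<Longrightarrow> sa_star cp a \<in> cpc"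
  unfolding cp_simps
proof (rule cpcI[where S="(\<lambda>h. inv h) ` cp_supp G a"], goal_cases)
  case (1 g)
  then show ?case by (auto intro!: act_fun_C0 C0_cnj simp: cpcD)
next
  case (4 g)
  then have "inv g \<notin> cp_supp G a" by (metis imageI inv_inv)
  then show ?case using 4 by (auto simp: fun_eq_iff act_fun_def cp_supp_def)
qed (auto simp: cpcD)

lemma covariant_repD:
  assumes "covariant_rep G \<alpha> \<pi> u"
  shows "C0_star_rep \<pi>" "unitary_rep G u"
    "g \<in> carrier G \<Longrightarrow> f \<in> C0 \<Longrightarrow> \<xi> \<in> ell2 \<Longrightarrow> u g (\<pi> f \<xi>) = \<pi> (act_fun G \<alpha> g f) (u g \<xi>)"
  using assms by (auto simp: covariant_rep_def)

lemma unitary_rep_one: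
  assumes u: "unitary_rep G u" and \<xi>: "\<xi> \<in> ell2"
  shows "u \<one> \<xi> = \<xi>"
proof -
  have "\<xi> \<in> u \<one> ` ell2" using u \<xi> by (auto simp: unitary_rep_def unitary_operator_def)
  then obtain \<zeta> where "\<zeta> \<in> ell2" "\<xi> = u \<one> \<zeta>" by auto
  then show ?thesis using unitary_repD(4)[OF u, of \<one> \<one> \<zeta>] by simp
qed

lemma unitary_rep_adjoint:
  assumes u: "unitary_rep G u" and g: "g \<in> carrier G" and \<xi>\<eta>: "\<xi> \<in> ell2" "\<eta> \<in> ell2"
  shows "ell2_inner (u g \<xi>) \<eta> = ell2_inner \<xi> (u (inv g) \<eta>)"
proof -
  have "u g (u (inv g) \<eta>) = \<eta>"
    using unitary_repD(4)[OF u g, of "inv g" \<eta>] g \<xi>\<eta> unitary_rep_one[OF u] by simp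
  then show ?thesis
    using unitary_repD(3)[OF u g \<xi>\<eta>(1), of "u (inv g) \<eta>"] unitary_repD(2)[OF u, of "inv g" \<eta>] g \<xi>\<eta> by simp
qed

lemma covariant_ell2:
  assumes "covariant_rep G \<alpha> \<pi> u" "f \<in> C0" "g \<in> carrier G" "\<xi> \<in> ell2"
  shows "\<pi> f (u g \<xi>) \<in> ell2"
  using assms covariant_repD unitary_repD(2) C0_star_repD(6) by metis

lemma integrated_form_eq:
  assumes cov: "covariant_rep G \<alpha> \<pi> u" and a: "a \<in> cpc" and \<xi>: "\<xi> \<in> ell2"
    and S: "finite S" "cp_supp G a \<subseteq> S" "S \<subseteq> carrier G"
  shows "integrated_form G \<pi> u a \<xi> = (\<lambda>i. \<Sum>g\<in>S. \<pi> (a g) (u g \<xi>) i)"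
  unfolding integrated_form_def
proof (intro ext sum.mono_neutral_left S ballI)
  fix i g assume "g \<in> S - cp_supp G a"
  then have "g \<in> carrier G" "a g = (\<lambda>x. 0)" using S by (auto simp: cp_supp_def)
  then show "\<pi> (a g) (u g \<xi>) i = 0"
    using C0_star_rep_zero[OF covariant_repD(1)[OF cov]] unitary_repD(2)[OF covariant_repD(2)[OF cov] _ \<xi>] by simp
qed

lemma integrated_form_ell2:
  assumes cov: "covariant_rep G \<alpha> \<pi> u" and a: "a \<in> cpc" and \<xi>: "\<xi> \<in> ell2"
  shows "integrated_form G \<pi> u a \<xi> \<in> ell2"
  unfolding integrated_form_def
  by (intro ell2_sum covariant_ell2[OF cov] cpcD(1)[OF a] \<xi>) (auto simp: cp_supp_def)

lemma integrated_form_add: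
  assumes cov: "covariant_rep G \<alpha> \<pi> u" and a: "a \<in> cpc" "b \<in> cpc" and \<xi>: "\<xi> \<in> ell2"
  shows "integrated_form G \<pi> u (sa_add cp a b) \<xi> = (\<lambda>i. integrated_form G \<pi> u a \<xi> i + integrated_form G \<pi> u b \<xi> i)"
proof -
  define S where "S = cp_supp G a \<union> cp_supp G b \<union> cp_supp G (sa_add cp a b)"
  have sub: "cp_supp G a \<subseteq> S" "cp_supp G (sa_add cp a b) \<subseteq> S" "cp_supp G b \<subseteq> S" by (auto simp: S_def)
  have S: "finite S" "S \<subseteq> carrier G"
    using cpcD(2) a cp_add_closed by (auto simp: S_def dest: cp_supp_carrier)
  have "\<pi> (sa_add cp a b g) (u g \<xi>) = (\<lambda>i. \<pi> (a g) (u g \<xi>) i + \<pi> (b g) (u g \<xi>) i)" if "g \<in> S" for g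
    unfolding cp_simps using C0_star_repD(2)[OF covariant_repD(1)[OF cov]] cpcD(1) a
      unitary_repD(2)[OF covariant_repD(2)[OF cov] _ \<xi>] S that by blast
  then show ?thesis
    using integrated_form_eq[OF cov a(1) \<xi> S(1) sub(1) S(2)] integrated_form_eq[OF cov a(2) \<xi> S(1) sub(3) S(2)]
      integrated_form_eq[OF cov cp_add_closed[OF a] \<xi> S(1) sub(2) S(2)] by (auto simp: sum.distrib)
qed

lemma integrated_form_scale:
  assumes cov: "covariant_rep G \<alpha> \<pi> u" and a: "a \<in> cpc" and \<xi>: "\<xi> \<in> ell2"
  shows "integrated_form G \<pi> u (sa_scale cp c a) \<xi> = (\<lambda>i. c * integrated_form G \<pi> u a \<xi> i)"
proof -
  define S where "S = cp_supp G a \<union> cp_supp G (sa_scale cp c a)"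
  have sub: "cp_supp G a \<subseteq> S" "cp_supp G (sa_scale cp c a) \<subseteq> S" by (auto simp: S_def)
  have S: "finite S" "S \<subseteq> carrier G"
    using cpcD(2) a cp_scale_closed by (auto simp: S_def dest: cp_supp_carrier)
  have "\<pi> (sa_scale cp c a g) (u g \<xi>) = (\<lambda>i. c * \<pi> (a g) (u g \<xi>) i)" if "g \<in> S" for g
    unfolding cp_simps using C0_star_repD(3)[OF covariant_repD(1)[OF cov]] cpcD(1) a
      unitary_repD(2)[OF covariant_repD(2)[OF cov] _ \<xi>] S that by blast
  then show ?thesis
    using integrated_form_eq[OF cov a \<xi> S(1) sub(1) S(2)]
      integrated_form_eq[OF cov cp_scale_closed[OF a] \<xi> S(1) sub(2) S(2)] by (auto simp: sum_distrib_left)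
qed

lemma integrated_form_diff:
  assumes cov: "covariant_rep G \<alpha> \<pi> u" and a: "a \<in> cpc" "b \<in> cpc" and \<xi>: "\<xi> \<in> ell2"
  shows "integrated_form G \<pi> u (sa_add cp a (sa_scale cp (-1) b)) \<xi> =
     (\<lambda>i. integrated_form G \<pi> u a \<xi> i - integrated_form G \<pi> u b \<xi> i)"
  using integrated_form_add[OF cov a(1) cp_scale_closed[OF a(2)] \<xi>] integrated_form_scale[OF cov a(2) \<xi>] by simp

lemma integrated_form_bounded:
  assumes cov: "covariant_rep G \<alpha> \<pi> u" and a: "a \<in> cpc"
    and B: "\<And>g x. g \<in> cp_supp G a \<Longrightarrow> cmod (a g x) \<le> B g" and \<xi>: "\<xi> \<in> ell2"
  shows "ell2_norm (integrated_form G \<pi> u a \<xi>) \<le> (\<Sum>g\<in>cp_supp G a. B g) * ell2_norm \<xi>"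
proof -
  have g: "g \<in> carrier G" if "g \<in> cp_supp G a" for g using that by (auto simp: cp_supp_def)
  have "ell2_norm (integrated_form G \<pi> u a \<xi>) \<le> (\<Sum>g\<in>cp_supp G a. ell2_norm (\<pi> (a g) (u g \<xi>)))"
    unfolding integrated_form_def
    by (intro ell2_norm_sum covariant_ell2[OF cov] cpcD(1)[OF a] \<xi> g)
  also have "\<dots> \<le> (\<Sum>g\<in>cp_supp G a. B g * ell2_norm \<xi>)"
  proof (rule sum_mono)
    fix h assume h: "h \<in> cp_supp G a"
    have "ell2_norm (\<pi> (a h) (u h \<xi>)) \<le> B h * ell2_norm (u h \<xi>)"
      by (rule C0_star_rep_contractive[OF covariant_repD(1)[OF cov] cpcD(1)[OF a]
            unitary_repD(2)[OF covariant_repD(2)[OF cov] g[OF h] \<xi>] B[OF h]])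
    then show "ell2_norm (\<pi> (a h) (u h \<xi>)) \<le> B h * ell2_norm \<xi>"
      using unitary_repD(5)[OF covariant_repD(2)[OF cov] g[OF h] \<xi>] by simp
  qed
  finally show ?thesis by (simp add: sum_distrib_right)
qed

lemma cp_coefficient_bounds:
  assumes a: "a \<in> cpc"
  obtains B where "\<And>g x. cmod (a g x) \<le> B g"
proof -
  have "\<exists>b. \<forall>x. cmod (a g x) \<le> b" for g using C0_bounded[OF cpcD(1)[OF a, of g]] by blast
  then show ?thesis using that by metis
qed

lemma integrated_form_operator:
  fixes \<pi> :: "('x \<Rightarrow> complex) \<Rightarrow> 'i operator"
  assumes cov: "covariant_rep G \<alpha> \<pi> u" and a: "a \<in> cpc"
  shows "bounded_operator (integrated_form G \<pi> u a)"
proof -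
  note C = covariant_repD[OF cov]
  have g: "bounded_operator (\<pi> (a g))" "bounded_operator (u g)" if "g \<in> cp_supp G a" for g
    using C0_star_repD(1)[OF C(1) cpcD(1)[OF a]] unitary_repD(1)[OF C(2)] that by (auto simp: cp_supp_def)
  obtain B where B: "\<And>g x. cmod (a g x) \<le> B g" using cp_coefficient_bounds[OF a] by blast
  show ?thesis
    unfolding bounded_operator_def
  proof (intro conjI ballI allI)
    show "\<exists>C. \<forall>\<xi>\<in>ell2. ell2_norm (integrated_form G \<pi> u a \<xi>) \<le> C * ell2_norm \<xi>"
      using integrated_form_bounded[OF cov a, of B] B by blast
  next
    fix \<xi> \<eta> :: "'i \<Rightarrow> complex" assume "\<xi> \<in> ell2" "\<eta> \<in> ell2"
    then show "integrated_form G \<pi> u a (\<lambda>i. \<xi> i + \<eta> i) = (\<lambda>i. integrated_form G \<pi> u a \<xi> i + integrated_form G \<pi> u a \<eta> i)"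
      unfolding integrated_form_def sum.distrib[symmetric]
      using bounded_operatorD[OF g(1)] bounded_operatorD[OF g(2)] by (intro ext sum.cong) auto
  next
    fix c and \<xi> :: "'i \<Rightarrow> complex" assume "\<xi> \<in> ell2"
    then show "integrated_form G \<pi> u a (\<lambda>i. c * \<xi> i) = (\<lambda>i. c * integrated_form G \<pi> u a \<xi> i)"
      unfolding integrated_form_def sum_distrib_left
      using bounded_operatorD[OF g(1)] bounded_operatorD[OF g(2)] by (intro ext sum.cong) auto
  qed (rule integrated_form_ell2[OF cov a])
qed

text \<open>Covariance moves \<open>u h\<close> past \<open>\<pi> (b k)\<close>; the substitution \<open>g = h k\<close> then turns the double sum into the
  convolution.\<close>

lemma integrated_form_mult:
  assumes cov: "covariant_rep G \<alpha> \<pi> u" and a: "a \<in> cpc" "b \<in> cpc" and \<xi>: "\<xi> \<in> ell2"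
  shows "integrated_form G \<pi> u (sa_mult cp a b) \<xi> = integrated_form G \<pi> u a (integrated_form G \<pi> u b \<xi>)"
proof -
  note C = covariant_repD[OF cov]
  define Sa where "Sa = cp_supp G a"
  define Sb where "Sb = cp_supp G b"
  define P where "P = (\<lambda>(h, k). h \<otimes> k) ` (Sa \<times> Sb)"
  have Sa: "finite Sa" "Sa \<subseteq> carrier G" and Sb: "finite Sb" "Sb \<subseteq> carrier G"
    using cpcD(2) a cp_supp_subset by (simp_all add: Sa_def Sb_def)
  have P: "finite P" "P \<subseteq> carrier G" using Sa Sb by (auto simp: P_def)
  have u: "u g \<xi> \<in> ell2" if "g \<in> carrier G" for g
    using unitary_repD(2)[OF C(2) that \<xi>] .
  have sub: "cp_supp G (sa_mult cp a b) \<subseteq> P"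
  proof
    fix g assume "g \<in> cp_supp G (sa_mult cp a b)"
    then have g: "g \<in> carrier G" "sa_mult cp a b g \<noteq> (\<lambda>x. 0)" by (auto simp: cp_supp_def)
    show "g \<in> P"
    proof (rule ccontr)
      assume "g \<notin> P"
      then have "b (inv h \<otimes> g) = (\<lambda>x. 0)" if "h \<in> cp_supp G a" for h
        using cp_mult_outside[OF a g(1) _ that] unfolding P_def Sa_def Sb_def by blast
      then have "sa_mult cp a b g x = 0" for x
        by (auto simp: cp_simps act_fun_def intro!: sum.neutral)
      then show False using g(2) by auto
    qed
  qed
  define F where "F = (\<lambda>h k. \<pi> (\<lambda>x. a h x * act_fun G \<alpha> h (b k) x) (u (h \<otimes> k) \<xi>))"
  have "integrated_form G \<pi> u (sa_mult cp a b) \<xi> = (\<lambda>i. \<Sum>g\<in>P. \<pi> (sa_mult cp a b g) (u g \<xi>) i)"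
    by (rule integrated_form_eq[OF cov cp_mult_closed[OF a] \<xi> P(1) sub P(2)])
  also have "\<dots> = (\<lambda>i. \<Sum>g\<in>P. \<Sum>h\<in>Sa. \<pi> (\<lambda>x. a h x * act_fun G \<alpha> h (b (inv h \<otimes> g)) x) (u g \<xi>) i)"
  proof (intro ext sum.cong refl)
    fix i g assume "g \<in> P"
    then have g: "g \<in> carrier G" using P by auto
    have "sa_mult cp a b g = (\<lambda>x. \<Sum>h\<in>Sa. a h x * act_fun G \<alpha> h (b (inv h \<otimes> g)) x)"
      using g by (simp add: cp_simps Sa_def)
    moreover have "\<pi> (\<lambda>x. \<Sum>h\<in>Sa. a h x * act_fun G \<alpha> h (b (inv h \<otimes> g)) x) (u g \<xi>) =
        (\<lambda>i. \<Sum>h\<in>Sa. \<pi> (\<lambda>x. a h x * act_fun G \<alpha> h (b (inv h \<otimes> g)) x) (u g \<xi>) i)"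
      using Sa(2) by (intro C0_star_rep_sum[OF C(1)] u[OF g] C0_mult cpcD(1)[OF a(1)] act_fun_C0 cpcD(1)[OF a(2)]) auto
    ultimately show "\<pi> (sa_mult cp a b g) (u g \<xi>) i =
        (\<Sum>h\<in>Sa. \<pi> (\<lambda>x. a h x * act_fun G \<alpha> h (b (inv h \<otimes> g)) x) (u g \<xi>) i)" by simp
  qed
  also have "\<dots> = (\<lambda>i. \<Sum>h\<in>Sa. \<Sum>g\<in>P. \<pi> (\<lambda>x. a h x * act_fun G \<alpha> h (b (inv h \<otimes> g)) x) (u g \<xi>) i)"
    by (intro ext sum.swap)
  also have "\<dots> = (\<lambda>i. \<Sum>h\<in>Sa. \<Sum>k\<in>Sb. F h k i)"
  proof (rule ext, rule sum.cong[OF refl])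
    fix i h assume h: "h \<in> Sa"
    then have hc: "h \<in> carrier G" using Sa by auto
    have inj: "inj_on (\<lambda>k. h \<otimes> k) Sb"
      using hc Sb by (intro inj_onI) (metis Units_eq Units_l_cancel subsetD)
    have "(\<Sum>g\<in>P. \<pi> (\<lambda>x. a h x * act_fun G \<alpha> h (b (inv h \<otimes> g)) x) (u g \<xi>) i) =
        (\<Sum>g\<in>(\<lambda>k. h \<otimes> k) ` Sb. \<pi> (\<lambda>x. a h x * act_fun G \<alpha> h (b (inv h \<otimes> g)) x) (u g \<xi>) i)"
    proof (intro sum.mono_neutral_right P ballI)
      show "(\<lambda>k. h \<otimes> k) ` Sb \<subseteq> P" using h by (auto simp: P_def)
      fix g assume g: "g \<in> P - (\<lambda>k. h \<otimes> k) ` Sb"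
      then have gc: "g \<in> carrier G" using P by auto
      have "b (inv h \<otimes> g) = (\<lambda>x. 0)"
      proof (rule ccontr)
        assume "b (inv h \<otimes> g) \<noteq> (\<lambda>x. 0)"
        then have "inv h \<otimes> g \<in> Sb" using gc hc by (auto simp: Sb_def cp_supp_def)
        moreover have "h \<otimes> (inv h \<otimes> g) = g" using gc hc by (simp flip: m_assoc)
        ultimately show False using g by (metis DiffD2 image_eqI)
      qed
      then show "\<pi> (\<lambda>x. a h x * act_fun G \<alpha> h (b (inv h \<otimes> g)) x) (u g \<xi>) i = 0"
        using C0_star_rep_zero[OF C(1) u[OF gc]] by (simp add: act_fun_def)
    qed
    also have "\<dots> = (\<Sum>k\<in>Sb. F h k i)"
      unfolding sum.reindex[OF inj] F_def comp_def
      using hc Sb by (intro sum.cong refl) (auto simp flip: m_assoc)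
    finally show "(\<Sum>g\<in>P. \<pi> (\<lambda>x. a h x * act_fun G \<alpha> h (b (inv h \<otimes> g)) x) (u g \<xi>) i) = (\<Sum>k\<in>Sb. F h k i)" .
  qed
  also have "\<dots> = (\<lambda>i. \<Sum>h\<in>Sa. \<pi> (a h) (u h (integrated_form G \<pi> u b \<xi>)) i)"
  proof (intro ext sum.cong refl)
    fix i h assume h: "h \<in> Sa"
    then have hc: "h \<in> carrier G" using Sa by auto
    have e: "\<pi> (b k) (u k \<xi>) \<in> ell2" "u h (\<pi> (b k) (u k \<xi>)) \<in> ell2" if "k \<in> Sb" for k
      using C0_star_repD(6)[OF C(1) cpcD(1)[OF a(2)] u] unitary_repD(2)[OF C(2) hc] that Sb by auto
    have "\<pi> (a h) (u h (integrated_form G \<pi> u b \<xi>)) = \<pi> (a h) (u h (\<lambda>i. \<Sum>k\<in>Sb. \<pi> (b k) (u k \<xi>) i))"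
      by (simp add: integrated_form_def Sb_def)
    also have "\<dots> = \<pi> (a h) (\<lambda>i. \<Sum>k\<in>Sb. u h (\<pi> (b k) (u k \<xi>)) i)"
      using bounded_operator_sum[OF unitary_repD(1)[OF C(2) hc], of Sb "\<lambda>k. \<pi> (b k) (u k \<xi>)"] e by simp
    also have "\<dots> = (\<lambda>i. \<Sum>k\<in>Sb. \<pi> (a h) (u h (\<pi> (b k) (u k \<xi>))) i)"
      using bounded_operator_sum[OF C0_star_repD(1)[OF C(1) cpcD(1)[OF a(1)]], of Sb "\<lambda>k. u h (\<pi> (b k) (u k \<xi>))"] e by simp
    also have "\<dots> = (\<lambda>i. \<Sum>k\<in>Sb. F h k i)"
    proof (intro ext sum.cong refl)
      fix i k assume "k \<in> Sb"
      then have kc: "k \<in> carrier G" using Sb by auto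
      have "\<pi> (a h) (u h (\<pi> (b k) (u k \<xi>))) = \<pi> (a h) (\<pi> (act_fun G \<alpha> h (b k)) (u h (u k \<xi>)))"
        using C(3)[OF hc cpcD(1)[OF a(2)] u[OF kc]] by simp
      also have "\<dots> = \<pi> (a h) (\<pi> (act_fun G \<alpha> h (b k)) (u (h \<otimes> k) \<xi>))"
        using unitary_repD(4)[OF C(2) hc kc \<xi>] by simp
      also have "\<dots> = F h k" unfolding F_def
        using hc kc by (intro C0_star_repD(4)[OF C(1), symmetric] cpcD(1)[OF a(1)] act_fun_C0 cpcD(1)[OF a(2)] u) auto
      finally show "\<pi> (a h) (u h (\<pi> (b k) (u k \<xi>))) i = F h k i" by simp
    qed
    finally show "(\<Sum>k\<in>Sb. F h k i) = \<pi> (a h) (u h (integrated_form G \<pi> u b \<xi>)) i" by simp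
  qed
  also have "\<dots> = integrated_form G \<pi> u a (integrated_form G \<pi> u b \<xi>)"
    by (simp add: integrated_form_def Sa_def)
  finally show ?thesis .
qed

text \<open>Reindexing by inverses, with \<open>u (inv h)\<close> the adjoint of \<open>u h\<close>.\<close>

lemma integrated_form_star:
  assumes cov: "covariant_rep G \<alpha> \<pi> u" and a: "a \<in> cpc" and \<xi>: "\<xi> \<in> ell2" and \<eta>: "\<eta> \<in> ell2"
  shows "ell2_inner (integrated_form G \<pi> u (sa_star cp a) \<xi>) \<eta> = ell2_inner \<xi> (integrated_form G \<pi> u a \<eta>)"
proof -
  note C = covariant_repD[OF cov]
  define S where "S = cp_supp G a"
  have S: "finite S" "S \<subseteq> carrier G" using cpcD(2)[OF a] cp_supp_subset by (auto simp: S_def)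
  have inj: "inj_on (\<lambda>h. inv h) S" using S by (meson inj_on_subset inv_inj)
  have sub: "cp_supp G (sa_star cp a) \<subseteq> (\<lambda>h. inv h) ` S"
  proof
    fix g assume "g \<in> cp_supp G (sa_star cp a)"
    then have "g \<in> carrier G" "inv g \<in> S" by (auto simp: cp_supp_def cp_simps S_def act_fun_def fun_eq_iff)
    then show "g \<in> (\<lambda>h. inv h) ` S" by (metis image_eqI inv_inv)
  qed
  have "integrated_form G \<pi> u (sa_star cp a) \<xi> = (\<lambda>i. \<Sum>g\<in>(\<lambda>h. inv h) ` S. \<pi> (sa_star cp a g) (u g \<xi>) i)"
    using S by (intro integrated_form_eq[OF cov cp_star_closed[OF a] \<xi> _ sub]) auto
  also have "\<dots> = (\<lambda>i. \<Sum>h\<in>S. \<pi> (sa_star cp a (inv h)) (u (inv h) \<xi>) i)"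
    unfolding sum.reindex[OF inj] comp_def ..
  finally have "ell2_inner (integrated_form G \<pi> u (sa_star cp a) \<xi>) \<eta> =
      ell2_inner (\<lambda>i. \<Sum>h\<in>S. \<pi> (sa_star cp a (inv h)) (u (inv h) \<xi>) i) \<eta>" by simp
  also have "\<dots> = (\<Sum>h\<in>S. ell2_inner (\<pi> (sa_star cp a (inv h)) (u (inv h) \<xi>)) \<eta>)"
    using S by (intro ell2_inner_sum covariant_ell2[OF cov] cpcD(1)[OF cp_star_closed[OF a]] \<xi> \<eta>) auto
  also have "\<dots> = (\<Sum>h\<in>S. ell2_inner \<xi> (\<pi> (a h) (u h \<eta>)))"
  proof (rule sum.cong[OF refl])
    fix h assume "h \<in> S"
    then have h: "h \<in> carrier G" "inv h \<in> carrier G" using S by auto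
    have cn: "(\<lambda>y. cnj (a h y)) \<in> C0" by (intro C0_cnj cpcD(1)[OF a])
    have "sa_star cp a (inv h) = act_fun G \<alpha> (inv h) (\<lambda>y. cnj (a h y))"
      using h by (auto simp: cp_simps)
    then have "\<pi> (sa_star cp a (inv h)) (u (inv h) \<xi>) = u (inv h) (\<pi> (\<lambda>y. cnj (a h y)) \<xi>)"
      using C(3)[OF h(2) cn \<xi>] by simp
    then have "ell2_inner (\<pi> (sa_star cp a (inv h)) (u (inv h) \<xi>)) \<eta> = ell2_inner (\<pi> (\<lambda>y. cnj (a h y)) \<xi>) (u h \<eta>)"
      using unitary_rep_adjoint[OF C(2) h(2) C0_star_repD(6)[OF C(1) cn \<xi>] \<eta>] h by simp
    also have "\<dots> = ell2_inner \<xi> (\<pi> (a h) (u h \<eta>))"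
      by (intro C0_star_repD(5)[OF C(1) cpcD(1)[OF a] \<xi>] unitary_repD(2)[OF C(2)] h \<eta>)
    finally show "ell2_inner (\<pi> (sa_star cp a (inv h)) (u (inv h) \<xi>)) \<eta> = ell2_inner \<xi> (\<pi> (a h) (u h \<eta>))" .
  qed
  also have "\<dots> = ell2_inner \<xi> (integrated_form G \<pi> u a \<eta>)"
    unfolding integrated_form_def S_def[symmetric]
    using S by (intro ell2_inner_sum_right[symmetric] covariant_ell2[OF cov] cpcD(1)[OF a] \<xi> \<eta>) auto
  finally show ?thesis .
qed

section \<open>The universal norm\<close>

text \<open>It makes the supremum that defines the universal norm one over a non-empty set.\<close>

lemma trivial_covariant_rep: "covariant_rep G \<alpha> (\<lambda>f \<xi> i. 0) (\<lambda>g \<xi>. \<xi>)"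
  by (auto simp: covariant_rep_def C0_star_rep_def unitary_rep_def unitary_operator_def bounded_operator_def
      intro!: exI[of _ 1])

text \<open>The supremum is finite because every covariant representation is contractive on the coefficients, which
  are bounded functions.\<close>

lemma universal_norm_bound:
  fixes \<pi> :: "('x \<Rightarrow> complex) \<Rightarrow> ('g \<Rightarrow> 'x \<Rightarrow> complex) operator"
  assumes cov: "covariant_rep G \<alpha> \<pi> u" and a: "a \<in> cpc" and \<xi>: "\<xi> \<in> ell2"
  shows "ell2_norm (integrated_form G \<pi> u a \<xi>) \<le> universal_norm G \<alpha> a * ell2_norm \<xi>"
proof -
  let ?X = "{operator_norm (integrated_form G \<pi> u a) |
            (\<pi> :: ('x \<Rightarrow> complex) \<Rightarrow> ('g \<Rightarrow> 'x \<Rightarrow> complex) operator) u. covariant_rep G \<alpha> \<pi> u}"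
  obtain B where B: "\<And>g x. cmod (a g x) \<le> B g" using cp_coefficient_bounds[OF a] by blast
  have B0: "0 \<le> B g" for g using B norm_ge_zero order_trans by blast
  have "bdd_above ?X"
    using integrated_form_bounded[OF _ a, of _ _ B] B B0
    by (auto intro!: bdd_aboveI[of _ "\<Sum>g\<in>cp_supp G a. B g"] operator_norm_le sum_nonneg)
  then have "operator_norm (integrated_form G \<pi> u a) \<le> universal_norm G \<alpha> a"
    unfolding universal_norm_def using cov by (intro cSup_upper) auto
  then have "operator_norm (integrated_form G \<pi> u a) * ell2_norm \<xi> \<le> universal_norm G \<alpha> a * ell2_norm \<xi>"
    by (intro mult_right_mono) auto
  then show ?thesis
    using operator_norm_bound[OF integrated_form_operator[OF cov a] \<xi>] by linarith
qed

lemma universal_norm_le: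
  assumes "0 \<le> C" "\<And>(\<pi> :: ('x \<Rightarrow> complex) \<Rightarrow> ('g \<Rightarrow> 'x \<Rightarrow> complex) operator) u \<xi>.
      covariant_rep G \<alpha> \<pi> u \<Longrightarrow> \<xi> \<in> ell2 \<Longrightarrow> ell2_norm (integrated_form G \<pi> u a \<xi>) \<le> C * ell2_norm \<xi>"
  shows "universal_norm G \<alpha> a \<le> C"
  unfolding universal_norm_def
  by (rule cSup_least) (use trivial_covariant_rep in blast, use assms operator_norm_le in blast)

lemma universal_norm_nonneg:
  assumes "a \<in> cpc"
  shows "0 \<le> universal_norm G \<alpha> a"
proof -
  have "0 \<le> universal_norm G \<alpha> a * ell2_norm (delta undefined :: ('g \<Rightarrow> 'x \<Rightarrow> complex) \<Rightarrow> complex)"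
    using universal_norm_bound[OF trivial_covariant_rep assms delta_ell2] ell2_norm_nonneg order_trans by blast
  then show ?thesis by (simp add: ell2_norm_delta)
qed

lemma cp_diff_closed: "a \<in> cpc \<Longrightarrow> b \<in> cpc \<Longrightarrow> sa_add cp a (sa_scale cp (-1) b) \<in> cpc"
  by (intro cp_add_closed cp_scale_closed)

lemma cp_dist_bound:
  fixes \<pi> :: "('x \<Rightarrow> complex) \<Rightarrow> ('g \<Rightarrow> 'x \<Rightarrow> complex) operator"
  assumes cov: "covariant_rep G \<alpha> \<pi> u" and a: "a \<in> cpc" "b \<in> cpc" and \<xi>: "\<xi> \<in> ell2"
  shows "ell2_norm (\<lambda>i. integrated_form G \<pi> u a \<xi> i - integrated_form G \<pi> u b \<xi> i) \<le> sa_dist cp a b * ell2_norm \<xi>"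
  using universal_norm_bound[OF cov cp_diff_closed[OF a] \<xi>] integrated_form_diff[OF cov a \<xi>]
  by (simp add: sa_dist_def cp_simps)

lemma cp_dist_le:
  assumes "a \<in> cpc" "b \<in> cpc"
    and "0 \<le> C" "\<And>(\<pi> :: ('x \<Rightarrow> complex) \<Rightarrow> ('g \<Rightarrow> 'x \<Rightarrow> complex) operator) u \<xi>.
      covariant_rep G \<alpha> \<pi> u \<Longrightarrow> \<xi> \<in> ell2 \<Longrightarrow>
      ell2_norm (\<lambda>i. integrated_form G \<pi> u a \<xi> i - integrated_form G \<pi> u b \<xi> i) \<le> C * ell2_norm \<xi>"
  shows "sa_dist cp a b \<le> C"
  unfolding sa_dist_def cp_simps(5)
proof (rule universal_norm_le[OF assms(3)])
  fix \<pi> :: "('x \<Rightarrow> complex) \<Rightarrow> ('g \<Rightarrow> 'x \<Rightarrow> complex) operator" and u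
    and \<xi> :: "('g \<Rightarrow> 'x \<Rightarrow> complex) \<Rightarrow> complex"
  assume "covariant_rep G \<alpha> \<pi> u" "\<xi> \<in> ell2"
  then show "ell2_norm (integrated_form G \<pi> u (sa_add cp a (sa_scale cp (-1) b)) \<xi>) \<le> C * ell2_norm \<xi>"
    using integrated_form_diff[OF _ assms(1,2), of \<pi> u \<xi>] assms(4)[of \<pi> u \<xi>] by metis
qed

lemma cp_dist_nonneg: "a \<in> cpc \<Longrightarrow> b \<in> cpc \<Longrightarrow> 0 \<le> sa_dist cp a b"
  using universal_norm_nonneg[OF cp_diff_closed] by (simp add: sa_dist_def cp_simps)

end

section \<open>Matrix representations of a completion\<close>

lemma mat_adjoint_index:
  fixes M :: "complex mat"
  assumes "M \<in> carrier_mat n n" "i < n" "j < n"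
  shows "mat_adjoint M $$ (i, j) = cnj (M $$ (j, i))"
  using assms by (auto simp: mat_adjoint_def mat_of_rows_def)

lemma mat_adjoint_carrier: "M \<in> carrier_mat n n \<Longrightarrow> mat_adjoint M \<in> carrier_mat n n"
  for M :: "complex mat"
  by (auto simp: mat_adjoint_def mat_of_rows_def)

lemma mat_mult_index:
  fixes M :: "complex mat"
  assumes "M \<in> carrier_mat n n" "N \<in> carrier_mat n n" "i < n" "j < n"
  shows "(M * N) $$ (i, j) = (\<Sum>k<n. M $$ (i, k) * N $$ (k, j))"
  using assms by (auto simp: scalar_prod_def lessThan_atLeast0)

text \<open>The estimates that make the termwise operations on Cauchy sequences respect null sequences, stated in terms
  of the distance from which the completion is built.\<close>

locale pre_normed_star_algebra =
  fixes A :: "'a star_algebra"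
  assumes add_closed: "\<And>a b. a \<in> sa_carrier A \<Longrightarrow> b \<in> sa_carrier A \<Longrightarrow> sa_add A a b \<in> sa_carrier A"
    and scale_closed: "\<And>c a. a \<in> sa_carrier A \<Longrightarrow> sa_scale A c a \<in> sa_carrier A"
    and mult_closed: "\<And>a b. a \<in> sa_carrier A \<Longrightarrow> b \<in> sa_carrier A \<Longrightarrow> sa_mult A a b \<in> sa_carrier A"
    and star_closed: "\<And>a. a \<in> sa_carrier A \<Longrightarrow> sa_star A a \<in> sa_carrier A"
    and dist_self: "\<And>a. a \<in> sa_carrier A \<Longrightarrow> sa_dist A a a = 0"
    and dist_nonneg: "\<And>a b. a \<in> sa_carrier A \<Longrightarrow> b \<in> sa_carrier A \<Longrightarrow> 0 \<le> sa_dist A a b"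
    and dist_commute: "\<And>a b. a \<in> sa_carrier A \<Longrightarrow> b \<in> sa_carrier A \<Longrightarrow> sa_dist A a b = sa_dist A b a"
    and dist_triangle: "\<And>a b c. a \<in> sa_carrier A \<Longrightarrow> b \<in> sa_carrier A \<Longrightarrow> c \<in> sa_carrier A \<Longrightarrow>
          sa_dist A a c \<le> sa_dist A a b + sa_dist A b c"
    and norm_le: "\<And>a b. a \<in> sa_carrier A \<Longrightarrow> b \<in> sa_carrier A \<Longrightarrow> sa_norm A a \<le> sa_norm A b + sa_dist A a b"
    and dist_add: "\<And>a b a' b'. a \<in> sa_carrier A \<Longrightarrow> b \<in> sa_carrier A \<Longrightarrow> a' \<in> sa_carrier A \<Longrightarrow> b' \<in> sa_carrier A \<Longrightarrow>
          sa_dist A (sa_add A a b) (sa_add A a' b') \<le> sa_dist A a a' + sa_dist A b b'"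
    and dist_scale: "\<And>c a a'. a \<in> sa_carrier A \<Longrightarrow> a' \<in> sa_carrier A \<Longrightarrow>
          sa_dist A (sa_scale A c a) (sa_scale A c a') \<le> cmod c * sa_dist A a a'"
    and dist_mult: "\<And>a b a' b'. a \<in> sa_carrier A \<Longrightarrow> b \<in> sa_carrier A \<Longrightarrow> a' \<in> sa_carrier A \<Longrightarrow> b' \<in> sa_carrier A \<Longrightarrow>
          sa_dist A (sa_mult A a b) (sa_mult A a' b') \<le> sa_norm A a * sa_dist A b b' + sa_dist A a a' * sa_norm A b'"
    and dist_star: "\<And>a a'. a \<in> sa_carrier A \<Longrightarrow> a' \<in> sa_carrier A \<Longrightarrow>
          sa_dist A (sa_star A a) (sa_star A a') \<le> sa_dist A a a'"
begin

abbreviation "CS \<equiv> Cauchy_seqs A"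
abbreviation cls where "cls s \<equiv> null_rel A `` {s}"

lemma CSD: "s \<in> CS \<Longrightarrow> s n \<in> sa_carrier A"
  by (simp add: Cauchy_seqs_def)

lemma CS_Cauchy:
  assumes "s \<in> CS" "e > 0"
  obtains N where "\<And>m n. m \<ge> N \<Longrightarrow> n \<ge> N \<Longrightarrow> sa_dist A (s m) (s n) < e"
  using assms unfolding Cauchy_seqs_def by blast

lemma CS_const: "a \<in> sa_carrier A \<Longrightarrow> (\<lambda>n. a) \<in> CS"
  by (simp add: Cauchy_seqs_def dist_self)

lemma CS_bounded:
  assumes s: "s \<in> CS"
  obtains B where "\<And>n. sa_norm A (s n) \<le> B"
proof -
  obtain N where N: "\<And>m n. m \<ge> N \<Longrightarrow> n \<ge> N \<Longrightarrow> sa_dist A (s m) (s n) < 1" using CS_Cauchy[OF s, of 1] by auto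
  define B where "B = Max ((\<lambda>n. sa_norm A (s n)) ` {..N}) + 1"
  have M: "sa_norm A (s n) \<le> B - 1" if "n \<le> N" for n
    unfolding B_def using that by (auto intro!: Max_ge)
  have "sa_norm A (s n) \<le> B" for n
  proof (cases "n \<le> N")
    case False
    then have "sa_norm A (s n) \<le> sa_norm A (s N) + 1"
      using norm_le[OF CSD[OF s] CSD[OF s], of n N] N[of n N] by simp
    then show ?thesis using M[of N] by simp
  qed (use M[of n] in simp)
  then show ?thesis using that by blast
qed

lemma null_relD: "(s, t) \<in> null_rel A \<Longrightarrow> s \<in> CS \<and> t \<in> CS \<and> (\<lambda>n. sa_dist A (s n) (t n)) \<longlonglongrightarrow> 0"
  by (simp add: null_rel_def)

lemma equiv_null_rel: "equiv CS (null_rel A)"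
proof (rule equivI)
  show "null_rel A \<subseteq> CS \<times> CS" by (auto simp: null_rel_def)
  show "refl_on CS (null_rel A)"
    by (auto simp: refl_on_def null_rel_def dist_self CSD)
  show "sym (null_rel A)"
    by (auto simp: sym_def null_rel_def dist_commute CSD)
  show "trans (null_rel A)"
  proof (rule transI)
    fix s t w assume st: "(s, t) \<in> null_rel A" and tw: "(t, w) \<in> null_rel A"
    have "(\<lambda>n. sa_dist A (s n) (w n)) \<longlonglongrightarrow> 0"
    proof (rule tendsto_sandwich[OF _ _ tendsto_const])
      show "(\<lambda>n. sa_dist A (s n) (t n) + sa_dist A (t n) (w n)) \<longlonglongrightarrow> 0"
        using null_relD[OF st] null_relD[OF tw] tendsto_add[of _ 0 _ _ 0] by fastforce
      show "\<forall>\<^sub>F n in sequentially. sa_dist A (s n) (w n) \<le> sa_dist A (s n) (t n) + sa_dist A (t n) (w n)"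
        using null_relD[OF st] null_relD[OF tw] by (intro always_eventually allI dist_triangle) (auto dest: CSD)
      show "\<forall>\<^sub>F n in sequentially. 0 \<le> sa_dist A (s n) (w n)"
        using null_relD[OF st] null_relD[OF tw] by (intro always_eventually allI dist_nonneg) (auto dest: CSD)
    qed
    then show "(s, w) \<in> null_rel A" using null_relD[OF st] null_relD[OF tw] by (simp add: null_rel_def)
  qed
qed

text \<open>The form that covers all operations at once; unary ones are read as constant in the second argument.
  Bounds are imposed on \<open>a\<close> and \<open>b'\<close> because \<open>ab - a'b' = a(b - b') + (a - a')b'\<close>.\<close>

definition locally_Lipschitz :: "('a \<Rightarrow> 'a \<Rightarrow> 'a) \<Rightarrow> bool" where
  "locally_Lipschitz f \<longleftrightarrow> (\<forall>B. \<exists>K\<ge>0. \<forall>a\<in>sa_carrier A. \<forall>b\<in>sa_carrier A. \<forall>a'\<in>sa_carrier A. \<forall>b'\<in>sa_carrier A.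
     sa_norm A a \<le> B \<longrightarrow> sa_norm A b' \<le> B \<longrightarrow>
     f a b \<in> sa_carrier A \<and> sa_dist A (f a b) (f a' b') \<le> K * (sa_dist A a a' + sa_dist A b b'))"

lemma locally_Lipschitz_Cauchy:
  assumes f: "locally_Lipschitz f" and s: "s \<in> CS" and t: "t \<in> CS"
  shows "(\<lambda>n. f (s n) (t n)) \<in> CS"
proof -
  obtain B1 where B1: "\<And>n. sa_norm A (s n) \<le> B1" using CS_bounded[OF s] by blast
  obtain B2 where B2: "\<And>n. sa_norm A (t n) \<le> B2" using CS_bounded[OF t] by blast
  obtain K where K: "K \<ge> 0" "\<And>a b a' b'. a \<in> sa_carrier A \<Longrightarrow> b \<in> sa_carrier A \<Longrightarrow> a' \<in> sa_carrier A \<Longrightarrow>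
     b' \<in> sa_carrier A \<Longrightarrow> sa_norm A a \<le> max B1 B2 \<Longrightarrow> sa_norm A b' \<le> max B1 B2 \<Longrightarrow>
     f a b \<in> sa_carrier A \<and> sa_dist A (f a b) (f a' b') \<le> K * (sa_dist A a a' + sa_dist A b b')"
    using f unfolding locally_Lipschitz_def by metis
  have K2: "f (s m) (t m) \<in> sa_carrier A \<and>
     sa_dist A (f (s m) (t m)) (f (s n) (t n)) \<le> K * (sa_dist A (s m) (s n) + sa_dist A (t m) (t n))" for m n
    using CSD s t B1[of m] B2[of n] by (intro K(2)) auto
  show ?thesis unfolding Cauchy_seqs_def
  proof (intro CollectI conjI allI impI)
    show "f (s n) (t n) \<in> sa_carrier A" for n using K2 by blast
    fix e :: real assume e: "e > 0"
    define d where "d = e / (K + 1) / 2"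
    have d: "d > 0" using e K(1) by (auto simp: d_def)
    obtain N1 where N1: "\<And>m n. m \<ge> N1 \<Longrightarrow> n \<ge> N1 \<Longrightarrow> sa_dist A (s m) (s n) < d" using CS_Cauchy[OF s d] by blast
    obtain N2 where N2: "\<And>m n. m \<ge> N2 \<Longrightarrow> n \<ge> N2 \<Longrightarrow> sa_dist A (t m) (t n) < d" using CS_Cauchy[OF t d] by blast
    have "sa_dist A (f (s m) (t m)) (f (s n) (t n)) < e" if "m \<ge> max N1 N2" "n \<ge> max N1 N2" for m n
    proof -
      have "sa_dist A (f (s m) (t m)) (f (s n) (t n)) \<le> K * (sa_dist A (s m) (s n) + sa_dist A (t m) (t n))"
        using K2 by blast
      also have "\<dots> \<le> K * (d + d)" using N1[of m n] N2[of m n] that K(1) by (intro mult_left_mono) auto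
      also have "\<dots> < (K + 1) * (d + d)" using d by (intro mult_strict_right_mono) auto
      also have "\<dots> = e" using K(1) by (simp add: d_def divide_simps)
      finally show ?thesis .
    qed
    then show "\<exists>N. \<forall>m\<ge>N. \<forall>n\<ge>N. sa_dist A (f (s m) (t m)) (f (s n) (t n)) < e" by blast
  qed
qed

lemma locally_Lipschitz_null:
  assumes f: "locally_Lipschitz f" and s: "(s, s') \<in> null_rel A" and t: "(t, t') \<in> null_rel A"
  shows "(\<lambda>n. f (s n) (t n), \<lambda>n. f (s' n) (t' n)) \<in> null_rel A"
proof -
  have c: "s \<in> CS" "s' \<in> CS" "t \<in> CS" "t' \<in> CS" using null_relD s t by auto
  obtain B1 where B1: "\<And>n. sa_norm A (s n) \<le> B1" using CS_bounded[OF c(1)] by blast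
  obtain B2 where B2: "\<And>n. sa_norm A (t' n) \<le> B2" using CS_bounded[OF c(4)] by blast
  obtain K where K: "K \<ge> 0" "\<And>a b a' b'. a \<in> sa_carrier A \<Longrightarrow> b \<in> sa_carrier A \<Longrightarrow> a' \<in> sa_carrier A \<Longrightarrow>
     b' \<in> sa_carrier A \<Longrightarrow> sa_norm A a \<le> max B1 B2 \<Longrightarrow> sa_norm A b' \<le> max B1 B2 \<Longrightarrow>
     f a b \<in> sa_carrier A \<and> sa_dist A (f a b) (f a' b') \<le> K * (sa_dist A a a' + sa_dist A b b')"
    using f unfolding locally_Lipschitz_def by metis
  have K2: "sa_dist A (f (s n) (t n)) (f (s' n) (t' n)) \<le> K * (sa_dist A (s n) (s' n) + sa_dist A (t n) (t' n))" for n
    using CSD c B1[of n] B2[of n] by (intro K(2)[THEN conjunct2]) auto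
  have cl: "(\<lambda>n. f (s n) (t n)) \<in> CS" "(\<lambda>n. f (s' n) (t' n)) \<in> CS"
    using locally_Lipschitz_Cauchy[OF f] c by auto
  have "(\<lambda>n. sa_dist A (f (s n) (t n)) (f (s' n) (t' n))) \<longlonglongrightarrow> 0"
  proof (rule tendsto_sandwich[OF _ _ tendsto_const])
    have "(\<lambda>n. K * (sa_dist A (s n) (s' n) + sa_dist A (t n) (t' n))) \<longlonglongrightarrow> K * (0 + 0)"
      using null_relD s t by (intro tendsto_intros) auto
    then show "(\<lambda>n. K * (sa_dist A (s n) (s' n) + sa_dist A (t n) (t' n))) \<longlonglongrightarrow> 0" by simp
    show "\<forall>\<^sub>F n in sequentially. 0 \<le> sa_dist A (f (s n) (t n)) (f (s' n) (t' n))"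
      using CSD[OF cl(1)] CSD[OF cl(2)] by (intro always_eventually allI dist_nonneg) auto
  qed (use K2 in auto)
  then show ?thesis using cl by (simp add: null_rel_def)
qed

lemma locally_Lipschitz_class:
  assumes f: "locally_Lipschitz f" and s: "s \<in> CS" and t: "t \<in> CS"
  shows "(\<Union>s'\<in>cls s. \<Union>t'\<in>cls t. cls (\<lambda>n. f (s' n) (t' n))) = cls (\<lambda>n. f (s n) (t n))"
proof -
  have "cls (\<lambda>n. f (s' n) (t' n)) = cls (\<lambda>n. f (s n) (t n))" if "s' \<in> cls s" "t' \<in> cls t" for s' t'
    using locally_Lipschitz_null[OF f, of s s' t t'] that
    by (intro equiv_class_eq[OF equiv_null_rel, symmetric]) auto
  moreover have "s \<in> cls s" "t \<in> cls t" using equiv_class_self[OF equiv_null_rel] s t by auto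
  ultimately show ?thesis by blast
qed

lemma locally_Lipschitz_add: "locally_Lipschitz (sa_add A)"
  unfolding locally_Lipschitz_def by (auto intro!: exI[of _ 1] add_closed dist_add)

lemma locally_Lipschitz_scale: "locally_Lipschitz (\<lambda>a b. sa_scale A c a)"
  unfolding locally_Lipschitz_def
proof (intro allI exI conjI ballI impI)
  fix a b a' b' assume c: "a \<in> sa_carrier A" "b \<in> sa_carrier A" "a' \<in> sa_carrier A" "b' \<in> sa_carrier A"
  show "sa_dist A (sa_scale A c a) (sa_scale A c a') \<le> cmod c * (sa_dist A a a' + sa_dist A b b')"
    unfolding distrib_left
    using dist_scale[OF c(1,3)] mult_nonneg_nonneg[OF norm_ge_zero dist_nonneg[OF c(2,4)]]
    by (rule add_increasing2[rotated])
qed (auto intro: scale_closed)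

lemma locally_Lipschitz_star: "locally_Lipschitz (\<lambda>a b. sa_star A a)"
  unfolding locally_Lipschitz_def
proof (intro allI exI[of _ 1] conjI ballI impI)
  fix a b a' b' assume c: "a \<in> sa_carrier A" "b \<in> sa_carrier A" "a' \<in> sa_carrier A" "b' \<in> sa_carrier A"
  show "sa_dist A (sa_star A a) (sa_star A a') \<le> 1 * (sa_dist A a a' + sa_dist A b b')"
    using dist_star[OF c(1,3)] dist_nonneg[OF c(2,4)] by simp
qed (auto intro: star_closed)

lemma locally_Lipschitz_mult: "locally_Lipschitz (sa_mult A)"
  unfolding locally_Lipschitz_def
proof (intro allI)
  fix B
  show "\<exists>K\<ge>0. \<forall>a\<in>sa_carrier A. \<forall>b\<in>sa_carrier A. \<forall>a'\<in>sa_carrier A. \<forall>b'\<in>sa_carrier A.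
     sa_norm A a \<le> B \<longrightarrow> sa_norm A b' \<le> B \<longrightarrow> sa_mult A a b \<in> sa_carrier A \<and>
      sa_dist A (sa_mult A a b) (sa_mult A a' b') \<le> K * (sa_dist A a a' + sa_dist A b b')"
  proof (intro exI[of _ "\<bar>B\<bar>"] conjI ballI impI)
    fix a b a' b' assume c: "a \<in> sa_carrier A" "b \<in> sa_carrier A" "a' \<in> sa_carrier A" "b' \<in> sa_carrier A"
      and B: "sa_norm A a \<le> B" "sa_norm A b' \<le> B"
    have "sa_norm A a * sa_dist A b b' \<le> \<bar>B\<bar> * sa_dist A b b'"
      using B c dist_nonneg by (intro mult_right_mono) auto
    moreover have "sa_dist A a a' * sa_norm A b' \<le> \<bar>B\<bar> * sa_dist A a a'"
      using mult_left_mono[OF order_trans[OF B(2) abs_ge_self] dist_nonneg[OF c(1,3)]] by (simp add: mult.commute)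
    ultimately show "sa_dist A (sa_mult A a b) (sa_mult A a' b') \<le> \<bar>B\<bar> * (sa_dist A a a' + sa_dist A b b')"
      using dist_mult[OF c] by (simp add: distrib_left)
  qed (auto intro: mult_closed)
qed

lemma completion_carrier: "sa_carrier (completion A) = CS // null_rel A"
  by (simp add: completion_def)

lemma cls_in_completion: "s \<in> CS \<Longrightarrow> cls s \<in> sa_carrier (completion A)"
  by (simp add: completion_carrier quotientI)

lemma completion_cases:
  assumes "P \<in> sa_carrier (completion A)"
  obtains s where "s \<in> CS" "P = cls s"
  using assms by (auto simp: completion_carrier elim: quotientE)

lemma completion_ops:
  assumes s: "s \<in> CS" and t: "t \<in> CS"
  shows "sa_add (completion A) (cls s) (cls t) = cls (\<lambda>n. sa_add A (s n) (t n))"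
    and "sa_mult (completion A) (cls s) (cls t) = cls (\<lambda>n. sa_mult A (s n) (t n))"
    and "sa_scale (completion A) c (cls s) = cls (\<lambda>n. sa_scale A c (s n))"
    and "sa_star (completion A) (cls s) = cls (\<lambda>n. sa_star A (s n))"
proof -
  have ne: "cls s \<noteq> {}" using equiv_class_self[OF equiv_null_rel s] by blast
  show "sa_add (completion A) (cls s) (cls t) = cls (\<lambda>n. sa_add A (s n) (t n))"
    using locally_Lipschitz_class[OF locally_Lipschitz_add s t] by (simp add: completion_def)
  show "sa_mult (completion A) (cls s) (cls t) = cls (\<lambda>n. sa_mult A (s n) (t n))"
    using locally_Lipschitz_class[OF locally_Lipschitz_mult s t] by (simp add: completion_def)
  show "sa_scale (completion A) c (cls s) = cls (\<lambda>n. sa_scale A c (s n))"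
    using locally_Lipschitz_class[OF locally_Lipschitz_scale s s] ne by (simp add: completion_def)
  show "sa_star (completion A) (cls s) = cls (\<lambda>n. sa_star A (s n))"
    using locally_Lipschitz_class[OF locally_Lipschitz_star s s] ne by (simp add: completion_def)
qed

lemma cls_const_eq_iff:
  assumes "a \<in> sa_carrier A" "b \<in> sa_carrier A"
  shows "cls (\<lambda>n. a) = cls (\<lambda>n. b) \<longleftrightarrow> sa_dist A a b = 0"
  using eq_equiv_class_iff[OF equiv_null_rel CS_const[OF assms(1)] CS_const[OF assms(2)]]
    CS_const assms by (auto simp: null_rel_def LIMSEQ_const_iff)

lemma RFD_completion_imp_separated:
  assumes rfd: "RFD (completion A)" and ab: "a \<in> sa_carrier A" "b \<in> sa_carrier A" "sa_dist A a b \<noteq> 0"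
  obtains n \<phi> where "fd_star_rep A n \<phi>" "\<phi> a \<noteq> \<phi> b"
proof -
  have "cls (\<lambda>n. a) \<noteq> cls (\<lambda>n. b)" using cls_const_eq_iff ab by simp
  then obtain n \<Phi> where \<Phi>: "fd_star_rep (completion A) n \<Phi>" "\<Phi> (cls (\<lambda>n. a)) \<noteq> \<Phi> (cls (\<lambda>n. b))"
    using rfd cls_in_completion CS_const ab unfolding RFD_def by metis
  have "fd_star_rep A n (\<lambda>a. \<Phi> (cls (\<lambda>n. a)))"
    unfolding fd_star_rep_def
  proof (intro conjI ballI allI)
    fix a assume a: "a \<in> sa_carrier A"
    note F = \<Phi>(1)[unfolded fd_star_rep_def]
    note c = cls_in_completion[OF CS_const]
    show "\<Phi> (cls (\<lambda>n. a)) \<in> carrier_mat n n" using F c[OF a] by blast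
    show "\<Phi> (cls (\<lambda>n. sa_scale A z a)) = z \<cdot>\<^sub>m \<Phi> (cls (\<lambda>n. a))" for z
      using F c[OF a] completion_ops(3)[OF CS_const[OF a] CS_const[OF a]] by metis
    show "\<Phi> (cls (\<lambda>n. sa_star A a)) = mat_adjoint (\<Phi> (cls (\<lambda>n. a)))"
      using F c[OF a] completion_ops(4)[OF CS_const[OF a] CS_const[OF a]] by metis
    fix b assume b: "b \<in> sa_carrier A"
    show "\<Phi> (cls (\<lambda>n. sa_add A a b)) = \<Phi> (cls (\<lambda>n. a)) + \<Phi> (cls (\<lambda>n. b))"
      using F c[OF a] c[OF b] completion_ops(1)[OF CS_const[OF a] CS_const[OF b]] by metis
    show "\<Phi> (cls (\<lambda>n. sa_mult A a b)) = \<Phi> (cls (\<lambda>n. a)) * \<Phi> (cls (\<lambda>n. b))"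
      using F c[OF a] c[OF b] completion_ops(2)[OF CS_const[OF a] CS_const[OF b]] by metis
  qed
  then show ?thesis using that \<Phi>(2) by blast
qed

lemma fd_star_rep_diff_index:
  assumes \<phi>: "fd_star_rep A n \<phi>" and a: "a \<in> sa_carrier A" "b \<in> sa_carrier A" and ij: "i < n" "j < n"
  shows "\<phi> (sa_add A a (sa_scale A (-1) b)) $$ (i, j) = \<phi> a $$ (i, j) - \<phi> b $$ (i, j)"
proof -
  have "\<phi> (sa_add A a (sa_scale A (-1) b)) = \<phi> a + (-1) \<cdot>\<^sub>m \<phi> b"
    using \<phi> a scale_closed unfolding fd_star_rep_def by metis
  moreover have "\<phi> a \<in> carrier_mat n n" "\<phi> b \<in> carrier_mat n n" using \<phi> a by (auto simp: fd_star_rep_def)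
  ultimately show ?thesis using ij by simp
qed

text \<open>Entries of \<open>\<phi>\<close> are Lipschitz, so they converge along Cauchy sequences, and the limits inherit the
  algebraic identities.\<close>

lemma extend_fd_star_rep:
  assumes \<phi>: "fd_star_rep A n \<phi>"
    and bd: "\<And>a i j. a \<in> sa_carrier A \<Longrightarrow> i < n \<Longrightarrow> j < n \<Longrightarrow> cmod (\<phi> a $$ (i, j)) \<le> sa_norm A a"
  obtains \<Phi> where "fd_star_rep (completion A) n \<Phi>"
    "\<And>s i j. s \<in> CS \<Longrightarrow> i < n \<Longrightarrow> j < n \<Longrightarrow> (\<lambda>k. \<phi> (s k) $$ (i, j)) \<longlonglongrightarrow> \<Phi> (cls s) $$ (i, j)"
proof -
  have diff: "cmod (\<phi> a $$ (i, j) - \<phi> b $$ (i, j)) \<le> sa_dist A a b"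
    if "a \<in> sa_carrier A" "b \<in> sa_carrier A" "i < n" "j < n" for a b i j
    using bd[OF add_closed[OF that(1) scale_closed[OF that(2)]] that(3,4), of "-1"]
      fd_star_rep_diff_index[OF \<phi> that] by (simp add: sa_dist_def)
  have conv: "convergent (\<lambda>k. \<phi> (s k) $$ (i, j))" if s: "s \<in> CS" and ij: "i < n" "j < n" for s i j
    unfolding Cauchy_convergent_iff[symmetric]
  proof (rule CauchyI)
    fix e :: real assume "e > 0"
    then obtain N where N: "\<And>m n. m \<ge> N \<Longrightarrow> n \<ge> N \<Longrightarrow> sa_dist A (s m) (s n) < e" using CS_Cauchy[OF s] by blast
    have "cmod (\<phi> (s m) $$ (i, j) - \<phi> (s k) $$ (i, j)) < e" if "m \<ge> N" "k \<ge> N" for m k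
      using diff[OF CSD[OF s] CSD[OF s] ij, of m k] N[OF that] by simp
    then show "\<exists>M. \<forall>m\<ge>M. \<forall>k\<ge>M. norm (\<phi> (s m) $$ (i, j) - \<phi> (s k) $$ (i, j)) < e" by blast
  qed
  define \<Phi> where "\<Phi> = (\<lambda>P. mat n n (\<lambda>(i, j). lim (\<lambda>k. \<phi> ((SOME s. s \<in> P) k) $$ (i, j))))"
  have lim: "(\<lambda>k. \<phi> (s k) $$ (i, j)) \<longlonglongrightarrow> \<Phi> (cls s) $$ (i, j)" if s: "s \<in> CS" and ij: "i < n" "j < n" for s i j
  proof -
    define t where "t = (SOME t. t \<in> cls s)"
    have "t \<in> cls s" unfolding t_def
      using equiv_class_self[OF equiv_null_rel s] by (rule someI[where P="\<lambda>t. t \<in> cls s"])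
    then have st: "(s, t) \<in> null_rel A" by simp
    then have t: "t \<in> CS" and d0: "(\<lambda>k. sa_dist A (s k) (t k)) \<longlonglongrightarrow> 0" using null_relD by auto
    have "(\<lambda>k. \<phi> (t k) $$ (i, j)) \<longlonglongrightarrow> \<Phi> (cls s) $$ (i, j)"
      using conv[OF t ij] ij unfolding \<Phi>_def t_def[symmetric] by (simp add: convergent_LIMSEQ_iff)
    moreover have "(\<lambda>k. \<phi> (s k) $$ (i, j) - \<phi> (t k) $$ (i, j)) \<longlonglongrightarrow> 0"
      by (rule Lim_null_comparison[OF _ d0]) (use diff[OF CSD[OF s] CSD[OF t] ij] in auto)
    ultimately show ?thesis using tendsto_add[of "\<lambda>k. \<phi> (t k) $$ (i, j)" _ sequentially "\<lambda>k. \<phi> (s k) $$ (i, j) - \<phi> (t k) $$ (i, j)" 0]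
      by simp
  qed
  have \<Phi>c: "\<Phi> P \<in> carrier_mat n n" for P by (simp add: \<Phi>_def)
  note F = \<phi>[unfolded fd_star_rep_def]
  have \<phi>c: "\<phi> (s k) \<in> carrier_mat n n" if "s \<in> CS" for s k using F CSD[OF that] by blast
  have "fd_star_rep (completion A) n \<Phi>"
    unfolding fd_star_rep_def
  proof (intro conjI ballI allI)
    fix P assume "P \<in> sa_carrier (completion A)"
    then obtain s where s: "s \<in> CS" and P: "P = cls s" using completion_cases by blast
    show "\<Phi> P \<in> carrier_mat n n" by (rule \<Phi>c)
    show "\<Phi> (sa_scale (completion A) c P) = c \<cdot>\<^sub>m \<Phi> P" for c
    proof (rule eq_matI)
      fix i j assume "i < dim_row (c \<cdot>\<^sub>m \<Phi> P)" "j < dim_col (c \<cdot>\<^sub>m \<Phi> P)"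
      then have ij: "i < n" "j < n" using \<Phi>c[of P] by auto
      have "(\<lambda>k. \<phi> (sa_scale A c (s k)) $$ (i, j)) \<longlonglongrightarrow> \<Phi> (cls (\<lambda>n. sa_scale A c (s n))) $$ (i, j)"
        using locally_Lipschitz_Cauchy[OF locally_Lipschitz_scale s s] ij by (intro lim)
      moreover have "\<phi> (sa_scale A c (s k)) $$ (i, j) = c * \<phi> (s k) $$ (i, j)" for k
        using F CSD[OF s, of k] \<phi>c[OF s, of k] ij by auto
      moreover have "(\<lambda>k. c * \<phi> (s k) $$ (i, j)) \<longlonglongrightarrow> c * \<Phi> (cls s) $$ (i, j)"
        by (intro tendsto_intros lim s ij)
      ultimately show "\<Phi> (sa_scale (completion A) c P) $$ (i, j) = (c \<cdot>\<^sub>m \<Phi> P) $$ (i, j)"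
        using \<Phi>c[of P] ij completion_ops(3)[OF s s] P by (simp add: LIMSEQ_unique)
    qed (use \<Phi>c[of P] \<Phi>c[of "sa_scale (completion A) c P"] in auto)
    show "\<Phi> (sa_star (completion A) P) = mat_adjoint (\<Phi> P)"
    proof (rule eq_matI)
      fix i j assume "i < dim_row (mat_adjoint (\<Phi> P))" "j < dim_col (mat_adjoint (\<Phi> P))"
      then have ij: "i < n" "j < n" using mat_adjoint_carrier[OF \<Phi>c[of P]] by auto
      have "(\<lambda>k. \<phi> (sa_star A (s k)) $$ (i, j)) \<longlonglongrightarrow> \<Phi> (cls (\<lambda>n. sa_star A (s n))) $$ (i, j)"
        using locally_Lipschitz_Cauchy[OF locally_Lipschitz_star s s] ij by (intro lim)
      moreover have "\<phi> (sa_star A (s k)) $$ (i, j) = cnj (\<phi> (s k) $$ (j, i))" for k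
        using F CSD[OF s, of k] mat_adjoint_index[OF \<phi>c[OF s, of k] ij] by auto
      moreover have "(\<lambda>k. cnj (\<phi> (s k) $$ (j, i))) \<longlonglongrightarrow> cnj (\<Phi> (cls s) $$ (j, i))"
        by (intro tendsto_intros lim s ij)
      ultimately show "\<Phi> (sa_star (completion A) P) $$ (i, j) = mat_adjoint (\<Phi> P) $$ (i, j)"
        using mat_adjoint_index[OF \<Phi>c[of P] ij] completion_ops(4)[OF s s] P by (simp add: LIMSEQ_unique)
    qed (use mat_adjoint_carrier[OF \<Phi>c[of P]] \<Phi>c[of "sa_star (completion A) P"] in auto)
    fix Q assume "Q \<in> sa_carrier (completion A)"
    then obtain t where t: "t \<in> CS" and Q: "Q = cls t" using completion_cases by blast
    show "\<Phi> (sa_add (completion A) P Q) = \<Phi> P + \<Phi> Q"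
    proof (rule eq_matI)
      fix i j assume "i < dim_row (\<Phi> P + \<Phi> Q)" "j < dim_col (\<Phi> P + \<Phi> Q)"
      then have ij: "i < n" "j < n" using \<Phi>c[of Q] by auto
      have "(\<lambda>k. \<phi> (sa_add A (s k) (t k)) $$ (i, j)) \<longlonglongrightarrow> \<Phi> (cls (\<lambda>n. sa_add A (s n) (t n))) $$ (i, j)"
        using locally_Lipschitz_Cauchy[OF locally_Lipschitz_add s t] ij by (intro lim)
      moreover have "\<phi> (sa_add A (s k) (t k)) $$ (i, j) = \<phi> (s k) $$ (i, j) + \<phi> (t k) $$ (i, j)" for k
        using F CSD[OF s, of k] CSD[OF t, of k] \<phi>c[OF t, of k] ij by auto
      moreover have "(\<lambda>k. \<phi> (s k) $$ (i, j) + \<phi> (t k) $$ (i, j)) \<longlonglongrightarrow> \<Phi> (cls s) $$ (i, j) + \<Phi> (cls t) $$ (i, j)"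
        by (intro tendsto_intros lim s t ij)
      ultimately show "\<Phi> (sa_add (completion A) P Q) $$ (i, j) = (\<Phi> P + \<Phi> Q) $$ (i, j)"
        using \<Phi>c[of Q] ij completion_ops(1)[OF s t] P Q by (simp add: LIMSEQ_unique)
    qed (use \<Phi>c[of Q] \<Phi>c[of "sa_add (completion A) P Q"] in auto)
    show "\<Phi> (sa_mult (completion A) P Q) = \<Phi> P * \<Phi> Q"
    proof (rule eq_matI)
      fix i j assume "i < dim_row (\<Phi> P * \<Phi> Q)" "j < dim_col (\<Phi> P * \<Phi> Q)"
      then have ij: "i < n" "j < n" using \<Phi>c[of P] \<Phi>c[of Q] by auto
      have "(\<lambda>k. \<phi> (sa_mult A (s k) (t k)) $$ (i, j)) \<longlonglongrightarrow> \<Phi> (cls (\<lambda>n. sa_mult A (s n) (t n))) $$ (i, j)"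
        using locally_Lipschitz_Cauchy[OF locally_Lipschitz_mult s t] ij by (intro lim)
      moreover have "\<phi> (sa_mult A (s k) (t k)) $$ (i, j) = (\<Sum>l<n. \<phi> (s k) $$ (i, l) * \<phi> (t k) $$ (l, j))" for k
        using F CSD[OF s, of k] CSD[OF t, of k] mat_mult_index[OF \<phi>c[OF s, of k] \<phi>c[OF t, of k] ij] by metis
      moreover have "(\<lambda>k. \<Sum>l<n. \<phi> (s k) $$ (i, l) * \<phi> (t k) $$ (l, j)) \<longlonglongrightarrow>
          (\<Sum>l<n. \<Phi> (cls s) $$ (i, l) * \<Phi> (cls t) $$ (l, j))"
        using ij by (intro tendsto_intros lim s t) auto
      ultimately show "\<Phi> (sa_mult (completion A) P Q) $$ (i, j) = (\<Phi> P * \<Phi> Q) $$ (i, j)"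
        unfolding mat_mult_index[OF \<Phi>c \<Phi>c ij] using completion_ops(2)[OF s t] P Q by (simp add: LIMSEQ_unique)
    qed (use \<Phi>c[of P] \<Phi>c[of Q] \<Phi>c[of "sa_mult (completion A) P Q"] in auto)
  qed
  then show ?thesis using that lim by blast
qed

text \<open>Contractive matrix representations that compute the norm separate the points of the completion:
  far out in a non-null Cauchy sequence one vector witnesses the norm of a term, and all later terms
  stay close to that term.\<close>

lemma RFD_completionI:
  assumes norming: "\<And>a r. a \<in> sa_carrier A \<Longrightarrow> 0 \<le> r \<Longrightarrow> r < sa_norm A a \<Longrightarrow>
     \<exists>n \<phi>. fd_star_rep A n \<phi> \<and>
       (\<forall>b\<in>sa_carrier A. \<forall>v. L2_set (\<lambda>i. cmod (\<Sum>j<n. \<phi> b $$ (i, j) * v j)) {..<n} \<le>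
           sa_norm A b * L2_set (\<lambda>j. cmod (v j)) {..<n}) \<and>
       (\<exists>v. r * L2_set (\<lambda>j. cmod (v j)) {..<n} < L2_set (\<lambda>i. cmod (\<Sum>j<n. \<phi> a $$ (i, j) * v j)) {..<n})"
  shows "RFD (completion A)"
  unfolding RFD_def
proof (intro ballI impI)
  fix P Q assume "P \<in> sa_carrier (completion A)" "Q \<in> sa_carrier (completion A)" and ne: "P \<noteq> Q"
  then obtain s t where s: "s \<in> CS" "P = cls s" and t: "t \<in> CS" "Q = cls t" using completion_cases by metis
  have "(s, t) \<notin> null_rel A" using ne s t equiv_class_eq[OF equiv_null_rel] by blast
  then have "\<not> (\<lambda>n. sa_dist A (s n) (t n)) \<longlonglongrightarrow> 0" using s t by (simp add: null_rel_def)
  then obtain e where e: "e > 0" and far: "\<And>N. \<exists>n\<ge>N. e \<le> sa_dist A (s n) (t n)"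
    using dist_nonneg[OF CSD[OF s(1)] CSD[OF t(1)]] unfolding LIMSEQ_def by (auto simp: not_less)
  obtain N1 where N1: "\<And>m n. m \<ge> N1 \<Longrightarrow> n \<ge> N1 \<Longrightarrow> sa_dist A (s m) (s n) < e/8" using CS_Cauchy[OF s(1), of "e/8"] e by auto
  obtain N2 where N2: "\<And>m n. m \<ge> N2 \<Longrightarrow> n \<ge> N2 \<Longrightarrow> sa_dist A (t m) (t n) < e/8" using CS_Cauchy[OF t(1), of "e/8"] e by auto
  obtain k where k: "k \<ge> max N1 N2" "e \<le> sa_dist A (s k) (t k)" using far by blast
  let ?d = "\<lambda>a b. sa_add A a (sa_scale A (-1) b)"
  have dcl: "?d a b \<in> sa_carrier A" if "a \<in> sa_carrier A" "b \<in> sa_carrier A" for a b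
    using that by (intro add_closed scale_closed)
  (* a representation is chosen for the threshold e/2; passing from k to later indices costs e/8 for each sequence *)
  have "e/2 < sa_norm A (?d (s k) (t k))" using k(2) e by (simp add: sa_dist_def)
  from norming[OF dcl[OF CSD[OF s(1)] CSD[OF t(1)]] _ this] e
  obtain n \<phi> v where \<phi>: "fd_star_rep A n \<phi>"
    and bd: "\<And>b v. b \<in> sa_carrier A \<Longrightarrow> L2_set (\<lambda>i. cmod (\<Sum>j<n. \<phi> b $$ (i, j) * v j)) {..<n} \<le>
           sa_norm A b * L2_set (\<lambda>j. cmod (v j)) {..<n}"
    and v: "e/2 * L2_set (\<lambda>j. cmod (v j)) {..<n} < L2_set (\<lambda>i. cmod (\<Sum>j<n. \<phi> (?d (s k) (t k)) $$ (i, j) * v j)) {..<n}"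
    by auto
  have entry: "cmod (\<phi> a $$ (i, j)) \<le> sa_norm A a" if a: "a \<in> sa_carrier A" and ij: "i < n" "j < n" for a i j
  proof -
    define w where "w = (\<lambda>l. if l = j then 1 else (0::complex))"
    have w: "(\<Sum>l<n. \<phi> a $$ (i, l) * w l) = \<phi> a $$ (i, j)" for i
      using ij by (simp add: w_def if_distrib cong: if_cong)
    have "L2_set (\<lambda>l. cmod (w l)) {..<n} = sqrt (\<Sum>l<n. (if l = j then 1 else 0))"
      unfolding L2_set_def w_def by (intro arg_cong[of _ _ sqrt] sum.cong) auto
    then have "L2_set (\<lambda>l. cmod (w l)) {..<n} = 1" using ij by simp
    then have "L2_set (\<lambda>i. cmod (\<phi> a $$ (i, j))) {..<n} \<le> sa_norm A a" using bd[OF a, of w] by (simp add: w)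
    moreover have "cmod (\<phi> a $$ (i, j)) \<le> L2_set (\<lambda>i. cmod (\<phi> a $$ (i, j))) {..<n}"
      using ij by (intro member_le_L2_set) auto
    ultimately show ?thesis by linarith
  qed
  obtain \<Phi> where \<Phi>: "fd_star_rep (completion A) n \<Phi>"
    "\<And>s i j. s \<in> CS \<Longrightarrow> i < n \<Longrightarrow> j < n \<Longrightarrow> (\<lambda>k. \<phi> (s k) $$ (i, j)) \<longlonglongrightarrow> \<Phi> (cls s) $$ (i, j)"
    using extend_fd_star_rep[OF \<phi> entry] by blast
  define V where "V = L2_set (\<lambda>j. cmod (v j)) {..<n}"
  define \<psi> where "\<psi> = (\<lambda>a i. \<Sum>j<n. \<phi> a $$ (i, j) * v j)"
  have \<psi>d: "\<psi> (?d a b) i = \<psi> a i - \<psi> b i" if "a \<in> sa_carrier A" "b \<in> sa_carrier A" "i < n" for a b i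
    unfolding \<psi>_def sum_subtractf[symmetric] using fd_star_rep_diff_index[OF \<phi> that(1,2,3)]
    by (intro sum.cong) (auto simp: left_diff_distrib)
  have \<psi>b: "L2_set (\<lambda>i. cmod (\<psi> (?d a b) i)) {..<n} \<le> sa_dist A a b * V" if "a \<in> sa_carrier A" "b \<in> sa_carrier A" for a b
    using bd[OF dcl[OF that], of v] unfolding \<psi>_def V_def sa_dist_def .
  define \<kappa> where "\<kappa> = L2_set (\<lambda>i. cmod (\<psi> (?d (s k) (t k)) i)) {..<n} - e/4 * V"
  have V0: "0 \<le> V" by (simp add: V_def)
  have "e/4 * V \<le> e/2 * V" using V0 e by (intro mult_right_mono) auto
  then have \<kappa>: "\<kappa> > 0" using v unfolding \<kappa>_def \<psi>_def V_def by linarith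
  have low: "\<kappa> \<le> L2_set (\<lambda>i. cmod (\<psi> (s m) i - \<psi> (t m) i)) {..<n}" if m: "m \<ge> max N1 N2" for m
  proof -
    have c: "s m \<in> sa_carrier A" "t m \<in> sa_carrier A" "s k \<in> sa_carrier A" "t k \<in> sa_carrier A"
      using CSD s(1) t(1) by auto
    have "L2_set (\<lambda>i. cmod (\<psi> (?d (s k) (t k)) i)) {..<n} \<le> L2_set (\<lambda>i. cmod (\<psi> (s m) i - \<psi> (t m) i)
        + (cmod (\<psi> (?d (s k) (s m)) i) + cmod (\<psi> (?d (t k) (t m)) i))) {..<n}"
    proof (rule L2_set_mono)
      fix i assume "i \<in> {..<n}"
      then have i: "i < n" by simp
      have e: "\<psi> (?d (s k) (t k)) i = \<psi> (s k) i - \<psi> (t k) i"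
        "\<psi> (?d (s k) (s m)) i = \<psi> (s k) i - \<psi> (s m) i"
        "\<psi> (?d (t k) (t m)) i = \<psi> (t k) i - \<psi> (t m) i"
        using \<psi>d[OF c(3,4) i] \<psi>d[OF c(3,1) i] \<psi>d[OF c(4,2) i] by auto
      have tri: "cmod (p - q) \<le> cmod (p' - q') + (cmod (p - p') + cmod (q - q'))" for p q p' q'
        using norm_triangle_ineq[of "p' - q'" "(p - p') - (q - q')"] norm_triangle_ineq4[of "p - p'" "q - q'"]
        by (simp add: algebra_simps)
      show "cmod (\<psi> (?d (s k) (t k)) i) \<le> cmod (\<psi> (s m) i - \<psi> (t m) i)
        + (cmod (\<psi> (?d (s k) (s m)) i) + cmod (\<psi> (?d (t k) (t m)) i))"
        unfolding e by (rule tri)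
    qed simp
    also have "\<dots> \<le> L2_set (\<lambda>i. cmod (\<psi> (s m) i - \<psi> (t m) i)) {..<n}
       + (L2_set (\<lambda>i. cmod (\<psi> (?d (s k) (s m)) i)) {..<n} + L2_set (\<lambda>i. cmod (\<psi> (?d (t k) (t m)) i)) {..<n})"
      by (rule order_trans[OF L2_set_triangle_ineq], rule add_left_mono, rule L2_set_triangle_ineq)
    also have "\<dots> \<le> L2_set (\<lambda>i. cmod (\<psi> (s m) i - \<psi> (t m) i)) {..<n} + (e/8 * V + e/8 * V)"
    proof (intro add_left_mono add_mono)
      show "L2_set (\<lambda>i. cmod (\<psi> (?d (s k) (s m)) i)) {..<n} \<le> e/8 * V"
        by (rule order_trans[OF \<psi>b[OF c(3,1)] mult_right_mono[OF less_imp_le[OF N1] V0]]) (use m k in auto)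
      show "L2_set (\<lambda>i. cmod (\<psi> (?d (t k) (t m)) i)) {..<n} \<le> e/8 * V"
        by (rule order_trans[OF \<psi>b[OF c(4,2)] mult_right_mono[OF less_imp_le[OF N2] V0]]) (use m k in auto)
    qed
    finally show ?thesis unfolding \<kappa>_def using e by (simp add: field_simps)
  qed
  have "\<Phi> P \<noteq> \<Phi> Q"
  proof
    assume eq: "\<Phi> P = \<Phi> Q"
    have "(\<lambda>m. L2_set (\<lambda>i. cmod (\<psi> (s m) i - \<psi> (t m) i)) {..<n}) \<longlonglongrightarrow>
       L2_set (\<lambda>i. cmod ((\<Sum>j<n. \<Phi> P $$ (i, j) * v j) - (\<Sum>j<n. \<Phi> Q $$ (i, j) * v j))) {..<n}"
      unfolding L2_set_def \<psi>_def
      by (intro tendsto_intros; unfold s(2) t(2); intro \<Phi>(2) s(1) t(1); simp)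
    also have "L2_set (\<lambda>i. cmod ((\<Sum>j<n. \<Phi> P $$ (i, j) * v j) - (\<Sum>j<n. \<Phi> Q $$ (i, j) * v j))) {..<n} = 0"
      using eq by (simp add: L2_set_def)
    finally have "\<kappa> \<le> 0"
      using low by (intro LIMSEQ_le_const exI[of _ "max N1 N2"]) auto
    then show False using \<kappa> by simp
  qed
  then show "\<exists>n \<Phi>. fd_star_rep (completion A) n \<Phi> \<and> \<Phi> P \<noteq> \<Phi> Q" using \<Phi>(1) by blast
qed

end

section \<open>The crossed product as a completion\<close>

context dynamical_system
begin

lemma integrated_form_diff_ell2:
  assumes "covariant_rep G \<alpha> \<pi> u" "a \<in> cpc" "b \<in> cpc" "\<xi> \<in> ell2"
  shows "(\<lambda>i. integrated_form G \<pi> u a \<xi> i - integrated_form G \<pi> u b \<xi> i) \<in> ell2"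
  by (intro ell2_diff integrated_form_ell2 assms)

text \<open>Each estimate is an inequality between operators in every single covariant representation.\<close>

lemma pre_normed_star_algebra_cp: "pre_normed_star_algebra cp"
proof
  fix a b a' b' c assume a: "a \<in> cpc" and b: "b \<in> cpc"
  show "sa_add cp a b \<in> cpc" "sa_scale cp z a \<in> cpc" "sa_mult cp a b \<in> cpc" "sa_star cp a \<in> cpc" for z
    using a b cp_add_closed cp_scale_closed cp_mult_closed cp_star_closed by auto
  show "0 \<le> sa_dist cp a b" by (rule cp_dist_nonneg[OF a b])
  show "sa_dist cp a a = 0"
    using cp_dist_le[OF a a, of 0] cp_dist_nonneg[OF a a] by simp
  have le: "sa_dist cp a b \<le> sa_dist cp b a" if "a \<in> cpc" "b \<in> cpc" for a b
  proof (rule cp_dist_le[OF that])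
    fix \<pi> :: "('x \<Rightarrow> complex) \<Rightarrow> ('g \<Rightarrow> 'x \<Rightarrow> complex) operator" and u and \<xi> :: "('g \<Rightarrow> 'x \<Rightarrow> complex) \<Rightarrow> complex"
    assume "covariant_rep G \<alpha> \<pi> u" "\<xi> \<in> ell2"
    then show "ell2_norm (\<lambda>i. integrated_form G \<pi> u a \<xi> i - integrated_form G \<pi> u b \<xi> i) \<le> sa_dist cp b a * ell2_norm \<xi>"
      by (subst ell2_norm_minus_commute) (intro cp_dist_bound that)
  qed (intro cp_dist_nonneg that)
  show "sa_dist cp a b = sa_dist cp b a" using le[OF a b] le[OF b a] by simp
  show "sa_norm cp a \<le> sa_norm cp b + sa_dist cp a b"
    unfolding cp_simps(5)
  proof (rule universal_norm_le)
    fix \<pi> :: "('x \<Rightarrow> complex) \<Rightarrow> ('g \<Rightarrow> 'x \<Rightarrow> complex) operator" and u and \<xi> :: "('g \<Rightarrow> 'x \<Rightarrow> complex) \<Rightarrow> complex"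
    assume cov: "covariant_rep G \<alpha> \<pi> u" and \<xi>: "\<xi> \<in> ell2"
    have "ell2_norm (integrated_form G \<pi> u a \<xi>) \<le> ell2_norm (integrated_form G \<pi> u b \<xi>)
        + ell2_norm (\<lambda>i. integrated_form G \<pi> u a \<xi> i - integrated_form G \<pi> u b \<xi> i)"
      using ell2_norm_triangle[OF integrated_form_ell2[OF cov b \<xi>] integrated_form_diff_ell2[OF cov a b \<xi>]] by simp
    then show "ell2_norm (integrated_form G \<pi> u a \<xi>) \<le> (universal_norm G \<alpha> b + sa_dist cp a b) * ell2_norm \<xi>"
      using universal_norm_bound[OF cov b \<xi>] cp_dist_bound[OF cov a b \<xi>] by (simp add: distrib_right)
  qed (use universal_norm_nonneg cp_dist_nonneg a b in simp)
  {
    assume c: "c \<in> cpc"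
    show "sa_dist cp a c \<le> sa_dist cp a b + sa_dist cp b c"
    proof (rule cp_dist_le[OF a c])
      fix \<pi> :: "('x \<Rightarrow> complex) \<Rightarrow> ('g \<Rightarrow> 'x \<Rightarrow> complex) operator" and u and \<xi> :: "('g \<Rightarrow> 'x \<Rightarrow> complex) \<Rightarrow> complex"
      assume cov: "covariant_rep G \<alpha> \<pi> u" and \<xi>: "\<xi> \<in> ell2"
      have "ell2_norm (\<lambda>i. integrated_form G \<pi> u a \<xi> i - integrated_form G \<pi> u c \<xi> i) \<le>
         ell2_norm (\<lambda>i. integrated_form G \<pi> u a \<xi> i - integrated_form G \<pi> u b \<xi> i)
        + ell2_norm (\<lambda>i. integrated_form G \<pi> u b \<xi> i - integrated_form G \<pi> u c \<xi> i)"
        using ell2_norm_triangle[OF integrated_form_diff_ell2[OF cov a b \<xi>] integrated_form_diff_ell2[OF cov b c \<xi>]] by simp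
      then show "ell2_norm (\<lambda>i. integrated_form G \<pi> u a \<xi> i - integrated_form G \<pi> u c \<xi> i)
         \<le> (sa_dist cp a b + sa_dist cp b c) * ell2_norm \<xi>"
        using cp_dist_bound[OF cov b c \<xi>] cp_dist_bound[OF cov a b \<xi>] by (simp add: distrib_right)
    qed (use cp_dist_nonneg a b c in simp)
  }
  assume a': "a' \<in> cpc"
  show "sa_dist cp (sa_scale cp z a) (sa_scale cp z a') \<le> cmod z * sa_dist cp a a'" for z
  proof (rule cp_dist_le[OF cp_scale_closed[OF a] cp_scale_closed[OF a']])
    fix \<pi> :: "('x \<Rightarrow> complex) \<Rightarrow> ('g \<Rightarrow> 'x \<Rightarrow> complex) operator" and u and \<xi> :: "('g \<Rightarrow> 'x \<Rightarrow> complex) \<Rightarrow> complex"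
    assume cov: "covariant_rep G \<alpha> \<pi> u" and \<xi>: "\<xi> \<in> ell2"
    have "(\<lambda>i. integrated_form G \<pi> u (sa_scale cp z a) \<xi> i - integrated_form G \<pi> u (sa_scale cp z a') \<xi> i) =
        (\<lambda>i. z * (integrated_form G \<pi> u a \<xi> i - integrated_form G \<pi> u a' \<xi> i))"
      by (simp add: integrated_form_scale[OF cov a \<xi>] integrated_form_scale[OF cov a' \<xi>] right_diff_distrib)
    then show "ell2_norm (\<lambda>i. integrated_form G \<pi> u (sa_scale cp z a) \<xi> i - integrated_form G \<pi> u (sa_scale cp z a') \<xi> i)
       \<le> (cmod z * sa_dist cp a a') * ell2_norm \<xi>"
      using cp_dist_bound[OF cov a a' \<xi>]
      by (simp add: ell2_norm_scale[OF integrated_form_diff_ell2[OF cov a a' \<xi>]] mult.assoc mult_left_mono)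
  qed (use cp_dist_nonneg a a' in simp)
  show "sa_dist cp (sa_star cp a) (sa_star cp a') \<le> sa_dist cp a a'"
  proof (rule cp_dist_le[OF cp_star_closed[OF a] cp_star_closed[OF a']])
    fix \<pi> :: "('x \<Rightarrow> complex) \<Rightarrow> ('g \<Rightarrow> 'x \<Rightarrow> complex) operator" and u and \<xi> :: "('g \<Rightarrow> 'x \<Rightarrow> complex) \<Rightarrow> complex"
    assume cov: "covariant_rep G \<alpha> \<pi> u" and \<xi>: "\<xi> \<in> ell2"
    define \<zeta> where "\<zeta> = (\<lambda>i. integrated_form G \<pi> u (sa_star cp a) \<xi> i + (-1) * integrated_form G \<pi> u (sa_star cp a') \<xi> i)"
    note sa = integrated_form_ell2[OF cov cp_star_closed[OF a] \<xi>]
    note sa' = integrated_form_ell2[OF cov cp_star_closed[OF a'] \<xi>]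
    have \<zeta>: "\<zeta> \<in> ell2" unfolding \<zeta>_def by (intro ell2_add ell2_scale sa sa')
    define \<omega> where "\<omega> = (\<lambda>i. integrated_form G \<pi> u a \<zeta> i + (-1) * integrated_form G \<pi> u a' \<zeta> i)"
    note ia = integrated_form_ell2[OF cov a \<zeta>] and ia' = integrated_form_ell2[OF cov a' \<zeta>]
    have \<omega>: "\<omega> \<in> ell2" unfolding \<omega>_def by (intro ell2_add ell2_scale ia ia')
    have "ell2_inner \<zeta> \<zeta> = ell2_inner (integrated_form G \<pi> u (sa_star cp a) \<xi>) \<zeta>
         + (-1) * ell2_inner (integrated_form G \<pi> u (sa_star cp a') \<xi>) \<zeta>"
      unfolding \<zeta>_def using \<zeta> ell2_inner_add[OF sa ell2_scale[OF sa', of "-1"] \<zeta>] ell2_inner_scale[OF sa' \<zeta>, of "-1"]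
      by (simp only: \<zeta>_def)
    also have "\<dots> = ell2_inner \<xi> \<omega>"
      unfolding \<omega>_def integrated_form_star[OF cov a \<xi> \<zeta>] integrated_form_star[OF cov a' \<xi> \<zeta>]
      using ell2_inner_add_right[OF ia ell2_scale[OF ia', of "-1"] \<xi>] ell2_inner_scale_right[OF ia' \<xi>, of "-1"] by simp
    finally have "complex_of_real ((ell2_norm \<zeta>)\<^sup>2) = ell2_inner \<xi> \<omega>" using ell2_inner_self[OF \<zeta>] by simp
    then have "(ell2_norm \<zeta>)\<^sup>2 \<le> ell2_norm \<xi> * ell2_norm \<omega>"
      using ell2_Cauchy_Schwarz[OF \<xi> \<omega>] by (metis norm_of_real abs_power2)
    also have "\<dots> \<le> ell2_norm \<xi> * (sa_dist cp a a' * ell2_norm \<zeta>)"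
      using cp_dist_bound[OF cov a a' \<zeta>] by (intro mult_left_mono) (auto simp: \<omega>_def)
    finally have *: "ell2_norm \<zeta> * ell2_norm \<zeta> \<le> (sa_dist cp a a' * ell2_norm \<xi>) * ell2_norm \<zeta>"
      by (simp add: power2_eq_square mult_ac)
    have "ell2_norm \<zeta> \<le> sa_dist cp a a' * ell2_norm \<xi>"
    proof (cases "ell2_norm \<zeta> = 0")
      case True
      then show ?thesis using cp_dist_nonneg[OF a a'] by simp
    next
      case False
      then have "0 < ell2_norm \<zeta>" using ell2_norm_nonneg[of \<zeta>] by linarith
      then show ?thesis using * mult_right_le_imp_le by blast
    qed
    then show "ell2_norm (\<lambda>i. integrated_form G \<pi> u (sa_star cp a) \<xi> i - integrated_form G \<pi> u (sa_star cp a') \<xi> i)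
       \<le> sa_dist cp a a' * ell2_norm \<xi>" by (simp add: \<zeta>_def)
  qed (use cp_dist_nonneg a a' in simp)
  assume b': "b' \<in> cpc"
  show "sa_dist cp (sa_add cp a b) (sa_add cp a' b') \<le> sa_dist cp a a' + sa_dist cp b b'"
  proof (rule cp_dist_le[OF cp_add_closed[OF a b] cp_add_closed[OF a' b']])
    fix \<pi> :: "('x \<Rightarrow> complex) \<Rightarrow> ('g \<Rightarrow> 'x \<Rightarrow> complex) operator" and u and \<xi> :: "('g \<Rightarrow> 'x \<Rightarrow> complex) \<Rightarrow> complex"
    assume cov: "covariant_rep G \<alpha> \<pi> u" and \<xi>: "\<xi> \<in> ell2"
    have "(\<lambda>i. integrated_form G \<pi> u (sa_add cp a b) \<xi> i - integrated_form G \<pi> u (sa_add cp a' b') \<xi> i) =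
      (\<lambda>i. (integrated_form G \<pi> u a \<xi> i - integrated_form G \<pi> u a' \<xi> i) + (integrated_form G \<pi> u b \<xi> i - integrated_form G \<pi> u b' \<xi> i))"
      by (simp add: integrated_form_add[OF cov a b \<xi>] integrated_form_add[OF cov a' b' \<xi>] algebra_simps)
    then show "ell2_norm (\<lambda>i. integrated_form G \<pi> u (sa_add cp a b) \<xi> i - integrated_form G \<pi> u (sa_add cp a' b') \<xi> i)
      \<le> (sa_dist cp a a' + sa_dist cp b b') * ell2_norm \<xi>"
      using ell2_norm_triangle[OF integrated_form_diff_ell2[OF cov a a' \<xi>] integrated_form_diff_ell2[OF cov b b' \<xi>]]
        cp_dist_bound[OF cov a a' \<xi>] cp_dist_bound[OF cov b b' \<xi>] by (simp add: distrib_right)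
  qed (use cp_dist_nonneg a a' b b' in simp)
  show "sa_dist cp (sa_mult cp a b) (sa_mult cp a' b') \<le> sa_norm cp a * sa_dist cp b b' + sa_dist cp a a' * sa_norm cp b'"
    unfolding cp_simps(5)
  proof (rule cp_dist_le[OF cp_mult_closed[OF a b] cp_mult_closed[OF a' b']])
    fix \<pi> :: "('x \<Rightarrow> complex) \<Rightarrow> ('g \<Rightarrow> 'x \<Rightarrow> complex) operator" and u and \<xi> :: "('g \<Rightarrow> 'x \<Rightarrow> complex) \<Rightarrow> complex"
    assume cov: "covariant_rep G \<alpha> \<pi> u" and \<xi>: "\<xi> \<in> ell2"
    let ?T = "integrated_form G \<pi> u"
    note b'\<xi> = integrated_form_ell2[OF cov b' \<xi>] and b\<xi> = integrated_form_ell2[OF cov b \<xi>]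
    note d\<xi> = integrated_form_diff_ell2[OF cov b b' \<xi>]
    have "?T a (\<lambda>i. ?T b \<xi> i - ?T b' \<xi> i) = (\<lambda>i. ?T a (?T b \<xi>) i - ?T a (?T b' \<xi>) i)"
      by (rule bounded_operator_diff[OF integrated_form_operator[OF cov a] b\<xi> b'\<xi>])
    then have "(\<lambda>i. ?T (sa_mult cp a b) \<xi> i - ?T (sa_mult cp a' b') \<xi> i) =
      (\<lambda>i. ?T a (\<lambda>i. ?T b \<xi> i - ?T b' \<xi> i) i + (?T a (?T b' \<xi>) i - ?T a' (?T b' \<xi>) i))"
      by (simp add: integrated_form_mult[OF cov a b \<xi>] integrated_form_mult[OF cov a' b' \<xi>])
    then have "ell2_norm (\<lambda>i. ?T (sa_mult cp a b) \<xi> i - ?T (sa_mult cp a' b') \<xi> i) \<le>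
       ell2_norm (?T a (\<lambda>i. ?T b \<xi> i - ?T b' \<xi> i)) + ell2_norm (\<lambda>i. ?T a (?T b' \<xi>) i - ?T a' (?T b' \<xi>) i)"
      using ell2_norm_triangle[OF integrated_form_ell2[OF cov a d\<xi>] integrated_form_diff_ell2[OF cov a a' b'\<xi>]] by simp
    also have "ell2_norm (?T a (\<lambda>i. ?T b \<xi> i - ?T b' \<xi> i)) \<le> universal_norm G \<alpha> a * (sa_dist cp b b' * ell2_norm \<xi>)"
      by (rule order_trans[OF universal_norm_bound[OF cov a d\<xi>] mult_left_mono[OF cp_dist_bound[OF cov b b' \<xi>] universal_norm_nonneg[OF a]]])
    also have "ell2_norm (\<lambda>i. ?T a (?T b' \<xi>) i - ?T a' (?T b' \<xi>) i) \<le> sa_dist cp a a' * (universal_norm G \<alpha> b' * ell2_norm \<xi>)"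
      by (rule order_trans[OF cp_dist_bound[OF cov a a' b'\<xi>] mult_left_mono[OF universal_norm_bound[OF cov b' \<xi>] cp_dist_nonneg[OF a a']]])
    finally show "ell2_norm (\<lambda>i. ?T (sa_mult cp a b) \<xi> i - ?T (sa_mult cp a' b') \<xi> i) \<le>
      (universal_norm G \<alpha> a * sa_dist cp b b' + sa_dist cp a a' * universal_norm G \<alpha> b') * ell2_norm \<xi>"
      by (simp add: distrib_right mult.assoc)
  qed (use cp_dist_nonneg universal_norm_nonneg a a' b b' in simp)
qed

end

section \<open>Diagonal and regular representations\<close>

lemma C0_star_rep_diagonal:
  fixes Z :: "'i set" and p :: "'i \<Rightarrow> 'x::topological_space"
  shows "C0_star_rep (\<lambda>f \<xi> i. if i \<in> Z then f (p i) * \<xi> i else 0)"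
    (is "C0_star_rep ?\<pi>")
proof -
  have b: "?\<pi> f \<xi> \<in> ell2 \<and> ell2_norm (?\<pi> f \<xi>) \<le> B * ell2_norm \<xi>"
    if f: "\<And>x. cmod (f x) \<le> B" "B \<ge> 0" and \<xi>: "\<xi> \<in> ell2" for f B and \<xi> :: "'i \<Rightarrow> complex"
  proof -
    have le: "(cmod (?\<pi> f \<xi> i))\<^sup>2 \<le> B\<^sup>2 * (cmod (\<xi> i))\<^sup>2" for i
      using f(1)[of "p i"] by (auto simp: norm_mult power_mult_distrib intro!: mult_right_mono power_mono)
    have s: "(\<lambda>i. B\<^sup>2 * (cmod (\<xi> i))\<^sup>2) summable_on UNIV"
      using \<xi> by (intro summable_on_cmult_right) (auto simp: ell2_def)
    have in2: "?\<pi> f \<xi> \<in> ell2" unfolding ell2_def mem_Collect_eq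
      by (rule summable_on_comparison_test[OF s]) (use le in auto)
    have "(ell2_norm (?\<pi> f \<xi>))\<^sup>2 \<le> (\<Sum>\<^sub>\<infinity>i. B\<^sup>2 * (cmod (\<xi> i))\<^sup>2)"
      unfolding ell2_norm_square using in2 s le by (intro infsum_mono) (auto simp: ell2_def)
    also have "\<dots> = (B * ell2_norm \<xi>)\<^sup>2"
      by (simp add: infsum_cmult_right' ell2_norm_square power_mult_distrib)
    finally have "ell2_norm (?\<pi> f \<xi>) \<le> B * ell2_norm \<xi>"
      by (rule power2_le_imp_le) (use f in simp)
    with in2 show ?thesis by blast
  qed
  show ?thesis
    unfolding C0_star_rep_def bounded_operator_def
  proof (intro conjI ballI allI)
    fix f :: "'x \<Rightarrow> complex" assume f: "f \<in> C0"
    obtain B where B: "B > 0" "\<And>x. cmod (f x) \<le> B" using C0_bounded[OF f] by blast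
    show "?\<pi> f \<xi> \<in> ell2" if "\<xi> \<in> ell2" for \<xi> :: "'i \<Rightarrow> complex"
      using b[of f B \<xi>] B that by auto
    show "\<exists>C. \<forall>\<xi>\<in>ell2. ell2_norm (?\<pi> f \<xi>) \<le> C * ell2_norm \<xi>"
      using b[of f B] B by (intro exI[of _ B]) auto
    show "ell2_inner (?\<pi> (\<lambda>x. cnj (f x)) \<xi>) \<eta> = ell2_inner \<xi> (?\<pi> f \<eta>)" for \<xi> \<eta> :: "'i \<Rightarrow> complex"
      unfolding ell2_inner_def by (intro infsum_cong) auto
  qed (auto simp: algebra_simps)
qed

lemma unitary_operator_permutation:
  fixes \<sigma> :: "'i \<Rightarrow> 'i"
  assumes "bij \<sigma>"
  shows "unitary_operator (\<lambda>\<xi> i. \<xi> (\<sigma> i))"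
proof -
  have e: "(\<lambda>i. \<xi> (\<tau> i)) \<in> ell2" if "bij \<tau>" "\<xi> \<in> ell2" for \<tau> :: "'i \<Rightarrow> 'i" and \<xi> :: "'i \<Rightarrow> complex"
    using that summable_on_reindex_bij_betw[of \<tau> UNIV UNIV "\<lambda>i. (cmod (\<xi> i))\<^sup>2"]
    by (simp add: ell2_def)
  have n: "ell2_inner (\<lambda>i. \<xi> (\<sigma> i)) (\<lambda>i. \<eta> (\<sigma> i)) = ell2_inner \<xi> \<eta>" for \<xi> \<eta> :: "'i \<Rightarrow> complex"
    unfolding ell2_inner_def
    using assms infsum_reindex_bij_betw[of \<sigma> UNIV UNIV "\<lambda>i. \<xi> i * cnj (\<eta> i)"] by simp
  have m: "ell2_norm (\<lambda>i. \<xi> (\<sigma> i)) = ell2_norm \<xi>" if "\<xi> \<in> ell2" for \<xi> :: "'i \<Rightarrow> complex"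
    using ell2_norm_eqI_inner[OF e[OF assms that] that n] .
  have "\<xi> \<in> (\<lambda>\<xi> i. \<xi> (\<sigma> i)) ` ell2" if "\<xi> \<in> ell2" for \<xi> :: "'i \<Rightarrow> complex"
  proof (rule image_eqI[where x="\<lambda>i. \<xi> (inv_into UNIV \<sigma> i)"])
    show "\<xi> = (\<lambda>i. \<xi> (inv_into UNIV \<sigma> (\<sigma> i)))" using assms by (simp add: bij_is_inj)
    show "(\<lambda>i. \<xi> (inv_into UNIV \<sigma> i)) \<in> ell2" by (rule e[OF bij_imp_bij_inv[OF assms] that])
  qed
  then have im: "(\<lambda>\<xi> i. \<xi> (\<sigma> i)) ` ell2 = (ell2 :: ('i \<Rightarrow> complex) set)" using e[OF assms] by blast
  show ?thesis
    unfolding unitary_operator_def bounded_operator_def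
  proof (intro conjI ballI allI exI[of _ 1])
    show "(\<lambda>i. \<xi> (\<sigma> i)) \<in> ell2" if "\<xi> \<in> ell2" for \<xi> :: "'i \<Rightarrow> complex" by (rule e[OF assms that])
    show "ell2_norm (\<lambda>i. \<xi> (\<sigma> i)) \<le> 1 * ell2_norm \<xi>" if "\<xi> \<in> ell2" for \<xi> :: "'i \<Rightarrow> complex"
      unfolding m[OF that] by simp
    show "(\<lambda>\<xi> i. \<xi> (\<sigma> i)) ` ell2 = (ell2 :: ('i \<Rightarrow> complex) set)" by (rule im)
    show "ell2_inner (\<lambda>i. \<xi> (\<sigma> i)) (\<lambda>i. \<eta> (\<sigma> i)) = ell2_inner \<xi> \<eta>" for \<xi> \<eta> :: "'i \<Rightarrow> complex"
      by (rule n)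
  qed (rule refl)+
qed

context dynamical_system
begin

text \<open>The regular representation induced from a point \<open>x\<close>: it lives on the square-summable families on \<open>G\<close>,
  embedded along an injection of \<open>G\<close> into the index type.\<close>

lemma regular_covariant_rep:
  fixes x :: 'x and \<iota> :: "'g \<Rightarrow> 'i"
  assumes \<iota>: "inj \<iota>"
  obtains \<pi> and u :: "'g \<Rightarrow> 'i operator" where "covariant_rep G \<alpha> \<pi> u"
    "\<And>f g \<xi>. g \<in> carrier G \<Longrightarrow> \<pi> f \<xi> (\<iota> g) = f (\<alpha> g x) * \<xi> (\<iota> g)"
    "\<And>g h \<xi>. g \<in> carrier G \<Longrightarrow> h \<in> carrier G \<Longrightarrow> u g \<xi> (\<iota> h) = \<xi> (\<iota> (inv g \<otimes> h))"
proof -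
  define Z where "Z = \<iota> ` carrier G"
  define d where "d = inv_into UNIV \<iota>"
  have d: "d (\<iota> g) = g" for g using \<iota> by (simp add: d_def)
  define \<sigma> where "\<sigma> = (\<lambda>g i. if i \<in> Z then \<iota> (inv g \<otimes> d i) else i)"
  have \<sigma>\<sigma>: "\<sigma> h (\<sigma> g i) = \<sigma> (g \<otimes> h) i" if "g \<in> carrier G" "h \<in> carrier G" for g h i
    using that by (auto simp: \<sigma>_def Z_def d inv_mult_group m_assoc)
  have \<sigma>1: "\<sigma> \<one> i = i" for i by (auto simp: \<sigma>_def Z_def d)
  have bij: "bij (\<sigma> g)" if g: "g \<in> carrier G" for g
  proof (rule o_bij)
    show "\<sigma> (inv g) \<circ> \<sigma> g = id" "\<sigma> g \<circ> \<sigma> (inv g) = id" using \<sigma>\<sigma> \<sigma>1 g by (auto simp: fun_eq_iff)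
  qed
  define \<pi> where "\<pi> = (\<lambda>f \<xi> i. if i \<in> Z then f (\<alpha> (d i) x) * \<xi> i else (0::complex))"
  define u where "u = (\<lambda>g \<xi> i. (\<xi> (\<sigma> g i) :: complex))"
  have "covariant_rep G \<alpha> \<pi> u"
    unfolding covariant_rep_def unitary_rep_def
  proof (intro conjI ballI)
    show "C0_star_rep \<pi>" unfolding \<pi>_def by (rule C0_star_rep_diagonal)
    show "unitary_operator (u g)" if "g \<in> carrier G" for g
      unfolding u_def by (intro unitary_operator_permutation bij that)
    show "u (g \<otimes> h) \<xi> = u g (u h \<xi>)" if "g \<in> carrier G" "h \<in> carrier G" for g h \<xi>
      using \<sigma>\<sigma> that by (auto simp: u_def)
    show "u g (\<pi> f \<xi>) = \<pi> (act_fun G \<alpha> g f) (u g \<xi>)" if g: "g \<in> carrier G" for g f \<xi>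
    proof (rule ext)
      fix i
      show "u g (\<pi> f \<xi>) i = \<pi> (act_fun G \<alpha> g f) (u g \<xi>) i"
      proof (cases "i \<in> Z")
        case True
        then obtain h where "h \<in> carrier G" "i = \<iota> h" by (auto simp: Z_def)
        then show ?thesis using g by (auto simp: u_def \<pi>_def act_fun_def \<sigma>_def Z_def d act_mult)
      qed (simp add: u_def \<pi>_def \<sigma>_def)
    qed
  qed
  then show ?thesis
    by (rule that) (auto simp: \<pi>_def u_def Z_def d \<sigma>_def)
qed

lemma inj_index_embedding: "inj (\<lambda>s g (x::'x). if g = s then 1 else (0::complex))"
  by (rule injI) (metis (mono_tags) one_neq_zero)

text \<open>In the regular representation induced from \<open>\<alpha> (inv g0) x\<close>, the value \<open>a g0 x\<close> is a matrix coefficient.\<close>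

lemma universal_norm_pos:
  assumes a: "a \<in> cpc" and g0: "g0 \<in> carrier G" "a g0 x \<noteq> 0"
  shows "0 < universal_norm G \<alpha> a"
proof -
  define \<iota> :: "'g \<Rightarrow> 'g \<Rightarrow> 'x \<Rightarrow> complex" where "\<iota> = (\<lambda>s g x. if g = s then 1 else 0)"
  have \<iota>: "inj \<iota>" unfolding \<iota>_def by (rule inj_index_embedding)
  obtain \<pi> and u :: "'g \<Rightarrow> ('g \<Rightarrow> 'x \<Rightarrow> complex) operator" where cov: "covariant_rep G \<alpha> \<pi> u"
    and \<pi>: "\<And>f g \<xi>. g \<in> carrier G \<Longrightarrow> \<pi> f \<xi> (\<iota> g) = f (\<alpha> g (\<alpha> (inv g0) x)) * \<xi> (\<iota> g)"
    and u: "\<And>g h \<xi>. g \<in> carrier G \<Longrightarrow> h \<in> carrier G \<Longrightarrow> u g \<xi> (\<iota> h) = \<xi> (\<iota> (inv g \<otimes> h))"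
    using regular_covariant_rep[OF \<iota>, of "\<alpha> (inv g0) x"] by blast
  have z: "delta (\<iota> \<one>) (\<iota> (inv g \<otimes> g0)) = (if g = g0 then 1 else 0)" if "g \<in> carrier G" for g
  proof -
    have "inv g \<otimes> g0 = \<one> \<longleftrightarrow> g = g0" using that g0 inv_solve_left'[of \<one> g g0] by auto
    then show ?thesis using \<iota> by (auto simp: delta_def inj_eq)
  qed
  have "integrated_form G \<pi> u a (delta (\<iota> \<one>)) (\<iota> g0) =
     (\<Sum>g\<in>cp_supp G a. a g x * (if g = g0 then 1 else 0))"
    unfolding integrated_form_def using g0 by (intro sum.cong) (auto simp: \<pi> u z cp_supp_def)
  also have "\<dots> = (\<Sum>g\<in>cp_supp G a. if g = g0 then a g0 x else 0)"
    by (intro sum.cong) auto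
  also have "\<dots> = a g0 x"
    using g0 cpcD(2)[OF a] by (auto simp: cp_supp_def fun_eq_iff)
  finally have "0 < ell2_norm (integrated_form G \<pi> u a (delta (\<iota> \<one>)))"
    using ell2_coord_le[OF integrated_form_ell2[OF cov a delta_ell2], of "\<iota> \<one>" "\<iota> g0"] g0
      less_le_trans[of 0 "cmod (a g0 x)"] by simp
  also have "\<dots> \<le> universal_norm G \<alpha> a"
    using universal_norm_bound[OF cov a delta_ell2, of "\<iota> \<one>"] by (simp add: ell2_norm_delta)
  finally show ?thesis .
qed

lemma cp_dist_pos:
  assumes "a \<in> cpc" "b \<in> cpc" "a \<noteq> b"
  shows "sa_dist cp a b \<noteq> 0"
proof -
  obtain g x where gx: "a g x \<noteq> b g x" using assms(3) by (auto simp: fun_eq_iff)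
  then have "g \<in> carrier G" using cpcD(3) assms by metis
  then show ?thesis
    using universal_norm_pos[OF cp_diff_closed[OF assms(1,2)], of g x] gx by (simp add: sa_dist_def cp_simps)
qed

end

section \<open>Finite-dimensional representations live on finite orbits\<close>

lemma mat_mult_adjoint_index:
  fixes M :: "complex mat"
  assumes "M \<in> carrier_mat n n" "i < n"
  shows "(M * mat_adjoint M) $$ (i, i) = of_real (\<Sum>k<n. (cmod (M $$ (i, k)))\<^sup>2)"
  using assms by (subst mat_mult_index[OF _ mat_adjoint_carrier])
    (auto simp: mat_adjoint_index complex_norm_square[symmetric])

lemma mat_mult_adjoint_zero:
  fixes M :: "complex mat"
  assumes M: "M \<in> carrier_mat n n" and z: "M * mat_adjoint M = 0\<^sub>m n n"
  shows "M = 0\<^sub>m n n"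
proof (rule eq_matI)
  fix i j assume "i < dim_row (0\<^sub>m n n :: complex mat)" "j < dim_col (0\<^sub>m n n :: complex mat)"
  then have ij: "i < n" "j < n" by auto
  have "of_real (\<Sum>k<n. (cmod (M $$ (i, k)))\<^sup>2) = (0 :: complex)"
    using mat_mult_adjoint_index[OF M ij(1)] z ij by simp
  then have "(\<Sum>k<n. (cmod (M $$ (i, k)))\<^sup>2) = 0" using of_real_eq_0_iff by blast
  then have "(cmod (M $$ (i, j)))\<^sup>2 = 0" using ij by (subst (asm) sum_nonneg_eq_0_iff) auto
  then show "M $$ (i, j) = 0\<^sub>m n n $$ (i, j)" using ij by simp
qed (use M in auto)

lemma smult_zero_mat: "M \<in> carrier_mat n n \<Longrightarrow> 0 \<cdot>\<^sub>m M = 0\<^sub>m n n" for M :: "complex mat"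
  by (intro eq_matI) auto

text \<open>Bessel's inequality for each standard basis vector, summed over the basis.\<close>

lemma card_orthonormal_le:
  fixes w :: "'k \<Rightarrow> nat \<Rightarrow> complex"
  assumes A: "finite A" and on: "\<And>i j. i \<in> A \<Longrightarrow> j \<in> A \<Longrightarrow> (\<Sum>k<n. w i k * cnj (w j k)) = (if i = j then 1 else 0)"
  shows "card A \<le> n"
proof -
  define s where "s = (\<lambda>k. \<Sum>i\<in>A. (cmod (w i k))\<^sup>2)"
  have s1: "s k \<le> 1" if k: "k < n" for k
  proof -
    define y where "y = (\<lambda>l. \<Sum>i\<in>A. cnj (w i k) * w i l)"
    have yk: "y k = of_real (s k)"
      unfolding y_def s_def of_real_sum by (intro sum.cong refl) (subst complex_norm_square, simp)
    have "of_real (\<Sum>l<n. (cmod (y l))\<^sup>2) = (\<Sum>l<n. \<Sum>i\<in>A. \<Sum>j\<in>A. cnj (w i k) * w j k * (w i l * cnj (w j l)))"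
      unfolding of_real_sum complex_norm_square y_def cnj_sum sum_product
      by (intro sum.cong refl) (simp add: mult_ac)
    also have "\<dots> = (\<Sum>i\<in>A. \<Sum>j\<in>A. cnj (w i k) * w j k * (\<Sum>l<n. w i l * cnj (w j l)))"
      unfolding sum_distrib_left by (subst sum.swap, rule sum.cong[OF refl], rule sum.swap)
    also have "\<dots> = (\<Sum>i\<in>A. \<Sum>j\<in>A. if i = j then cnj (w i k) * w j k else 0)"
      using on by (intro sum.cong refl) auto
    also have "\<dots> = of_real (s k)"
      unfolding s_def of_real_sum complex_norm_square using A by (auto intro!: sum.cong)
    finally have e: "(\<Sum>l<n. (cmod (y l))\<^sup>2) = s k" using of_real_eq_iff by blast
    have "(cmod (y k))\<^sup>2 \<le> s k"
      unfolding e[symmetric] using k by (intro member_le_sum) auto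
    then have "(s k)\<^sup>2 \<le> s k" unfolding yk by simp
    moreover have "0 \<le> s k" by (simp add: s_def sum_nonneg)
    ultimately show ?thesis
      using mult_strict_left_mono[of 1 "s k" "s k"] unfolding power2_eq_square by linarith
  qed
  have n1: "(\<Sum>k<n. (cmod (w i k))\<^sup>2) = 1" if "i \<in> A" for i
  proof -
    have "of_real (\<Sum>k<n. (cmod (w i k))\<^sup>2) = (1::complex)"
      unfolding of_real_sum complex_norm_square using on[OF that that] by simp
    then show ?thesis using of_real_eq_1_iff by blast
  qed
  have "real (card A) = (\<Sum>i\<in>A. \<Sum>k<n. (cmod (w i k))\<^sup>2)" using n1 by simp
  also have "\<dots> = (\<Sum>k<n. s k)" unfolding s_def by (rule sum.swap)
  also have "\<dots> \<le> (\<Sum>k<n. 1)" using s1 by (intro sum_mono) auto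
  finally show ?thesis by simp
qed

lemma finite_set_disjoint_nhds:
  fixes A :: "'x::t2_space set"
  assumes A: "finite A"
  obtains U where "\<And>x. x \<in> A \<Longrightarrow> open (U x)" "\<And>x. x \<in> A \<Longrightarrow> x \<in> U x"
    "\<And>x y. x \<in> A \<Longrightarrow> y \<in> A \<Longrightarrow> x \<noteq> y \<Longrightarrow> U x \<inter> U y = {}"
proof -
  have "\<exists>V. open (fst V) \<and> open (snd V) \<and> x \<in> fst V \<and> y \<in> snd V \<and> fst V \<inter> snd V = {}" if "x \<noteq> y" for x y :: 'x
    using hausdorff[OF that] by auto
  then obtain V where V: "\<And>x y :: 'x. x \<noteq> y \<Longrightarrow> open (fst (V x y)) \<and> open (snd (V x y)) \<and> x \<in> fst (V x y) \<and> y \<in> snd (V x y)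
      \<and> fst (V x y) \<inter> snd (V x y) = {}" by metis
  define U where "U = (\<lambda>x. (\<Inter>y\<in>A - {x}. fst (V x y) \<inter> snd (V y x)))"
  show ?thesis
  proof (rule that[of U])
    show "open (U x)" for x unfolding U_def using A V by (intro open_INT) (auto intro!: open_Int)
    show "x \<in> U x" for x
    proof -
      have "x \<in> fst (V x y) \<inter> snd (V y x)" if "y \<noteq> x" for y using V[of x y] V[of y x] that by auto
      then show ?thesis by (auto simp: U_def)
    qed
    show "U x \<inter> U y = {}" if "x \<in> A" "y \<in> A" "x \<noteq> y" for x y
      using V[OF that(3)] that unfolding U_def by blast
  qed
qed

context dynamical_system
begin

definition single :: "'g \<Rightarrow> ('x \<Rightarrow> complex) \<Rightarrow> 'g \<Rightarrow> 'x \<Rightarrow> complex" where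
  "single g f = (\<lambda>h. if h = g then f else (\<lambda>x. 0))"

lemma single_closed: "g \<in> carrier G \<Longrightarrow> f \<in> C0 \<Longrightarrow> single g f \<in> cpc"
  by (rule cpcI[of _ "{g}"]) (auto simp: single_def)

lemma single_add: "sa_add cp (single g f) (single g k) = single g (\<lambda>x. f x + k x)"
  by (auto simp: cp_simps single_def fun_eq_iff)

lemma single_scale: "sa_scale cp c (single g f) = single g (\<lambda>x. c * f x)"
  by (auto simp: cp_simps single_def fun_eq_iff)

lemma single_mult:
  assumes g: "g \<in> carrier G" and h: "h \<in> carrier G"
  shows "sa_mult cp (single g f) (single h k) = single (g \<otimes> h) (\<lambda>x. f x * act_fun G \<alpha> g k x)"
proof (intro ext)
  fix l x
  have eq: "inv g \<otimes> l = h \<longleftrightarrow> l = g \<otimes> h" if "l \<in> carrier G"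
    using that g h by (metis inv_solve_left')
  have *: "single h k (inv g \<otimes> l) = (if l = g \<otimes> h then k else (\<lambda>x. 0))" if "l \<in> carrier G"
    using eq[OF that] by (auto simp: single_def)
  have s: "cp_supp G (single g f) = (if f = (\<lambda>x. 0) then {} else {g})"
    using g by (auto simp: cp_supp_def single_def)
  show "sa_mult cp (single g f) (single h k) l x = single (g \<otimes> h) (\<lambda>x. f x * act_fun G \<alpha> g k x) l x"
  proof (cases "l \<in> carrier G")
    case True
    then show ?thesis unfolding cp_simps s
      using *[OF True] by (auto simp: single_def act_fun_def)
  next
    case False
    then have "l \<noteq> g \<otimes> h" using g h by auto
    with False show ?thesis by (auto simp: cp_simps single_def)
  qed
qed

lemma single_star:
  assumes g: "g \<in> carrier G"
  shows "sa_star cp (single g f) = single (inv g) (act_fun G \<alpha> (inv g) (\<lambda>x. cnj (f x)))"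
proof (intro ext)
  fix l x
  have eq: "inv l = g \<longleftrightarrow> l = inv g" if "l \<in> carrier G" using that g by auto
  show "sa_star cp (single g f) l x = single (inv g) (act_fun G \<alpha> (inv g) (\<lambda>x. cnj (f x))) l x"
    using g eq by (auto simp: cp_simps single_def act_fun_def)
qed

lemma orbit_finite_invariant:
  assumes "finite Z" "x \<in> Z" "\<And>g y. g \<in> carrier G \<Longrightarrow> y \<in> Z \<Longrightarrow> \<alpha> g y \<in> Z"
  shows "orbit G \<alpha> x \<in> {S \<in> orbits G UNIV \<alpha>. finite S}" "x \<in> orbit G \<alpha> x"
proof -
  have "orbit G \<alpha> x \<subseteq> Z" using assms by (auto simp: orbit_def)
  then show "orbit G \<alpha> x \<in> {S \<in> orbits G UNIV \<alpha>. finite S}"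
    using assms(1) finite_subset by (auto simp: orbits_def)
  show "x \<in> orbit G \<alpha> x" using group_action.orbit_refl[OF group_action] by simp
qed

end

locale fd_crossed_product_rep = dynamical_system G \<alpha>
  for G :: "('g, 'b) monoid_scheme" (structure) and \<alpha> :: "'g \<Rightarrow> 'x::t2_space \<Rightarrow> 'x" +
  fixes \<phi> :: "('g \<Rightarrow> 'x \<Rightarrow> complex) \<Rightarrow> complex mat" and n :: nat
  assumes rep: "fd_star_rep (alg_crossed_product G \<alpha>) n \<phi>"
begin

lemma \<phi>_carrier: "a \<in> cpc \<Longrightarrow> \<phi> a \<in> carrier_mat n n"
  and \<phi>_add: "a \<in> cpc \<Longrightarrow> b \<in> cpc \<Longrightarrow> \<phi> (sa_add cp a b) = \<phi> a + \<phi> b"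
  and \<phi>_scale: "a \<in> cpc \<Longrightarrow> \<phi> (sa_scale cp c a) = c \<cdot>\<^sub>m \<phi> a"
  and \<phi>_mult: "a \<in> cpc \<Longrightarrow> b \<in> cpc \<Longrightarrow> \<phi> (sa_mult cp a b) = \<phi> a * \<phi> b"
  and \<phi>_star: "a \<in> cpc \<Longrightarrow> \<phi> (sa_star cp a) = mat_adjoint (\<phi> a)"
  using rep by (auto simp: fd_star_rep_def)

abbreviation A where "A g f \<equiv> \<phi> (single g f)"

lemma A_carrier: "g \<in> carrier G \<Longrightarrow> f \<in> C0 \<Longrightarrow> A g f \<in> carrier_mat n n"
  by (intro \<phi>_carrier single_closed)

lemma A_add: "g \<in> carrier G \<Longrightarrow> f \<in> C0 \<Longrightarrow> k \<in> C0 \<Longrightarrow> A g (\<lambda>x. f x + k x) = A g f + A g k"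
  using \<phi>_add[of "single g f" "single g k"] by (simp add: single_closed single_add)

lemma A_scale: "g \<in> carrier G \<Longrightarrow> f \<in> C0 \<Longrightarrow> A g (\<lambda>x. c * f x) = c \<cdot>\<^sub>m A g f"
  using \<phi>_scale[of "single g f"] by (simp add: single_closed single_scale)

lemma A_mult: "g \<in> carrier G \<Longrightarrow> h \<in> carrier G \<Longrightarrow> f \<in> C0 \<Longrightarrow> k \<in> C0 \<Longrightarrow>
    A g f * A h k = A (g \<otimes> h) (\<lambda>x. f x * act_fun G \<alpha> g k x)"
  using \<phi>_mult[of "single g f" "single h k"] by (simp add: single_closed single_mult)

lemma A_star: "g \<in> carrier G \<Longrightarrow> f \<in> C0 \<Longrightarrow> mat_adjoint (A g f) = A (inv g) (act_fun G \<alpha> (inv g) (\<lambda>x. cnj (f x)))"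
  using \<phi>_star[of "single g f"] by (simp add: single_closed single_star)

lemma A_diff_eq:
  assumes g: "g \<in> carrier G" and f: "f \<in> C0" "k \<in> C0" and z: "A g (\<lambda>x. f x - k x) = 0\<^sub>m n n"
  shows "A g f = A g k"
proof -
  have "A g f = A g (\<lambda>x. (f x - k x) + k x)" by simp
  also have "\<dots> = 0\<^sub>m n n + A g k" by (subst A_add) (auto intro: C0_diff simp: g f z)
  also have "\<dots> = A g k" using A_carrier[OF g f(2)] by simp
  finally show ?thesis .
qed

definition null_ideal :: "('x \<Rightarrow> complex) set" where
  "null_ideal = {f \<in> C0. A \<one> f = 0\<^sub>m n n}"

lemma null_idealD: "f \<in> null_ideal \<Longrightarrow> f \<in> C0" "f \<in> null_ideal \<Longrightarrow> A \<one> f = 0\<^sub>m n n"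
  by (auto simp: null_ideal_def)

lemma null_ideal_mult:
  assumes f: "f \<in> null_ideal" and k: "k \<in> C0"
  shows "(\<lambda>x. k x * f x) \<in> null_ideal"
proof -
  have "A \<one> (\<lambda>x. k x * f x) = A \<one> k * A \<one> f"
    using A_mult[of \<one> \<one> k f] null_idealD[OF f] k by simp
  also have "\<dots> = 0\<^sub>m n n" using null_idealD[OF f] A_carrier[of \<one> k] k by simp
  finally show ?thesis using null_idealD[OF f] k by (simp add: null_ideal_def C0_mult)
qed

lemma null_ideal_sum:
  assumes "\<And>k. k \<in> S \<Longrightarrow> f k \<in> null_ideal"
  shows "(\<lambda>x. \<Sum>k\<in>S. f k x) \<in> null_ideal"
proof -
  have z: "(\<lambda>x. 0) \<in> null_ideal"
    using A_scale[of \<one> "\<lambda>x. 0" 0] smult_zero_mat[OF A_carrier[of \<one> "\<lambda>x. 0"]] by (simp add: null_ideal_def)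
  have add: "(\<lambda>x. p x + q x) \<in> null_ideal" if "p \<in> null_ideal" "q \<in> null_ideal" for p q
    using that A_add[of \<one> p q] by (simp add: null_ideal_def C0_add)
  from assms show ?thesis
    by (induction S rule: infinite_finite_induct) (auto intro: z add)
qed

lemma abs_square_C0: "f \<in> C0 \<Longrightarrow> (\<lambda>x. f x * cnj (f x)) \<in> C0"
  by (intro C0_mult C0_cnj)

text \<open>Vanishing of \<open>\<phi>\<close> on \<open>f \<delta>\<^sub>g\<close> can thus be tested on the function \<open>|f|\<^sup>2\<close> alone.\<close>

lemma A_mult_adjoint:
  assumes g: "g \<in> carrier G" and f: "f \<in> C0"
  shows "A g f * mat_adjoint (A g f) = A \<one> (\<lambda>x. f x * cnj (f x))"
proof -
  have "act_fun G \<alpha> g (act_fun G \<alpha> (inv g) (\<lambda>x. cnj (f x))) = (\<lambda>x. cnj (f x))"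
    using act_fun_mult[of g "inv g" "\<lambda>x. cnj (f x)"] g by simp
  then show ?thesis
    using A_mult[OF g inv_closed[OF g] f act_fun_C0[OF inv_closed[OF g] C0_cnj[OF f]]] A_star[OF g f] g by simp
qed

lemma A_zero_if_square_null:
  assumes g: "g \<in> carrier G" and f: "f \<in> C0" and z: "(\<lambda>x. f x * cnj (f x)) \<in> null_ideal"
  shows "A g f = 0\<^sub>m n n"
  using mat_mult_adjoint_zero[OF A_carrier[OF g f]] A_mult_adjoint[OF g f] null_idealD(2)[OF z] by simp

lemma A_zero_if_null: "g \<in> carrier G \<Longrightarrow> f \<in> null_ideal \<Longrightarrow> A g f = 0\<^sub>m n n"
  using A_zero_if_square_null[of g f] null_ideal_mult[of f "\<lambda>x. cnj (f x)"] null_idealD(1)[of f] C0_cnj[of f]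
  by (simp add: mult.commute)

lemma null_ideal_if_square_null:
  assumes f: "f \<in> C0" and z: "(\<lambda>x. f x * cnj (f x)) \<in> null_ideal"
  shows "f \<in> null_ideal"
  using A_zero_if_square_null[OF one_closed f z] f by (simp add: null_ideal_def)

text \<open>The ideal is invariant although the canonical unitaries themselves are not in the algebra:
  with \<open>c = \<alpha>\<^sub>g(f)\<close>, the element \<open>c\<^sup>* \<delta>\<^sub>g f\<close> of the kernel has coefficient \<open>|c|\<^sup>2\<close>, so the
  test by squares applies.\<close>

lemma null_ideal_invariant:
  assumes g: "g \<in> carrier G" and f: "f \<in> null_ideal"
  shows "act_fun G \<alpha> g f \<in> null_ideal"
proof -
  define c where "c = act_fun G \<alpha> g f"
  have fC: "f \<in> C0" using null_idealD f by blast
  then have c: "c \<in> C0" unfolding c_def by (intro act_fun_C0 g)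
  define h where "h = (\<lambda>x. cnj (c x) * c x)"
  have h: "h \<in> C0" unfolding h_def using c by (intro C0_mult C0_cnj)
  have "A g h = A g (\<lambda>x. cnj (c x)) * A \<one> f"
    using A_mult[OF g one_closed C0_cnj[OF c] fC] g by (simp add: h_def c_def)
  also have "\<dots> = 0\<^sub>m n n" using null_idealD(2)[OF f] A_carrier[OF g C0_cnj[OF c]] by simp
  finally have Ag: "A g h = 0\<^sub>m n n" .
  have "A \<one> (\<lambda>x. h x * cnj (h x)) = 0\<^sub>m n n * mat_adjoint (0\<^sub>m n n)"
    using A_mult_adjoint[OF g h] Ag by simp
  also have "\<dots> = 0\<^sub>m n n" using mat_adjoint_carrier[of "0\<^sub>m n n" n] by simp
  finally have "(\<lambda>x. h x * cnj (h x)) \<in> null_ideal" using abs_square_C0[OF h] by (simp add: null_ideal_def)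
  then have "h \<in> null_ideal" by (rule null_ideal_if_square_null[OF h])
  have "c \<in> null_ideal"
    by (rule null_ideal_if_square_null[OF c]) (use \<open>h \<in> null_ideal\<close> in \<open>simp add: h_def mult.commute\<close>)
  then show ?thesis by (simp add: c_def)
qed

definition zero_set :: "'x set" where
  "zero_set = {x. \<forall>f\<in>null_ideal. f x = 0}"

lemma zero_set_invariant: "g \<in> carrier G \<Longrightarrow> x \<in> zero_set \<Longrightarrow> \<alpha> g x \<in> zero_set"
  using null_ideal_invariant[of "inv g"] by (fastforce simp: zero_set_def act_fun_def)

text \<open>By compactness some \<open>s \<ge> 0\<close> in the ideal is positive on \<open>K\<close>. Then \<open>f\<close> is a multiple of \<open>s\<close>; the quotient is
  written with \<open>max s \<delta>\<close>, where \<open>\<delta>\<close> is the minimum of \<open>s\<close> on \<open>K\<close>, to be continuous and bounded everywhere.\<close>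

lemma null_ideal_compact_support:
  assumes f: "continuous_on UNIV f" and K: "compact K" "\<And>x. x \<notin> K \<Longrightarrow> f x = 0" and disj: "K \<inter> zero_set = {}"
  shows "f \<in> null_ideal"
proof (cases "K = {}")
  case True
  then have "f = (\<lambda>x. \<Sum>k\<in>{}. 0)" using K by auto
  then show ?thesis using null_ideal_sum[of "{}"] by simp
next
  case False
  have fC: "f \<in> C0" using C0_compact_support[OF f K] .
  have "\<exists>h\<in>null_ideal. h y \<noteq> 0" if "y \<in> K" for y using that disj by (auto simp: zero_set_def)
  then obtain h where h: "\<And>y. y \<in> K \<Longrightarrow> h y \<in> null_ideal" "\<And>y. y \<in> K \<Longrightarrow> h y y \<noteq> 0" by metis
  have hc: "continuous_on UNIV (h y)" if "y \<in> K" for y using h(1)[OF that] null_idealD C0_continuous by blast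
  have op: "open {x. h y x \<noteq> 0}" if "y \<in> K" for y
    using hc[OF that] by (intro open_Collect_neq) (auto intro: continuous_intros)
  obtain D where D: "D \<subseteq> K" "finite D" "K \<subseteq> (\<Union>y\<in>D. {x. h y x \<noteq> 0})"
    using compactE_image[OF K(1), of K "\<lambda>y. {x. h y x \<noteq> 0}"] op h(2) by blast
  define s where "s = (\<lambda>x. \<Sum>y\<in>D. (cmod (h y x))\<^sup>2)"
  have sc: "continuous_on UNIV s" unfolding s_def using hc D by (intro continuous_intros) auto
  have sn: "(\<lambda>x. of_real (s x)) \<in> null_ideal"
  proof -
    have "(\<lambda>x. cnj (h y x) * h y x) \<in> null_ideal" if "y \<in> D" for y
      using that D h(1) null_idealD(1) by (intro null_ideal_mult C0_cnj) auto
    then have "(\<lambda>x. \<Sum>y\<in>D. cnj (h y x) * h y x) \<in> null_ideal" by (rule null_ideal_sum)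
    then show ?thesis unfolding s_def of_real_sum complex_norm_square by (simp add: mult.commute)
  qed
  have spos: "s x > 0" if xK: "x \<in> K" for x
  proof -
    obtain y where y: "y \<in> D" "h y x \<noteq> 0" using D xK by auto
    then have "0 < (cmod (h y x))\<^sup>2" by simp
    also have "\<dots> \<le> s x" unfolding s_def using y D by (intro member_le_sum) auto
    finally show ?thesis .
  qed
  obtain x0 where x0: "x0 \<in> K" "\<And>x. x \<in> K \<Longrightarrow> s x0 \<le> s x"
    using continuous_attains_inf[OF K(1) False continuous_on_subset[OF sc]] by auto
  define \<delta> where "\<delta> = s x0"
  have \<delta>: "\<delta> > 0" using spos x0 by (simp add: \<delta>_def)
  define q where "q = (\<lambda>x. f x * of_real (1 / max (s x) \<delta>))"
  have q: "q \<in> C0" unfolding q_def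
  proof (rule C0_mult_bounded[OF fC])
    show "continuous_on UNIV (\<lambda>x. complex_of_real (1 / max (s x) \<delta>))"
      using sc \<delta> by (intro continuous_intros) (auto simp: max_def)
    show "cmod (of_real (1 / max (s x) \<delta>)) \<le> 1 / \<delta>" for x
      unfolding norm_of_real using \<delta> by (simp add: frac_le)
  qed
  have "f = (\<lambda>x. q x * of_real (s x))"
  proof
    fix x show "f x = q x * of_real (s x)"
      using K(2)[of x] x0(2)[of x] spos[of x] by (cases "x \<in> K") (auto simp: q_def \<delta>_def max_def)
  qed
  then show ?thesis using null_ideal_mult[OF sn q] by simp
qed

text \<open>For \<open>k = |f|\<^sup>2\<close> the difference of \<open>k\<close> and \<open>min k e\<close> has compact support off the zero set, so the image \<open>M\<close> of
  \<open>k\<close> is the image of \<open>min k e\<close> for every \<open>e > 0\<close>. Then \<open>e M - M\<^sup>2\<close> is positive for every \<open>e\<close>, which forces \<open>M = 0\<close>.\<close>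

lemma null_ideal_if_vanishes:
  assumes f: "f \<in> C0" and z: "\<And>x. x \<in> zero_set \<Longrightarrow> f x = 0"
  shows "f \<in> null_ideal"
proof -
  define k where "k = (\<lambda>x. (cmod (f x))\<^sup>2)"
  define kc where "kc = (\<lambda>x. complex_of_real (k x))"
  have kC: "(\<lambda>x. complex_of_real (\<psi> (k x))) \<in> C0" if "continuous_on UNIV \<psi>" "\<psi> 0 = 0" for \<psi> :: "real \<Rightarrow> real"
    unfolding k_def by (rule C0_compose[OF f, where \<phi>="\<lambda>z. complex_of_real (\<psi> ((cmod z)\<^sup>2))"])
      (auto intro!: continuous_intros continuous_on_compose2[OF that(1)] simp: that(2))
  have kc: "kc \<in> C0" unfolding kc_def using kC[of "\<lambda>t. t"] by (auto intro: continuous_intros)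
  define M where "M = A \<one> kc"
  have M: "M \<in> carrier_mat n n" unfolding M_def by (intro A_carrier kc one_closed)
  have bound: "(\<Sum>j<n. (cmod (M $$ (i, j)))\<^sup>2) \<le> e * Re (M $$ (i, i))" if i: "i < n" and e: "e > 0" for i e
  proof -
    define p where "p = (\<lambda>x. complex_of_real (min (k x) e))"
    define r where "r = (\<lambda>x. complex_of_real (sqrt (min (k x) e * (e - min (k x) e))))"
    have p: "p \<in> C0" unfolding p_def using e by (intro kC[of "\<lambda>t. min t e"]) (auto intro!: continuous_intros)
    have r: "r \<in> C0" unfolding r_def using e
      by (intro kC[of "\<lambda>t. sqrt (min t e * (e - min t e))"]) (auto intro!: continuous_intros)
    have kcont: "continuous_on UNIV k" unfolding k_def using C0_continuous[OF f] by (intro continuous_intros)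
    have "(\<lambda>x. kc x - p x) \<in> null_ideal"
    proof -
      obtain K where K: "compact K" "\<And>x. x \<notin> K \<Longrightarrow> cmod (kc x) < e" using C0_small[OF kc e] by blast
      show ?thesis
      proof (rule null_ideal_compact_support)
        show "continuous_on UNIV (\<lambda>x. kc x - p x)"
          using kc p C0_continuous by (intro continuous_intros) auto
        have cl: "closed {x. e \<le> k x}" using kcont by (intro closed_Collect_le) (auto intro: continuous_intros)
        show "compact (K \<inter> {x. e \<le> k x})" using K(1) cl by (rule compact_Int_closed)
        show "kc x - p x = 0" if "x \<notin> K \<inter> {x. e \<le> k x}" for x
        proof -
          have "k x \<le> e"
          proof (cases "x \<in> K")
            case False
            then have "cmod (kc x) < e" by (rule K(2))
            then show ?thesis by (simp add: kc_def)
          qed (use that in auto)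
          then show ?thesis by (simp add: kc_def p_def)
        qed
        show "K \<inter> {x. e \<le> k x} \<inter> zero_set = {}" using z e by (auto simp: k_def)
      qed
    qed
    then have Mp: "M = A \<one> p" unfolding M_def
      by (intro A_diff_eq one_closed kc p) (auto simp: null_ideal_def)
    have "M * mat_adjoint M = A \<one> (\<lambda>x. p x * cnj (p x))" unfolding Mp by (intro A_mult_adjoint one_closed p)
    then have 1: "A \<one> (\<lambda>x. p x * cnj (p x)) $$ (i, i) = of_real (\<Sum>j<n. (cmod (M $$ (i, j)))\<^sup>2)"
      using mat_mult_adjoint_index[OF M i] by simp
    have R: "A \<one> r \<in> carrier_mat n n" by (intro A_carrier r one_closed)
    have 2: "A \<one> (\<lambda>x. r x * cnj (r x)) $$ (i, i) = of_real (\<Sum>j<n. (cmod (A \<one> r $$ (i, j)))\<^sup>2)"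
      using mat_mult_adjoint_index[OF R i] A_mult_adjoint[OF one_closed r] by simp
    have pr: "(\<lambda>x. p x * cnj (p x) + r x * cnj (r x)) = (\<lambda>x. of_real e * p x)"
    proof
      fix x
      define t where "t = min (k x) e"
      have t: "0 \<le> t" "t \<le> e" using e by (auto simp: t_def k_def)
      have "(sqrt (t * (e - t)))\<^sup>2 = t * (e - t)" using t by (intro real_sqrt_pow2) auto
      then have "t * t + sqrt (t * (e - t)) * sqrt (t * (e - t)) = e * t"
        by (simp add: power2_eq_square algebra_simps)
      then show "p x * cnj (p x) + r x * cnj (r x) = of_real e * p x"
        unfolding p_def r_def t_def[symmetric] complex_cnj_complex_of_real of_real_mult[symmetric] of_real_add[symmetric]
        by simp
    qed
    have "A \<one> (\<lambda>x. p x * cnj (p x)) + A \<one> (\<lambda>x. r x * cnj (r x)) = of_real e \<cdot>\<^sub>m M"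
      using A_add[OF one_closed abs_square_C0[OF p] abs_square_C0[OF r]] A_scale[OF one_closed p, of "of_real e"]
      by (simp add: pr Mp)
    then have "(A \<one> (\<lambda>x. p x * cnj (p x)) + A \<one> (\<lambda>x. r x * cnj (r x))) $$ (i, i) = of_real e * M $$ (i, i)"
      using M i by simp
    then have "A \<one> (\<lambda>x. p x * cnj (p x)) $$ (i, i) + A \<one> (\<lambda>x. r x * cnj (r x)) $$ (i, i) = of_real e * M $$ (i, i)"
      using A_carrier[OF one_closed abs_square_C0[OF r]] i by simp
    then have "Re (of_real (\<Sum>j<n. (cmod (M $$ (i, j)))\<^sup>2) + of_real (\<Sum>j<n. (cmod (A \<one> r $$ (i, j)))\<^sup>2)) = Re (of_real e * M $$ (i, i))"
      using 1 2 by simp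
    then have "(\<Sum>j<n. (cmod (M $$ (i, j)))\<^sup>2) + (\<Sum>j<n. (cmod (A \<one> r $$ (i, j)))\<^sup>2) = e * Re (M $$ (i, i))"
      by simp
    moreover have "0 \<le> (\<Sum>j<n. (cmod (A \<one> r $$ (i, j)))\<^sup>2)" by (simp add: sum_nonneg)
    ultimately show ?thesis by linarith
  qed
  have "M = 0\<^sub>m n n"
  proof (rule eq_matI)
    fix i j assume "i < dim_row (0\<^sub>m n n :: complex mat)" "j < dim_col (0\<^sub>m n n :: complex mat)"
    then have ij: "i < n" "j < n" by auto
    define m where "m = (\<Sum>j<n. (cmod (M $$ (i, j)))\<^sup>2)"
    have "m \<le> 0"
    proof (rule field_le_epsilon)
      fix d :: real assume d: "d > 0"
      define c where "c = \<bar>Re (M $$ (i, i))\<bar> + 1"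
      have c: "c > 0" by (simp add: c_def)
      have "m \<le> (d / c) * Re (M $$ (i, i))" unfolding m_def using bound[OF ij(1), of "d / c"] d c by simp
      also have "\<dots> \<le> (d / c) * c" using d c by (intro mult_left_mono) (auto simp: c_def)
      finally show "m \<le> 0 + d" using c by simp
    qed
    moreover have "(cmod (M $$ (i, j)))\<^sup>2 \<le> m" unfolding m_def using ij by (intro member_le_sum) auto
    ultimately have "(cmod (M $$ (i, j)))\<^sup>2 \<le> 0" by linarith
    then show "M $$ (i, j) = 0\<^sub>m n n $$ (i, j)" using ij by simp
  qed (use M in auto)
  then have "kc \<in> null_ideal" using kc by (simp add: null_ideal_def M_def)
  moreover have "kc = (\<lambda>x. f x * cnj (f x))" by (simp only: kc_def k_def complex_norm_square)
  ultimately show ?thesis using null_ideal_if_square_null[OF f] by simp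
qed

text \<open>Disjoint bumps at points of the zero set have non-zero images, and a row of one is orthogonal to all rows of the
  others; there are at most \<open>n\<close> orthogonal vectors.\<close>

lemma finite_zero_set: "finite zero_set"
proof (rule ccontr)
  assume "infinite zero_set"
  then obtain D where D: "D \<subseteq> zero_set" "finite D" "card D = Suc n" using infinite_arbitrarily_large by blast
  obtain U where U: "\<And>x. x \<in> D \<Longrightarrow> open (U x)" "\<And>x. x \<in> D \<Longrightarrow> x \<in> U x"
    "\<And>x y. x \<in> D \<Longrightarrow> y \<in> D \<Longrightarrow> x \<noteq> y \<Longrightarrow> U x \<inter> U y = {}" using finite_set_disjoint_nhds[OF D(2)] by metis
  have "\<exists>b::'x \<Rightarrow> real. (\<lambda>y. complex_of_real (b y)) \<in> C0 \<and> b x = 1 \<and> (\<forall>y. y \<notin> U x \<longrightarrow> b y = 0)" if x: "x \<in> D" for x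
  proof -
    obtain f :: "'x \<Rightarrow> real" and K where f: "continuous_on UNIV f" "f x = 1" "compact K" "K \<subseteq> U x" "\<And>y. y \<notin> K \<Longrightarrow> f y = 0"
      using bump_function[OF locally_compact U(1)[OF x] U(2)[OF x]] by metis
    have "(\<lambda>y. complex_of_real (f y)) \<in> C0"
      using f by (intro C0_compact_support[of _ K]) (auto intro: continuous_intros)
    then show ?thesis using f by blast
  qed
  then obtain b :: "'x \<Rightarrow> 'x \<Rightarrow> real" where b: "\<And>x. x \<in> D \<Longrightarrow> (\<lambda>y. complex_of_real (b x y)) \<in> C0"
     "\<And>x. x \<in> D \<Longrightarrow> b x x = 1" "\<And>x y. x \<in> D \<Longrightarrow> y \<notin> U x \<Longrightarrow> b x y = 0" by metis
  define B where "B = (\<lambda>x. A \<one> (\<lambda>y. complex_of_real (b x y)))"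
  have Bc: "B x \<in> carrier_mat n n" if "x \<in> D" for x unfolding B_def by (intro A_carrier one_closed b that)
  have BB: "B x * mat_adjoint (B y) = 0\<^sub>m n n" if "x \<in> D" "y \<in> D" "x \<noteq> y" for x y
  proof -
    have "mat_adjoint (B y) = B y" unfolding B_def using A_star[OF one_closed b(1)[OF that(2)]] by simp
    then have "B x * mat_adjoint (B y) = A \<one> (\<lambda>z. complex_of_real (b x z) * complex_of_real (b y z))"
      unfolding B_def using A_mult[OF one_closed one_closed b(1)[OF that(1)] b(1)[OF that(2)]] by simp
    also have "(\<lambda>z. complex_of_real (b x z) * complex_of_real (b y z)) = (\<lambda>z. 0 * complex_of_real (b x z))"
      using U(3)[OF that] b(3) that by fastforce
    also have "A \<one> (\<lambda>z. 0 * complex_of_real (b x z)) = 0\<^sub>m n n"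
      unfolding A_scale[OF one_closed b(1)[OF that(1)]] using Bc[OF that(1)] by (auto simp: B_def intro!: eq_matI)
    finally show ?thesis .
  qed
  have "\<exists>i<n. \<exists>j<n. B x $$ (i, j) \<noteq> 0" if x: "x \<in> D" for x
  proof (rule ccontr)
    assume "\<not> ?thesis"
    then have "B x = 0\<^sub>m n n" using Bc[OF x] by (intro eq_matI) auto
    then have nul: "(\<lambda>y. complex_of_real (b x y)) \<in> null_ideal" using b(1)[OF x] by (simp add: null_ideal_def B_def)
    have "f x = 0" if "f \<in> null_ideal" for f using D(1) x that by (auto simp: zero_set_def)
    from this[OF nul] have "complex_of_real (b x x) = 0" .
    then show False using b(2)[OF x] by simp
  qed
  then obtain r where r: "\<And>x. x \<in> D \<Longrightarrow> r x < n" "\<And>x. x \<in> D \<Longrightarrow> \<exists>j<n. B x $$ (r x, j) \<noteq> 0" by metis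
  define N where "N = (\<lambda>x. sqrt (\<Sum>j<n. (cmod (B x $$ (r x, j)))\<^sup>2))"
  define w where "w = (\<lambda>x j. B x $$ (r x, j) / of_real (N x))"
  have Nsq: "(N x)\<^sup>2 = (\<Sum>j<n. (cmod (B x $$ (r x, j)))\<^sup>2)" for x by (simp add: N_def sum_nonneg)
  have Npos: "N x \<noteq> 0" if x: "x \<in> D" for x
  proof
    assume "N x = 0"
    then have "(\<Sum>j<n. (cmod (B x $$ (r x, j)))\<^sup>2) = 0" using Nsq[of x] by simp
    then show False using r(2)[OF x] by (subst (asm) sum_nonneg_eq_0_iff) auto
  qed
  have "card D \<le> n"
  proof (rule card_orthonormal_le[OF D(2)])
    fix x y assume xy: "x \<in> D" "y \<in> D"
    have e: "(\<Sum>k<n. w x k * cnj (w y k)) = (\<Sum>k<n. B x $$ (r x, k) * cnj (B y $$ (r y, k))) / (of_real (N x) * of_real (N y))"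
      by (simp add: w_def sum_divide_distrib)
    show "(\<Sum>k<n. w x k * cnj (w y k)) = (if x = y then 1 else 0)"
    proof (cases "x = y")
      case True
      have "(\<Sum>k<n. B x $$ (r x, k) * cnj (B x $$ (r x, k))) = of_real ((N x)\<^sup>2)"
        unfolding Nsq of_real_sum complex_norm_square ..
      then show ?thesis using e True Npos[OF xy(1)] by (simp add: power2_eq_square)
    next
      case False
      have "(\<Sum>k<n. B x $$ (r x, k) * cnj (B y $$ (r y, k))) = (B x * mat_adjoint (B y)) $$ (r x, r y)"
        using r(1) xy by (subst mat_mult_index[OF Bc[OF xy(1)] mat_adjoint_carrier[OF Bc[OF xy(2)]]])
          (auto simp: mat_adjoint_index[OF Bc[OF xy(2)]])
      also have "\<dots> = 0" using BB[OF xy False] r(1) xy by simp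
      finally show ?thesis using e False by simp
    qed
  qed
  then show False using D(3) by simp
qed

text \<open>The image of such a function is the unit of the image of \<open>C0\<close>.\<close>

lemma zero_set_unit:
  obtains e where "e \<in> C0" "\<And>x. cnj (e x) = e x" "\<And>x. x \<in> zero_set \<Longrightarrow> e x = 1"
proof -
  have "\<exists>b::'x \<Rightarrow> real. continuous_on UNIV b \<and> b x = 1 \<and> (\<exists>K. compact K \<and> (\<forall>y. y \<notin> K \<longrightarrow> b y = 0))" for x
    using bump_function[OF locally_compact, of UNIV x] by (metis UNIV_I open_UNIV)
  then obtain b :: "'x \<Rightarrow> 'x \<Rightarrow> real" and K where b: "\<And>x. continuous_on UNIV (b x)" "\<And>x. b x x = 1"
    "\<And>x. compact (K x)" "\<And>x y. y \<notin> K x \<Longrightarrow> b x y = 0" by metis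
  define e where "e = (\<lambda>y. complex_of_real (1 - (\<Prod>x\<in>zero_set. (1 - b x y))))"
  show ?thesis
  proof (rule that[of e])
    show "e \<in> C0"
    proof (rule C0_compact_support)
      show "continuous_on UNIV e" unfolding e_def using b(1) by (intro continuous_intros)
      show "compact (\<Union>x\<in>zero_set. K x)" using finite_zero_set b(3) by (intro compact_UN)
      show "e y = 0" if "y \<notin> (\<Union>x\<in>zero_set. K x)" for y
        using that b(4) by (auto simp: e_def intro!: prod.neutral)
    qed
    show "e x = 1" if "x \<in> zero_set" for x
      using finite_zero_set that b(2) by (auto simp: e_def intro!: prod_zero bexI[of _ x])
  qed (simp add: e_def)
qed

lemma A_eq_if_agree:
  assumes g: "g \<in> carrier G" and f: "f \<in> C0" "k \<in> C0" and agree: "\<And>x. x \<in> zero_set \<Longrightarrow> f x = k x"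
  shows "A g f = A g k"
  by (intro A_diff_eq g f A_zero_if_null null_ideal_if_vanishes C0_diff) (simp add: agree)

text \<open>For \<open>e\<close> equal to \<open>1\<close> on the zero set, the matrices \<open>A g e\<close> are unitary on the range of the projection
  \<open>A \<one> e\<close>; on its complement the group is made to act trivially. The representation remembers \<open>\<phi>\<close> because
  \<open>A g f = A \<one> f * A g e\<close>.\<close>

lemma fd_unitary_rep_of_fd_rep:
  obtains \<rho> where "fd_unitary_rep G n \<rho>"
    "\<And>g h f. g \<in> carrier G \<Longrightarrow> h \<in> carrier G \<Longrightarrow> f \<in> C0 \<Longrightarrow> \<rho> g = \<rho> h \<Longrightarrow> A g f = A h f"
proof -
  obtain e where e: "e \<in> C0" "\<And>x. cnj (e x) = e x" "\<And>x. x \<in> zero_set \<Longrightarrow> e x = 1" using zero_set_unit by blast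
  define E where "E = (\<lambda>g. A g e)"
  have Ec: "E g \<in> carrier_mat n n" if "g \<in> carrier G" for g unfolding E_def by (intro A_carrier that e)
  have act_e: "act_fun G \<alpha> g e x = 1" if "g \<in> carrier G" "x \<in> zero_set" for g x
    using zero_set_invariant[of "inv g" x] that e(3) by (simp add: act_fun_def)
  have AE: "A g f * E h = A (g \<otimes> h) f" if "g \<in> carrier G" "h \<in> carrier G" "f \<in> C0" for g h f
    unfolding E_def A_mult[OF that(1,2,3) e(1)]
    using that act_e by (intro A_eq_if_agree C0_mult act_fun_C0 e) auto
  have EE: "E g * E h = E (g \<otimes> h)" if "g \<in> carrier G" "h \<in> carrier G" for g h
    using AE[OF that e(1)] by (simp add: E_def)
  have Es: "mat_adjoint (E g) = E (inv g)" if "g \<in> carrier G" for g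
    unfolding E_def A_star[OF that e(1)] e(2)
    using that act_e e(3) by (intro A_eq_if_agree act_fun_C0 e) auto
  define Q where "Q = 1\<^sub>m n - E \<one>"
  have Qc: "Q \<in> carrier_mat n n" unfolding Q_def by (rule minus_carrier_mat[OF Ec[OF one_closed]])
  have EQ: "E g * Q = 0\<^sub>m n n" and QE: "Q * E g = 0\<^sub>m n n" if g: "g \<in> carrier G" for g
  proof -
    have "E g * Q = E g * 1\<^sub>m n - E g * E \<one>"
      unfolding Q_def by (rule mult_minus_distrib_mat[OF Ec[OF g] one_carrier_mat Ec[OF one_closed]])
    then show "E g * Q = 0\<^sub>m n n" using EE[OF g one_closed] Ec[OF g] g by simp
    have "Q * E g = 1\<^sub>m n * E g - E \<one> * E g"
      unfolding Q_def by (rule minus_mult_distrib_mat[OF one_carrier_mat Ec[OF one_closed] Ec[OF g]])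
    then show "Q * E g = 0\<^sub>m n n" using EE[OF one_closed g] Ec[OF g] g by simp
  qed
  have QQ: "Q * Q = Q"
  proof -
    have "Q * Q = 1\<^sub>m n * Q - E \<one> * Q"
      by (subst (1) Q_def) (rule minus_mult_distrib_mat[OF one_carrier_mat Ec[OF one_closed] Qc])
    then show ?thesis using EQ[OF one_closed] Qc by (auto intro!: eq_matI)
  qed
  have adj: "mat_adjoint (E g + Q) = E (inv g) + Q" if g: "g \<in> carrier G" for g
  proof (rule eq_matI)
    fix i j assume "i < dim_row (E (inv g) + Q)" "j < dim_col (E (inv g) + Q)"
    then have ij: "i < n" "j < n" using Qc by auto
    have "cnj (E g $$ (j, i)) = E (inv g) $$ (i, j)" "cnj (E \<one> $$ (j, i)) = E \<one> $$ (i, j)"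
      using mat_adjoint_index[OF Ec ij] Es g by (metis, metis inv_one one_closed)
    then show "mat_adjoint (E g + Q) $$ (i, j) = (E (inv g) + Q) $$ (i, j)"
      using ij Qc Ec[OF g] Ec[OF one_closed] by (subst mat_adjoint_index[of _ n]) (auto simp: Q_def)
  qed (use Qc mat_adjoint_carrier[of "E g + Q" n] in auto)
  have mul: "(E g + Q) * (E h + Q) = E (g \<otimes> h) + Q" if g: "g \<in> carrier G" and h: "h \<in> carrier G" for g h
  proof -
    have "(E g + Q) * (E h + Q) = E g * (E h + Q) + Q * (E h + Q)"
      using Ec[OF g] Ec[OF h] Qc by (intro add_mult_distrib_mat) auto
    also have "E g * (E h + Q) = E g * E h + E g * Q"
      using Ec[OF g] Ec[OF h] Qc by (intro mult_add_distrib_mat) auto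
    also have "Q * (E h + Q) = Q * E h + Q * Q"
      using Ec[OF g] Ec[OF h] Qc by (intro mult_add_distrib_mat) auto
    finally show ?thesis using EE[OF g h] EQ[OF g] QE[OF h] QQ Ec[of "g \<otimes> h"] Qc g h by simp
  qed
  have one: "E \<one> + Q = 1\<^sub>m n"
    unfolding Q_def using Ec[OF one_closed] by (intro eq_matI) auto
  show ?thesis
  proof (rule that[of "\<lambda>g. E g + Q"])
    show "fd_unitary_rep G n (\<lambda>g. E g + Q)"
      unfolding fd_unitary_rep_def unitary_mats_def
    proof (intro conjI ballI CollectI)
      fix g assume g: "g \<in> carrier G"
      show "E g + Q \<in> carrier_mat n n" using Qc by simp
      show "(E g + Q) * mat_adjoint (E g + Q) = 1\<^sub>m n" "mat_adjoint (E g + Q) * (E g + Q) = 1\<^sub>m n"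
        using adj[OF g] mul[of g "inv g"] mul[of "inv g" g] g one by auto
      show "E (g \<otimes> h) + Q = (E g + Q) * (E h + Q)" if "h \<in> carrier G" for h using mul[OF g that] by simp
    qed
    fix g h and f :: "'x \<Rightarrow> complex"
    assume g: "g \<in> carrier G" and h: "h \<in> carrier G" and f: "f \<in> C0" and eq: "E g + Q = E h + Q"
    have "E g = E h"
    proof (rule eq_matI)
      fix i j assume "i < dim_row (E h)" "j < dim_col (E h)"
      then have ij: "i < n" "j < n" using Ec[OF h] by auto
      have "(E g + Q) $$ (i, j) = (E h + Q) $$ (i, j)" using eq by simp
      then show "E g $$ (i, j) = E h $$ (i, j)" using ij Qc by simp
    qed (use Ec[OF g] Ec[OF h] in auto)
    then show "A g f = A h f" using AE[OF one_closed g f] AE[OF one_closed h f] g h by simp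
  qed
qed

end

context dynamical_system
begin

lemma RFD_separates:
  assumes "RFD (full_crossed_product G \<alpha>)" "a \<in> cpc" "b \<in> cpc" "a \<noteq> b"
  obtains n \<phi> where "fd_star_rep cp n \<phi>" "\<phi> a \<noteq> \<phi> b"
  using pre_normed_star_algebra.RFD_completion_imp_separated[OF pre_normed_star_algebra_cp _ assms(2,3) cp_dist_pos[OF assms(2,3,4)]]
    assms(1) unfolding full_crossed_product_def by blast

lemma compact_bump:
  assumes "open U" "x \<in> U"
  obtains f :: "'x \<Rightarrow> complex" and K where "f \<in> C0" "continuous_on UNIV f" "f x = 1" "compact K" "K \<subseteq> U" "\<And>y. y \<notin> K \<Longrightarrow> f y = 0"
proof -
  obtain f :: "'x \<Rightarrow> real" and K where f: "continuous_on UNIV f" "f x = 1" "compact K" "K \<subseteq> U" "\<And>y. y \<notin> K \<Longrightarrow> f y = 0"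
    using bump_function[OF locally_compact assms] by metis
  have c: "continuous_on UNIV (\<lambda>y. complex_of_real (f y))" using f(1) by (intro continuous_intros)
  show ?thesis
    by (rule that[of "\<lambda>y. complex_of_real (f y)" K]) (use f c C0_compact_support[OF c f(3)] in auto)
qed

theorem RFD_imp_MAP:
  assumes "RFD (full_crossed_product G \<alpha>)"
  shows "MAP G"
  unfolding MAP_def
proof (intro ballI impI)
  fix g h assume g: "g \<in> carrier G" and h: "h \<in> carrier G" and ne: "g \<noteq> h"
  obtain f :: "'x \<Rightarrow> complex" and x where f: "f \<in> C0" "f x = 1" using compact_bump[of UNIV] by (metis UNIV_I open_UNIV)
  have "single g f \<noteq> single h f"
  proof
    assume "single g f = single h f"
    then have "single g f g x = single h f g x" by simp
    then show False using ne f(2) by (simp add: single_def)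
  qed
  then obtain n \<phi> where \<phi>: "fd_star_rep cp n \<phi>" "\<phi> (single g f) \<noteq> \<phi> (single h f)"
    using RFD_separates[OF assms single_closed[OF g f(1)] single_closed[OF h f(1)]] by blast
  interpret fd_crossed_product_rep G \<alpha> \<phi> n by unfold_locales (rule \<phi>(1))
  obtain \<rho> where "fd_unitary_rep G n \<rho>"
    "\<And>g h f. g \<in> carrier G \<Longrightarrow> h \<in> carrier G \<Longrightarrow> f \<in> C0 \<Longrightarrow> \<rho> g = \<rho> h \<Longrightarrow> A g f = A h f"
    using fd_unitary_rep_of_fd_rep by blast
  then show "\<exists>n \<rho>. fd_unitary_rep G n \<rho> \<and> \<rho> g \<noteq> \<rho> h" using \<phi>(2) g h f(1) by metis
qed

text \<open>A bump supported off the closure of the finite orbits would be killed by every finite-dimensional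
  representation, since its support misses their zero sets, which consist of points of finite orbits.\<close>

theorem RFD_imp_dense_finite_orbits:
  assumes "RFD (full_crossed_product G \<alpha>)"
  shows "closure (\<Union>{S \<in> orbits G UNIV \<alpha>. finite S}) = UNIV"
proof (rule ccontr)
  let ?W = "\<Union>{S \<in> orbits G UNIV \<alpha>. finite S}"
  assume "closure ?W \<noteq> UNIV"
  then obtain x where x: "x \<in> - closure ?W" by blast
  have op: "open (- closure ?W)" by (rule open_Compl[OF closed_closure])
  obtain f :: "'x \<Rightarrow> complex" and K where f: "f \<in> C0" "continuous_on UNIV f" "f x = 1" "compact K" "K \<subseteq> - closure ?W" "\<And>y. y \<notin> K \<Longrightarrow> f y = 0"
    using compact_bump[OF op x] by blast
  have "single \<one> f \<noteq> single \<one> (\<lambda>x. 0)" using f(3) by (auto simp: single_def fun_eq_iff intro!: exI[of _ x])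
  then obtain n \<phi> where \<phi>: "fd_star_rep cp n \<phi>" "\<phi> (single \<one> f) \<noteq> \<phi> (single \<one> (\<lambda>x. 0))"
    using RFD_separates[OF assms single_closed[OF one_closed f(1)] single_closed[OF one_closed C0_zero]] by blast
  interpret fd_crossed_product_rep G \<alpha> \<phi> n by unfold_locales (rule \<phi>(1))
  have "K \<inter> zero_set \<noteq> {}"
  proof
    assume "K \<inter> zero_set = {}"
    then have "f \<in> null_ideal" using null_ideal_compact_support[OF f(2,4,6)] by blast
    moreover have "(\<lambda>x. 0) \<in> null_ideal" using null_ideal_sum[of "{}"] by simp
    ultimately show False using \<phi>(2) null_idealD(2) by simp
  qed
  then obtain y where y: "y \<in> K" "y \<in> zero_set" by blast
  note o = orbit_finite_invariant[OF finite_zero_set y(2) zero_set_invariant]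
  have "y \<in> ?W" by (rule UnionI[OF o])
  then have "y \<in> closure ?W" by (rule subsetD[OF closure_subset])
  then show False using subsetD[OF f(5) y(1)] by simp
qed

end

section \<open>Approximately invariant probability measures and amenability\<close>

lemma ProbD:
  assumes "p \<in> Prob G"
  shows "s \<in> carrier G \<Longrightarrow> 0 \<le> p s" "s \<notin> carrier G \<Longrightarrow> p s = 0" "p summable_on carrier G" "infsum p (carrier G) = 1"
  using assms by (auto simp: Prob_def has_sum_iff)

lemma Prob_mult_summable:
  assumes p: "p \<in> Prob G" and f: "\<And>s. s \<in> carrier G \<Longrightarrow> \<bar>f s\<bar> \<le> b"
  shows "(\<lambda>s. p s * f s) summable_on carrier G" "\<bar>\<Sum>\<^sub>\<infinity>s\<in>carrier G. p s * f s\<bar> \<le> b"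
proof -
  have le: "norm (p s * f s) \<le> b * p s" if "s \<in> carrier G" for s
    using mult_left_mono[OF f[OF that] ProbD(1)[OF p that]] ProbD(1)[OF p that] by (simp add: abs_mult mult.commute)
  have b: "(\<lambda>s. b * p s) summable_on carrier G" using ProbD(3)[OF p] by (rule summable_on_cmult_right)
  have a: "(\<lambda>s. norm (p s * f s)) summable_on carrier G"
    by (rule summable_on_comparison_test[OF b]) (use le in auto)
  show "(\<lambda>s. p s * f s) summable_on carrier G" by (rule abs_summable_summable[OF a])
  have "\<bar>\<Sum>\<^sub>\<infinity>s\<in>carrier G. p s * f s\<bar> \<le> (\<Sum>\<^sub>\<infinity>s\<in>carrier G. norm (p s * f s))"
    using norm_infsum_bound[OF a] by simp
  also have "\<dots> \<le> (\<Sum>\<^sub>\<infinity>s\<in>carrier G. b * p s)" using a b le by (rule infsum_mono)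
  also have "\<dots> = b" using ProbD(4)[OF p] by (simp add: infsum_cmult_right')
  finally show "\<bar>\<Sum>\<^sub>\<infinity>s\<in>carrier G. p s * f s\<bar> \<le> b" .
qed

lemma Prob_dist_summable:
  assumes "p \<in> Prob G" "q \<in> Prob G"
  shows "(\<lambda>s. \<bar>p s - q s\<bar>) summable_on carrier G"
proof (rule summable_on_comparison_test)
  show "(\<lambda>s. p s + q s) summable_on carrier G" using assms ProbD(3) by (intro summable_on_add) auto
  show "\<bar>p s - q s\<bar> \<le> p s + q s" if "s \<in> carrier G" for s
    using ProbD(1)[OF assms(1) that] ProbD(1)[OF assms(2) that] by simp
qed simp

lemma ell1_dist_nonneg: "0 \<le> ell1_dist G p q"
  unfolding ell1_dist_def by (intro infsum_nonneg) auto

lemma ell1_dist_finite_sum: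
  assumes "p \<in> Prob G" "q \<in> Prob G" "finite L" "L \<subseteq> carrier G"
  shows "(\<Sum>s\<in>L. \<bar>p s - q s\<bar>) \<le> ell1_dist G p q"
  unfolding ell1_dist_def using Prob_dist_summable[OF assms(1,2)] assms(3,4) by (intro finite_sum_le_infsum) auto

context group
begin

lemma inv_mult_bij:
  assumes "g \<in> carrier G"
  shows "bij_betw (\<lambda>s. inv g \<otimes> s) (carrier G) (carrier G)"
  by (rule bij_betw_byWitness[where f'="\<lambda>s. g \<otimes> s"]) (use assms in \<open>auto simp flip: m_assoc\<close>)

lemma translate_eq: "s \<in> carrier G \<Longrightarrow> translate G g p s = p (inv g \<otimes> s)"
  by (simp add: translate_def)

lemma translate_Prob:
  assumes g: "g \<in> carrier G" and p: "p \<in> Prob G"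
  shows "translate G g p \<in> Prob G"
  unfolding Prob_def
proof (intro CollectI conjI ballI allI impI)
  have "(p has_sum 1) (carrier G)" using p by (simp add: Prob_def)
  then have "((\<lambda>s. p (inv g \<otimes> s)) has_sum 1) (carrier G)"
    using has_sum_reindex_bij_betw[OF inv_mult_bij[OF g], of p 1] by simp
  then show "(translate G g p has_sum 1) (carrier G)"
    by (rule has_sum_cong[THEN iffD1, rotated]) (simp add: translate_def)
qed (use ProbD(1)[OF p] g in \<open>auto simp: translate_def\<close>)

text \<open>An invariant mean is a cluster point of the functionals \<open>f \<mapsto> \<Sum>\<^sub>s p(s) f(s)\<close> in a product of compact
  intervals.\<close>

lemma amenable_groupI:
  assumes F: "F \<noteq> bot" and Prob: "\<forall>\<^sub>F p in F. p \<in> Prob G"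
    and inv: "\<And>g. g \<in> carrier G \<Longrightarrow> ((\<lambda>p. ell1_dist G (translate G g p) p) \<longlongrightarrow> 0) F"
  shows "amenable_group G"
proof -
  define B where "B = {f :: 'a \<Rightarrow> real. bounded (f ` carrier G)}"
  have "\<exists>b. f \<in> B \<longrightarrow> (\<forall>s\<in>carrier G. \<bar>f s\<bar> \<le> b)" for f by (auto simp: B_def bounded_iff)
  then obtain b where b: "\<And>f s. f \<in> B \<Longrightarrow> s \<in> carrier G \<Longrightarrow> \<bar>f s\<bar> \<le> b f" by metis
  have PS: "(\<lambda>s. p s * f s) summable_on carrier G" and PB: "\<bar>\<Sum>\<^sub>\<infinity>s\<in>carrier G. p s * f s\<bar> \<le> b f"
    if "p \<in> Prob G" "f \<in> B" for p f
    using Prob_mult_summable[OF that(1), of f "b f"] b[OF that(2)] by auto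
  have BI: "f \<in> B" if "\<And>s. s \<in> carrier G \<Longrightarrow> \<bar>f s\<bar> \<le> c" for f c
    using that unfolding B_def bounded_iff by auto
  define I where "I = (\<lambda>p f. if f \<in> B then \<Sum>\<^sub>\<infinity>s\<in>carrier G. p s * f s else (0::real))"
  define U where "U = PiE UNIV (\<lambda>f. {- \<bar>b f\<bar>..\<bar>b f\<bar>})"
  have "compactin (product_topology (\<lambda>f. euclidean) UNIV) U"
    unfolding U_def compactin_PiE by auto
  then have U: "compact U" by (simp add: euclidean_product_topology)
  have IU: "I p \<in> U" if p: "p \<in> Prob G" for p
  proof -
    have "\<bar>I p f\<bar> \<le> \<bar>b f\<bar>" for f
    proof (cases "f \<in> B")
      case True
      then show ?thesis using PB[OF p True] by (simp add: I_def)
    qed (simp add: I_def)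
    then show ?thesis by (auto simp: U_def abs_le_iff) (metis abs_le_iff minus_le_iff)+
  qed
  have "filtermap I F \<noteq> bot" using F by (simp add: filtermap_bot_iff)
  moreover have "\<forall>\<^sub>F \<nu> in filtermap I F. \<nu> \<in> U"
    using Prob IU by (simp add: eventually_filtermap eventually_mono)
  ultimately obtain \<mu> where \<mu>: "inf (nhds \<mu>) (filtermap I F) \<noteq> bot"
    using U unfolding compact_filter by blast
  define L where "L = inf (nhds \<mu>) (filtermap I F)"
  have lim: "((\<lambda>\<nu>. \<nu> f) \<longlongrightarrow> \<mu> f) L" for f
  proof -
    have "continuous_on UNIV (\<lambda>\<nu> :: ('a \<Rightarrow> real) \<Rightarrow> real. \<nu> f)" by simp
    note c = this
    have "((\<lambda>\<nu>. \<nu> f) \<longlongrightarrow> \<mu> f) (nhds \<mu>)"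
    proof (rule topological_tendstoI)
      fix S :: "real set" assume "open S" "\<mu> f \<in> S"
      then have "open ((\<lambda>\<nu>. \<nu> f) -` S)" "\<mu> \<in> (\<lambda>\<nu>. \<nu> f) -` S"
        using open_vimage[OF _ c] by auto
      then show "\<forall>\<^sub>F \<nu> in nhds \<mu>. \<nu> f \<in> S" unfolding eventually_nhds by blast
    qed
    then show ?thesis unfolding L_def by (rule tendsto_mono[rotated]) simp
  qed
  have ev: "\<forall>\<^sub>F \<nu> in L. P \<nu>" if "\<And>p. p \<in> Prob G \<Longrightarrow> P (I p)" for P
  proof -
    have "\<forall>\<^sub>F \<nu> in filtermap I F. P \<nu>" using Prob that by (simp add: eventually_filtermap eventually_mono)
    then show ?thesis unfolding L_def by (rule filter_leD[rotated]) simp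
  qed
  have eqI: "t = 0" if "(h \<longlongrightarrow> t) L" "\<And>p. p \<in> Prob G \<Longrightarrow> h (I p) = 0" for h and t :: real
  proof -
    have "(h \<longlongrightarrow> 0) L" using ev[of "\<lambda>\<nu>. h \<nu> = 0"] that(2) by (simp add: tendsto_eventually)
    then show ?thesis using tendsto_unique[OF _ that(1)] \<mu> unfolding L_def by blast
  qed
  have add: "\<mu> (\<lambda>s. f s + f' s) = \<mu> f + \<mu> f'" if f: "f \<in> B" "f' \<in> B" for f f'
  proof -
    have ff: "(\<lambda>s. f s + f' s) \<in> B"
      using b[OF f(1)] b[OF f(2)] by (intro BI[of _ "b f + b f'"]) (smt (verit) abs_triangle_ineq)
    have "\<mu> (\<lambda>s. f s + f' s) - (\<mu> f + \<mu> f') = 0"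
    proof (rule eqI)
      show "((\<lambda>\<nu>. \<nu> (\<lambda>s. f s + f' s) - (\<nu> f + \<nu> f')) \<longlongrightarrow> \<mu> (\<lambda>s. f s + f' s) - (\<mu> f + \<mu> f')) L"
        by (intro tendsto_intros lim)
      show "I p (\<lambda>s. f s + f' s) - (I p f + I p f') = 0" if "p \<in> Prob G" for p
        using infsum_add[OF PS[OF that f(1)] PS[OF that f(2)]] f ff
        by (simp add: I_def distrib_left)
    qed
    then show ?thesis by simp
  qed
  have scale: "\<mu> (\<lambda>s. c * f s) = c * \<mu> f" if f: "f \<in> B" for c f
  proof -
    have ff: "(\<lambda>s. c * f s) \<in> B"
      using b[OF f] by (intro BI[of _ "\<bar>c\<bar> * b f"]) (auto simp: abs_mult intro!: mult_left_mono)
    have "\<mu> (\<lambda>s. c * f s) - c * \<mu> f = 0"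
    proof (rule eqI)
      show "((\<lambda>\<nu>. \<nu> (\<lambda>s. c * f s) - c * \<nu> f) \<longlongrightarrow> \<mu> (\<lambda>s. c * f s) - c * \<mu> f) L"
        by (intro tendsto_intros lim)
      show "I p (\<lambda>s. c * f s) - c * I p f = 0" if "p \<in> Prob G" for p
        using infsum_cmult_right'[of c "\<lambda>s. p s * f s" "carrier G"] f ff by (simp add: I_def mult_ac)
    qed
    then show ?thesis by simp
  qed
  have pos: "0 \<le> \<mu> f" if f: "f \<in> B" "\<And>s. s \<in> carrier G \<Longrightarrow> 0 \<le> f s" for f
  proof (rule tendsto_lowerbound[OF lim])
    show "\<forall>\<^sub>F \<nu> in L. 0 \<le> \<nu> f"
    proof (rule ev)
      show "0 \<le> I p f" if "p \<in> Prob G" for p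
        using f ProbD(1)[OF that] by (auto simp: I_def intro!: infsum_nonneg)
    qed
    show "L \<noteq> bot" using \<mu> by (simp add: L_def)
  qed
  have one: "\<mu> (\<lambda>s. 1) = 1"
  proof -
    have o: "(\<lambda>s. 1) \<in> B" by (rule BI[of _ 1]) simp
    have "\<mu> (\<lambda>s. 1) - 1 = 0"
    proof (rule eqI)
      show "((\<lambda>\<nu>. \<nu> (\<lambda>s. 1) - 1) \<longlongrightarrow> \<mu> (\<lambda>s. 1) - 1) L" by (intro tendsto_intros lim)
      show "I p (\<lambda>s. 1) - 1 = 0" if "p \<in> Prob G" for p using ProbD(4)[OF that] o by (simp add: I_def)
    qed
    then show ?thesis by simp
  qed
  have inv: "\<mu> (\<lambda>s. f (inv g \<otimes> s)) = \<mu> f" if g: "g \<in> carrier G" and f: "f \<in> B" for g f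
  proof -
    have ff: "(\<lambda>s. f (inv g \<otimes> s)) \<in> B" using b[OF f] g by (intro BI[of _ "b f"]) auto
    have bd: "\<bar>I p (\<lambda>s. f (inv g \<otimes> s)) - I p f\<bar> \<le> \<bar>b f\<bar> * ell1_dist G (translate G (inv g) p) p" if p: "p \<in> Prob G" for p
    proof -
      let ?q = "translate G (inv g) p"
      have q: "?q \<in> Prob G" using g p by (intro translate_Prob) auto
      have "I p (\<lambda>s. f (inv g \<otimes> s)) = (\<Sum>\<^sub>\<infinity>s\<in>carrier G. ?q (inv g \<otimes> s) * f (inv g \<otimes> s))"
        using ff g by (simp add: I_def) (intro infsum_cong, simp add: translate_def flip: m_assoc)
      also have "\<dots> = (\<Sum>\<^sub>\<infinity>s\<in>carrier G. ?q s * f s)"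
        by (rule infsum_reindex_bij_betw[OF inv_mult_bij[OF g], of "\<lambda>s. ?q s * f s"])
      finally have "I p (\<lambda>s. f (inv g \<otimes> s)) - I p f = (\<Sum>\<^sub>\<infinity>s\<in>carrier G. ?q s * f s) - (\<Sum>\<^sub>\<infinity>s\<in>carrier G. p s * f s)"
        using f by (simp add: I_def)
      also have "\<dots> = (\<Sum>\<^sub>\<infinity>s\<in>carrier G. ?q s * f s + (- (p s * f s)))"
        using PS[OF q f] summable_on_cmult_right[OF PS[OF p f], of "-1"]
        by (subst infsum_add) (auto simp: infsum_uminus)
      also have "\<dots> = (\<Sum>\<^sub>\<infinity>s\<in>carrier G. (?q s - p s) * f s)" by (simp add: left_diff_distrib)
      finally have e: "I p (\<lambda>s. f (inv g \<otimes> s)) - I p f = (\<Sum>\<^sub>\<infinity>s\<in>carrier G. (?q s - p s) * f s)" .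
      have S: "(\<lambda>s. \<bar>b f\<bar> * \<bar>?q s - p s\<bar>) summable_on carrier G"
        using Prob_dist_summable[OF q p] by (rule summable_on_cmult_right)
      have le: "norm ((?q s - p s) * f s) \<le> \<bar>b f\<bar> * \<bar>?q s - p s\<bar>" if "s \<in> carrier G" for s
      proof -
        have "\<bar>f s\<bar> \<le> \<bar>b f\<bar>" using b[OF f that] by linarith
        from mult_right_mono[OF this abs_ge_zero[of "?q s - p s"]] show ?thesis
          by (simp only: real_norm_def abs_mult mult.commute[of "\<bar>?q s - p s\<bar>"])
      qed
      have S2: "(\<lambda>s. norm ((?q s - p s) * f s)) summable_on carrier G"
        by (rule summable_on_comparison_test[OF S]) (use le in auto)
      have "\<bar>\<Sum>\<^sub>\<infinity>s\<in>carrier G. (?q s - p s) * f s\<bar> \<le> (\<Sum>\<^sub>\<infinity>s\<in>carrier G. norm ((?q s - p s) * f s))"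
        using norm_infsum_bound[OF S2] by simp
      also have "\<dots> \<le> (\<Sum>\<^sub>\<infinity>s\<in>carrier G. \<bar>b f\<bar> * \<bar>?q s - p s\<bar>)" using S2 S le by (rule infsum_mono)
      also have "\<dots> = \<bar>b f\<bar> * ell1_dist G ?q p" by (simp add: ell1_dist_def infsum_cmult_right')
      finally show ?thesis unfolding e .
    qed
    have "((\<lambda>p. \<bar>b f\<bar> * ell1_dist G (translate G (inv g) p) p) \<longlongrightarrow> 0) F"
      using tendsto_mult_right_zero[OF assms(3)[of "inv g"]] g by simp
    then have "((\<lambda>p. I p (\<lambda>s. f (inv g \<otimes> s)) - I p f) \<longlongrightarrow> 0) F"
      by (rule Lim_null_comparison[rotated]) (use bd Prob in \<open>auto elim: eventually_mono\<close>)
    then have "((\<lambda>\<nu>. \<nu> (\<lambda>s. f (inv g \<otimes> s)) - \<nu> f) \<longlongrightarrow> 0) (filtermap I F)"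
      by (simp add: filterlim_filtermap)
    then have "((\<lambda>\<nu>. \<nu> (\<lambda>s. f (inv g \<otimes> s)) - \<nu> f) \<longlongrightarrow> 0) L"
      unfolding L_def by (rule tendsto_mono[rotated]) simp
    moreover have "((\<lambda>\<nu>. \<nu> (\<lambda>s. f (inv g \<otimes> s)) - \<nu> f) \<longlongrightarrow> \<mu> (\<lambda>s. f (inv g \<otimes> s)) - \<mu> f) L"
      by (intro tendsto_intros lim)
    ultimately have "\<mu> (\<lambda>s. f (inv g \<otimes> s)) - \<mu> f = 0"
      using tendsto_unique \<mu> unfolding L_def by blast
    then show ?thesis by simp
  qed
  show ?thesis
    unfolding amenable_group_def Let_def B_def[symmetric]
    using add scale pos one inv by (intro exI[of _ \<mu>]) blast
qed

text \<open>The square roots of approximately invariant probability measures, cut off outside a large finite set, are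
  approximately invariant vectors in \<open>\<ell>\<^sup>2(G)\<close>; the key estimate is \<open>(a - b)\<^sup>2 \<le> |a\<^sup>2 - b\<^sup>2|\<close>.\<close>

lemma approximately_invariant_vectors:
  assumes approx: "\<And>S d. finite S \<Longrightarrow> S \<subseteq> carrier G \<Longrightarrow> d > 0 \<Longrightarrow>
      \<exists>p\<in>Prob G. \<forall>g\<in>S. ell1_dist G (translate G g p) p < d"
    and S: "finite S" "S \<subseteq> carrier G" and e: "e > 0"
  obtains K and w :: "'a \<Rightarrow> real" where "finite K" "K \<subseteq> carrier G" "\<And>s. s \<notin> K \<Longrightarrow> w s = 0"
    "(\<Sum>s\<in>K. (w s)\<^sup>2) \<le> 1"
    "\<And>g h. g \<in> S \<Longrightarrow> h \<in> S \<Longrightarrow>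
       \<bar>(\<Sum>k\<in>(\<lambda>(s, t). s \<otimes> t) ` (S \<times> K). w (inv g \<otimes> k) * w (inv h \<otimes> k)) - 1\<bar> \<le> e"
proof -
  (* the cut-off lowers the total mass W by at most d, and D below is at most 4 d, so that W - D/2 is within 3 d of 1 *)
  define d where "d = e / 3"
  have d: "d > 0" using e by (simp add: d_def)
  obtain p where p: "p \<in> Prob G" and pinv: "\<And>g. g \<in> S \<Longrightarrow> ell1_dist G (translate G g p) p < d"
    using approx[OF S d] by blast
  have p0: "0 \<le> p s" for s using ProbD(1,2)[OF p] by (cases "s \<in> carrier G") auto
  obtain K where K: "finite K" "K \<subseteq> carrier G" "dist (sum p K) (infsum p (carrier G)) \<le> d"
    using infsum_finite_approximation[OF ProbD(3)[OF p] d] by blast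
  define W where "W = sum p K"
  have W1: "1 - d \<le> W" using K(3) ProbD(4)[OF p] by (simp add: W_def dist_real_def)
  have W2: "W \<le> 1" unfolding W_def using ProbD[OF p] K p0 finite_sum_le_infsum[of p "carrier G" K] by simp
  have tail: "sum p T \<le> d" if T: "finite T" "T \<subseteq> carrier G" "T \<inter> K = {}" for T
  proof -
    have "sum p T + sum p K = sum p (T \<union> K)" using T K by (simp add: sum.union_disjoint)
    also have "\<dots> \<le> 1" using finite_sum_le_infsum[of p "carrier G" "T \<union> K"] ProbD[OF p] p0 T K by simp
    finally show ?thesis using W1 by (simp add: W_def)
  qed
  define w where "w = (\<lambda>s. if s \<in> K then sqrt (p s) else 0)"
  define L where "L = (\<lambda>(s, t). s \<otimes> t) ` (S \<times> K)"
  have L: "finite L" "L \<subseteq> carrier G" using S K by (auto simp: L_def)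
  have wsq: "(w s)\<^sup>2 = (if s \<in> K then p s else 0)" for s using p0 by (simp add: w_def)
  have w0: "0 \<le> w s" for s using p0 by (simp add: w_def)
  have reind: "inj_on (\<lambda>k. inv g \<otimes> k) L" if "g \<in> S" for g
    using bij_betw_imp_inj_on[OF inv_mult_bij] that S L by (meson inj_on_subset subsetD)
  have Wg: "(\<Sum>k\<in>L. (w (inv g \<otimes> k))\<^sup>2) = W" if g: "g \<in> S" for g
  proof -
    have gc: "g \<in> carrier G" using g S by auto
    have "(\<Sum>k\<in>L. (w (inv g \<otimes> k))\<^sup>2) = (\<Sum>s\<in>(\<lambda>k. inv g \<otimes> k) ` L. (w s)\<^sup>2)"
      using reind[OF g] by (simp add: sum.reindex)
    also have "\<dots> = (\<Sum>s\<in>K. (w s)\<^sup>2)"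
    proof (rule sum.mono_neutral_right)
      show "K \<subseteq> (\<lambda>k. inv g \<otimes> k) ` L"
      proof
        fix s assume s: "s \<in> K"
        then have "s = inv g \<otimes> (g \<otimes> s)" using gc K by (simp add: subsetD flip: m_assoc)
        moreover have "g \<otimes> s \<in> L" using g s by (auto simp: L_def)
        ultimately show "s \<in> (\<lambda>k. inv g \<otimes> k) ` L" by blast
      qed
    qed (use L wsq in auto)
    also have "\<dots> = W" unfolding W_def by (intro sum.cong) (auto simp: wsq)
    finally show ?thesis .
  qed
  have tailg: "(\<Sum>k\<in>L. if inv g \<otimes> k \<in> K then 0 else p (inv g \<otimes> k)) \<le> d" if g: "g \<in> S" for g
  proof -
    have gc: "g \<in> carrier G" using g S by auto
    have "(\<Sum>k\<in>L. if inv g \<otimes> k \<in> K then 0 else p (inv g \<otimes> k)) = (\<Sum>s\<in>(\<lambda>k. inv g \<otimes> k) ` L. if s \<in> K then 0 else p s)"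
      using reind[OF g] by (simp add: sum.reindex)
    also have "\<dots> = sum p ((\<lambda>k. inv g \<otimes> k) ` L - K)"
      using L by (intro sum.mono_neutral_cong_right) auto
    also have "\<dots> \<le> d" using L gc by (intro tail) auto
    finally show ?thesis .
  qed
  have main: "\<bar>(\<Sum>k\<in>L. w (inv g \<otimes> k) * w (inv h \<otimes> k)) - 1\<bar> \<le> e" if g: "g \<in> S" and h: "h \<in> S" for g h
  proof -
    have gc: "g \<in> carrier G" "h \<in> carrier G" using g h S by auto
    define D where "D = (\<Sum>k\<in>L. (w (inv g \<otimes> k) - w (inv h \<otimes> k))\<^sup>2)"
    define X where "X = (\<Sum>k\<in>L. w (inv g \<otimes> k) * w (inv h \<otimes> k))"
    have "D = (\<Sum>k\<in>L. (w (inv g \<otimes> k))\<^sup>2 + (w (inv h \<otimes> k))\<^sup>2 - 2 * (w (inv g \<otimes> k) * w (inv h \<otimes> k)))"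
      unfolding D_def by (intro sum.cong refl) (simp add: power2_diff)
    also have "\<dots> = W + W - 2 * X"
      unfolding X_def by (simp add: sum_subtractf sum.distrib Wg[OF g] Wg[OF h] sum_distrib_left)
    finally have DX: "D = 2 * W - 2 * X" by simp
    have D0: "0 \<le> D" unfolding D_def by (intro sum_nonneg) auto
    have sq: "(a - b)\<^sup>2 \<le> \<bar>a\<^sup>2 - b\<^sup>2\<bar>" if "0 \<le> a" "0 \<le> b" for a b :: real
    proof -
      have "(a - b)\<^sup>2 = \<bar>a - b\<bar> * \<bar>a - b\<bar>" by (simp add: power2_eq_square flip: abs_mult)
      also have "\<dots> \<le> \<bar>a - b\<bar> * (a + b)" using that by (intro mult_left_mono) auto
      also have "\<dots> = \<bar>(a - b) * (a + b)\<bar>" using that by (simp add: abs_mult)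
      also have "(a - b) * (a + b) = a\<^sup>2 - b\<^sup>2" by (simp add: power2_eq_square algebra_simps)
      finally show ?thesis .
    qed
    have "D \<le> (\<Sum>k\<in>L. \<bar>(w (inv g \<otimes> k))\<^sup>2 - (w (inv h \<otimes> k))\<^sup>2\<bar>)"
      unfolding D_def by (intro sum_mono sq w0)
    also have "\<dots> \<le> (\<Sum>k\<in>L. (\<bar>translate G g p k - p k\<bar> + \<bar>translate G h p k - p k\<bar>)
        + ((if inv g \<otimes> k \<in> K then 0 else p (inv g \<otimes> k)) + (if inv h \<otimes> k \<in> K then 0 else p (inv h \<otimes> k))))"
    proof (rule sum_mono)
      fix k assume "k \<in> L"
      then have k: "translate G g p k = p (inv g \<otimes> k)" "translate G h p k = p (inv h \<otimes> k)"
        using L by (auto simp: translate_eq)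
      show "\<bar>(w (inv g \<otimes> k))\<^sup>2 - (w (inv h \<otimes> k))\<^sup>2\<bar> \<le> (\<bar>translate G g p k - p k\<bar> + \<bar>translate G h p k - p k\<bar>)
        + ((if inv g \<otimes> k \<in> K then 0 else p (inv g \<otimes> k)) + (if inv h \<otimes> k \<in> K then 0 else p (inv h \<otimes> k)))"
        unfolding wsq k using p0[of "inv g \<otimes> k"] p0[of "inv h \<otimes> k"] by auto
    qed
    also have "\<dots> \<le> (d + d) + (d + d)"
      unfolding sum.distrib
      using ell1_dist_finite_sum[OF translate_Prob[OF gc(1) p] p L] ell1_dist_finite_sum[OF translate_Prob[OF gc(2) p] p L]
        pinv[OF g] pinv[OF h] tailg[OF g] tailg[OF h] by (intro add_mono) auto
    finally have "D \<le> 4 * d" by simp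
    then have "\<bar>X - 1\<bar> \<le> e" using DX D0 W1 W2 by (simp add: d_def)
    then show ?thesis by (simp add: X_def)
  qed
  show ?thesis
  proof (rule that[OF K(1,2), of w])
    have "(\<Sum>s\<in>K. (w s)\<^sup>2) = W" unfolding W_def by (intro sum.cong) (auto simp: wsq)
    then show "(\<Sum>s\<in>K. (w s)\<^sup>2) \<le> 1" using W2 by simp
  qed (use main in \<open>auto simp: w_def L_def\<close>)
qed

end

context dynamical_system
begin

definition orbit_average :: "'x set \<Rightarrow> ('x \<Rightarrow> 'g \<Rightarrow> real) \<Rightarrow> 'g \<Rightarrow> real" where
  "orbit_average S m = (\<lambda>s. (\<Sum>y\<in>S. m y s) / real (card S))"

lemma orbit_average_Prob:
  assumes S: "finite S" "S \<noteq> {}" and m: "\<And>y. y \<in> S \<Longrightarrow> m y \<in> Prob G"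
  shows "orbit_average S m \<in> Prob G"
  unfolding Prob_def
proof (intro CollectI conjI ballI allI impI)
  have "((\<lambda>s. \<Sum>y\<in>S. m y s) has_sum (\<Sum>y\<in>S. 1)) (carrier G)"
    using S(1) m
  proof (induction S rule: finite_induct)
    case (insert x F)
    then have "(m x has_sum 1) (carrier G)" "((\<lambda>s. \<Sum>y\<in>F. m y s) has_sum (\<Sum>y\<in>F. 1)) (carrier G)"
      by (auto simp: Prob_def)
    from has_sum_add[OF this] insert show ?case by simp
  qed simp
  then have "((\<lambda>s. (\<Sum>y\<in>S. m y s) * (1 / card S)) has_sum (real (card S) * (1 / card S))) (carrier G)"
    by (intro has_sum_cmult_left) simp
  then show "(orbit_average S m has_sum 1) (carrier G)" using S by (simp add: orbit_average_def)
qed (use ProbD[OF m] in \<open>auto simp: orbit_average_def intro!: divide_nonneg_nonneg sum_nonneg\<close>)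

text \<open>Translation by \<open>g\<close> permutes the orbit, so the errors of equivariance at its points add up.\<close>

lemma orbit_average_invariant:
  assumes S: "finite S" "S \<noteq> {}" and inv: "\<And>h y. h \<in> carrier G \<Longrightarrow> y \<in> S \<Longrightarrow> \<alpha> h y \<in> S"
    and m: "\<And>y. y \<in> S \<Longrightarrow> m y \<in> Prob G" and g: "g \<in> carrier G"
  shows "ell1_dist G (translate G g (orbit_average S m)) (orbit_average S m) \<le>
     (\<Sum>y\<in>S. ell1_dist G (translate G g (m y)) (m (\<alpha> g y)))"
proof -
  define N where "N = real (card S)"
  have N: "N \<ge> 1" using S by (simp add: N_def Suc_le_eq card_gt_0_iff)
  have bij: "bij_betw (\<alpha> g) S S"
    by (rule bij_betw_byWitness[where f'="\<alpha> (inv g)"]) (use g inv in auto)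
  have T: "translate G g (m y) \<in> Prob G" "m (\<alpha> g y) \<in> Prob G" if "y \<in> S" for y
    using translate_Prob g m inv that by auto
  have sumS: "((\<lambda>s. \<Sum>y\<in>S. \<bar>translate G g (m y) s - m (\<alpha> g y) s\<bar>) has_sum
       (\<Sum>y\<in>S. ell1_dist G (translate G g (m y)) (m (\<alpha> g y)))) (carrier G)"
    using S(1) Prob_dist_summable[OF T]
  proof (induction S rule: finite_induct)
    case (insert x F)
    then have "((\<lambda>s. \<bar>translate G g (m x) s - m (\<alpha> g x) s\<bar>) has_sum ell1_dist G (translate G g (m x)) (m (\<alpha> g x))) (carrier G)"
      by (simp add: ell1_dist_def)
    from has_sum_add[OF this insert.IH] insert show ?case by simp
  qed simp
  have le: "\<bar>translate G g (orbit_average S m) s - orbit_average S m s\<bar> \<le>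
      (\<Sum>y\<in>S. \<bar>translate G g (m y) s - m (\<alpha> g y) s\<bar>)" if s: "s \<in> carrier G" for s
  proof -
    have "orbit_average S m s = (\<Sum>y\<in>S. m (\<alpha> g y) s) / N"
      unfolding orbit_average_def N_def using sum.reindex_bij_betw[OF bij, of "\<lambda>y. m y s"] by simp
    moreover have "translate G g (orbit_average S m) s = (\<Sum>y\<in>S. translate G g (m y) s) / N"
      using s by (simp add: translate_def orbit_average_def N_def)
    ultimately have "\<bar>translate G g (orbit_average S m) s - orbit_average S m s\<bar> =
        \<bar>\<Sum>y\<in>S. translate G g (m y) s - m (\<alpha> g y) s\<bar> / N"
      using N by (simp add: sum_subtractf diff_divide_distrib[symmetric])
    also have "\<dots> \<le> \<bar>\<Sum>y\<in>S. translate G g (m y) s - m (\<alpha> g y) s\<bar>"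
      using N mult_left_mono[of 1 N "\<bar>\<Sum>y\<in>S. translate G g (m y) s - m (\<alpha> g y) s\<bar>"] by (simp add: field_simps)
    also have "\<dots> \<le> (\<Sum>y\<in>S. \<bar>translate G g (m y) s - m (\<alpha> g y) s\<bar>)" by (rule sum_abs)
    finally show ?thesis .
  qed
  have av: "orbit_average S m \<in> Prob G" by (rule orbit_average_Prob[OF S m])
  have "ell1_dist G (translate G g (orbit_average S m)) (orbit_average S m) \<le>
      (\<Sum>\<^sub>\<infinity>s\<in>carrier G. \<Sum>y\<in>S. \<bar>translate G g (m y) s - m (\<alpha> g y) s\<bar>)"
    unfolding ell1_dist_def
    using Prob_dist_summable[OF translate_Prob[OF g av] av] sumS le
    by (intro infsum_mono) (auto simp: has_sum_iff)
  also have "\<dots> = (\<Sum>y\<in>S. ell1_dist G (translate G g (m y)) (m (\<alpha> g y)))" using sumS by (simp add: has_sum_iff)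
  finally show ?thesis .
qed

lemma approximately_invariant_net:
  assumes am: "amenable_action G \<alpha>"
    and S: "finite S" "S \<noteq> {}" "\<And>h y. h \<in> carrier G \<Longrightarrow> y \<in> S \<Longrightarrow> \<alpha> h y \<in> S"
  obtains F where "F \<noteq> bot" "\<forall>\<^sub>F p in F. p \<in> Prob G"
    "\<And>g. g \<in> carrier G \<Longrightarrow> ((\<lambda>p. ell1_dist G (translate G g p) p) \<longlongrightarrow> 0) F"
proof -
  obtain F :: "('x \<Rightarrow> 'g \<Rightarrow> real) filter" where F0: "F \<noteq> bot" "\<forall>\<^sub>F m in F. m \<in> continuous_Prob_maps G"
    "\<forall>g\<in>carrier G. \<forall>K. compact K \<longrightarrow>
      uniform_limit K (\<lambda>m x. ell1_dist G (translate G g (m x)) (m (\<alpha> g x))) (\<lambda>x. 0) F"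
    using am unfolding amenable_action_def by (elim conjE exE) (rule that)
  note F = F0(1,2) F0(3)[rule_format]
  have P: "\<forall>\<^sub>F m in F. \<forall>y. m y \<in> Prob G"
    using F(2) by (auto simp: continuous_Prob_maps_def elim: eventually_mono)
  show ?thesis
  proof (rule that[of "filtermap (orbit_average S) F"])
    show "filtermap (orbit_average S) F \<noteq> bot" using F(1) by (simp add: filtermap_bot_iff)
    show "\<forall>\<^sub>F p in filtermap (orbit_average S) F. p \<in> Prob G"
      unfolding eventually_filtermap using P by (rule eventually_mono) (rule orbit_average_Prob[OF S(1,2)], blast)
    fix g assume g: "g \<in> carrier G"
    have "((\<lambda>m. \<Sum>y\<in>S. ell1_dist G (translate G g (m y)) (m (\<alpha> g y))) \<longlongrightarrow> (\<Sum>y\<in>S. 0)) F"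
      using tendsto_uniform_limitI[OF F(3)[OF g finite_imp_compact[OF S(1)]]] by (intro tendsto_sum) auto
    then have z: "((\<lambda>m. \<Sum>y\<in>S. ell1_dist G (translate G g (m y)) (m (\<alpha> g y))) \<longlongrightarrow> 0) F" by simp
    have "((\<lambda>m. ell1_dist G (translate G g (orbit_average S m)) (orbit_average S m)) \<longlongrightarrow> 0) F"
    proof (rule Lim_null_comparison[OF eventually_mono[OF P] z])
      fix m :: "'x \<Rightarrow> 'g \<Rightarrow> real" assume "\<forall>y. m y \<in> Prob G"
      then show "norm (ell1_dist G (translate G g (orbit_average S m)) (orbit_average S m)) \<le>
          (\<Sum>y\<in>S. ell1_dist G (translate G g (m y)) (m (\<alpha> g y)))"
        using orbit_average_invariant[OF S _ g, of m] ell1_dist_nonneg[of G] by simp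
    qed
    then show "((\<lambda>p. ell1_dist G (translate G g p) p) \<longlongrightarrow> 0) (filtermap (orbit_average S) F)"
      by (simp add: filterlim_filtermap)
  qed
qed

lemma finite_invariant_set_of_orbit:
  assumes "S \<in> {S \<in> orbits G UNIV \<alpha>. finite S}"
  shows "finite S" "S \<noteq> {}" "\<And>h y. h \<in> carrier G \<Longrightarrow> y \<in> S \<Longrightarrow> \<alpha> h y \<in> S"
proof -
  obtain x where x: "S = orbit G \<alpha> x" using assms by (auto simp: orbits_def)
  show "finite S" using assms by simp
  show "S \<noteq> {}" using x group_action.orbit_refl[OF group_action] by auto
  show "\<alpha> h y \<in> S" if "h \<in> carrier G" "y \<in> S" for h y
    using that unfolding x orbit_def by (auto simp flip: act_mult)
qed

theorem amenable_if_finite_orbit: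
  assumes "amenable_action G \<alpha>" "S \<in> {S \<in> orbits G UNIV \<alpha>. finite S}"
  shows "amenable_group G"
  by (rule approximately_invariant_net[OF assms(1) finite_invariant_set_of_orbit[OF assms(2)]])
    (assumption | rule amenable_groupI)+

lemma approximately_invariant_probability:
  assumes "amenable_action G \<alpha>" "S \<in> {S \<in> orbits G UNIV \<alpha>. finite S}"
    and T: "finite T" "T \<subseteq> carrier G" and d: "d > 0"
  shows "\<exists>p\<in>Prob G. \<forall>g\<in>T. ell1_dist G (translate G g p) p < d"
proof -
  obtain F where F: "F \<noteq> bot" "\<forall>\<^sub>F p in F. p \<in> Prob G"
    "\<And>g. g \<in> carrier G \<Longrightarrow> ((\<lambda>p. ell1_dist G (translate G g p) p) \<longlongrightarrow> 0) F"
    by (rule approximately_invariant_net[OF assms(1) finite_invariant_set_of_orbit[OF assms(2)]]) (assumption+, rule that, blast+)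
  have "\<forall>\<^sub>F p in F. \<forall>g\<in>T. ell1_dist G (translate G g p) p < d"
    using T d F(3) by (intro eventually_ball_finite ballI order_tendstoD(2)) auto
  then have "\<forall>\<^sub>F p in F. p \<in> Prob G \<and> (\<forall>g\<in>T. ell1_dist G (translate G g p) p < d)"
    using F(2) by (rule eventually_conj[rotated])
  from eventually_happens'[OF F(1) this] show ?thesis by blast
qed

end

section \<open>Finite-dimensional unitary representations with small trace\<close>

text \<open>Matrices indexed by an arbitrary finite set, so that tensor products and permutation representations can be
  formed without enumerating their bases.\<close>

definition unitary_kernel ::
  "('g, 'b) monoid_scheme \<Rightarrow> 'j set \<Rightarrow> ('g \<Rightarrow> 'j \<Rightarrow> 'j \<Rightarrow> complex) \<Rightarrow> bool" where
  "unitary_kernel G J r \<longleftrightarrow> finite J \<and>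
     (\<forall>g\<in>carrier G. \<forall>h\<in>carrier G. \<forall>i\<in>J. \<forall>l\<in>J. r (g \<otimes>\<^bsub>G\<^esub> h) i l = (\<Sum>j\<in>J. r g i j * r h j l)) \<and>
     (\<forall>g\<in>carrier G. \<forall>i\<in>J. \<forall>j\<in>J. r (inv\<^bsub>G\<^esub> g) i j = cnj (r g j i)) \<and>
     (\<forall>i\<in>J. \<forall>j\<in>J. r \<one>\<^bsub>G\<^esub> i j = (if i = j then 1 else 0))"

lemma unitary_kernelD:
  assumes "unitary_kernel G J r"
  shows "finite J"
    "g \<in> carrier G \<Longrightarrow> h \<in> carrier G \<Longrightarrow> i \<in> J \<Longrightarrow> l \<in> J \<Longrightarrow> r (g \<otimes>\<^bsub>G\<^esub> h) i l = (\<Sum>j\<in>J. r g i j * r h j l)"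
    "g \<in> carrier G \<Longrightarrow> i \<in> J \<Longrightarrow> j \<in> J \<Longrightarrow> r (inv\<^bsub>G\<^esub> g) i j = cnj (r g j i)"
    "i \<in> J \<Longrightarrow> j \<in> J \<Longrightarrow> r \<one>\<^bsub>G\<^esub> i j = (if i = j then 1 else 0)"
  using assms by (auto simp: unitary_kernel_def)

context group
begin

lemma unitary_kernel_rows:
  assumes r: "unitary_kernel G J r" and g: "g \<in> carrier G" and i: "i \<in> J"
  shows "(\<Sum>j\<in>J. (cmod (r g i j))\<^sup>2) = 1"
proof -
  have "complex_of_real (\<Sum>j\<in>J. (cmod (r g i j))\<^sup>2) = (\<Sum>j\<in>J. r g i j * r (inv g) j i)"
    unfolding of_real_sum using unitary_kernelD(3)[OF r g _ i]
    by (intro sum.cong refl) (subst complex_norm_square, simp)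
  also have "\<dots> = r \<one> i i" using unitary_kernelD(2)[OF r g inv_closed[OF g] i i] g by simp
  also have "\<dots> = complex_of_real 1" using unitary_kernelD(4)[OF r i i] by simp
  finally show ?thesis using of_real_eq_iff by blast
qed

lemma unitary_kernel_entry_le:
  assumes r: "unitary_kernel G J r" and g: "g \<in> carrier G" and ij: "i \<in> J" "j \<in> J"
  shows "cmod (r g i j) \<le> 1"
proof -
  have "(cmod (r g i j))\<^sup>2 \<le> (\<Sum>j\<in>J. (cmod (r g i j))\<^sup>2)"
    using ij unitary_kernelD(1)[OF r] by (intro member_le_sum) auto
  then have "(cmod (r g i j))\<^sup>2 \<le> 1\<^sup>2" using unitary_kernel_rows[OF r g ij(1)] by simp
  then show ?thesis by (rule power2_le_imp_le) simp
qed

lemma unitary_kernel_trace_le: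
  assumes r: "unitary_kernel G J r" and g: "g \<in> carrier G"
  shows "cmod (\<Sum>j\<in>J. r g j j) \<le> real (card J)"
proof -
  have "cmod (\<Sum>j\<in>J. r g j j) \<le> (\<Sum>j\<in>J. 1)"
    using unitary_kernel_entry_le[OF r g] by (intro sum_norm_le) auto
  then show ?thesis by simp
qed

lemma fd_unitary_rep_kernel:
  assumes \<rho>: "fd_unitary_rep G n \<rho>"
  shows "unitary_kernel G {..<n} (\<lambda>g i j. \<rho> g $$ (i, j))"
proof -
  have c: "\<rho> g \<in> carrier_mat n n" and u: "\<rho> g * mat_adjoint (\<rho> g) = 1\<^sub>m n" "mat_adjoint (\<rho> g) * \<rho> g = 1\<^sub>m n"
    if "g \<in> carrier G" for g
    using \<rho> that by (auto simp: fd_unitary_rep_def unitary_mats_def)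
  have m: "\<rho> (g \<otimes> h) = \<rho> g * \<rho> h" if "g \<in> carrier G" "h \<in> carrier G" for g h
    using \<rho> that by (auto simp: fd_unitary_rep_def)
  note ac = mat_adjoint_carrier[OF c]
  have one: "\<rho> \<one> = 1\<^sub>m n"
  proof -
    have "\<rho> \<one> = \<rho> \<one> * (\<rho> \<one> * mat_adjoint (\<rho> \<one>))" using u(1)[OF one_closed] c[OF one_closed] by simp
    also have "\<dots> = (\<rho> \<one> * \<rho> \<one>) * mat_adjoint (\<rho> \<one>)"
      by (rule assoc_mult_mat[symmetric, OF c[OF one_closed] c[OF one_closed] ac[OF one_closed]])
    also have "\<rho> \<one> * \<rho> \<one> = \<rho> \<one>" using m[OF one_closed one_closed] by simp
    finally show ?thesis using u(1)[OF one_closed] by simp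
  qed
  have inv: "\<rho> (inv g) = mat_adjoint (\<rho> g)" if g: "g \<in> carrier G" for g
  proof -
    have ig: "inv g \<in> carrier G" using g by simp
    have "\<rho> (inv g) = \<rho> (inv g) * (\<rho> g * mat_adjoint (\<rho> g))" using u(1)[OF g] c[OF ig] by simp
    also have "\<dots> = (\<rho> (inv g) * \<rho> g) * mat_adjoint (\<rho> g)"
      by (rule assoc_mult_mat[symmetric, OF c[OF ig] c[OF g] ac[OF g]])
    also have "\<rho> (inv g) * \<rho> g = 1\<^sub>m n" using m[OF ig g] g one by simp
    finally show ?thesis using ac[OF g] by simp
  qed
  show ?thesis
    unfolding unitary_kernel_def
  proof (intro conjI ballI)
    fix g h i l assume "g \<in> carrier G" "h \<in> carrier G" "i \<in> {..<n}" "l \<in> {..<n}"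
    then show "\<rho> (g \<otimes> h) $$ (i, l) = (\<Sum>j<n. \<rho> g $$ (i, j) * \<rho> h $$ (j, l))"
      using mat_mult_index[OF c c, of g h i l] m by simp
  next
    fix g i j assume "g \<in> carrier G" "i \<in> {..<n}" "j \<in> {..<n}"
    then show "\<rho> (inv g) $$ (i, j) = cnj (\<rho> g $$ (j, i))"
      using mat_adjoint_index[OF c, of g i j] inv by simp
  qed (auto simp: one)
qed

text \<open>Adding a trivial summand makes the trace detect every non-trivial unitary, scalar ones included.\<close>

lemma separating_kernel:
  assumes map: "MAP G" and s: "s \<in> carrier G" "s \<noteq> \<one>"
  obtains n :: nat and r where "unitary_kernel G {..n} r" "cmod (\<Sum>j\<le>n. r s j j) < real (card {..n})"
proof -
  obtain n \<rho> where \<rho>: "fd_unitary_rep G n \<rho>" "\<rho> s \<noteq> \<rho> \<one>" using map s unfolding MAP_def by blast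
  define q where "q = (\<lambda>g i j. \<rho> g $$ (i, j))"
  have q: "unitary_kernel G {..<n} q" unfolding q_def by (rule fd_unitary_rep_kernel[OF \<rho>(1)])
  define r where "r = (\<lambda>g i j. if i < n \<and> j < n then q g i j else if i = j then 1 else 0)"
  have ins: "{..n} = insert n {..<n}" by auto
  have r: "unitary_kernel G {..n} r"
    unfolding unitary_kernel_def
  proof (intro conjI ballI)
    fix g h i l assume g: "g \<in> carrier G" "h \<in> carrier G" "i \<in> {..n}" "l \<in> {..n}"
    show "r (g \<otimes> h) i l = (\<Sum>j\<le>n. r g i j * r h j l)"
    proof (cases "i < n \<and> l < n")
      case True
      then have "(\<Sum>j\<le>n. r g i j * r h j l) = (\<Sum>j<n. q g i j * q h j l)" unfolding ins by (simp add: r_def)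
      then show ?thesis using unitary_kernelD(2)[OF q g(1,2)] True by (simp add: r_def)
    next
      case False
      have "(\<Sum>j\<le>n. r g i j * r h j l) = (\<Sum>j\<le>n. if j = n then (if i = n \<and> l = n then 1 else 0) else 0)"
        using False g by (intro sum.cong) (auto simp: r_def)
      then show ?thesis using False g by (auto simp: r_def)
    qed
  next
    fix g i j assume "g \<in> carrier G" "i \<in> {..n}" "j \<in> {..n}"
    then show "r (inv g) i j = cnj (r g j i)" using unitary_kernelD(3)[OF q] by (auto simp: r_def)
  qed (use unitary_kernelD(4)[OF q] in \<open>auto simp: r_def\<close>)
  define t where "t = (\<Sum>j<n. q s j j)"
  have tr: "(\<Sum>j\<le>n. r s j j) = 1 + t" unfolding ins t_def by (simp add: r_def)
  have tle: "cmod t \<le> n" unfolding t_def using unitary_kernel_trace_le[OF q s(1)] by simp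
  have Re1: "Re (q s j j) \<le> 1" if "j < n" for j
    using unitary_kernel_entry_le[OF q s(1), of j j] complex_Re_le_cmod[of "q s j j"] that by simp
  (* otherwise every diagonal entry has real part 1; rows being unit vectors, the matrix would be the identity *)
  have "Re t < n"
  proof (rule ccontr)
    assume "\<not> Re t < n"
    then have "(\<Sum>j<n. 1 - Re (q s j j)) \<le> 0" by (simp add: t_def sum_subtractf)
    moreover have "0 \<le> (\<Sum>j<n. 1 - Re (q s j j))" using Re1 by (intro sum_nonneg) auto
    ultimately have "(\<Sum>j<n. 1 - Re (q s j j)) = 0" by linarith
    then have re: "Re (q s j j) = 1" if "j < n" for j
      using that Re1 by (subst (asm) sum_nonneg_eq_0_iff) auto
    have off: "q s i j = (if i = j then 1 else 0)" if ij: "i < n" "j < n" for i j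
    proof -
      have c1: "cmod (q s i i) \<le> 1" using unitary_kernel_entry_le[OF q s(1)] ij by simp
      have "(cmod (q s i i))\<^sup>2 = 1 + (Im (q s i i))\<^sup>2" using re[OF ij(1)] by (simp add: cmod_power2)
      moreover have "(cmod (q s i i))\<^sup>2 \<le> 1" using c1 by (simp add: power_le_one)
      ultimately have im: "(Im (q s i i))\<^sup>2 = 0" using zero_le_power2[of "Im (q s i i)"] by linarith
      then have qii: "q s i i = 1" using re[OF ij(1)] by (simp add: complex_eq_iff)
      show ?thesis
      proof (cases "i = j")
        case False
        have "(cmod (q s i i))\<^sup>2 + (cmod (q s i j))\<^sup>2 = (\<Sum>l\<in>{i, j}. (cmod (q s i l))\<^sup>2)" using False by simp
        also have "\<dots> \<le> (\<Sum>l\<in>{..<n}. (cmod (q s i l))\<^sup>2)" using ij by (intro sum_mono2) auto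
        also have "\<dots> = 1" using unitary_kernel_rows[OF q s(1)] ij by simp
        finally show ?thesis using qii False by simp
      qed (use qii in simp)
    qed
    have "\<rho> s = \<rho> \<one>"
    proof (rule eq_matI)
      have d: "\<rho> g \<in> carrier_mat n n" if "g \<in> carrier G" for g
        using \<rho>(1) that by (auto simp: fd_unitary_rep_def unitary_mats_def)
      show "dim_row (\<rho> s) = dim_row (\<rho> \<one>)" "dim_col (\<rho> s) = dim_col (\<rho> \<one>)" using d[OF s(1)] d[OF one_closed] by auto
      fix i j assume "i < dim_row (\<rho> \<one>)" "j < dim_col (\<rho> \<one>)"
      then have "i < n" "j < n" using d[OF one_closed] by auto
      then show "\<rho> s $$ (i, j) = \<rho> \<one> $$ (i, j)" using off unitary_kernelD(4)[OF q] by (simp add: q_def)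
    qed
    then show False using \<rho>(2) by simp
  qed
  moreover have "(cmod (1 + t))\<^sup>2 = 1 + 2 * Re t + (cmod t)\<^sup>2"
    unfolding cmod_power2 by (simp add: power2_eq_square algebra_simps)
  moreover have "(cmod t)\<^sup>2 \<le> (real n)\<^sup>2" using tle by (intro power_mono) auto
  ultimately have "(cmod (1 + t))\<^sup>2 < (real n + 1)\<^sup>2" by (simp add: power2_eq_square algebra_simps)
  then have "cmod (1 + t) < real n + 1" by (rule power_less_imp_less_base) simp
  then show ?thesis using that[OF r] tr by simp
qed

lemma tensor_kernel:
  assumes I: "finite I" and r: "\<And>s. s \<in> I \<Longrightarrow> unitary_kernel G (J s) (r s)"
  shows "unitary_kernel G (PiE I J) (\<lambda>g p q. \<Prod>s\<in>I. r s g (p s) (q s))"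
  unfolding unitary_kernel_def
proof (intro conjI ballI)
  have fJ: "finite (J s)" if "s \<in> I" for s using unitary_kernelD(1)[OF r[OF that]] .
  show "finite (PiE I J)" using I fJ by (rule finite_PiE)
  fix p q assume p: "p \<in> PiE I J" and q: "q \<in> PiE I J"
  then have pq: "p s \<in> J s" "q s \<in> J s" if "s \<in> I" for s using that by auto
  show "(\<Prod>s\<in>I. r s \<one> (p s) (q s)) = (if p = q then 1 else 0)"
  proof (cases "p = q")
    case False
    then obtain s where "s \<in> I" "p s \<noteq> q s" using PiE_ext[OF p q] by blast
    then show ?thesis using False I pq unitary_kernelD(4)[OF r] by (auto intro!: prod_zero bexI[of _ s])
  qed (use pq unitary_kernelD(4)[OF r] in \<open>auto intro!: prod.neutral\<close>)
  fix g assume g: "g \<in> carrier G"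
  show "(\<Prod>s\<in>I. r s (inv g) (p s) (q s)) = cnj (\<Prod>s\<in>I. r s g (q s) (p s))"
    unfolding cnj_prod using pq unitary_kernelD(3)[OF r g] by (intro prod.cong) auto
  fix h assume h: "h \<in> carrier G"
  have "(\<Prod>s\<in>I. r s (g \<otimes> h) (p s) (q s)) = (\<Prod>s\<in>I. \<Sum>j\<in>J s. r s g (p s) j * r s h j (q s))"
    using pq unitary_kernelD(2)[OF r g h] by (intro prod.cong) auto
  also have "\<dots> = (\<Sum>f\<in>PiE I J. \<Prod>s\<in>I. r s g (p s) (f s) * r s h (f s) (q s))"
    using I fJ by (rule prod_sum_PiE)
  finally show "(\<Prod>s\<in>I. r s (g \<otimes> h) (p s) (q s)) =
      (\<Sum>f\<in>PiE I J. (\<Prod>s\<in>I. r s g (p s) (f s)) * (\<Prod>s\<in>I. r s h (f s) (q s)))"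
    by (simp add: prod.distrib)
qed

lemma tensor_kernel_trace:
  assumes I: "finite I" and r: "\<And>s. s \<in> I \<Longrightarrow> unitary_kernel G (J s) (r s)"
  shows "(\<Sum>p\<in>PiE I J. \<Prod>s\<in>I. r s g (p s) (p s)) = (\<Prod>s\<in>I. \<Sum>j\<in>J s. r s g j j)"
  using prod_sum_PiE[of I J "\<lambda>s j. r s g j j"] I unitary_kernelD(1)[OF r] by simp

text \<open>High tensor powers make the normalized traces small on a prescribed finite set.\<close>

lemma small_trace_kernel:
  assumes map: "MAP G" and E: "finite E" "E \<subseteq> carrier G - {\<one>}" and e: "e > 0"
  obtains J :: "('a \<times> nat \<Rightarrow> nat) set" and r where "unitary_kernel G J r" "J \<noteq> {}"
    "\<And>s. s \<in> E \<Longrightarrow> cmod (\<Sum>j\<in>J. r s j j) \<le> e * real (card J)"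
proof -
  have "\<exists>(n::nat) r. unitary_kernel G {..n} r \<and> cmod (\<Sum>j\<le>n. r s j j) < real (card {..n})" if "s \<in> E" for s
    using separating_kernel[OF map, of s] E that by (metis DiffD1 DiffD2 insertCI subsetD)
  then obtain n :: "'a \<Rightarrow> nat" and r where r: "\<And>s. s \<in> E \<Longrightarrow> unitary_kernel G {..n s} (r s)"
    and lt: "\<And>s. s \<in> E \<Longrightarrow> cmod (\<Sum>j\<le>n s. r s s j j) < real (card {..n s})" by metis
  define \<theta> where "\<theta> = (\<lambda>s g. cmod (\<Sum>j\<le>n s. r s g j j) / real (card {..n s}))"
  have \<theta>1: "\<theta> s g \<le> 1" if "s \<in> E" "g \<in> carrier G" for s g
    using unitary_kernel_trace_le[OF r[OF that(1)] that(2)] by (simp add: \<theta>_def)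
  have \<theta>0: "0 \<le> \<theta> s g" for s g by (simp add: \<theta>_def)
  have "\<exists>k. \<theta> s s ^ k < e" if "s \<in> E" for s
    using real_arch_pow_inv[OF e, of "\<theta> s s"] lt[OF that] by (auto simp: \<theta>_def)
  then obtain k where k: "\<And>s. s \<in> E \<Longrightarrow> \<theta> s s ^ k s < e" by metis
  define m where "m = Max (insert 0 (k ` E))"
  have km: "k s \<le> m" if "s \<in> E" for s unfolding m_def using that E by (intro Max_ge) auto
  define I where "I = E \<times> {..<m}"
  have I: "finite I" using E by (simp add: I_def)
  define J where "J = PiE I (\<lambda>i. {..n (fst i)})"
  define R where "R = (\<lambda>g p q. \<Prod>i\<in>I. r (fst i) g (p i) (q i))"
  have rI: "unitary_kernel G {..n (fst i)} (r (fst i))" if "i \<in> I" for i using r that by (auto simp: I_def)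
  have R: "unitary_kernel G J R" unfolding J_def R_def by (rule tensor_kernel[OF I rI])
  have card: "card J = (\<Prod>i\<in>I. card {..n (fst i)})" unfolding J_def by (rule card_PiE[OF I])
  have cpos: "real (card J) > 0" unfolding card by (simp add: prod_pos)
  have tr: "cmod (\<Sum>j\<in>J. R g j j) = (\<Prod>i\<in>I. \<theta> (fst i) g) * real (card J)" for g
  proof -
    have "(\<Sum>j\<in>J. R g j j) = (\<Prod>i\<in>I. \<Sum>j\<le>n (fst i). r (fst i) g j j)"
      unfolding J_def R_def by (rule tensor_kernel_trace[OF I rI])
    then have "cmod (\<Sum>j\<in>J. R g j j) = (\<Prod>i\<in>I. \<theta> (fst i) g * real (card {..n (fst i)}))"
      by (simp add: prod_norm[symmetric] \<theta>_def)
    then show ?thesis by (simp add: prod.distrib card)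
  qed
  show ?thesis
  proof (rule that[OF R])
    show "J \<noteq> {}" using cpos by auto
    fix s assume s: "s \<in> E"
    then have sc: "s \<in> carrier G" using E by auto
    have "(\<Prod>i\<in>I. \<theta> (fst i) s) = (\<Prod>t\<in>E. \<theta> t s ^ m)"
      unfolding I_def
      using prod.cartesian_product[of "\<lambda>t _. \<theta> t s" "{..<m}" E] by (simp add: case_prod_beta)
    also have "\<dots> = \<theta> s s ^ m * (\<Prod>t\<in>E - {s}. \<theta> t s ^ m)" using E s by (simp add: prod.remove)
    also have "\<dots> \<le> \<theta> s s ^ m * 1"
      using \<theta>0 \<theta>1[OF _ sc] by (intro mult_left_mono prod_le_1) (auto simp: power_le_one)
    also have "\<dots> \<le> \<theta> s s ^ k s" using \<theta>0 \<theta>1[OF s sc] km[OF s] by (simp add: power_decreasing)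
    also have "\<dots> \<le> e" using k[OF s] by simp
    finally show "cmod (\<Sum>j\<in>J. R s j j) \<le> e * real (card J)" unfolding tr by (intro mult_right_mono) auto
  qed
qed

end

section \<open>Finite-dimensional covariant representations\<close>

lemma finite_plus_rest:
  fixes f :: "'i \<Rightarrow> complex"
  assumes f: "f summable_on UNIV" and Z: "finite Z"
  shows "infsum f UNIV = (\<Sum>i\<in>Z. f i) + infsum f (-Z)"
proof -
  have "infsum f (Z \<union> -Z) = infsum f Z + infsum f (-Z)"
    using f Z by (intro infsum_Un_disjoint) (auto intro: summable_on_subset_banach)
  then show ?thesis using Z by (simp add: Un_commute)
qed

lemma (in group) kernel_unitary_rep:
  fixes \<kappa> :: "'a \<Rightarrow> 'i \<Rightarrow> 'i \<Rightarrow> complex"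
  assumes \<kappa>: "unitary_kernel G Z \<kappa>"
  shows "unitary_rep G (\<lambda>g \<xi> i. if i \<in> Z then \<Sum>j\<in>Z. \<kappa> g i j * \<xi> j else \<xi> i)"
    (is "unitary_rep G ?u")
proof -
  note Z = unitary_kernelD(1)[OF \<kappa>]
  have e: "?u g \<xi> \<in> ell2" if \<xi>: "\<xi> \<in> ell2" for g \<xi>
  proof -
    have "(\<lambda>i. (if i \<in> Z then (\<Sum>j\<in>Z. \<kappa> g i j * \<xi> j) - \<xi> i else 0) + \<xi> i) \<in> ell2"
      by (intro ell2_add \<xi> finite_support_ell2[OF Z]) auto
    moreover have "(\<lambda>i. (if i \<in> Z then (\<Sum>j\<in>Z. \<kappa> g i j * \<xi> j) - \<xi> i else 0) + \<xi> i) = ?u g \<xi>" by auto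
    ultimately show ?thesis by simp
  qed
  have mul: "?u (g \<otimes> h) \<xi> = ?u g (?u h \<xi>)" if g: "g \<in> carrier G" "h \<in> carrier G" for g h \<xi>
  proof
    fix i
    show "?u (g \<otimes> h) \<xi> i = ?u g (?u h \<xi>) i"
    proof (cases "i \<in> Z")
      case True
      have "(\<Sum>l\<in>Z. \<kappa> (g \<otimes> h) i l * \<xi> l) = (\<Sum>l\<in>Z. \<Sum>j\<in>Z. \<kappa> g i j * \<kappa> h j l * \<xi> l)"
        using unitary_kernelD(2)[OF \<kappa> g True] by (intro sum.cong) (auto simp: sum_distrib_right)
      also have "\<dots> = (\<Sum>j\<in>Z. \<kappa> g i j * (\<Sum>l\<in>Z. \<kappa> h j l * \<xi> l))"
        by (subst sum.swap) (simp add: sum_distrib_left mult.assoc)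
      finally show ?thesis using True by simp
    qed simp
  qed
  have one: "?u \<one> \<xi> = \<xi>" for \<xi>
  proof
    fix i
    have "(\<Sum>j\<in>Z. \<kappa> \<one> i j * \<xi> j) = (\<Sum>j\<in>Z. if i = j then \<xi> j else 0)" if "i \<in> Z"
      using unitary_kernelD(4)[OF \<kappa> that] by (intro sum.cong) auto
    then show "?u \<one> \<xi> i = \<xi> i" using Z by auto
  qed
  have inner: "ell2_inner (?u g \<xi>) (?u g \<eta>) = ell2_inner \<xi> \<eta>"
    if g: "g \<in> carrier G" and \<xi>: "\<xi> \<in> ell2" and \<eta>: "\<eta> \<in> ell2" for g \<xi> \<eta>
  proof -
    have "(\<Sum>i\<in>Z. ?u g \<xi> i * cnj (?u g \<eta> i)) = (\<Sum>i\<in>Z. \<Sum>j\<in>Z. \<Sum>l\<in>Z. \<kappa> (inv g) l i * \<kappa> g i j * (\<xi> j * cnj (\<eta> l)))"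
    proof (rule sum.cong[OF refl])
      fix i assume i: "i \<in> Z"
      have "?u g \<xi> i * cnj (?u g \<eta> i) = (\<Sum>j\<in>Z. \<kappa> g i j * \<xi> j) * (\<Sum>l\<in>Z. \<kappa> (inv g) l i * cnj (\<eta> l))"
        using i unitary_kernelD(3)[OF \<kappa> g _ i] by simp
      then show "?u g \<xi> i * cnj (?u g \<eta> i) = (\<Sum>j\<in>Z. \<Sum>l\<in>Z. \<kappa> (inv g) l i * \<kappa> g i j * (\<xi> j * cnj (\<eta> l)))"
        by (simp add: sum_product mult_ac)
    qed
    also have "\<dots> = (\<Sum>j\<in>Z. \<Sum>l\<in>Z. (\<Sum>i\<in>Z. \<kappa> (inv g) l i * \<kappa> g i j) * (\<xi> j * cnj (\<eta> l)))"
      unfolding sum_distrib_right by (subst sum.swap, rule sum.cong[OF refl], rule sum.swap)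
    also have "\<dots> = (\<Sum>j\<in>Z. \<Sum>l\<in>Z. if l = j then \<xi> j * cnj (\<eta> l) else 0)"
    proof (intro sum.cong refl)
      fix j l assume "j \<in> Z" "l \<in> Z"
      then have "(\<Sum>i\<in>Z. \<kappa> (inv g) l i * \<kappa> g i j) = (if l = j then 1 else 0)"
        using unitary_kernelD(2)[OF \<kappa> inv_closed[OF g] g, of l j] unitary_kernelD(4)[OF \<kappa>, of l j] g by simp
      then show "(\<Sum>i\<in>Z. \<kappa> (inv g) l i * \<kappa> g i j) * (\<xi> j * cnj (\<eta> l)) = (if l = j then \<xi> j * cnj (\<eta> l) else 0)"
        by simp
    qed
    also have "\<dots> = (\<Sum>j\<in>Z. \<xi> j * cnj (\<eta> j))" using Z by simp
    finally have fin: "(\<Sum>i\<in>Z. ?u g \<xi> i * cnj (?u g \<eta> i)) = (\<Sum>j\<in>Z. \<xi> j * cnj (\<eta> j))" .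
    have "(\<Sum>\<^sub>\<infinity>i\<in>-Z. ?u g \<xi> i * cnj (?u g \<eta> i)) = (\<Sum>\<^sub>\<infinity>i\<in>-Z. \<xi> i * cnj (\<eta> i))"
      by (intro infsum_cong) auto
    then show ?thesis
      unfolding ell2_inner_def
      using finite_plus_rest[OF ell2_summable[OF e[OF \<xi>, of g] e[OF \<eta>, of g]] Z]
        finite_plus_rest[OF ell2_summable[OF \<xi> \<eta>] Z] fin by simp
  qed
  have unit: "unitary_operator (?u g)" if g: "g \<in> carrier G" for g
    unfolding unitary_operator_def bounded_operator_def
  proof (intro conjI ballI allI)
    fix \<xi> :: "'i \<Rightarrow> complex" assume \<xi>: "\<xi> \<in> ell2"
    show "?u g \<xi> \<in> ell2" by (rule e[OF \<xi>])
    show "?u g (\<lambda>i. c * \<xi> i) = (\<lambda>i. c * ?u g \<xi> i)" for c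
      by (auto simp: sum_distrib_left mult_ac)
    fix \<eta> :: "'i \<Rightarrow> complex" assume \<eta>: "\<eta> \<in> ell2"
    show "?u g (\<lambda>i. \<xi> i + \<eta> i) = (\<lambda>i. ?u g \<xi> i + ?u g \<eta> i)"
      by (auto simp: sum.distrib distrib_left)
    show "ell2_inner (?u g \<xi>) (?u g \<eta>) = ell2_inner \<xi> \<eta>" by (rule inner[OF g \<xi> \<eta>])
  next
    show "\<exists>C. \<forall>\<xi>\<in>ell2. ell2_norm (?u g \<xi>) \<le> C * ell2_norm \<xi>"
      using ell2_norm_eqI_inner[OF e _ inner[OF g]] by (intro exI[of _ 1]) auto
    have "\<xi> \<in> ?u g ` ell2" if "\<xi> \<in> ell2" for \<xi>
    proof (rule image_eqI)
      show "\<xi> = ?u g (?u (inv g) \<xi>)" using mul[OF g inv_closed[OF g], of \<xi>] one[of \<xi>] g by (simp only: r_inv)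
    qed (rule e[OF that])
    then show "?u g ` ell2 = ell2" using e by blast
  qed
  show ?thesis
    unfolding unitary_rep_def
  proof (intro conjI ballI)
    show "unitary_operator (?u g)" if "g \<in> carrier G" for g by (rule unit[OF that])
    show "?u (g \<otimes> h) \<xi> = ?u g (?u h \<xi>)" if "g \<in> carrier G" "h \<in> carrier G" for g h \<xi>
      by (rule mul[OF that])
  qed
qed

context dynamical_system
begin

text \<open>The permutation representation on the orbit tensored with \<open>r\<close>, realized on a finite set \<open>Z\<close> of coordinates;
  off \<open>Z\<close> functions act by zero and the group acts trivially.\<close>

lemma finite_orbit_covariant_rep:
  fixes S :: "'x set" and r :: "'g \<Rightarrow> 'j \<Rightarrow> 'j \<Rightarrow> complex"
  assumes S: "finite S" "\<And>h y. h \<in> carrier G \<Longrightarrow> y \<in> S \<Longrightarrow> \<alpha> h y \<in> S" and r: "unitary_kernel G J r"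
    and inf: "infinite (UNIV :: 'i set)"
  obtains \<pi> and u :: "'g \<Rightarrow> 'i operator" and Z and b :: "'x \<times> 'j \<Rightarrow> 'i" where "covariant_rep G \<alpha> \<pi> u"
    "finite Z" "\<And>f \<xi> i. i \<notin> Z \<Longrightarrow> \<pi> f \<xi> i = 0" "\<And>y j. y \<in> S \<Longrightarrow> j \<in> J \<Longrightarrow> b (y, j) \<in> Z"
    "\<And>f k y j. k \<in> carrier G \<Longrightarrow> y \<in> S \<Longrightarrow> j \<in> J \<Longrightarrow>
        \<pi> f (u k (delta (b (y, j)))) = (\<lambda>i. f (\<alpha> k y) * u k (delta (b (y, j))) i)"
    "\<And>k y j. k \<in> carrier G \<Longrightarrow> y \<in> S \<Longrightarrow> j \<in> J \<Longrightarrow> 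
        u k (delta (b (y, j))) (b (y, j)) = (if \<alpha> k y = y then r k j j else 0)"
    "\<And>k y j i. k \<in> carrier G \<Longrightarrow> y \<in> S \<Longrightarrow> j \<in> J \<Longrightarrow> i \<notin> Z \<Longrightarrow> u k (delta (b (y, j))) i = 0"
proof -
  have J: "finite J" using unitary_kernelD(1)[OF r] .
  have fSJ: "finite (S \<times> J)" using S J by simp
  obtain Z :: "'i set" where Z0: "finite Z" "card Z = card (S \<times> J)"
    using infinite_arbitrarily_large[OF inf] by metis
  obtain b where b: "bij_betw b (S \<times> J) Z" using finite_same_card_bij[OF fSJ Z0(1)] Z0(2) by metis
  define d where "d = inv_into (S \<times> J) b"
  have d: "d (b p) = p" if "p \<in> S \<times> J" for p
    unfolding d_def using b that by (simp add: bij_betw_def)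
  have dZ: "d i \<in> S \<times> J" "b (d i) = i" if "i \<in> Z" for i
    unfolding d_def using b that by (auto simp: bij_betw_def inv_into_into f_inv_into_f)
  have dS: "fst (d i) \<in> S" "snd (d i) \<in> J" if "i \<in> Z" for i using dZ(1)[OF that] by (auto simp: mem_Times_iff)
  have d_inj: "d i = d j \<longleftrightarrow> i = j" if "i \<in> Z" "j \<in> Z" for i j using dZ(2) that by metis
  define \<kappa> where "\<kappa> = (\<lambda>g i j. if fst (d i) = \<alpha> g (fst (d j)) then r g (snd (d i)) (snd (d j)) else 0)"
  have \<kappa>: "unitary_kernel G Z \<kappa>"
    unfolding unitary_kernel_def
  proof (intro conjI ballI)
    show "finite Z" by (rule Z0(1))
    fix i l assume i: "i \<in> Z" and l: "l \<in> Z"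
    show "\<kappa> \<one> i l = (if i = l then 1 else 0)"
      using unitary_kernelD(4)[OF r dS(2)[OF i] dS(2)[OF l]] d_inj[OF i l]
      by (auto simp: \<kappa>_def prod_eq_iff)
    fix g assume g: "g \<in> carrier G"
    have "fst (d i) = \<alpha> (inv g) (fst (d l)) \<longleftrightarrow> fst (d l) = \<alpha> g (fst (d i))" using g by (metis act_inv)
    then show "\<kappa> (inv g) i l = cnj (\<kappa> g l i)"
      using unitary_kernelD(3)[OF r g dS(2)[OF i] dS(2)[OF l]] by (simp add: \<kappa>_def)
    fix h assume h: "h \<in> carrier G"
    define y where "y = \<alpha> h (fst (d l))"
    have yS: "y \<in> S" unfolding y_def using S(2)[OF h] dS(1)[OF l] by simp
    have "(\<Sum>j\<in>Z. \<kappa> g i j * \<kappa> h j l) = (\<Sum>p\<in>S \<times> J. \<kappa> g i (b p) * \<kappa> h (b p) l)"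
      using sum.reindex_bij_betw[OF b, of "\<lambda>j. \<kappa> g i j * \<kappa> h j l"] by simp
    also have "\<dots> = (\<Sum>p\<in>S \<times> J. (if fst (d i) = \<alpha> g (fst p) then r g (snd (d i)) (snd p) else 0)
        * (if fst p = y then r h (snd p) (snd (d l)) else 0))"
      using d by (intro sum.cong) (auto simp: \<kappa>_def y_def)
    also have "\<dots> = (\<Sum>z\<in>S. \<Sum>j\<in>J. (if fst (d i) = \<alpha> g z then r g (snd (d i)) j else 0)
        * (if z = y then r h j (snd (d l)) else 0))"
      by (simp add: sum.cartesian_product case_prod_beta)
    also have "\<dots> = (\<Sum>z\<in>S. if z = y then (\<Sum>j\<in>J. (if fst (d i) = \<alpha> g y then r g (snd (d i)) j else 0) * r h j (snd (d l))) else 0)"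
      by (intro sum.cong) auto
    also have "\<dots> = (\<Sum>j\<in>J. (if fst (d i) = \<alpha> g y then r g (snd (d i)) j else 0) * r h j (snd (d l)))"
      using S(1) yS by simp
    also have "\<dots> = \<kappa> (g \<otimes> h) i l"
      using unitary_kernelD(2)[OF r g h dS(2)[OF i] dS(2)[OF l]] act_mult[OF g h]
      by (auto simp: \<kappa>_def y_def)
    finally show "\<kappa> (g \<otimes> h) i l = (\<Sum>j\<in>Z. \<kappa> g i j * \<kappa> h j l)" ..
  qed
  define u where "u = (\<lambda>g \<xi> i. if i \<in> Z then \<Sum>j\<in>Z. \<kappa> g i j * \<xi> j else (\<xi> i :: complex))"
  define \<pi> where "\<pi> = (\<lambda>f \<xi> i. if i \<in> Z then f (fst (d i)) * \<xi> i else (0::complex))"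
  have cov: "covariant_rep G \<alpha> \<pi> u"
    unfolding covariant_rep_def
  proof (intro conjI ballI)
    show "C0_star_rep \<pi>" unfolding \<pi>_def by (rule C0_star_rep_diagonal)
    show "unitary_rep G u" unfolding u_def by (rule kernel_unitary_rep[OF \<kappa>])
    fix g f \<xi> assume g: "g \<in> carrier G"
    show "u g (\<pi> f \<xi>) = \<pi> (act_fun G \<alpha> g f) (u g \<xi>)"
    proof
      fix i
      have "f (fst (d j)) * \<kappa> g i j = f (\<alpha> (inv g) (fst (d i))) * \<kappa> g i j" for j
        using g by (simp add: \<kappa>_def)
      then have "(\<Sum>j\<in>Z. \<kappa> g i j * (f (fst (d j)) * \<xi> j)) = f (\<alpha> (inv g) (fst (d i))) * (\<Sum>j\<in>Z. \<kappa> g i j * \<xi> j)"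
        unfolding sum_distrib_left by (intro sum.cong refl) (metis mult.assoc mult.commute)
      then show "u g (\<pi> f \<xi>) i = \<pi> (act_fun G \<alpha> g f) (u g \<xi>) i"
        by (auto simp: u_def \<pi>_def act_fun_def cong: sum.cong)
    qed
  qed
  have ud: "u k (delta (b p)) i = (if i \<in> Z then \<kappa> k i (b p) else 0)" if p: "p \<in> S \<times> J" for k p i
  proof -
    have bp: "b p \<in> Z" using b p by (auto simp: bij_betw_def)
    have "(\<Sum>j\<in>Z. \<kappa> k i j * delta (b p) j) = (\<Sum>j\<in>Z. if j = b p then \<kappa> k i j else 0)"
      by (intro sum.cong) (auto simp: delta_def)
    then show ?thesis using bp Z0(1) by (auto simp: u_def delta_def)
  qed
  show ?thesis
  proof (rule that[OF cov Z0(1), of b])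
    show "\<pi> f \<xi> i = 0" if "i \<notin> Z" for f \<xi> i using that by (simp add: \<pi>_def)
    show bZ: "b (y, j) \<in> Z" if "y \<in> S" "j \<in> J" for y j using b that by (auto simp: bij_betw_def)
    show "\<pi> f (u k (delta (b (y, j)))) = (\<lambda>i. f (\<alpha> k y) * u k (delta (b (y, j))) i)"
      if "k \<in> carrier G" "y \<in> S" "j \<in> J" for f k y j
      using that d[of "(y, j)"] by (auto simp: \<pi>_def ud \<kappa>_def fun_eq_iff)
    show "u k (delta (b (y, j))) (b (y, j)) = (if \<alpha> k y = y then r k j j else 0)"
      if "k \<in> carrier G" "y \<in> S" "j \<in> J" for k y j
      using that d[of "(y, j)"] bZ by (auto simp: ud \<kappa>_def)
    show "u k (delta (b (y, j))) i = 0" if "k \<in> carrier G" "y \<in> S" "j \<in> J" "i \<notin> Z" for k y j i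
      using that by (simp add: ud)
  qed
qed

text \<open>Functions act by zero off \<open>Z\<close>, so the integrated form takes values in the span of the basis vectors of \<open>Z\<close>, and its
  compression to that span is multiplicative.\<close>

lemma fd_star_rep_of_finite_support:
  fixes \<pi> :: "('x \<Rightarrow> complex) \<Rightarrow> ('g \<Rightarrow> 'x \<Rightarrow> complex) operator"
  assumes cov: "covariant_rep G \<alpha> \<pi> u" and Z: "finite Z" and supp: "\<And>f \<xi> i. i \<notin> Z \<Longrightarrow> \<pi> f \<xi> i = 0"
  obtains n \<phi> e where "bij_betw e {..<n} Z" "fd_star_rep cp n \<phi>"
    "\<And>b \<zeta> i. b \<in> cpc \<Longrightarrow> \<zeta> \<in> ell2 \<Longrightarrow> (\<And>k. k \<notin> Z \<Longrightarrow> \<zeta> k = 0) \<Longrightarrow> i < n \<Longrightarrow>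
       (\<Sum>j<n. \<phi> b $$ (i, j) * \<zeta> (e j)) = integrated_form G \<pi> u b \<zeta> (e i)"
proof -
  define n where "n = card Z"
  obtain e where e: "bij_betw e {..<n} Z"
    using ex_bij_betw_nat_finite[OF Z] by (auto simp: n_def lessThan_atLeast0)
  define T where "T = integrated_form G \<pi> u"
  have supp_T: "T b \<zeta> i = 0" if "i \<notin> Z" for b \<zeta> i
    using supp[OF that] by (simp add: T_def integrated_form_def)
  define \<phi> where "\<phi> = (\<lambda>b. mat n n (\<lambda>(i, j). T b (delta (e j)) (e i)))"
  have eZ: "e i \<in> Z" if "i < n" for i using e that by (auto simp: bij_betw_def)
  have exp: "(\<Sum>j<n. \<phi> b $$ (i, j) * \<zeta> (e j)) = T b \<zeta> (e i)"
    if b: "b \<in> cpc" and \<zeta>: "\<zeta> \<in> ell2" "\<And>k. k \<notin> Z \<Longrightarrow> \<zeta> k = 0" and i: "i < n" for b \<zeta> i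
  proof -
    have inj: "e j = e l \<longleftrightarrow> j = l" if "j < n" "l < n" for j l
      using e that by (metis bij_betw_imp_inj_on inj_on_eq_iff lessThan_iff)
    have "\<zeta> = (\<lambda>k. \<Sum>j<n. \<zeta> (e j) * delta (e j) k)"
    proof
      fix k
      show "\<zeta> k = (\<Sum>j<n. \<zeta> (e j) * delta (e j) k)"
      proof (cases "k \<in> Z")
        case True
        then obtain l where l: "l < n" "k = e l" using e by (auto simp: bij_betw_def)
        then have "(\<Sum>j<n. \<zeta> (e j) * delta (e j) k) = (\<Sum>j<n. if j = l then \<zeta> (e l) else 0)"
          by (intro sum.cong) (auto simp: delta_def inj)
        then show ?thesis using l by simp
      next
        case False
        then have "k \<noteq> e j" if "j < n" for j using eZ[OF that] by auto
        then show ?thesis using \<zeta>(2)[OF False] by (auto simp: delta_def intro!: sum.neutral[symmetric])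
      qed
    qed
    then have "T b \<zeta> = T b (\<lambda>k. \<Sum>j<n. \<zeta> (e j) * delta (e j) k)" by simp
    also have "\<dots> = (\<lambda>k. \<Sum>j<n. T b (\<lambda>k. \<zeta> (e j) * delta (e j) k) k)"
      unfolding T_def by (rule bounded_operator_sum[OF integrated_form_operator[OF cov b]]) (simp add: ell2_scale)
    also have "\<dots> = (\<lambda>k. \<Sum>j<n. \<zeta> (e j) * T b (delta (e j)) k)"
      unfolding T_def using bounded_operatorD(3)[OF integrated_form_operator[OF cov b] delta_ell2] by simp
    finally show ?thesis using i by (simp add: \<phi>_def mult.commute)
  qed
  have c: "\<phi> b \<in> carrier_mat n n" for b by (simp add: \<phi>_def)
  have "fd_star_rep cp n \<phi>"
    unfolding fd_star_rep_def
  proof (intro conjI ballI allI)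
    fix a assume a: "a \<in> cpc"
    show "\<phi> a \<in> carrier_mat n n" by (rule c)
    show "\<phi> (sa_scale cp z a) = z \<cdot>\<^sub>m \<phi> a" for z
      using integrated_form_scale[OF cov a delta_ell2] by (intro eq_matI) (auto simp: \<phi>_def T_def)
    show "\<phi> (sa_star cp a) = mat_adjoint (\<phi> a)"
    proof (rule eq_matI)
      fix i j assume "i < dim_row (mat_adjoint (\<phi> a))" "j < dim_col (mat_adjoint (\<phi> a))"
      then have ij: "i < n" "j < n" using mat_adjoint_carrier[OF c[of a]] by auto
      have "T (sa_star cp a) (delta (e j)) (e i) = ell2_inner (T (sa_star cp a) (delta (e j))) (delta (e i))"
        by (simp add: ell2_inner_delta)
      also have "\<dots> = ell2_inner (delta (e j)) (T a (delta (e i)))"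
        unfolding T_def by (rule integrated_form_star[OF cov a delta_ell2 delta_ell2])
      also have "\<dots> = cnj (ell2_inner (T a (delta (e i))) (delta (e j)))" by (rule ell2_inner_commute)
      also have "\<dots> = cnj (T a (delta (e i)) (e j))" by (simp add: ell2_inner_delta)
      finally show "\<phi> (sa_star cp a) $$ (i, j) = mat_adjoint (\<phi> a) $$ (i, j)"
        using ij mat_adjoint_index[OF c[of a] ij] by (simp add: \<phi>_def)
    qed (use mat_adjoint_carrier[OF c[of a]] c[of "sa_star cp a"] in auto)
    fix b assume b: "b \<in> cpc"
    show "\<phi> (sa_add cp a b) = \<phi> a + \<phi> b"
      using integrated_form_add[OF cov a b delta_ell2] by (intro eq_matI) (auto simp: \<phi>_def T_def)
    show "\<phi> (sa_mult cp a b) = \<phi> a * \<phi> b"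
    proof (rule eq_matI)
      fix i j assume "i < dim_row (\<phi> a * \<phi> b)" "j < dim_col (\<phi> a * \<phi> b)"
      then have ij: "i < n" "j < n" using c[of a] c[of b] by auto
      have Tb: "T b (delta (e j)) \<in> ell2" unfolding T_def by (rule integrated_form_ell2[OF cov b delta_ell2])
      have "(\<phi> a * \<phi> b) $$ (i, j) = (\<Sum>l<n. \<phi> a $$ (i, l) * T b (delta (e j)) (e l))"
        using ij by (subst mat_mult_index[OF c c ij]) (simp add: \<phi>_def)
      also have "\<dots> = T a (T b (delta (e j))) (e i)" by (rule exp[OF a Tb supp_T ij(1)])
      also have "\<dots> = \<phi> (sa_mult cp a b) $$ (i, j)"
        using integrated_form_mult[OF cov a b delta_ell2] ij by (simp add: \<phi>_def T_def)
      finally show "\<phi> (sa_mult cp a b) $$ (i, j) = (\<phi> a * \<phi> b) $$ (i, j)" ..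
    qed (use c[of a] c[of b] c[of "sa_mult cp a b"] in auto)
  qed
  then show ?thesis by (rule that[OF e]) (use exp in \<open>simp add: T_def\<close>)
qed

end

section \<open>Finite-dimensional representations compute the universal norm\<close>

lemma double_sum_estimate:
  fixes M :: "'k \<Rightarrow> 'k \<Rightarrow> complex"
  assumes "\<And>k l. k \<in> A \<Longrightarrow> l \<in> A \<Longrightarrow> cmod (M k l) \<le> e * (n k * n l)"
  shows "cmod (\<Sum>k\<in>A. \<Sum>l\<in>A. M k l) \<le> e * (\<Sum>k\<in>A. n k)\<^sup>2"
proof -
  have "cmod (\<Sum>k\<in>A. \<Sum>l\<in>A. M k l) \<le> (\<Sum>k\<in>A. \<Sum>l\<in>A. e * (n k * n l))"
    using assms by (intro sum_norm_le)
  also have "\<dots> = e * (\<Sum>k\<in>A. n k)\<^sup>2"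
    unfolding power2_eq_square sum_product by (simp add: sum_distrib_left)
  finally show ?thesis .
qed

context dynamical_system
begin

lemma infinite_index_type: "infinite (UNIV :: ('g \<Rightarrow> 'x \<Rightarrow> complex) set)"
proof
  assume "finite (UNIV :: ('g \<Rightarrow> 'x \<Rightarrow> complex) set)"
  moreover have "inj (\<lambda>(n::nat) (g::'g) (x::'x). complex_of_nat n)" by (auto simp: inj_def fun_eq_iff)
  ultimately have "finite (UNIV :: nat set)" by (rule inj_on_finite[OF _ subset_UNIV, rotated])
  then show False by simp
qed

text \<open>The inner product of the translates by \<open>k\<close> and \<open>l\<close> is the coefficient of \<open>inv l \<otimes> k\<close>, and the sum of these
  over \<open>j\<close> is a trace, which is small unless \<open>k = l\<close>.\<close>

lemma small_trace_gram:
  fixes u :: "'g \<Rightarrow> 'i operator" and \<delta> :: "'j \<Rightarrow> 'i \<Rightarrow> complex"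
  assumes u: "unitary_rep G u" and \<delta>: "\<And>j. j \<in> J \<Longrightarrow> \<delta> j \<in> ell2" and A: "A \<subseteq> carrier G" and e: "e \<ge> 0"
    and one: "(\<Sum>j\<in>J. ell2_inner (u \<one> (\<delta> j)) (\<delta> j)) = N"
    and small: "\<And>k l. k \<in> A \<Longrightarrow> l \<in> A \<Longrightarrow> k \<noteq> l \<Longrightarrow> cmod (\<Sum>j\<in>J. ell2_inner (u (inv l \<otimes> k) (\<delta> j)) (\<delta> j)) \<le> e"
  shows "cmod (of_real (\<Sum>j\<in>J. (ell2_norm (\<lambda>i. \<Sum>k\<in>A. c k * u k (\<delta> j) i))\<^sup>2) - N * of_real (\<Sum>k\<in>A. (cmod (c k))\<^sup>2))
     \<le> e * (\<Sum>k\<in>A. cmod (c k))\<^sup>2"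
proof (cases "finite A")
  case fin: True
  have ue: "u k (\<delta> j) \<in> ell2" if "k \<in> A" "j \<in> J" for k j
    using unitary_repD(2)[OF u] \<delta> A that by auto
  define t where "t = (\<lambda>k l. \<Sum>j\<in>J. ell2_inner (u k (\<delta> j)) (u l (\<delta> j)))"
  have t: "t k l = (\<Sum>j\<in>J. ell2_inner (u (inv l \<otimes> k) (\<delta> j)) (\<delta> j))" if "k \<in> A" "l \<in> A" for k l
    unfolding t_def
  proof (rule sum.cong[OF refl])
    fix j assume j: "j \<in> J"
    have kl: "k \<in> carrier G" "l \<in> carrier G" using A that by auto
    have "u k (\<delta> j) = u l (u (inv l \<otimes> k) (\<delta> j))"
      using unitary_repD(4)[OF u kl(2), of "inv l \<otimes> k" "\<delta> j"] kl \<delta>[OF j] by (simp flip: m_assoc)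
    then show "ell2_inner (u k (\<delta> j)) (u l (\<delta> j)) = ell2_inner (u (inv l \<otimes> k) (\<delta> j)) (\<delta> j)"
      using unitary_repD(3)[OF u kl(2), of "u (inv l \<otimes> k) (\<delta> j)" "\<delta> j"] unitary_repD(2)[OF u, of "inv l \<otimes> k" "\<delta> j"]
        kl \<delta>[OF j] by simp
  qed
  have "of_real (\<Sum>j\<in>J. (ell2_norm (\<lambda>i. \<Sum>k\<in>A. c k * u k (\<delta> j) i))\<^sup>2) =
      (\<Sum>j\<in>J. \<Sum>k\<in>A. \<Sum>l\<in>A. c k * cnj (c l) * ell2_inner (u k (\<delta> j)) (u l (\<delta> j)))"
    unfolding of_real_sum using ue by (intro sum.cong refl ell2_norm_sum_square) auto
  also have "\<dots> = (\<Sum>k\<in>A. \<Sum>l\<in>A. c k * cnj (c l) * t k l)"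
    unfolding t_def sum_distrib_left by (subst sum.swap, rule sum.cong[OF refl], rule sum.swap)
  finally have 1: "of_real (\<Sum>j\<in>J. (ell2_norm (\<lambda>i. \<Sum>k\<in>A. c k * u k (\<delta> j) i))\<^sup>2) = (\<Sum>k\<in>A. \<Sum>l\<in>A. c k * cnj (c l) * t k l)" .
  have "(\<Sum>k\<in>A. \<Sum>l\<in>A. c k * cnj (c l) * (if k = l then N else 0)) = (\<Sum>k\<in>A. \<Sum>l\<in>A. if k = l then c k * cnj (c k) * N else 0)"
    by (intro sum.cong refl) auto
  also have "\<dots> = (\<Sum>k\<in>A. c k * cnj (c k) * N)" using fin by simp
  also have "\<dots> = N * of_real (\<Sum>k\<in>A. (cmod (c k))\<^sup>2)"
    unfolding of_real_sum sum_distrib_left by (intro sum.cong refl, subst complex_norm_square) (simp add: mult_ac)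
  finally have 2: "N * of_real (\<Sum>k\<in>A. (cmod (c k))\<^sup>2) = (\<Sum>k\<in>A. \<Sum>l\<in>A. c k * cnj (c l) * (if k = l then N else 0))" ..
  have b: "cmod (t k l - (if k = l then N else 0)) \<le> e" if "k \<in> A" "l \<in> A" for k l
  proof (cases "k = l")
    case True
    have "inv k \<otimes> k = \<one>" using that A by auto
    then show ?thesis using one e t[OF that(1,1)] True by simp
  next
    case False
    then show ?thesis using small[OF that False] t[OF that] by simp
  qed
  show ?thesis
    unfolding 1 2 sum_subtractf[symmetric] right_diff_distrib[symmetric]
  proof (rule double_sum_estimate)
    fix k l assume kl: "k \<in> A" "l \<in> A"
    have "cmod (c k * cnj (c l) * (t k l - (if k = l then N else 0))) =
        (cmod (c k) * cmod (c l)) * cmod (t k l - (if k = l then N else 0))" by (simp add: norm_mult)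
    also have "\<dots> \<le> (cmod (c k) * cmod (c l)) * e" by (intro mult_left_mono b kl) auto
    finally show "cmod (c k * cnj (c l) * (t k l - (if k = l then N else 0))) \<le> e * (cmod (c k) * cmod (c l))"
      by (simp add: mult.commute)
  qed
next
  case False
  then show ?thesis using e by simp
qed

text \<open>The test vectors \<open>\<zeta>\<^sub>j = \<Sum>\<^sub>h z\<^sub>h u(h) \<delta>\<^sub>j\<close> are mapped by \<open>a\<close> to \<open>\<Sum>\<^sub>k c\<^sub>k u(k) \<delta>\<^sub>j\<close>, where \<open>c\<close> is the matrix applied
  to \<open>z\<close>. On average over \<open>j\<close>, the translates of \<open>\<delta>\<^sub>j\<close> are orthonormal up to \<open>e\<close>, which tends to zero.\<close>

lemma finite_orbit_bound:
  assumes map: "MAP G" and S: "finite S" "\<And>h y. h \<in> carrier G \<Longrightarrow> y \<in> S \<Longrightarrow> \<alpha> h y \<in> S" "x \<in> S"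
    and a: "a \<in> cpc" and r: "0 \<le> r"
    and le: "\<And>(\<pi> :: ('x \<Rightarrow> complex) \<Rightarrow> ('g \<Rightarrow> 'x \<Rightarrow> complex) operator) u Z \<zeta>. covariant_rep G \<alpha> \<pi> u \<Longrightarrow> finite Z \<Longrightarrow>
       (\<And>f \<xi> i. i \<notin> Z \<Longrightarrow> \<pi> f \<xi> i = 0) \<Longrightarrow> \<zeta> \<in> ell2 \<Longrightarrow> (\<And>i. i \<notin> Z \<Longrightarrow> \<zeta> i = 0) \<Longrightarrow>
       ell2_norm (integrated_form G \<pi> u a \<zeta>) \<le> r * ell2_norm \<zeta>"
    and K: "finite K" "K \<subseteq> carrier G" and L: "finite L" "L \<subseteq> carrier G"
    and KL: "\<And>g h. g \<in> cp_supp G a \<Longrightarrow> h \<in> K \<Longrightarrow> g \<otimes> h \<in> L"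
  shows "(\<Sum>k\<in>L. (cmod (\<Sum>h\<in>K. a (k \<otimes> inv h) (\<alpha> k x) * z h))\<^sup>2) \<le> r\<^sup>2 * (\<Sum>h\<in>K. (cmod (z h))\<^sup>2)"
proof -
  define c where "c = (\<lambda>k. \<Sum>h\<in>K. a (k \<otimes> inv h) (\<alpha> k x) * z h)"
  define E where "E = (\<lambda>(s, t). inv s \<otimes> t) ` (L \<times> L \<union> K \<times> K) - {\<one>}"
  have E: "finite E" "E \<subseteq> carrier G - {\<one>}" using K L by (auto simp: E_def)
  define C1 where "C1 = (\<Sum>k\<in>L. cmod (c k))\<^sup>2"
  define C2 where "C2 = (\<Sum>h\<in>K. cmod (z h))\<^sup>2"
  define N1 where "N1 = (\<Sum>k\<in>L. (cmod (c k))\<^sup>2)"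
  define N2 where "N2 = (\<Sum>h\<in>K. (cmod (z h))\<^sup>2)"
  have approx: "N1 \<le> r\<^sup>2 * N2 + e * (C1 + r\<^sup>2 * C2)" if e: "e > 0" for e
  proof -
    obtain J :: "('g \<times> nat \<Rightarrow> nat) set" and q where q: "unitary_kernel G J q" "J \<noteq> {}"
      and small: "\<And>s. s \<in> E \<Longrightarrow> cmod (\<Sum>j\<in>J. q s j j) \<le> e * real (card J)"
      using small_trace_kernel[OF map E e] by blast
    define N where "N = real (card J)"
    have N: "N > 0" using unitary_kernelD(1)[OF q(1)] q(2) by (simp add: N_def card_gt_0_iff)
    show ?thesis
    proof (rule finite_orbit_covariant_rep[OF S(1,2) q(1) infinite_index_type], assumption+)
      fix \<pi> :: "('x \<Rightarrow> complex) \<Rightarrow> ('g \<Rightarrow> 'x \<Rightarrow> complex) operator" and u :: "'g \<Rightarrow> ('g \<Rightarrow> 'x \<Rightarrow> complex) operator"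
        and Z and b :: "'x \<times> ('g \<times> nat \<Rightarrow> nat) \<Rightarrow> 'g \<Rightarrow> 'x \<Rightarrow> complex"
      assume cov: "covariant_rep G \<alpha> \<pi> u" and Z: "finite Z" "\<And>f \<xi> i. i \<notin> Z \<Longrightarrow> \<pi> f \<xi> i = 0"
        and "\<And>y j. y \<in> S \<Longrightarrow> j \<in> J \<Longrightarrow> b (y, j) \<in> Z"
        and diag: "\<And>f k y j. k \<in> carrier G \<Longrightarrow> y \<in> S \<Longrightarrow> j \<in> J \<Longrightarrow>
          \<pi> f (u k (delta (b (y, j)))) = (\<lambda>i. f (\<alpha> k y) * u k (delta (b (y, j))) i)"
        and coeff: "\<And>k y j. k \<in> carrier G \<Longrightarrow> y \<in> S \<Longrightarrow> j \<in> J \<Longrightarrow>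
          u k (delta (b (y, j))) (b (y, j)) = (if \<alpha> k y = y then q k j j else 0)"
        and uZ: "\<And>k y j i. k \<in> carrier G \<Longrightarrow> y \<in> S \<Longrightarrow> j \<in> J \<Longrightarrow> i \<notin> Z \<Longrightarrow> u k (delta (b (y, j))) i = 0"
      note u = covariant_repD(2)[OF cov]
      define \<delta> where "\<delta> = (\<lambda>j. delta (b (x, j)))"
      have \<delta>: "\<delta> j \<in> ell2" for j by (simp add: \<delta>_def)
      have inner: "(\<Sum>j\<in>J. ell2_inner (u s (\<delta> j)) (\<delta> j)) = (if \<alpha> s x = x then \<Sum>j\<in>J. q s j j else 0)"
        if "s \<in> carrier G" for s
        using coeff[OF that S(3)] by (auto simp: \<delta>_def ell2_inner_delta)
      have one: "(\<Sum>j\<in>J. ell2_inner (u \<one> (\<delta> j)) (\<delta> j)) = of_real N"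
        using inner[OF one_closed] unitary_kernelD(4)[OF q(1)] by (simp add: N_def)
      have sm: "cmod (\<Sum>j\<in>J. ell2_inner (u (inv l \<otimes> k) (\<delta> j)) (\<delta> j)) \<le> e * N"
        if "(l, k) \<in> L \<times> L \<union> K \<times> K" "k \<noteq> l" for k l
      proof -
        have kl: "k \<in> carrier G" "l \<in> carrier G" using that K L by auto
        then have "inv l \<otimes> k \<noteq> \<one>" using that(2) inv_solve_left'[of \<one> l k] by auto
        then have "inv l \<otimes> k \<in> E" using that(1) by (force simp: E_def)
        then show ?thesis using small[of "inv l \<otimes> k"] inner[of "inv l \<otimes> k"] kl e N by (auto simp: N_def)
      qed
      have eN: "0 \<le> e * N" using e N by simp
      define \<zeta> where "\<zeta> = (\<lambda>j i. \<Sum>h\<in>K. z h * u h (\<delta> j) i)"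
      have ue: "u k (\<delta> j) \<in> ell2" if "k \<in> carrier G" for k j using unitary_repD(2)[OF u that \<delta>] .
      have \<zeta>: "\<zeta> j \<in> ell2" for j unfolding \<zeta>_def using K ue by (intro ell2_sum ell2_scale) auto
      have \<zeta>Z: "\<zeta> j i = 0" if "j \<in> J" "i \<notin> Z" for j i
        unfolding \<zeta>_def \<delta>_def using uZ[OF _ S(3) that] K by (intro sum.neutral) auto
      have T\<zeta>: "integrated_form G \<pi> u a (\<zeta> j) = (\<lambda>i. \<Sum>k\<in>L. c k * u k (\<delta> j) i)" if j: "j \<in> J" for j
      proof
        fix i
        have "integrated_form G \<pi> u a (\<zeta> j) i = (\<Sum>g\<in>cp_supp G a. \<Sum>h\<in>K. z h * (a g (\<alpha> (g \<otimes> h) x) * u (g \<otimes> h) (\<delta> j) i))"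
          unfolding integrated_form_def
        proof (rule sum.cong[OF refl])
          fix g assume "g \<in> cp_supp G a"
          then have g: "g \<in> carrier G" by (rule cp_supp_carrier)
          have "u g (\<zeta> j) = (\<lambda>i. \<Sum>h\<in>K. u g (\<lambda>i. z h * u h (\<delta> j) i) i)"
            unfolding \<zeta>_def using K ue by (intro bounded_operator_sum unitary_repD(1)[OF u g] ell2_scale) auto
          also have "\<dots> = (\<lambda>i. \<Sum>h\<in>K. z h * u (g \<otimes> h) (\<delta> j) i)"
            using bounded_operatorD(3)[OF unitary_repD(1)[OF u g] ue] unitary_repD(4)[OF u g _ \<delta>] K
            by (intro ext sum.cong) (auto simp: subsetD)
          finally have "\<pi> (a g) (u g (\<zeta> j)) = \<pi> (a g) (\<lambda>i. \<Sum>h\<in>K. z h * u (g \<otimes> h) (\<delta> j) i)" by simp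
          also have "\<dots> = (\<lambda>i. \<Sum>h\<in>K. \<pi> (a g) (\<lambda>i. z h * u (g \<otimes> h) (\<delta> j) i) i)"
            using K g ue by (intro bounded_operator_sum C0_star_repD(1)[OF covariant_repD(1)[OF cov] cpcD(1)[OF a]] ell2_scale) auto
          also have "\<dots> = (\<lambda>i. \<Sum>h\<in>K. z h * (a g (\<alpha> (g \<otimes> h) x) * u (g \<otimes> h) (\<delta> j) i))"
          proof (rule ext, rule sum.cong[OF refl])
            fix i h assume "h \<in> K"
            then have gh: "g \<otimes> h \<in> carrier G" using g K by auto
            have "\<pi> (a g) (\<lambda>i. z h * u (g \<otimes> h) (\<delta> j) i) = (\<lambda>i. z h * \<pi> (a g) (u (g \<otimes> h) (\<delta> j)) i)"
              by (rule bounded_operatorD(3)[OF C0_star_repD(1)[OF covariant_repD(1)[OF cov] cpcD(1)[OF a]] ue[OF gh]])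
            then show "\<pi> (a g) (\<lambda>i. z h * u (g \<otimes> h) (\<delta> j) i) i = z h * (a g (\<alpha> (g \<otimes> h) x) * u (g \<otimes> h) (\<delta> j) i)"
              using diag[OF gh S(3) j, of "a g"] by (simp add: \<delta>_def)
          qed
          finally show "\<pi> (a g) (u g (\<zeta> j)) i = (\<Sum>h\<in>K. z h * (a g (\<alpha> (g \<otimes> h) x) * u (g \<otimes> h) (\<delta> j) i))" by simp
        qed
        also have "\<dots> = (\<Sum>h\<in>K. \<Sum>g\<in>cp_supp G a. z h * (a g (\<alpha> (g \<otimes> h) x) * u (g \<otimes> h) (\<delta> j) i))" by (rule sum.swap)
        also have "\<dots> = (\<Sum>h\<in>K. \<Sum>k\<in>L. z h * (a (k \<otimes> inv h) (\<alpha> k x) * u k (\<delta> j) i))"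
        proof (rule sum.cong[OF refl])
          fix h assume h: "h \<in> K"
          then have hc: "h \<in> carrier G" using K by auto
          have inj: "inj_on (\<lambda>g. g \<otimes> h) (cp_supp G a)"
          proof (rule inj_onI)
            fix x y assume xy: "x \<in> cp_supp G a" "y \<in> cp_supp G a" "x \<otimes> h = y \<otimes> h"
            then have c: "x \<in> carrier G" "y \<in> carrier G" by (auto dest: cp_supp_carrier)
            have "x = (x \<otimes> h) \<otimes> inv h" using c hc by (simp add: m_assoc)
            also have "\<dots> = y" unfolding xy(3) using c hc by (simp add: m_assoc)
            finally show "x = y" .
          qed
          have "(\<Sum>k\<in>L. z h * (a (k \<otimes> inv h) (\<alpha> k x) * u k (\<delta> j) i)) =
              (\<Sum>k\<in>(\<lambda>g. g \<otimes> h) ` cp_supp G a. z h * (a (k \<otimes> inv h) (\<alpha> k x) * u k (\<delta> j) i))"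
          proof (rule sum.mono_neutral_right[OF L(1)])
            show "(\<lambda>g. g \<otimes> h) ` cp_supp G a \<subseteq> L" using KL[OF _ h] by auto
            show "\<forall>k\<in>L - (\<lambda>g. g \<otimes> h) ` cp_supp G a. z h * (a (k \<otimes> inv h) (\<alpha> k x) * u k (\<delta> j) i) = 0"
            proof
              fix k assume k: "k \<in> L - (\<lambda>g. g \<otimes> h) ` cp_supp G a"
              then have kc: "k \<in> carrier G" using L by auto
              have "a (k \<otimes> inv h) = (\<lambda>x. 0)"
              proof (rule ccontr)
                assume "a (k \<otimes> inv h) \<noteq> (\<lambda>x. 0)"
                then have "k \<otimes> inv h \<in> cp_supp G a" using kc hc by (auto simp: cp_supp_def)
                moreover have "k = (k \<otimes> inv h) \<otimes> h" using kc hc by (simp add: m_assoc)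
                ultimately show False using k by blast
              qed
              then show "z h * (a (k \<otimes> inv h) (\<alpha> k x) * u k (\<delta> j) i) = 0" by simp
            qed
          qed
          also have "\<dots> = (\<Sum>g\<in>cp_supp G a. z h * (a g (\<alpha> (g \<otimes> h) x) * u (g \<otimes> h) (\<delta> j) i))"
            unfolding sum.reindex[OF inj] comp_def
          proof (rule sum.cong[OF refl])
            fix g assume "g \<in> cp_supp G a"
            then have "g \<in> carrier G" by (rule cp_supp_carrier)
            then have "g \<otimes> h \<otimes> inv h = g" using hc by (simp add: m_assoc)
            then show "z h * (a (g \<otimes> h \<otimes> inv h) (\<alpha> (g \<otimes> h) x) * u (g \<otimes> h) (\<delta> j) i) =
              z h * (a g (\<alpha> (g \<otimes> h) x) * u (g \<otimes> h) (\<delta> j) i)" by simp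
          qed
          finally show "(\<Sum>g\<in>cp_supp G a. z h * (a g (\<alpha> (g \<otimes> h) x) * u (g \<otimes> h) (\<delta> j) i)) =
            (\<Sum>k\<in>L. z h * (a (k \<otimes> inv h) (\<alpha> k x) * u k (\<delta> j) i))" ..
        qed
        also have "\<dots> = (\<Sum>k\<in>L. c k * u k (\<delta> j) i)"
          unfolding c_def sum_distrib_right by (subst sum.swap) (simp add: mult_ac)
        finally show "integrated_form G \<pi> u a (\<zeta> j) i = (\<Sum>k\<in>L. c k * u k (\<delta> j) i)" .
      qed
      define P1 where "P1 = (\<Sum>j\<in>J. (ell2_norm (\<lambda>i. \<Sum>k\<in>L. c k * u k (\<delta> j) i))\<^sup>2)"
      define P2 where "P2 = (\<Sum>j\<in>J. (ell2_norm (\<zeta> j))\<^sup>2)"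
      have "cmod (of_real P1 - of_real N * of_real N1) \<le> e * N * C1"
        unfolding P1_def N1_def C1_def
        by (rule small_trace_gram[OF u \<delta> L(2) eN one sm]) auto
      then have "\<bar>P1 - N * N1\<bar> \<le> e * N * C1" by (simp flip: of_real_mult of_real_diff)
      then have 1: "N * N1 - e * N * C1 \<le> P1" by linarith
      have "cmod (of_real P2 - of_real N * of_real N2) \<le> e * N * C2"
        unfolding P2_def N2_def C2_def \<zeta>_def
        by (rule small_trace_gram[OF u \<delta> K(2) eN one sm]) auto
      then have "\<bar>P2 - N * N2\<bar> \<le> e * N * C2" by (simp flip: of_real_mult of_real_diff)
      then have 2: "P2 \<le> N * N2 + e * N * C2" by linarith
      have "P1 \<le> (\<Sum>j\<in>J. r\<^sup>2 * (ell2_norm (\<zeta> j))\<^sup>2)"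
        unfolding P1_def
      proof (rule sum_mono)
        fix j assume j: "j \<in> J"
        have "ell2_norm (integrated_form G \<pi> u a (\<zeta> j)) \<le> r * ell2_norm (\<zeta> j)"
          by (rule le[OF cov Z(1) Z(2) \<zeta> \<zeta>Z[OF j]])
        then show "(ell2_norm (\<lambda>i. \<Sum>k\<in>L. c k * u k (\<delta> j) i))\<^sup>2 \<le> r\<^sup>2 * (ell2_norm (\<zeta> j))\<^sup>2"
          unfolding T\<zeta>[OF j] power_mult_distrib[symmetric] by (intro power_mono) auto
      qed
      also have "\<dots> = r\<^sup>2 * P2" by (simp add: P2_def sum_distrib_left)
      finally have "N * N1 - e * N * C1 \<le> r\<^sup>2 * (N * N2 + e * N * C2)"
        using 1 mult_left_mono[OF 2, of "r\<^sup>2"] by simp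
      then have "N * N1 \<le> N * (r\<^sup>2 * N2 + e * (C1 + r\<^sup>2 * C2))" by (simp add: algebra_simps)
      then show ?thesis using N by simp
    qed
  qed
  have "N1 \<le> r\<^sup>2 * N2"
  proof (rule field_le_epsilon)
    fix d :: real assume d: "d > 0"
    (* C + 1 is used as a divisor because C may vanish *)
    define C where "C = C1 + r\<^sup>2 * C2"
    have C: "C \<ge> 0" by (simp add: C_def C1_def C2_def)
    have "N1 \<le> r\<^sup>2 * N2 + (d / (C + 1)) * C" unfolding C_def
      by (rule approx) (use d C in \<open>auto simp: C_def[symmetric]\<close>)
    also have "(d / (C + 1)) * C \<le> d" using d C by (simp add: field_simps)
    finally show "N1 \<le> r\<^sup>2 * N2 + d" by simp
  qed
  then show ?thesis by (simp add: N1_def N2_def c_def)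
qed

text \<open>Cutting a vector \<open>\<xi>\<close> into the pieces \<open>w(h) u(h\<^sup>-\<^sup>1) \<xi>\<close> with an almost invariant \<open>w\<close> turns the action of
  \<open>a\<close> on \<open>\<xi>\<close> into that of a matrix over \<open>C0\<close>.\<close>

lemma integrated_form_bound_from_matrices:
  fixes \<pi> :: "('x \<Rightarrow> complex) \<Rightarrow> 'i operator"
  assumes am: "\<And>e. e > 0 \<Longrightarrow> \<exists>K (w :: 'g \<Rightarrow> real). finite K \<and> K \<subseteq> carrier G \<and> (\<forall>s. s \<notin> K \<longrightarrow> w s = 0) \<and> (\<Sum>s\<in>K. (w s)\<^sup>2) \<le> 1 \<and>
      (\<forall>g\<in>cp_supp G a. \<forall>h\<in>cp_supp G a.
         \<bar>(\<Sum>k\<in>(\<lambda>(s, t). s \<otimes> t) ` (cp_supp G a \<times> K). w (inv g \<otimes> k) * w (inv h \<otimes> k)) - 1\<bar> \<le> e)"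
    and cov: "covariant_rep G \<alpha> \<pi> u" and a: "a \<in> cpc" and \<xi>: "\<xi> \<in> ell2" and r: "0 \<le> r"
    and bd: "\<And>K x z. finite K \<Longrightarrow> K \<subseteq> carrier G \<Longrightarrow>
      (\<Sum>k\<in>(\<lambda>(s, t). s \<otimes> t) ` (cp_supp G a \<times> K). (cmod (\<Sum>h\<in>K. a (k \<otimes> inv h) (\<alpha> k x) * z h))\<^sup>2) \<le> r\<^sup>2 * (\<Sum>h\<in>K. (cmod (z h))\<^sup>2)"
  shows "ell2_norm (integrated_form G \<pi> u a \<xi>) \<le> r * ell2_norm \<xi>"
proof -
  note C = covariant_repD[OF cov]
  define S where "S = cp_supp G a"
  have S: "finite S" "S \<subseteq> carrier G" using cpcD(2)[OF a] cp_supp_subset by (auto simp: S_def)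
  define \<zeta> where "\<zeta> = (\<lambda>g. \<pi> (a g) (u g \<xi>))"
  have \<zeta>: "\<zeta> g \<in> ell2" if "g \<in> carrier G" for g unfolding \<zeta>_def by (rule covariant_ell2[OF cov cpcD(1)[OF a] that \<xi>])
  define M where "M = (\<Sum>g\<in>S. ell2_norm (\<zeta> g))\<^sup>2"
  define T where "T = ell2_norm (integrated_form G \<pi> u a \<xi>)"
  have approx: "T\<^sup>2 \<le> (r * ell2_norm \<xi>)\<^sup>2 + e * M" if e: "e > 0" for e
  proof -
    obtain K and w :: "'g \<Rightarrow> real" where K: "finite K" "K \<subseteq> carrier G" and w0: "\<And>s. s \<notin> K \<Longrightarrow> w s = 0"
      and w1: "(\<Sum>s\<in>K. (w s)\<^sup>2) \<le> 1"
      and w: "\<And>g h. g \<in> S \<Longrightarrow> h \<in> S \<Longrightarrow> \<bar>(\<Sum>k\<in>(\<lambda>(s, t). s \<otimes> t) ` (S \<times> K). w (inv g \<otimes> k) * w (inv h \<otimes> k)) - 1\<bar> \<le> e"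
      using am[OF e] unfolding S_def by blast
    define L where "L = (\<lambda>(s, t). s \<otimes> t) ` (S \<times> K)"
    have L: "finite L" "L \<subseteq> carrier G" using S K by (auto simp: L_def)
    define b where "b = (\<lambda>k h. act_fun G \<alpha> (inv k) (a (k \<otimes> inv h)))"
    have b: "b k h \<in> C0" if "k \<in> carrier G" for k h
      unfolding b_def using that by (intro act_fun_C0 cpcD(1)[OF a]) auto
    define \<eta> where "\<eta> = (\<lambda>h i. complex_of_real (w h) * u (inv h) \<xi> i)"
    have u\<xi>: "u g \<xi> \<in> ell2" if "g \<in> carrier G" for g using unitary_repD(2)[OF C(2) that \<xi>] .
    have \<eta>: "\<eta> h \<in> ell2" if "h \<in> K" for h unfolding \<eta>_def using that K by (intro ell2_scale u\<xi>) auto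
    have "(\<Sum>k\<in>L. (ell2_norm (\<lambda>i. \<Sum>h\<in>K. \<pi> (b k h) (\<eta> h) i))\<^sup>2) \<le> r\<^sup>2 * (\<Sum>h\<in>K. (ell2_norm (\<eta> h))\<^sup>2)"
    proof (rule C0_star_rep_matrix_contractive[OF locally_compact C(1) L(1) K(1)])
      show "b k h \<in> C0" if "k \<in> L" for k h using b L that by auto
      show "(\<Sum>k\<in>L. (cmod (\<Sum>h\<in>K. b k h x * z h))\<^sup>2) \<le> r\<^sup>2 * (\<Sum>h\<in>K. (cmod (z h))\<^sup>2)" for x z
      proof -
        have "(\<Sum>k\<in>L. (cmod (\<Sum>h\<in>K. b k h x * z h))\<^sup>2) = (\<Sum>k\<in>L. (cmod (\<Sum>h\<in>K. a (k \<otimes> inv h) (\<alpha> k x) * z h))\<^sup>2)"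
          using L by (intro sum.cong refl) (auto simp: b_def act_fun_def subsetD)
        then show ?thesis using bd[OF K, of x z] by (simp add: L_def S_def)
      qed
    qed (use \<eta> in auto)
    also have "(\<Sum>h\<in>K. (ell2_norm (\<eta> h))\<^sup>2) = (\<Sum>h\<in>K. (w h)\<^sup>2) * (ell2_norm \<xi>)\<^sup>2"
      unfolding sum_distrib_right
    proof (rule sum.cong[OF refl])
      fix h assume "h \<in> K"
      then have h: "inv h \<in> carrier G" using K by auto
      show "(ell2_norm (\<eta> h))\<^sup>2 = (w h)\<^sup>2 * (ell2_norm \<xi>)\<^sup>2"
        unfolding \<eta>_def ell2_norm_scale[OF u\<xi>[OF h]] unitary_repD(5)[OF C(2) h \<xi>] by (simp add: power_mult_distrib)
    qed
    also have "r\<^sup>2 * ((\<Sum>h\<in>K. (w h)\<^sup>2) * (ell2_norm \<xi>)\<^sup>2) \<le> r\<^sup>2 * (1 * (ell2_norm \<xi>)\<^sup>2)"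
      by (intro mult_left_mono mult_right_mono w1) auto
    also have "\<dots> = (r * ell2_norm \<xi>)\<^sup>2" by (simp add: power_mult_distrib)
    finally have 1: "(\<Sum>k\<in>L. (ell2_norm (\<lambda>i. \<Sum>h\<in>K. \<pi> (b k h) (\<eta> h) i))\<^sup>2) \<le> (r * ell2_norm \<xi>)\<^sup>2" .
    have 2: "ell2_norm (\<lambda>i. \<Sum>h\<in>K. \<pi> (b k h) (\<eta> h) i) = ell2_norm (\<lambda>i. \<Sum>g\<in>S. complex_of_real (w (inv g \<otimes> k)) * \<zeta> g i)"
      if k: "k \<in> L" for k
    proof -
      have kc: "k \<in> carrier G" using k L by auto
      have pe: "\<pi> (b k h) (\<eta> h) \<in> ell2" if "h \<in> K" for h by (rule C0_star_repD(6)[OF C(1) b[OF kc] \<eta>[OF that]])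
      have "u k (\<lambda>i. \<Sum>h\<in>K. \<pi> (b k h) (\<eta> h) i) = (\<lambda>i. \<Sum>h\<in>K. u k (\<pi> (b k h) (\<eta> h)) i)"
        by (intro bounded_operator_sum unitary_repD(1)[OF C(2) kc] pe)
      also have "\<dots> = (\<lambda>i. \<Sum>h\<in>K. complex_of_real (w h) * \<zeta> (k \<otimes> inv h) i)"
      proof (rule ext, rule sum.cong[OF refl])
        fix i h assume h: "h \<in> K"
        then have hc: "h \<in> carrier G" "inv h \<in> carrier G" using K by auto
        have "act_fun G \<alpha> k (b k h) = a (k \<otimes> inv h)"
          unfolding b_def using act_fun_mult[OF kc inv_closed[OF kc], of "a (k \<otimes> inv h)"] kc by simp
        then have "u k (\<pi> (b k h) (\<eta> h)) = \<pi> (a (k \<otimes> inv h)) (u k (\<eta> h))"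
          using C(3)[OF kc b[OF kc] \<eta>[OF h]] by simp
        also have "u k (\<eta> h) = (\<lambda>i. complex_of_real (w h) * u (k \<otimes> inv h) \<xi> i)"
          unfolding \<eta>_def using bounded_operatorD(3)[OF unitary_repD(1)[OF C(2) kc] u\<xi>[OF hc(2)]]
            unitary_repD(4)[OF C(2) kc hc(2) \<xi>] by simp
        also have "\<pi> (a (k \<otimes> inv h)) \<dots> = (\<lambda>i. complex_of_real (w h) * \<zeta> (k \<otimes> inv h) i)"
          unfolding \<zeta>_def using kc hc by (intro bounded_operatorD(3) C0_star_repD(1)[OF C(1) cpcD(1)[OF a]] u\<xi>) auto
        finally show "u k (\<pi> (b k h) (\<eta> h)) i = complex_of_real (w h) * \<zeta> (k \<otimes> inv h) i" by simp
      qed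
      also have "\<dots> = (\<lambda>i. \<Sum>g\<in>S. complex_of_real (w (inv g \<otimes> k)) * \<zeta> g i)"
      proof
        fix i
        define m where "m = (\<lambda>h. k \<otimes> inv h)"
        define K' where "K' = {h \<in> K. m h \<in> S}"
        define S' where "S' = {g \<in> S. inv g \<otimes> k \<in> K}"
        have z: "\<zeta> g = (\<lambda>i. 0)" if "g \<in> carrier G" "g \<notin> S" for g
          using that C0_star_rep_zero[OF C(1) u\<xi>[OF that(1)]] by (auto simp: \<zeta>_def S_def cp_supp_def)
        have "(\<Sum>h\<in>K. complex_of_real (w h) * \<zeta> (m h) i) = (\<Sum>h\<in>K'. complex_of_real (w h) * \<zeta> (m h) i)"
        proof -
          have "\<zeta> (m h) = (\<lambda>i. 0)" if "h \<in> K" "m h \<notin> S" for h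
            using z[of "m h"] that K kc by (auto simp: m_def)
          then show ?thesis using K(1) by (intro sum.mono_neutral_right) (auto simp: K'_def)
        qed
        also have "\<dots> = (\<Sum>g\<in>S'. complex_of_real (w (inv g \<otimes> k)) * \<zeta> g i)"
        proof (rule sum.reindex_bij_witness[where i="\<lambda>g. inv g \<otimes> k" and j=m])
          fix h assume "h \<in> K'"
          then have h: "h \<in> K" "m h \<in> S" "h \<in> carrier G" using K by (auto simp: K'_def)
          show e: "inv (m h) \<otimes> k = h" using h kc by (simp add: m_def inv_mult_group m_assoc)
          show "m h \<in> S'" using h e by (simp add: S'_def)
          show "complex_of_real (w (inv (m h) \<otimes> k)) * \<zeta> (m h) i = complex_of_real (w h) * \<zeta> (m h) i" using e by simp
        next
          fix g assume "g \<in> S'"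
          then have g: "g \<in> S" "inv g \<otimes> k \<in> K" "g \<in> carrier G" using S by (auto simp: S'_def)
          show e: "m (inv g \<otimes> k) = g" using g kc by (simp add: m_def inv_mult_group flip: m_assoc)
          show "inv g \<otimes> k \<in> K'" using g e by (simp add: K'_def)
        qed
        also have "\<dots> = (\<Sum>g\<in>S. complex_of_real (w (inv g \<otimes> k)) * \<zeta> g i)"
          using S w0 by (intro sum.mono_neutral_left) (auto simp: S'_def)
        finally show "(\<Sum>h\<in>K. complex_of_real (w h) * \<zeta> (k \<otimes> inv h) i) = (\<Sum>g\<in>S. complex_of_real (w (inv g \<otimes> k)) * \<zeta> g i)"
          by (simp add: m_def)
      qed
      finally have "u k (\<lambda>i. \<Sum>h\<in>K. \<pi> (b k h) (\<eta> h) i) = (\<lambda>i. \<Sum>g\<in>S. complex_of_real (w (inv g \<otimes> k)) * \<zeta> g i)" .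
      then show ?thesis using unitary_repD(5)[OF C(2) kc ell2_sum[of K "\<lambda>h. \<pi> (b k h) (\<eta> h)"]] pe by simp
    qed
    define X where "X = (\<lambda>g h. \<Sum>k\<in>L. w (inv g \<otimes> k) * w (inv h \<otimes> k))"
    have \<zeta>S: "\<zeta> g \<in> ell2" if "g \<in> S" for g using \<zeta> S that by auto
    define Y where "Y = (\<Sum>k\<in>L. (ell2_norm (\<lambda>i. \<Sum>g\<in>S. complex_of_real (w (inv g \<otimes> k)) * \<zeta> g i))\<^sup>2)"
    have "of_real Y = (\<Sum>k\<in>L. \<Sum>g\<in>S. \<Sum>h\<in>S. complex_of_real (w (inv g \<otimes> k)) * cnj (complex_of_real (w (inv h \<otimes> k))) * ell2_inner (\<zeta> g) (\<zeta> h))"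
      unfolding Y_def of_real_sum using ell2_norm_sum_square[of S \<zeta>] \<zeta>S by (intro sum.cong refl) auto
    also have "\<dots> = (\<Sum>g\<in>S. \<Sum>h\<in>S. of_real (X g h) * ell2_inner (\<zeta> g) (\<zeta> h))"
      unfolding X_def of_real_sum sum_distrib_right
      by (subst sum.swap, rule sum.cong[OF refl], subst sum.swap) simp
    finally have Ye: "of_real Y = (\<Sum>g\<in>S. \<Sum>h\<in>S. of_real (X g h) * ell2_inner (\<zeta> g) (\<zeta> h))" .
    have "integrated_form G \<pi> u a \<xi> = (\<lambda>i. \<Sum>g\<in>S. 1 * \<zeta> g i)" by (simp add: integrated_form_def S_def \<zeta>_def)
    then have "complex_of_real (T\<^sup>2) = (\<Sum>g\<in>S. \<Sum>h\<in>S. 1 * cnj 1 * ell2_inner (\<zeta> g) (\<zeta> h))"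
      unfolding T_def using ell2_norm_sum_square[of S \<zeta> "\<lambda>g. 1"] \<zeta>S by simp
    then have "of_real Y - of_real (T\<^sup>2) = (\<Sum>g\<in>S. \<Sum>h\<in>S. (of_real (X g h) - 1) * ell2_inner (\<zeta> g) (\<zeta> h))"
      unfolding Ye by (simp add: sum_subtractf left_diff_distrib)
    also have "cmod \<dots> \<le> e * M" unfolding M_def
    proof (rule double_sum_estimate)
      fix g h assume gh: "g \<in> S" "h \<in> S"
      have "cmod (complex_of_real (X g h) - 1) = \<bar>X g h - 1\<bar>"
        by (metis norm_of_real of_real_1 of_real_diff)
      also have "\<dots> \<le> e" using w[OF gh] by (simp add: X_def L_def)
      finally show "cmod ((of_real (X g h) - 1) * ell2_inner (\<zeta> g) (\<zeta> h)) \<le> e * (ell2_norm (\<zeta> g) * ell2_norm (\<zeta> h))"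
        unfolding norm_mult using e by (intro mult_mono ell2_Cauchy_Schwarz \<zeta>S gh) auto
    qed
    finally have "\<bar>Y - T\<^sup>2\<bar> \<le> e * M" by (simp flip: of_real_diff of_real_power)
    moreover have "Y \<le> (r * ell2_norm \<xi>)\<^sup>2" using 1 2 by (simp add: Y_def)
    ultimately show ?thesis by linarith
  qed
  have "T\<^sup>2 \<le> (r * ell2_norm \<xi>)\<^sup>2"
  proof (rule field_le_epsilon)
    fix d :: real assume d: "d > 0"
    have M: "M \<ge> 0" by (simp add: M_def)
    have "T\<^sup>2 \<le> (r * ell2_norm \<xi>)\<^sup>2 + (d / (M + 1)) * M" by (rule approx) (use d M in auto)
    also have "(d / (M + 1)) * M \<le> d" using d M by (simp add: field_simps)
    finally show "T\<^sup>2 \<le> (r * ell2_norm \<xi>)\<^sup>2 + d" by simp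
  qed
  then show ?thesis unfolding T_def by (rule power2_le_imp_le) (simp add: r)
qed

lemma finite_orbit_exists:
  assumes "closure (\<Union>{S \<in> orbits G UNIV \<alpha>. finite S}) = UNIV"
  obtains S where "S \<in> {S \<in> orbits G UNIV \<alpha>. finite S}"
proof (cases "{S \<in> orbits G UNIV \<alpha>. finite S} = {}")
  case True
  have "closure (\<Union>{}) = (UNIV :: 'x set)" using assms unfolding True .
  then show ?thesis by simp
qed (use that in blast)

text \<open>The matrix inequality at points of finite orbits extends to all points by continuity in \<open>x\<close>.\<close>

lemma universal_norm_le_of_finite_dimensional:
  assumes map: "MAP G" and dense: "closure (\<Union>{S \<in> orbits G UNIV \<alpha>. finite S}) = UNIV"
    and am: "amenable_action G \<alpha>" and a: "a \<in> cpc" and r: "0 \<le> r"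
    and le: "\<And>(\<pi> :: ('x \<Rightarrow> complex) \<Rightarrow> ('g \<Rightarrow> 'x \<Rightarrow> complex) operator) u Z \<zeta>. covariant_rep G \<alpha> \<pi> u \<Longrightarrow> finite Z \<Longrightarrow>
       (\<And>f \<xi> i. i \<notin> Z \<Longrightarrow> \<pi> f \<xi> i = 0) \<Longrightarrow> \<zeta> \<in> ell2 \<Longrightarrow> (\<And>i. i \<notin> Z \<Longrightarrow> \<zeta> i = 0) \<Longrightarrow>
       ell2_norm (integrated_form G \<pi> u a \<zeta>) \<le> r * ell2_norm \<zeta>"
  shows "universal_norm G \<alpha> a \<le> r"
proof (rule universal_norm_le[OF r])
  fix \<pi> :: "('x \<Rightarrow> complex) \<Rightarrow> ('g \<Rightarrow> 'x \<Rightarrow> complex) operator" and u and \<xi> :: "('g \<Rightarrow> 'x \<Rightarrow> complex) \<Rightarrow> complex"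
  assume cov: "covariant_rep G \<alpha> \<pi> u" and \<xi>: "\<xi> \<in> ell2"
  let ?W = "\<Union>{S \<in> orbits G UNIV \<alpha>. finite S}"
  obtain S0 where S0: "S0 \<in> {S \<in> orbits G UNIV \<alpha>. finite S}" by (rule finite_orbit_exists[OF dense])
  define P where "P = cp_supp G a"
  have P: "finite P" "P \<subseteq> carrier G" using cpcD(2)[OF a] cp_supp_subset by (auto simp: P_def)
  show "ell2_norm (integrated_form G \<pi> u a \<xi>) \<le> r * ell2_norm \<xi>"
  proof (rule integrated_form_bound_from_matrices[OF _ cov a \<xi> r])
    fix e :: real assume e: "e > 0"
    show "\<exists>K (w :: 'g \<Rightarrow> real). finite K \<and> K \<subseteq> carrier G \<and> (\<forall>s. s \<notin> K \<longrightarrow> w s = 0) \<and> (\<Sum>s\<in>K. (w s)\<^sup>2) \<le> 1 \<and>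
      (\<forall>g\<in>cp_supp G a. \<forall>h\<in>cp_supp G a.
         \<bar>(\<Sum>k\<in>(\<lambda>(s, t). s \<otimes> t) ` (cp_supp G a \<times> K). w (inv g \<otimes> k) * w (inv h \<otimes> k)) - 1\<bar> \<le> e)"
      unfolding P_def[symmetric]
      by (rule approximately_invariant_vectors[OF approximately_invariant_probability[OF am S0] P e]) blast+
  next
    fix K x and z :: "'g \<Rightarrow> complex" assume K: "finite K" "K \<subseteq> carrier G"
    define L where "L = (\<lambda>(s, t). s \<otimes> t) ` (P \<times> K)"
    have L: "finite L" "L \<subseteq> carrier G" using P K by (auto simp: L_def)
    define F where "F = (\<lambda>x. \<Sum>k\<in>L. (cmod (\<Sum>h\<in>K. a (k \<otimes> inv h) (\<alpha> k x) * z h))\<^sup>2)"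
    define c where "c = r\<^sup>2 * (\<Sum>h\<in>K. (cmod (z h))\<^sup>2)"
    have "continuous_on UNIV (\<lambda>x. a (k \<otimes> inv h) (\<alpha> k x))" if "k \<in> L" for k h
      using continuous_on_compose2[OF C0_continuous[OF cpcD(1)[OF a]] act_continuous] L that by auto
    then have "continuous_on UNIV F" unfolding F_def by (intro continuous_intros)
    then have cl: "closed {x. F x \<le> c}" by (intro closed_Collect_le) auto
    have "?W \<subseteq> {x. F x \<le> c}"
    proof
      fix y assume "y \<in> ?W"
      then obtain S where S: "S \<in> {S \<in> orbits G UNIV \<alpha>. finite S}" and y: "y \<in> S" by blast
      note fS = finite_invariant_set_of_orbit[OF S]
      show "y \<in> {x. F x \<le> c}"
        unfolding F_def c_def mem_Collect_eq
      proof (rule finite_orbit_bound[OF map fS(1,3) y a r le K L])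
        show "g \<otimes> h \<in> L" if "g \<in> cp_supp G a" "h \<in> K" for g h using that by (force simp: L_def P_def)
      qed
    qed
    then have "closure ?W \<subseteq> {x. F x \<le> c}" by (rule closure_minimal[OF _ cl])
    then show "(\<Sum>k\<in>(\<lambda>(s, t). s \<otimes> t) ` (cp_supp G a \<times> K). (cmod (\<Sum>h\<in>K. a (k \<otimes> inv h) (\<alpha> k x) * z h))\<^sup>2) \<le> r\<^sup>2 * (\<Sum>h\<in>K. (cmod (z h))\<^sup>2)"
      using dense by (auto simp: F_def c_def L_def P_def)
  qed
qed

theorem MAP_dense_imp_RFD:
  assumes map: "MAP G" and dense: "closure (\<Union>{S \<in> orbits G UNIV \<alpha>. finite S}) = UNIV"
    and am: "amenable_action G \<alpha>"
  shows "RFD (full_crossed_product G \<alpha>)"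
  unfolding full_crossed_product_def
proof (rule pre_normed_star_algebra.RFD_completionI[OF pre_normed_star_algebra_cp])
  fix a r assume a: "a \<in> cpc" and r: "0 \<le> r" and lt: "r < sa_norm cp a"
  obtain \<pi> :: "('x \<Rightarrow> complex) \<Rightarrow> ('g \<Rightarrow> 'x \<Rightarrow> complex) operator" and u Z \<zeta> where cov: "covariant_rep G \<alpha> \<pi> u"
    and Z: "finite Z" "\<And>f \<xi> i. i \<notin> Z \<Longrightarrow> \<pi> f \<xi> i = 0" and \<zeta>: "\<zeta> \<in> ell2" "\<And>i. i \<notin> Z \<Longrightarrow> \<zeta> i = 0"
    and big: "r * ell2_norm \<zeta> < ell2_norm (integrated_form G \<pi> u a \<zeta>)"
  proof (rule ccontr)
    assume no: "\<not> thesis"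
    have "universal_norm G \<alpha> a \<le> r"
    proof (rule universal_norm_le_of_finite_dimensional[OF map dense am a r], rule ccontr)
      fix \<pi> :: "('x \<Rightarrow> complex) \<Rightarrow> ('g \<Rightarrow> 'x \<Rightarrow> complex) operator" and u Z \<zeta>
      assume H: "covariant_rep G \<alpha> \<pi> u" "finite Z" "\<And>f \<xi> i. i \<notin> Z \<Longrightarrow> \<pi> f \<xi> i = 0" "\<zeta> \<in> ell2" "\<And>i. i \<notin> Z \<Longrightarrow> \<zeta> i = 0"
        "\<not> ell2_norm (integrated_form G \<pi> u a \<zeta>) \<le> r * ell2_norm \<zeta>"
      have "r * ell2_norm \<zeta> < ell2_norm (integrated_form G \<pi> u a \<zeta>)" using H(6) by simp
      from that[OF H(1,2,3,4,5) this] show False using no by contradiction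
    qed
    then show False using lt by (simp add: cp_simps)
  qed
  show "\<exists>n \<phi>. fd_star_rep cp n \<phi> \<and>
       (\<forall>b\<in>cpc. \<forall>v. L2_set (\<lambda>i. cmod (\<Sum>j<n. \<phi> b $$ (i, j) * v j)) {..<n} \<le>
           sa_norm cp b * L2_set (\<lambda>j. cmod (v j)) {..<n}) \<and>
       (\<exists>v. r * L2_set (\<lambda>j. cmod (v j)) {..<n} < L2_set (\<lambda>i. cmod (\<Sum>j<n. \<phi> a $$ (i, j) * v j)) {..<n})"
  proof (rule fd_star_rep_of_finite_support[OF cov Z], assumption+)
    fix n and \<phi> :: "('g \<Rightarrow> 'x \<Rightarrow> complex) \<Rightarrow> complex mat" and e :: "nat \<Rightarrow> 'g \<Rightarrow> 'x \<Rightarrow> complex"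
    assume e: "bij_betw e {..<n} Z" and \<phi>: "fd_star_rep cp n \<phi>"
      and \<phi>T: "\<And>b \<zeta> i. b \<in> cpc \<Longrightarrow> \<zeta> \<in> ell2 \<Longrightarrow> (\<And>k. k \<notin> Z \<Longrightarrow> \<zeta> k = 0) \<Longrightarrow> i < n \<Longrightarrow>
         (\<Sum>j<n. \<phi> b $$ (i, j) * \<zeta> (e j)) = integrated_form G \<pi> u b \<zeta> (e i)"
    have L2: "L2_set (\<lambda>i. cmod (\<eta> (e i))) {..<n} = ell2_norm \<eta>" if "\<And>k. k \<notin> Z \<Longrightarrow> \<eta> k = 0" for \<eta> :: "('g \<Rightarrow> 'x \<Rightarrow> complex) \<Rightarrow> complex"
    proof -
      have "(\<Sum>i<n. (cmod (\<eta> (e i)))\<^sup>2) = (\<Sum>k\<in>Z. (cmod (\<eta> k))\<^sup>2)"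
        by (rule sum.reindex_bij_betw[OF e, of "\<lambda>k. (cmod (\<eta> k))\<^sup>2"])
      then show ?thesis using ell2_norm_finite_support[OF Z(1) that] by (simp add: L2_set_def)
    qed
    have TZ: "integrated_form G \<pi> u b \<eta> k = 0" if "k \<notin> Z" for b \<eta> k
      using Z(2)[OF that] by (simp add: integrated_form_def)
    have norm_eq: "L2_set (\<lambda>i. cmod (\<Sum>j<n. \<phi> b $$ (i, j) * \<eta> (e j))) {..<n} = ell2_norm (integrated_form G \<pi> u b \<eta>)"
      if "b \<in> cpc" "\<eta> \<in> ell2" "\<And>k. k \<notin> Z \<Longrightarrow> \<eta> k = 0" for b \<eta>
    proof -
      have "L2_set (\<lambda>i. cmod (\<Sum>j<n. \<phi> b $$ (i, j) * \<eta> (e j))) {..<n} = L2_set (\<lambda>i. cmod (integrated_form G \<pi> u b \<eta> (e i))) {..<n}"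
        using \<phi>T[OF that] by (intro L2_set_cong) auto
      then show ?thesis using L2[OF TZ] by simp
    qed
    have contr: "L2_set (\<lambda>i. cmod (\<Sum>j<n. \<phi> b $$ (i, j) * v j)) {..<n} \<le> sa_norm cp b * L2_set (\<lambda>j. cmod (v j)) {..<n}"
      if b: "b \<in> cpc" for b and v :: "nat \<Rightarrow> complex"
    proof -
      define \<eta> where "\<eta> = (\<lambda>k. if k \<in> Z then v (inv_into {..<n} e k) else 0)"
      have \<eta>0: "\<eta> k = 0" if "k \<notin> Z" for k using that by (simp add: \<eta>_def)
      have \<eta>: "\<eta> \<in> ell2" by (rule finite_support_ell2[OF Z(1) \<eta>0])
      have \<eta>e: "\<eta> (e j) = v j" if "j < n" for j
        using that e by (auto simp: \<eta>_def bij_betw_def)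
      have "L2_set (\<lambda>i. cmod (\<Sum>j<n. \<phi> b $$ (i, j) * v j)) {..<n} = L2_set (\<lambda>i. cmod (\<Sum>j<n. \<phi> b $$ (i, j) * \<eta> (e j))) {..<n}"
        using \<eta>e by simp
      also have "\<dots> = ell2_norm (integrated_form G \<pi> u b \<eta>)" by (rule norm_eq[OF b \<eta> \<eta>0])
      also have "\<dots> \<le> universal_norm G \<alpha> b * ell2_norm \<eta>" by (rule universal_norm_bound[OF cov b \<eta>])
      also have "ell2_norm \<eta> = L2_set (\<lambda>j. cmod (v j)) {..<n}"
      proof -
        have "ell2_norm \<eta> = L2_set (\<lambda>i. cmod (\<eta> (e i))) {..<n}" by (rule L2[OF \<eta>0, symmetric])
        also have "\<dots> = L2_set (\<lambda>j. cmod (v j)) {..<n}" using \<eta>e by (intro L2_set_cong) auto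
        finally show ?thesis .
      qed
      finally show ?thesis by (simp add: cp_simps)
    qed
    have wit: "r * L2_set (\<lambda>j. cmod (\<zeta> (e j))) {..<n} < L2_set (\<lambda>i. cmod (\<Sum>j<n. \<phi> a $$ (i, j) * \<zeta> (e j))) {..<n}"
    proof -
      have "L2_set (\<lambda>i. cmod (\<Sum>j<n. \<phi> a $$ (i, j) * \<zeta> (e j))) {..<n} = ell2_norm (integrated_form G \<pi> u a \<zeta>)"
        by (rule norm_eq[OF a \<zeta>])
      moreover have "L2_set (\<lambda>j. cmod (\<zeta> (e j))) {..<n} = ell2_norm \<zeta>" by (rule L2[OF \<zeta>(2)])
      ultimately show ?thesis using big by simp
    qed
    show "\<exists>n \<phi>. fd_star_rep cp n \<phi> \<and>
         (\<forall>b\<in>cpc. \<forall>v. L2_set (\<lambda>i. cmod (\<Sum>j<n. \<phi> b $$ (i, j) * v j)) {..<n} \<le>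
             sa_norm cp b * L2_set (\<lambda>j. cmod (v j)) {..<n}) \<and>
         (\<exists>v. r * L2_set (\<lambda>j. cmod (v j)) {..<n} < L2_set (\<lambda>i. cmod (\<Sum>j<n. \<phi> a $$ (i, j) * v j)) {..<n})"
      using \<phi> contr wit by (intro exI[of _ n] exI[of _ \<phi>] conjI ballI allI exI[of _ "\<lambda>j. \<zeta> (e j)"])
  qed
qed

end

theorem corollary2p9:
  fixes G :: "('g, 'b) monoid_scheme"
    and \<alpha> :: "'g \<Rightarrow> 'x::{t2_space, second_countable_topology} \<Rightarrow> 'x"
  assumes "group G"
    and "locally_compact_space (euclidean :: 'x topology)"
    and "amenable_action G \<alpha>"
  shows "((MAP G \<and> closure (\<Union>{S \<in> orbits G UNIV \<alpha>. finite S}) = UNIV)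
            \<longleftrightarrow> RFD (full_crossed_product G \<alpha>)) \<and>
         ((MAP G \<and> closure (\<Union>{S \<in> orbits G UNIV \<alpha>. finite S}) = UNIV)
            \<or> RFD (full_crossed_product G \<alpha>) \<longrightarrow> amenable_group G)"
proof -
  have act: "action_by_homeomorphisms G \<alpha>" using assms(3) by (simp add: amenable_action_def)
  interpret dynamical_system G \<alpha>
    using assms(1,2) act by (intro dynamical_system.intro dynamical_system_axioms.intro)
  have iff: "(MAP G \<and> closure (\<Union>{S \<in> orbits G UNIV \<alpha>. finite S}) = UNIV) \<longleftrightarrow> RFD (full_crossed_product G \<alpha>)"
    using MAP_dense_imp_RFD[OF _ _ assms(3)] RFD_imp_MAP RFD_imp_dense_finite_orbits by blast
  have "amenable_group G" if dense: "closure (\<Union>{S \<in> orbits G UNIV \<alpha>. finite S}) = UNIV"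
  proof -
    obtain S where "S \<in> {S \<in> orbits G UNIV \<alpha>. finite S}" by (rule finite_orbit_exists[OF dense])
    then show ?thesis by (rule amenable_if_finite_orbit[OF assms(3)])
  qed
  with iff show ?thesis by blast
qed

end
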